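(* Let $\mathcal M=\mathcal M(r,a,c)$ and $\mathcal N=\mathcal M(s,b,d)$ be rank one Breuil modules. Every extension of $\mathcal M$ by $\mathcal N$ (in the category of Breuil modules) is isomorphic to precisely one of the following form: $\mathcal P=S\,m\oplus S\,n$, $\mathrm{Fil}^1\mathcal P=\langle u^{\underline s}n,\ u^{\underline r}m+\underline h\,n\rangle$, $\phi_1(u^{\underline s}n)=\underline b\,n$, $\phi_1(u^{\underline r}m+\underline h n)=\underline a\,m$, $\hat g(n)=(\overline\eta(g)^{\underline d}\otimes1)n$, $\hat g(m)=(\overline\eta(g)^{\underline c}\otimes1)m$ for all $g\in\mathrm{Gal}(K/L)$, in which each $h_i\in k_E[u]/u^{ep}$ is a polynomial such that: $u^{\max(0,r_i+s_i-e)}$ divides $h_i$; the sequence $(h_i)$ is periodic with period dividing $f'$; every nonzero term of $h_i$ has degree congruent to $r_i+c_i-d_i\pmod{e(K/L)}$; and $\deg h_i<s_i$, except that when there exists a nonzero morphism $\mathcal M\to\mathcal N$, the polynomials $h_i$ for $f'\mid i$ may in addition have a common term of degree $r_0+\beta_0-\alpha_0$. In particular $$\dim_{k_E}\mathrm{Ext}^1(\mathcal M,\mathcal N)=\delta+\sum_{i=0}^{f'-1}\#\{j\in[\max(0,r_i+s_i-e),s_i):\ j\equiv r_i+c_i-d_i\pmod{e(K/L)}\},$$ where $\delta=1$ if there is a nonzero morphism $\mathcal M\to\mathcal N$ and $\delta=0$ otherwise.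
   Context: Let $p$ be an odd prime, $K\supseteq L$ finite extensions of $\mathbb Q_p$ with $K/L$ Galois and tamely ramified, $\pi$ a uniformiser of $\mathcal O_K$ with $\pi^{e(K/L)}\in L$ ($e(K/L)$ the ramification index of $K/L$). Let $e,f$ (resp. $e',f'$) be the absolute ramification index and residue degree of $K$ (resp. $L$), $k$ the residue field of $K$. $E\subset\overline{\mathbb Q}_p$ is finite over $\mathbb Q_p$, contains the images of all embeddings of $K$, residue field $k_E$. $\overline\eta:\mathrm{Gal}(K/L)\to k^\times$ is the reduction of $g\mapsto g(\pi)/\pi$. Fix $\sigma_0:k\hookrightarrow k_E$, define $\sigma_i$ ($i\in\mathbb Z$) by $\sigma_{i+1}^p=\sigma_i$. $e_i\in k\otimes_{\mathbb F_p}k_E$ is the idempotent with $(x\otimes1)e_i=(1\otimes\sigma_i(x))e_i$ ($e_{i+f}=e_i$). For $x_0,\dots,x_{f-1}$ (indices mod $f$) in a $k\otimes k_E$-module, $\underline x=\sum x_ie_i$ (e.g. $u^{\underline r}=\sum u^{r_i}e_i$); conversely for $\underline a$ in $S:=(k\otimes_{\mathbb F_p}k_E)[u]/u^{ep}$, $a_i\in k_E[u]/u^{ep}$ is defined by $e_i\underline a=e_ia_i$. $\varphi$ is the $k_E$-linear extension to $S$ of the $p$-th power map on $k[u]/u^{ep}$; $\mathrm{Gal}(K/L)$ acts on $S$ by $g((a\otimes1)u^i)=(g(a)\overline\eta(g)^i\otimes1)u^i$, $k_E$-linearly. A Breuil module (with $k_E$-coefficients and descent data from $K$ to $L$) is a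 finitely generated free $S$-module $\mathcal M$ with an $S$-submodule $\mathrm{Fil}^1\mathcal M\supseteq u^e\mathcal M$, a $\varphi$-semilinear $\phi_1:\mathrm{Fil}^1\mathcal M\to\mathcal M$ whose image generates $\mathcal M$, and additive bijections $\hat g$ ($g\in\mathrm{Gal}(K/L)$) preserving $\mathrm{Fil}^1$, commuting with $\phi_1$ and $k_E$, with $\hat g_1\hat g_2=\widehat{g_1g_2}$, $\hat 1=\mathrm{id}$, $\hat g(am)=g(a)\hat g(m)$. Morphisms are $S$-linear maps preserving $\mathrm{Fil}^1$ and commuting with $\phi_1$ and descent data. $\mathrm{Ext}^1(\mathcal M,\mathcal N)$ is the $k_E$-space of extension classes $0\to\mathcal N\to\mathcal P\to\mathcal M\to0$ in this category. For $r_i\in\{0,\dots,e\}$, $c_i\in\mathbb Z/e(K/L)$, $a_i\in k_E^\times$ ($i\in\mathbb Z$), each periodic with period dividing $f'$, with $c_{i+1}\equiv p(c_i+r_i)\pmod{e(K/L)}$, $\mathcal M(r,a,c)$ is the rank one Breuil module $S\,m$ with $\mathrm{Fil}^1=u^{\underline r}\mathcal M$, $\phi_1(u^{\underline r}m)=\underline am$, $\hat g(m)=(\overline\eta(g)^{\underline c}\otimes1)m$. For $\mathcal M(r,a,c)$ put $\alpha_i=p(p^{f-1}r_i+p^{f-2}r_{i+1}+\cdots+r_{i+f-1})/(p^f-1)$; for $\mathcal M(s,b,d)$ define $\beta_i$ likewise from the $s_i$. *)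

theory Defs
  imports
    "Jordan_Normal_Form.VS_Connect"
    "HOL-Algebra.Embedded_Algebras"
    "HOL-Algebra.QuotRing"
    "HOL-Number_Theory.Cong"
    "HOL-Library.Poly_Mapping"
    "HOL-Library.FuncSet"
begin

hide_const (open) UnivPoly.up_ring.coeff UnivPoly.up_ring.monom Ring_Hom.ring_hom
  Multiset.mult Polynomial.smult Modules.module Module.submodule Modules.module_hom

section \<open>p-adic fields\<close>

definition padic_abs :: "nat \<Rightarrow> rat \<Rightarrow> real" where
  "padic_abs p q =
    (if q = 0 then 0
     else real p powi (int (multiplicity (int p) (snd (quotient_of q)))
                     - int (multiplicity (int p) (fst (quotient_of q)))))"

text \<open>The type \<open>'a\<close> is an algebraic closure of \<open>F\<close>, where \<open>F\<close> is the completion of the rationals for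
  the \<open>p\<close>-adic absolute value, and \<open>v\<close> is the (unique) extension of the \<open>p\<close>-adic absolute value
  to \<open>'a\<close>.\<close>

definition padic_closure ::
  "nat \<Rightarrow> ('a::{alg_closed_field,field_char_0} \<Rightarrow> real) \<Rightarrow> 'a set \<Rightarrow> bool" where
  "padic_closure p v F \<longleftrightarrow>
     (\<forall>x. v x \<ge> 0) \<and> (\<forall>x. v x = 0 \<longleftrightarrow> x = 0) \<and>
     (\<forall>x y. v (x * y) = v x * v y) \<and> (\<forall>x y. v (x + y) \<le> max (v x) (v y)) \<and>
     (\<forall>q. v (of_rat q) = padic_abs p q) \<and>
     subfield F class_ring \<and>
     (\<forall>x\<in>F. \<forall>\<epsilon>>0. \<exists>q. v (x - of_rat q) < \<epsilon>) \<and>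
     (\<forall>X. range X \<subseteq> F \<and> (\<forall>\<epsilon>>0. \<exists>n0. \<forall>m\<ge>n0. \<forall>n\<ge>n0. v (X m - X n) < \<epsilon>)
        \<longrightarrow> (\<exists>l\<in>F. \<forall>\<epsilon>>0. \<exists>n0::nat. \<forall>n\<ge>n0. v (X n - l) < \<epsilon>)) \<and>
     (\<forall>x. \<exists>q. q \<noteq> 0 \<and> (\<forall>i. coeff q i \<in> F) \<and> poly q x = 0)"

definition int_ring :: "('a::field \<Rightarrow> real) \<Rightarrow> 'a set \<Rightarrow> 'a set" where
  "int_ring v F = {x \<in> F. v x \<le> 1}"

definition max_ideal :: "('a::field \<Rightarrow> real) \<Rightarrow> 'a set \<Rightarrow> 'a set" where
  "max_ideal v F = {x \<in> F. v x < 1}"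

definition uniformiser :: "('a::field \<Rightarrow> real) \<Rightarrow> 'a set \<Rightarrow> 'a \<Rightarrow> bool" where
  "uniformiser v F w \<longleftrightarrow> w \<in> F \<and> max_ideal v F = (\<lambda>y. w * y) ` int_ring v F"

definition ram_index :: "('a::field \<Rightarrow> real) \<Rightarrow> 'a set \<Rightarrow> 'a set \<Rightarrow> nat" where
  "ram_index v F F' =
    (THE n. \<exists>w w'. uniformiser v F w \<and> uniformiser v F' w' \<and> v w = v w' ^ n)"

definition residue_map :: "('a::field \<Rightarrow> real) \<Rightarrow> 'a set \<Rightarrow> ('a \<Rightarrow> 'k::field) \<Rightarrow> bool" where
  "residue_map v F \<rho> \<longleftrightarrow>
     \<rho> \<in> ring_hom (class_ring\<lparr>carrier := int_ring v F\<rparr>) class_ring \<and>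
     \<rho> ` int_ring v F = UNIV \<and> {x \<in> int_ring v F. \<rho> x = 0} = max_ideal v F"

definition galois_group :: "'a::field set \<Rightarrow> 'a set \<Rightarrow> ('a \<Rightarrow> 'a) set" where
  "galois_group F F' =
    {g \<in> extensional F'. g \<in> ring_iso (class_ring\<lparr>carrier := F'\<rparr>) (class_ring\<lparr>carrier := F'\<rparr>)
       \<and> (\<forall>x\<in>F. g x = x)}"


section \<open>The tensor product over the prime field\<close>

text \<open>The subgroup of the free abelian group on pairs by which one divides to form the tensor product
  over the common prime field; the action of the prime field is multiplication by integers.\<close>

inductive_set tensor_relations :: "(('k::field \<times> 'e::field) \<Rightarrow>\<^sub>0 int) set" where
  "0 \<in> tensor_relations"
| "z \<in> tensor_relations \<Longrightarrow> z' \<in> tensor_relations \<Longrightarrow> z - z' \<in> tensor_relations"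
| "Poly_Mapping.single (x + x', y) 1 - Poly_Mapping.single (x, y) 1
     - Poly_Mapping.single (x', y) 1 \<in> tensor_relations"
| "Poly_Mapping.single (x, y + y') 1 - Poly_Mapping.single (x, y) 1
     - Poly_Mapping.single (x, y') 1 \<in> tensor_relations"
| "Poly_Mapping.single (of_int n * x, y) 1 - Poly_Mapping.single (x, of_int n * y) 1
     \<in> tensor_relations"

definition tensor_eval ::
  "('k::field \<Rightarrow> 't::comm_ring_1) \<Rightarrow> ('e::field \<Rightarrow> 't) \<Rightarrow> (('k \<times> 'e) \<Rightarrow>\<^sub>0 int) \<Rightarrow> 't" where
  "tensor_eval il ir z =
    (\<Sum>(x, y)\<in>Poly_Mapping.keys z. of_int (Poly_Mapping.lookup z (x, y)) * (il x * ir y))"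

text \<open>The ring \<open>'t\<close> together with \<open>x \<otimes> 1 = il x\<close>, \<open>1 \<otimes> y = ir y\<close> is the tensor product:
  \<open>x \<otimes> y = il x * ir y\<close> identifies it with the free abelian group modulo the above relations.\<close>

definition is_tensor_product ::
  "('k::field \<Rightarrow> 't::comm_ring_1) \<Rightarrow> ('e::field \<Rightarrow> 't) \<Rightarrow> bool" where
  "is_tensor_product il ir \<longleftrightarrow>
     il \<in> ring_hom class_ring class_ring \<and> ir \<in> ring_hom class_ring class_ring \<and>
     surj (tensor_eval il ir) \<and> (\<forall>z. tensor_eval il ir z = 0 \<longleftrightarrow> z \<in> tensor_relations)"


section \<open>The setting\<close>

text \<open>All fields of characteristic zero live inside the algebraic closure \<open>'a\<close>; the types \<open>'k\<close>, \<open>'e\<close>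
  and \<open>'t\<close> are the residue fields of \<open>K\<close> and \<open>E\<close> and their tensor product. The field
  \<open>sig\<close> is the whole family of embeddings indexed by the integers, which is determined by its
  member at 0.\<close>

record ('a, 'k, 'e, 't) datum =
  prm :: nat
  absv :: "'a \<Rightarrow> real"
  fQp :: "'a set"
  fL :: "'a set"
  fK :: "'a set"
  fE :: "'a set"
  unif :: 'a
  resK :: "'a \<Rightarrow> 'k"
  resE :: "'a \<Rightarrow> 'e"
  sig :: "int \<Rightarrow> 'k \<Rightarrow> 'e"
  inl :: "'k \<Rightarrow> 't"
  inr :: "'e \<Rightarrow> 't"

definition Gal :: "('a::field, 'k, 'e, 't) datum \<Rightarrow> ('a \<Rightarrow> 'a) set" where
  "Gal D = galois_group (fL D) (fK D)"

definition ram_KL :: "('a::field, 'k, 'e, 't) datum \<Rightarrow> nat" where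
  "ram_KL D = ram_index (absv D) (fL D) (fK D)"

definition ramK :: "('a::field, 'k, 'e, 't) datum \<Rightarrow> nat" where
  "ramK D = ram_index (absv D) (fQp D) (fK D)"

text \<open>Degrees over the prime field; the residue field of \<open>L\<close> is the image of its ring of integers in
  the residue field of \<open>K\<close>.\<close>

definition resdegK :: "('a::field, 'k::field, 'e, 't) datum \<Rightarrow> nat" where
  "resdegK D = ring.dim class_ring (range of_int) (resK D ` int_ring (absv D) (fK D))"

definition resdegL :: "('a::field, 'k::field, 'e, 't) datum \<Rightarrow> nat" where
  "resdegL D = ring.dim class_ring (range of_int) (resK D ` int_ring (absv D) (fL D))"

definition setting ::
  "('a::{alg_closed_field,field_char_0}, 'k::field, 'e::field, 't::comm_ring_1) datum \<Rightarrow> bool" where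
  "setting D \<longleftrightarrow>
     prime (prm D) \<and> odd (prm D) \<and>
     padic_closure (prm D) (absv D) (fQp D) \<and>
     subfield (fL D) class_ring \<and> subfield (fK D) class_ring \<and> subfield (fE D) class_ring \<and>
     fQp D \<subseteq> fL D \<and> fL D \<subseteq> fK D \<and> fQp D \<subseteq> fE D \<and>
     ring.finite_dimension class_ring (fQp D) (fL D) \<and>
     ring.finite_dimension class_ring (fQp D) (fK D) \<and>
     ring.finite_dimension class_ring (fQp D) (fE D) \<and>
     {x \<in> fK D. \<forall>g\<in>Gal D. g x = x} = fL D \<and>
     \<not> prm D dvd ram_KL D \<and>
     uniformiser (absv D) (fK D) (unif D) \<and> unif D ^ ram_KL D \<in> fL D \<and>
     (\<forall>\<tau>\<in>ring_hom (class_ring\<lparr>carrier := fK D\<rparr>) class_ring.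
        (\<forall>x\<in>fQp D. \<tau> x = x) \<longrightarrow> \<tau> ` fK D \<subseteq> fE D) \<and>
     residue_map (absv D) (fK D) (resK D) \<and> residue_map (absv D) (fE D) (resE D) \<and>
     (\<forall>i. sig D i \<in> ring_hom class_ring class_ring) \<and>
     (\<forall>i x. sig D (i + 1) x ^ prm D = sig D i x) \<and>
     is_tensor_product (inl D) (inr D)"

definition etabar :: "('a::field, 'k, 'e, 't) datum \<Rightarrow> ('a \<Rightarrow> 'a) \<Rightarrow> 'k" where
  "etabar D g = resK D (g (unif D) / unif D)"

definition gal_res :: "('a::field, 'k, 'e, 't) datum \<Rightarrow> ('a \<Rightarrow> 'a) \<Rightarrow> 'k \<Rightarrow> 'k" where
  "gal_res D g x =
    (THE z. \<exists>y\<in>int_ring (absv D) (fK D). resK D y = x \<and> z = resK D (g y))"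

text \<open>\<open>\<psi> \<otimes> id\<close>\<close>

definition tensor_map ::
  "('a, 'k, 'e, 't::comm_ring_1) datum \<Rightarrow> ('k \<Rightarrow> 'k) \<Rightarrow> 't \<Rightarrow> 't" where
  "tensor_map D \<psi> =
    (THE F. (\<forall>s t. F (s + t) = F s + F t) \<and>
            (\<forall>x y. F (inl D x * inr D y) = inl D (\<psi> x) * inr D y))"

definition idem :: "('a, 'k, 'e, 't::comm_ring_1) datum \<Rightarrow> int \<Rightarrow> 't" where
  "idem D i =
    (THE \<epsilon>. \<epsilon> \<noteq> 0 \<and> \<epsilon> * \<epsilon> = \<epsilon> \<and> (\<forall>x. inl D x * \<epsilon> = inr D (sig D i x) * \<epsilon>))"


section \<open>The coefficient ring\<close>

definition trunc :: "('a::field, 'k, 'e, 't) datum \<Rightarrow> nat" where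
  "trunc D = ramK D * prm D"

text \<open>Elements of \<open>T[u]/u^n\<close> are represented by the polynomials of degree less than \<open>n\<close>.\<close>

definition breuil_ring :: "('a::field, 'k, 'e, 't::comm_ring_1) datum \<Rightarrow> 't poly ring" where
  "breuil_ring D = \<lparr>carrier = range (poly_cutoff (trunc D)),
          mult = (\<lambda>x y. poly_cutoff (trunc D) (x * y)), one = 1, zero = 0, add = (+)\<rparr>"

definition frob :: "('a::field, 'k::field, 'e, 't::comm_ring_1) datum \<Rightarrow> 't poly \<Rightarrow> 't poly" where
  "frob D q = poly_cutoff (trunc D)
     (\<Sum>j<trunc D. monom (tensor_map D (\<lambda>x. x ^ prm D) (coeff q j)) (prm D * j))"

definition gal_S ::
  "('a::field, 'k::field, 'e, 't::comm_ring_1) datum \<Rightarrow> ('a \<Rightarrow> 'a) \<Rightarrow> 't poly \<Rightarrow> 't poly" where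
  "gal_S D g q =
    (\<Sum>j<trunc D. monom (tensor_map D (gal_res D g) (coeff q j) * inl D (etabar D g ^ j)) j)"

text \<open>The underline notation: \<open>\<Sum> x\<^sub>i e\<^sub>i\<close>.\<close>

definition assemble ::
  "('a::field, 'k::field, 'e, 't::comm_ring_1) datum \<Rightarrow> (int \<Rightarrow> 't poly) \<Rightarrow> 't poly" where
  "assemble D x = (\<Sum>i<resdegK D. x (int i) * [:idem D (int i):])"

definition u_pow ::
  "('a::field, 'k::field, 'e, 't::comm_ring_1) datum \<Rightarrow> (int \<Rightarrow> nat) \<Rightarrow> 't poly" where
  "u_pow D r = assemble D (\<lambda>i. monom 1 (r i))"

definition und_poly ::
  "('a::field, 'k::field, 'e::field, 't::comm_ring_1) datum \<Rightarrow> (int \<Rightarrow> 'e poly) \<Rightarrow> 't poly" where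
  "und_poly D h = assemble D (\<lambda>i. map_poly (inr D) (h i))"

definition und_const ::
  "('a::field, 'k::field, 'e::field, 't::comm_ring_1) datum \<Rightarrow> (int \<Rightarrow> 'e) \<Rightarrow> 't poly" where
  "und_const D a = und_poly D (\<lambda>i. [:a i:])"

text \<open>Exponents modulo the ramification index of \<open>K/L\<close> are represented by integers.\<close>

definition eta_pow ::
  "('a::field, 'k::field, 'e, 't::comm_ring_1) datum \<Rightarrow> (int \<Rightarrow> int) \<Rightarrow> ('a \<Rightarrow> 'a) \<Rightarrow> 't poly" where
  "eta_pow D c g = assemble D (\<lambda>i. [:inl D (etabar D g powi c i):])"


section \<open>Breuil modules\<close>

record ('a, 't, 'm) breuil = "('t poly, 'm) module" +
  Fil :: "'m set"
  phi1 :: "'m \<Rightarrow> 'm"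
  desc :: "('a \<Rightarrow> 'a) \<Rightarrow> 'm \<Rightarrow> 'm"

definition is_breuil ::
  "('a::field, 'k::field, 'e, 't::comm_ring_1) datum \<Rightarrow> ('a, 't, 'm) breuil \<Rightarrow> bool" where
  "is_breuil D M \<longleftrightarrow>
     module (breuil_ring D) M \<and>
     (\<exists>B. finite B \<and> B \<subseteq> carrier M \<and> module.gen_set (breuil_ring D) M B \<and> module.lin_indpt (breuil_ring D) M B) \<and>
     submodule (breuil_ring D) (Fil M) M \<and>
     (\<forall>x\<in>carrier M. monom 1 (ramK D) \<odot>\<^bsub>M\<^esub> x \<in> Fil M) \<and>
     phi1 M \<in> Fil M \<rightarrow> carrier M \<and>
     (\<forall>x\<in>Fil M. \<forall>y\<in>Fil M. phi1 M (x \<oplus>\<^bsub>M\<^esub> y) = phi1 M x \<oplus>\<^bsub>M\<^esub> phi1 M y) \<and>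
     (\<forall>q\<in>carrier (breuil_ring D). \<forall>x\<in>Fil M. phi1 M (q \<odot>\<^bsub>M\<^esub> x) = frob D q \<odot>\<^bsub>M\<^esub> phi1 M x) \<and>
     module.gen_set (breuil_ring D) M (phi1 M ` Fil M) \<and>
     (\<forall>g\<in>Gal D. bij_betw (desc M g) (carrier M) (carrier M) \<and>
        (\<forall>x\<in>carrier M. \<forall>y\<in>carrier M. desc M g (x \<oplus>\<^bsub>M\<^esub> y) = desc M g x \<oplus>\<^bsub>M\<^esub> desc M g y) \<and>
        desc M g ` Fil M \<subseteq> Fil M \<and>
        (\<forall>x\<in>Fil M. desc M g (phi1 M x) = phi1 M (desc M g x)) \<and>
        (\<forall>l. \<forall>x\<in>carrier M. desc M g ([:inr D l:] \<odot>\<^bsub>M\<^esub> x) = [:inr D l:] \<odot>\<^bsub>M\<^esub> desc M g x) \<and>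
        (\<forall>q\<in>carrier (breuil_ring D). \<forall>x\<in>carrier M. desc M g (q \<odot>\<^bsub>M\<^esub> x) = gal_S D g q \<odot>\<^bsub>M\<^esub> desc M g x)) \<and>
     (\<forall>g1\<in>Gal D. \<forall>g2\<in>Gal D. \<forall>x\<in>carrier M.
        desc M g1 (desc M g2 x) = desc M (compose (fK D) g1 g2) x) \<and>
     (\<forall>x\<in>carrier M. desc M (\<lambda>y\<in>fK D. y) x = x)"

definition breuil_hom ::
  "('a::field, 'k::field, 'e, 't::comm_ring_1) datum \<Rightarrow> ('a, 't, 'm) breuil \<Rightarrow> ('a, 't, 'n) breuil
    \<Rightarrow> ('m \<Rightarrow> 'n) set" where
  "breuil_hom D M N =
    {\<theta> \<in> module_hom (breuil_ring D) M N.
       \<theta> ` Fil M \<subseteq> Fil N \<and>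
       (\<forall>x\<in>Fil M. \<theta> (phi1 M x) = phi1 N (\<theta> x)) \<and>
       (\<forall>g\<in>Gal D. \<forall>x\<in>carrier M. \<theta> (desc M g x) = desc N g (\<theta> x))}"

definition has_nonzero_hom ::
  "('a::field, 'k::field, 'e, 't::comm_ring_1) datum \<Rightarrow> ('a, 't, 'm) breuil \<Rightarrow> ('a, 't, 'n) breuil
    \<Rightarrow> bool" where
  "has_nonzero_hom D M N \<longleftrightarrow> (\<exists>\<theta>\<in>breuil_hom D M N. \<exists>x\<in>carrier M. \<theta> x \<noteq> \<zero>\<^bsub>N\<^esub>)"


section \<open>Extensions\<close>

record (overloaded) ('a, 't, 'n, 'p, 'm) extension =
  Mid :: "('a, 't, 'p) breuil"
  Inc :: "'n \<Rightarrow> 'p"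
  Proj :: "'p \<Rightarrow> 'm"

text \<open>Extensions of \<open>M\<close> by \<open>N\<close>. Exactness is imposed on underlying modules; exactness of the induced
  sequence of filtrations is then automatic because the image of \<open>phi1\<close> generates.\<close>

definition is_extension ::
  "('a::field, 'k::field, 'e, 't::comm_ring_1) datum \<Rightarrow> ('a, 't, 'm) breuil \<Rightarrow> ('a, 't, 'n) breuil
    \<Rightarrow> ('a, 't, 'n, 'p, 'm) extension \<Rightarrow> bool" where
  "is_extension D M N X \<longleftrightarrow>
     is_breuil D (Mid X) \<and>
     Inc X \<in> breuil_hom D N (Mid X) \<and> Proj X \<in> breuil_hom D (Mid X) M \<and>
     inj_on (Inc X) (carrier N) \<and>
     Inc X ` carrier N = {x \<in> carrier (Mid X). Proj X x = \<zero>\<^bsub>M\<^esub>} \<and>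
     Proj X ` carrier (Mid X) = carrier M"

definition ext_iso ::
  "('a::field, 'k::field, 'e, 't::comm_ring_1) datum \<Rightarrow> ('a, 't, 'n) breuil
    \<Rightarrow> ('a, 't, 'n, 'p, 'm) extension \<Rightarrow> ('a, 't, 'n, 'q, 'm) extension \<Rightarrow> bool" where
  "ext_iso D N X Y \<longleftrightarrow>
     (\<exists>\<theta>\<in>breuil_hom D (Mid X) (Mid Y).
        bij_betw \<theta> (carrier (Mid X)) (carrier (Mid Y)) \<and>
        inv_into (carrier (Mid X)) \<theta> \<in> breuil_hom D (Mid Y) (Mid X) \<and>
        (\<forall>n\<in>carrier N. \<theta> (Inc X n) = Inc Y n) \<and>
        (\<forall>x\<in>carrier (Mid X). Proj Y (\<theta> x) = Proj X x))"

definition fibre_product ::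
  "('a, 't, 'n, 'p, 'm) extension \<Rightarrow> ('a, 't, 'n, 'q, 'm) extension \<Rightarrow> ('a, 't, 'p \<times> 'q) breuil" where
  "fibre_product X Y =
    \<lparr>carrier = {(x, y). x \<in> carrier (Mid X) \<and> y \<in> carrier (Mid Y) \<and> Proj X x = Proj Y y},
     mult = undefined, one = undefined,
     zero = (\<zero>\<^bsub>Mid X\<^esub>, \<zero>\<^bsub>Mid Y\<^esub>),
     add = (\<lambda>(x, y) (x', y'). (x \<oplus>\<^bsub>Mid X\<^esub> x', y \<oplus>\<^bsub>Mid Y\<^esub> y')),
     smult = (\<lambda>q (x, y). (q \<odot>\<^bsub>Mid X\<^esub> x, q \<odot>\<^bsub>Mid Y\<^esub> y)),
     Fil = {(x, y). x \<in> Fil (Mid X) \<and> y \<in> Fil (Mid Y) \<and> Proj X x = Proj Y y},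
     phi1 = (\<lambda>(x, y). (phi1 (Mid X) x, phi1 (Mid Y) y)),
     desc = (\<lambda>g (x, y). (desc (Mid X) g x, desc (Mid Y) g y))\<rparr>"

text \<open>\<open>Z\<close> is the Baer sum of \<open>X\<close> and \<open>Y\<close>: the pullback of their direct sum along the diagonal of \<open>M\<close>
  is the fibre product, an extension of \<open>M\<close> by \<open>N \<oplus> N\<close>, and \<open>Z\<close> is its pushforward along addition
  \<open>N \<oplus> N \<rightarrow> N\<close>. As usual the pushforward of an extension along a morphism \<open>\<alpha>\<close> of the left-hand ends
  is the extension receiving a morphism of extensions that is \<open>\<alpha>\<close> on the left and the identity
  on the right.\<close>

definition is_baer_sum ::
  "('a::field, 'k::field, 'e, 't::comm_ring_1) datum \<Rightarrow> ('a, 't, 'n) breuil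
    \<Rightarrow> ('a, 't, 'n, 'p, 'm) extension \<Rightarrow> ('a, 't, 'n, 'q, 'm) extension
    \<Rightarrow> ('a, 't, 'n, 'r, 'm) extension \<Rightarrow> bool" where
  "is_baer_sum D N X Y Z \<longleftrightarrow>
     (\<exists>\<theta>\<in>breuil_hom D (fibre_product X Y) (Mid Z).
        (\<forall>n\<in>carrier N. \<forall>n'\<in>carrier N. \<theta> (Inc X n, Inc Y n') = Inc Z (n \<oplus>\<^bsub>N\<^esub> n')) \<and>
        (\<forall>(x, y)\<in>carrier (fibre_product X Y). Proj Z (\<theta> (x, y)) = Proj X x))"

text \<open>\<open>Z\<close> is the pushforward of \<open>X\<close> along multiplication by \<open>l\<close> on \<open>N\<close>.\<close>

definition is_scaling ::
  "('a::field, 'k::field, 'e, 't::comm_ring_1) datum \<Rightarrow> ('a, 't, 'n) breuil \<Rightarrow> 'e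
    \<Rightarrow> ('a, 't, 'n, 'p, 'm) extension \<Rightarrow> ('a, 't, 'n, 'q, 'm) extension \<Rightarrow> bool" where
  "is_scaling D N l X Z \<longleftrightarrow>
     (\<exists>\<theta>\<in>breuil_hom D (Mid X) (Mid Z).
        (\<forall>n\<in>carrier N. \<theta> (Inc X n) = Inc Z ([:inr D l:] \<odot>\<^bsub>N\<^esub> n)) \<and>
        (\<forall>x\<in>carrier (Mid X). Proj Z (\<theta> x) = Proj X x))"

definition split_extension ::
  "('a, 't, 'm) breuil \<Rightarrow> ('a, 't, 'n) breuil \<Rightarrow> ('a, 't, 'n, 'm \<times> 'n, 'm) extension" where
  "split_extension M N =
    \<lparr>Mid = \<lparr>carrier = carrier M \<times> carrier N, mult = undefined, one = undefined,
            zero = (\<zero>\<^bsub>M\<^esub>, \<zero>\<^bsub>N\<^esub>),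
            add = (\<lambda>(x, y) (x', y'). (x \<oplus>\<^bsub>M\<^esub> x', y \<oplus>\<^bsub>N\<^esub> y')),
            smult = (\<lambda>q (x, y). (q \<odot>\<^bsub>M\<^esub> x, q \<odot>\<^bsub>N\<^esub> y)),
            Fil = Fil M \<times> Fil N,
            phi1 = (\<lambda>(x, y). (phi1 M x, phi1 N y)),
            desc = (\<lambda>g (x, y). (desc M g x, desc N g y))\<rparr>,
     Inc = (\<lambda>n. (\<zero>\<^bsub>M\<^esub>, n)), Proj = fst\<rparr>"

text \<open>Since \<open>M\<close> is free, the underlying module of any extension is isomorphic to \<open>M \<oplus> N\<close>, so extensions
  with underlying set in \<open>'m \<times> 'n\<close> represent all extension classes.\<close>

definition extensions ::
  "('a::field, 'k::field, 'e, 't::comm_ring_1) datum \<Rightarrow> ('a, 't, 'm) breuil \<Rightarrow> ('a, 't, 'n) breuil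
    \<Rightarrow> ('a, 't, 'n, 'm \<times> 'n, 'm) extension set" where
  "extensions D M N = {X. is_extension D M N X}"

definition Ext1 ::
  "('a::field, 'k::field, 'e, 't::comm_ring_1) datum \<Rightarrow> ('a, 't, 'm) breuil \<Rightarrow> ('a, 't, 'n) breuil
    \<Rightarrow> ('e, ('a, 't, 'n, 'm \<times> 'n, 'm) extension set) module" where
  "Ext1 D M N =
    \<lparr>carrier = extensions D M N //
               {(X, Y). X \<in> extensions D M N \<and> Y \<in> extensions D M N \<and> ext_iso D N X Y},
     mult = undefined, one = undefined,
     zero = {Z \<in> extensions D M N. ext_iso D N Z (split_extension M N)},
     add = (\<lambda>A B. {Z \<in> extensions D M N. \<exists>X\<in>A. \<exists>Y\<in>B. is_baer_sum D N X Y Z}),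
     smult = (\<lambda>l A. {Z \<in> extensions D M N. \<exists>X\<in>A. is_scaling D N l X Z})\<rparr>"


section \<open>Rank one modules and their extensions\<close>

definition rank1_data ::
  "('a::field, 'k::field, 'e::field, 't) datum \<Rightarrow> (int \<Rightarrow> nat) \<Rightarrow> (int \<Rightarrow> 'e) \<Rightarrow> (int \<Rightarrow> int) \<Rightarrow> bool"
  where
  "rank1_data D r a c \<longleftrightarrow>
     (\<forall>i. r i \<le> ramK D \<and> a i \<noteq> 0 \<and>
          r (i + int (resdegL D)) = r i \<and> a (i + int (resdegL D)) = a i \<and>
          [c (i + int (resdegL D)) = c i] (mod int (ram_KL D)) \<and>
          [c (i + 1) = int (prm D) * (c i + int (r i))] (mod int (ram_KL D)))"

text \<open>The element \<open>x m\<close> is represented by \<open>x\<close>.\<close>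

definition rank1 ::
  "('a::field, 'k::field, 'e::field, 't::comm_ring_1) datum \<Rightarrow> (int \<Rightarrow> nat) \<Rightarrow> (int \<Rightarrow> 'e)
    \<Rightarrow> (int \<Rightarrow> int) \<Rightarrow> ('a, 't, 't poly) breuil" where
  "rank1 D r a c =
    \<lparr>carrier = carrier (breuil_ring D), mult = undefined, one = undefined, zero = 0, add = (+),
     smult = mult (breuil_ring D),
     Fil = {x \<otimes>\<^bsub>breuil_ring D\<^esub> u_pow D r | x. x \<in> carrier (breuil_ring D)},
     phi1 = (\<lambda>z. THE w. \<exists>x\<in>carrier (breuil_ring D).
               z = x \<otimes>\<^bsub>breuil_ring D\<^esub> u_pow D r \<and> w = frob D x \<otimes>\<^bsub>breuil_ring D\<^esub> und_const D a),
     desc = (\<lambda>g x. gal_S D g x \<otimes>\<^bsub>breuil_ring D\<^esub> eta_pow D c g)\<rparr>"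

text \<open>The element \<open>x m + y n\<close> is represented by \<open>(x, y)\<close>.\<close>

definition model_extension ::
  "('a::field, 'k::field, 'e::field, 't::comm_ring_1) datum
    \<Rightarrow> (int \<Rightarrow> nat) \<Rightarrow> (int \<Rightarrow> 'e) \<Rightarrow> (int \<Rightarrow> int) \<Rightarrow> (int \<Rightarrow> nat) \<Rightarrow> (int \<Rightarrow> 'e) \<Rightarrow> (int \<Rightarrow> int)
    \<Rightarrow> (int \<Rightarrow> 'e poly) \<Rightarrow> ('a, 't, 't poly, 't poly \<times> 't poly, 't poly) extension" where
  "model_extension D r a c s b d h =
    \<lparr>Mid = \<lparr>carrier = carrier (breuil_ring D) \<times> carrier (breuil_ring D), mult = undefined, one = undefined,
            zero = (0, 0), add = (\<lambda>(x, y) (x', y'). (x + x', y + y')),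
            smult = (\<lambda>q (x, y). (q \<otimes>\<^bsub>breuil_ring D\<^esub> x, q \<otimes>\<^bsub>breuil_ring D\<^esub> y)),
            Fil = {(x \<otimes>\<^bsub>breuil_ring D\<^esub> u_pow D r, y \<otimes>\<^bsub>breuil_ring D\<^esub> u_pow D s + x \<otimes>\<^bsub>breuil_ring D\<^esub> und_poly D h) | x y.
                     x \<in> carrier (breuil_ring D) \<and> y \<in> carrier (breuil_ring D)},
            phi1 = (\<lambda>z. THE w. \<exists>x\<in>carrier (breuil_ring D). \<exists>y\<in>carrier (breuil_ring D).
                     z = (x \<otimes>\<^bsub>breuil_ring D\<^esub> u_pow D r, y \<otimes>\<^bsub>breuil_ring D\<^esub> u_pow D s + x \<otimes>\<^bsub>breuil_ring D\<^esub> und_poly D h) \<and>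
                     w = (frob D x \<otimes>\<^bsub>breuil_ring D\<^esub> und_const D a, frob D y \<otimes>\<^bsub>breuil_ring D\<^esub> und_const D b)),
            desc = (\<lambda>g (x, y). (gal_S D g x \<otimes>\<^bsub>breuil_ring D\<^esub> eta_pow D c g,
                                gal_S D g y \<otimes>\<^bsub>breuil_ring D\<^esub> eta_pow D d g))\<rparr>,
     Inc = (\<lambda>y. (0, y)), Proj = fst\<rparr>"

text \<open>The numbers \<open>\<alpha>\<^sub>i\<close> (for \<open>r\<close>) and \<open>\<beta>\<^sub>i\<close> (for \<open>s\<close>).\<close>

definition slope :: "('a::field, 'k::field, 'e, 't) datum \<Rightarrow> (int \<Rightarrow> nat) \<Rightarrow> int \<Rightarrow> rat" where
  "slope D r i =
    of_nat (prm D) * (\<Sum>j<resdegK D. of_nat (prm D) ^ (resdegK D - 1 - j) * of_nat (r (i + int j)))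
      / (of_nat (prm D) ^ resdegK D - 1)"

text \<open>The additional term is common to all \<open>h i\<close> with \<open>i\<close> divisible by the residue degree of \<open>L\<close>
  because these \<open>h i\<close> coincide by periodicity.\<close>

definition admissible ::
  "('a::field, 'k::field, 'e::field, 't::comm_ring_1) datum
    \<Rightarrow> (int \<Rightarrow> nat) \<Rightarrow> (int \<Rightarrow> 'e) \<Rightarrow> (int \<Rightarrow> int) \<Rightarrow> (int \<Rightarrow> nat) \<Rightarrow> (int \<Rightarrow> 'e) \<Rightarrow> (int \<Rightarrow> int)
    \<Rightarrow> (int \<Rightarrow> 'e poly) \<Rightarrow> bool" where
  "admissible D r a c s b d h \<longleftrightarrow>
     (\<forall>i. h i \<in> range (poly_cutoff (trunc D)) \<and>
          monom 1 (nat (max 0 (int (r i) + int (s i) - int (ramK D)))) dvd h i \<and>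
          h (i + int (resdegL D)) = h i \<and>
          (\<forall>j. coeff (h i) j \<noteq> 0 \<longrightarrow>
             [int j = int (r i) + c i - d i] (mod int (ram_KL D)) \<and>
             (j < s i \<or>
              has_nonzero_hom D (rank1 D r a c) (rank1 D s b d) \<and> int (resdegL D) dvd i \<and>
              of_nat j = of_nat (r 0) + slope D s 0 - slope D r 0)))"

end

theory Submission
  imports Defs
begin

text \<open>In an extension \<open>P\<close> of \<open>M\<close> by \<open>N\<close> the generator \<open>u^r m\<close> of the filtration of \<open>M\<close> lifts to the
  filtration of \<open>P\<close>, because the image of \<open>phi1\<close> generates; averaging over the Galois group with a
  residue class of trace one makes the lift \<open>z\<close> equivariant. Then \<open>z = u^r (a\<inverse> phi1 z) + h n\<close> for
  some \<open>h\<close>, and \<open>P\<close> is determined by \<open>h\<close>. Replacing \<open>z\<close> by \<open>z + y u^s n\<close> changes \<open>h\<close> by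
  \<open>y u^s - (b/a) \<phi>(y) u^r\<close>, so extension classes form the quotient of the space of all \<open>h\<close> of the
  correct weight and divisibility by these elements. In the quotient a term of degree \<open>n \<ge> s i\<close> at
  index \<open>i\<close> may be moved to degree \<open>r (i + 1) + p (n - s i)\<close> at index \<open>i + 1\<close>. This map expands
  distances from the degrees \<open>r i + \<beta> i - \<alpha> i\<close> by \<open>p\<close>, so every such term is eventually pushed out of
  the ring or becomes a term of degree less than \<open>s\<close>, except on the fixed cycle
  of the map. There the obstruction to elimination is one-dimensional and present exactly
  if the product of the \<open>b i / a i\<close> is 1, which is the condition for a nonzero morphism
  \<open>M \<rightarrow> N\<close>.\<close>

section \<open>Finite fields\<close>

text \<open>All computations are made in components: the f embeddings identify the tensor product
  with f copies of k_E, so S is a product of truncated polynomial rings in which \<phi> raises the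
  index by one and sends u to u^p, while a Galois element shifts the index and rescales u. The
  arithmetic must supply two facts. Inertia realises every root of unity of order dividing the
  ramification index of K/L, which fixes degrees modulo that index; and some automorphism induces
  the Frobenius over the residue field of L while fixing \<pi> to first order, which produces the
  period f'. Both come from tameness, through traces and through counting roots in the residue
  field. The recurring obstacle is that u^r is a zero divisor in S, so x is not determined by x u^r.
  Modulo u^(ep), however, \<phi> sees only coefficients below degree e, and 3e \<le> ep leaves room
  for two factors u^r and u^s; here p being odd enters. The lower bound max(0, r + s - e) on the
  order of h is equivalent to u^e P lying in the filtration. The degree of the extra term is the
  unique zero of an integral height function.\<close>

lemma map_poly_hom_add:
  assumes "h 0 = 0" "\<And>x y. h (x + y) = h x + h y"
  shows "map_poly h (P + Q) = map_poly h P + map_poly h Q"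
  using assms by (intro poly_eqI) (simp add: coeff_map_poly)

lemma hom_sum:
  assumes "h 0 = 0" "\<And>x y. h (x + y) = h x + h y"
  shows "h (\<Sum>i\<in>A. t i) = (\<Sum>i\<in>A. h (t i))"
  by (induction A rule: infinite_finite_induct) (auto simp: assms)

lemma map_poly_hom_mult:
  assumes "h 0 = 0" "\<And>x y. h (x + y) = h x + h y" "\<And>x y. h (x * y) = h x * h y"
  shows "map_poly h (P * Q) = map_poly h P * map_poly h Q"
  using assms by (intro poly_eqI) (simp add: coeff_map_poly coeff_mult hom_sum[of h])

lemma map_poly_hom_prod:
  assumes "h 0 = 0" "h 1 = 1" "\<And>x y. h (x + y) = h x + h y" "\<And>x y. h (x * y) = h x * h y"
  shows "map_poly h (\<Prod>i\<in>A. P i) = (\<Prod>i\<in>A. map_poly h (P i))"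
  by (induction A rule: infinite_finite_induct) (auto simp: assms map_poly_hom_mult map_poly_1)

text \<open>Models the residue field of \<open>K\<close>, with \<open>f\<close> its degree over the
  prime field. The parameter \<open>kk\<close> pins the type, which no other parameter
  mentions.\<close>

locale finite_prime_field =
  fixes p f :: nat and kk :: "'k::field itself"
  assumes prime_p: "prime p" and char_p: "of_nat p = (0::'k)"
    and finite_k: "finite (UNIV :: 'k set)" and card_k: "card (UNIV :: 'k set) = p ^ f"
begin

lemma p_gt_1: "p > 1"
  using prime_p prime_gt_1_nat by blast

lemma CHAR_k: "CHAR('k) = p"
proof -
  have "CHAR('k) dvd p" using char_p of_nat_eq_0_iff_char_dvd by blast
  moreover have "CHAR('k) \<noteq> 1" by simp
  ultimately show ?thesis using prime_p by (auto simp: prime_nat_iff)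
qed

lemma f_pos: "f > 0"
proof (rule ccontr)
  assume "\<not> f > 0"
  then have "card (UNIV :: 'k set) = 1" using card_k by simp
  then obtain z where "(UNIV :: 'k set) = {z}" using card_1_singletonE by blast
  then show False using zero_neq_one by (metis UNIV_I singletonD)
qed

lemma frob_add: "(x + y) ^ p ^ n = x ^ p ^ n + (y::'k) ^ p ^ n"
  using prime_p CHAR_k by (intro freshmans_dream') auto

lemma frob_sum: "(\<Sum>i\<in>A. g i) ^ p ^ n = (\<Sum>i\<in>A. (g i::'k) ^ p ^ n)"
proof (induction A rule: infinite_finite_induct)
  case empty
  then show ?case using p_gt_1 by simp
qed (use p_gt_1 in \<open>auto simp: frob_add\<close>)

lemma power_card_minus_1: "x \<noteq> 0 \<Longrightarrow> (x::'k) ^ (p ^ f - 1) = 1"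
proof -
  assume x: "x \<noteq> 0"
  let ?P = "\<Prod>y\<in>UNIV - {0::'k}. y"
  have "bij_betw ((*) x) (UNIV - {0}) (UNIV - {0})"
    using x by (intro bij_betwI[where g = "\<lambda>y. y / x"]) auto
  then have "?P = (\<Prod>y\<in>UNIV - {0::'k}. x * y)"
    using prod.reindex_bij_betw[of "(*) x" "UNIV - {0}" "UNIV - {0}" "\<lambda>y. y"] by simp
  also have "\<dots> = x ^ card (UNIV - {0::'k}) * ?P"
    by (simp add: prod.distrib)
  finally have "x ^ card (UNIV - {0::'k}) = 1"
    using finite_k by simp
  then show ?thesis using finite_k card_k by (simp add: card_Diff_singleton)
qed

lemma power_card: "(x::'k) ^ p ^ f = x"
proof (cases "x = 0")
  case True
  then show ?thesis using p_gt_1 by simp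
next
  case False
  have "x ^ p ^ f = x ^ (p ^ f - 1) * x"
    using p_gt_1 by (simp flip: power_Suc2)
  then show ?thesis using power_card_minus_1[OF False] by simp
qed

lemma frob_period: "(x::'k) ^ p ^ (n + f * j) = x ^ p ^ n"
proof (induction j)
  case (Suc j)
  have "x ^ p ^ (n + f * Suc j) = (x ^ p ^ (n + f * j)) ^ p ^ f"
    by (simp only: mult_Suc_right add.assoc[symmetric] add.commute[of f] power_add power_mult)
  then show ?case using Suc power_card by simp
qed simp

lemma frob_inj: "(x::'k) ^ p ^ n = y ^ p ^ n \<Longrightarrow> x = y"
proof -
  assume a: "x ^ p ^ n = y ^ p ^ n"
  \<comment> \<open>Any j with n \<le> f * j would do: completing the exponents to p ^ (f * j) turns
    the two sides into x and y.\<close>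
  define j where "j = n"
  have j: "n \<le> f * j" using f_pos by (simp add: j_def)
  have "x ^ p ^ (n + (f * j - n)) = y ^ p ^ (n + (f * j - n))"
    using a by (simp add: power_add power_mult)
  then show ?thesis using j frob_period[of x 0 j] frob_period[of y 0 j] by simp
qed

lemma frob_surj: "\<exists>y::'k. y ^ p = x"
proof -
  have "(x ^ p ^ (f - 1)) ^ p = x ^ p ^ f"
    using f_pos by (simp flip: power_mult power_Suc2)
  then show ?thesis using power_card by metis
qed

lemma card_roots_of_unity_le: "n > 0 \<Longrightarrow> card {x::'k. x ^ n = 1} \<le> n"
proof -
  assume n: "n > 0"
  have "{x::'k. x ^ n = 1} = {x. poly (monom 1 n - 1) x = 0}"
    by (auto simp: poly_monom)
  moreover have "degree (monom (1::'k) n - 1) \<le> n"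
    by (intro degree_diff_le) (auto simp: degree_monom_le)
  moreover have "monom (1::'k) n - 1 \<noteq> 0"
  proof
    assume "monom (1::'k) n - 1 = 0"
    then have "coeff (monom (1::'k) n - 1) n = 0" by simp
    then show False using n by simp
  qed
  ultimately show ?thesis using card_poly_roots_bound[of "monom (1::'k) n - 1"] by simp
qed

lemma generator: "\<exists>g::'k. g \<noteq> 0 \<and> (\<forall>x. x \<noteq> 0 \<longrightarrow> (\<exists>n::nat. x = g ^ n))"
proof -
  obtain a :: 'k where a: "a \<noteq> 0"
    "UNIV - {0} = {a [^]\<^bsub>class_ring\<^esub> i | i::nat. i \<in> UNIV}"
    using field.finite_field_mult_group_has_gen[OF class_field.field_axioms[where 'a = 'k]] finite_k
    by (auto simp del: Diff_iff)
  have pw: "a [^]\<^bsub>class_ring\<^esub> i = a ^ i" for i :: nat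
    by (induction i) (auto simp: nat_pow_def)
  have "\<exists>n::nat. x = a ^ n" if "x \<noteq> 0" for x
    using a(2) that unfolding pw by (auto simp: set_eq_iff)
  then show ?thesis using a(1) by blast
qed

text \<open>A nonzero remainder m of n would give g ^ m = 1. Every nonzero element is a power of g,
  hence would be a root of X ^ m - 1, and these are more roots than the degree m < p ^ f - 1
  allows.\<close>

lemma generator_order:
  assumes g: "g \<noteq> (0::'k)" "\<forall>x. x \<noteq> 0 \<longrightarrow> (\<exists>n::nat. x = g ^ n)" and n: "g ^ n = 1"
  shows "(p ^ f - 1) dvd n"
proof -
  have q1: "p ^ f - 1 > 0" using one_less_power[OF p_gt_1 f_pos] by simp
  define m where "m = n mod (p ^ f - 1)"
  have "g ^ n = g ^ m * (g ^ (p ^ f - 1)) ^ (n div (p ^ f - 1))"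
    by (simp add: m_def flip: power_mult power_add)
  then have m1: "g ^ m = 1" using n power_card_minus_1[OF g(1)] by simp
  have "m = 0"
  proof (rule ccontr)
    assume "m \<noteq> 0"
    have "UNIV - {0} \<subseteq> {x::'k. x ^ m = 1}"
    proof
      fix x :: 'k assume "x \<in> UNIV - {0}"
      then obtain i where "x = g ^ i" using g(2) by auto
      then have "x ^ m = (g ^ m) ^ i" by (simp add: mult.commute flip: power_mult)
      then show "x \<in> {x. x ^ m = 1}" using m1 by simp
    qed
    then have "card (UNIV - {0::'k}) \<le> card {x::'k. x ^ m = 1}"
      by (intro card_mono finite_subset[OF subset_UNIV finite_k])
    then have "p ^ f - 1 \<le> m"
      using card_roots_of_unity_le[of m] \<open>m \<noteq> 0\<close> finite_k card_k by (simp add: card_Diff_singleton)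
    moreover have "m < p ^ f - 1" using q1 by (simp add: m_def)
    ultimately show False by simp
  qed
  then show ?thesis by (auto simp: m_def)
qed

text \<open>Compare on a generator: the two exponents differ by less than its order p ^ f - 1, so
  equal powers force equal exponents.\<close>

lemma frob_distinct:
  assumes "m < f" "n < f" "\<forall>x::'k. x ^ p ^ m = x ^ p ^ n"
  shows "m = n"
proof -
  obtain g where g: "g \<noteq> (0::'k)" "\<forall>x. x \<noteq> 0 \<longrightarrow> (\<exists>n::nat. x = g ^ n)" using generator by blast
  have aux: "m = n" if le: "m \<le> n" "n < f" and e: "g ^ p ^ m = g ^ p ^ n" for m n
  proof -
    have le': "p ^ m \<le> p ^ n" using le p_gt_1 by (intro power_increasing) auto
    have "g ^ p ^ m * g ^ (p ^ n - p ^ m) = g ^ p ^ n"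
      using le' by (simp only: le_add_diff_inverse flip: power_add)
    then have "g ^ (p ^ n - p ^ m) = 1" using g e by simp
    then have d: "(p ^ f - 1) dvd (p ^ n - p ^ m)" using generator_order g by blast
    have "p ^ n < p ^ f" using le p_gt_1 by (simp add: power_strict_increasing)
    moreover have "p ^ m > 0" using p_gt_1 by simp
    ultimately have "p ^ n - p ^ m < p ^ f - 1 \<or> p ^ n - p ^ m = 0" by linarith
    then have "p ^ n - p ^ m = 0" using d nat_dvd_not_less by auto
    then have "p ^ n = p ^ m" using le' by simp
    then show ?thesis using p_gt_1 by (simp add: power_inject_exp)
  qed
  have e: "g ^ p ^ m = g ^ p ^ n" using assms(3) by blast
  show ?thesis
  proof (cases "m \<le> n")
    case True
    then show ?thesis using aux e assms(2) by blast
  next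
    case False
    then have "n \<le> m" by simp
    then show ?thesis using aux[of n m] e[symmetric] assms(1) by blast
  qed
qed

text \<open>Stands in for the linear independence of automorphisms. The polynomial has linear
  coefficient c 0 and degree at most p ^ (f - 1), so it cannot vanish at all p ^ f elements. It
  later yields elements of nonzero trace.\<close>

lemma additive_poly_nonzero:
  assumes "c 0 \<noteq> (0::'k)"
  shows "\<exists>y. (\<Sum>m<f. c m * y ^ p ^ m) \<noteq> 0"
proof (rule ccontr)
  assume a: "\<not> ?thesis"
  define P where "P = (\<Sum>m<f. monom (c m) (p ^ m))"
  have "poly P y = 0" for y using a by (simp add: P_def poly_sum poly_monom)
  then have U: "{x. poly P x = 0} = UNIV" by auto
  have "coeff P 1 = (\<Sum>m<f. if m = 0 then c m else 0)"
    unfolding P_def coeff_sum by (intro sum.cong) (use p_gt_1 in \<open>auto\<close>)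
  also have "\<dots> = c 0" using f_pos by simp
  finally have P0: "P \<noteq> 0" using assms by auto
  have "degree P \<le> p ^ (f - 1)"
    unfolding P_def
  proof (intro degree_sum_le)
    fix m assume "m \<in> {..<f}"
    then have "p ^ m \<le> p ^ (f - 1)" using p_gt_1 by (intro power_increasing) auto
    then show "degree (monom (c m) (p ^ m)) \<le> p ^ (f - 1)"
      using degree_monom_le[of "c m" "p ^ m"] by linarith
  qed simp
  moreover have "p ^ (f - 1) < p ^ f" using p_gt_1 f_pos by (intro power_strict_increasing) auto
  ultimately have "degree P < card (UNIV :: 'k set)" using card_k by simp
  then show False using card_poly_roots_bound[OF P0] U by simp
qed

text \<open>Frobenius permutes the conjugates g ^ p ^ m of a generator g, so the polynomial
  \<open>Q\<close> with these roots has coefficients in the prime field. Hence \<psi> sends g to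
  another root of \<open>Q\<close>, and its value at g determines \<psi>.\<close>

lemma automorphism_is_frob:
  fixes \<psi> :: "'k \<Rightarrow> 'k"
  assumes add: "\<And>x y. \<psi> (x + y) = \<psi> x + \<psi> y" and mult: "\<And>x y. \<psi> (x * y) = \<psi> x * \<psi> y"
    and one: "\<psi> 1 = 1"
  shows "\<exists>m<f. \<forall>x. \<psi> x = x ^ p ^ m"
proof -
  obtain g where g: "g \<noteq> (0::'k)" "\<forall>x. x \<noteq> 0 \<longrightarrow> (\<exists>n::nat. x = g ^ n)" using generator by blast
  have z: "\<psi> 0 = 0" using add[of 0 0] by (metis add_cancel_left_left)
  have pw: "\<psi> (x ^ n) = \<psi> x ^ n" for x n by (induction n) (auto simp: one mult)
  define Q where "Q = (\<Prod>m<f. [:- (g ^ p ^ m), 1:])"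
  define F where "F = (\<lambda>x::'k. x ^ p)"
  have Fadd: "F (x + y) = F x + F y" for x y unfolding F_def using frob_add[of x y 1] by simp
  have Fz: "F 0 = 0" unfolding F_def using p_gt_1 by simp
  have Fm: "F (x * y) = F x * F y" for x y unfolding F_def by (simp add: power_mult_distrib)
  have F1: "F 1 = 1" by (simp add: F_def)
  have Fneg: "F (- x) = - F x" for x using Fadd[of x "-x"] Fz by (simp add: eq_neg_iff_add_eq_0 add.commute)
  have "map_poly F Q = (\<Prod>m<f. [:- (g ^ p ^ Suc m), 1:])"
    unfolding Q_def map_poly_hom_prod[OF Fz F1 Fadd Fm]
  proof (intro prod.cong refl poly_eqI)
    fix m i
    have "F (g ^ p ^ m) = g ^ p ^ Suc m" by (simp add: F_def mult.commute flip: power_mult)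
    then show "coeff (map_poly F [:- (g ^ p ^ m), 1:]) i = coeff [:- (g ^ p ^ Suc m), 1:] i"
      unfolding coeff_map_poly[where f = F, OF Fz] by (auto simp: Fneg Fz F1 coeff_pCons split: nat.splits)
  qed
  also have "\<dots> = (\<Prod>m\<in>{Suc 0..<Suc f}. [:- (g ^ p ^ m), 1:])"
    using prod.shift_bounds_Suc_ivl[of "\<lambda>m. [:- (g ^ p ^ m), 1:]" 0 f] by (simp add: lessThan_atLeast0)
  also have "\<dots> = (\<Prod>m\<in>{Suc 0..<f}. [:- (g ^ p ^ m), 1:]) * [:- (g ^ p ^ f), 1:]"
    using f_pos by (simp add: prod.atLeastLessThan_Suc)
  also have "\<dots> = (\<Prod>m\<in>{0..<f}. [:- (g ^ p ^ m), 1:])"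
    using f_pos by (subst prod.atLeast_Suc_lessThan[of 0 f]) (auto simp: power_card mult.commute)
  finally have "map_poly F Q = Q" by (simp add: Q_def lessThan_atLeast0)
  then have fixed: "coeff Q i ^ p = coeff Q i" for i
    by (metis F_def coeff_map_poly Fz)
  \<comment> \<open>The p residues of integers already exhaust the roots of X ^ p - X.\<close>
  have prime_field: "x \<in> range of_int" if x: "(x::'k) ^ p = x" for x
  proof -
    let ?R = "of_int ` {0..<int p} :: 'k set"
    have inj: "inj_on (of_int :: int \<Rightarrow> 'k) {0..<int p}"
    proof
      fix a b assume ab: "a \<in> {0..<int p}" "b \<in> {0..<int p}" "of_int a = (of_int b :: 'k)"
      then have "[a = b] (mod int p)" using of_int_eq_iff_cong_CHAR CHAR_k by metis
      then show "a = b" using ab by (auto simp: cong_def)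
    qed
    have pp: "(of_int n :: 'k) ^ p = of_int n" for n
    proof -
      have nn: "(of_nat m :: 'k) ^ p = of_nat m" for m
        by (induction m) (use p_gt_1 frob_add[of 1 _ 1] in auto)
      show ?thesis
      proof (cases n)
        case (neg m)
        then show ?thesis using nn[of "Suc m"] minus_power_prime_CHAR[of p "of_nat (Suc m) :: 'k"] CHAR_k prime_p
          by simp
      qed (use nn in simp)
    qed
    have P0: "monom (1::'k) p - monom 1 1 \<noteq> 0"
    proof
      assume "monom (1::'k) p - monom 1 1 = 0"
      then have "coeff (monom (1::'k) p - monom 1 1) p = 0" by simp
      then show False using p_gt_1 by simp
    qed
    have "degree (monom (1::'k) p - monom 1 1) \<le> p"
      using p_gt_1 by (intro degree_diff_le) (auto intro: order_trans[OF degree_monom_le])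
    then have c: "card {x::'k. x ^ p = x} \<le> p"
      using card_poly_roots_bound[OF P0] by (simp add: poly_monom)
    have "?R \<subseteq> {x::'k. x ^ p = x}" using pp by auto
    moreover have "card ?R = p" using inj by (simp add: card_image)
    ultimately have "?R = {x::'k. x ^ p = x}"
      using c finite_k by (metis card_seteq finite_subset subset_UNIV)
    then show ?thesis using x by auto
  qed
  have psi_int: "\<psi> (of_int n) = of_int n" for n
  proof -
    have nn: "\<psi> (of_nat m) = of_nat m" for m by (induction m) (auto simp: z add one)
    have "\<psi> (- x) = - \<psi> x" for x using add[of x "-x"] z by (simp add: eq_neg_iff_add_eq_0 add.commute)
    then show ?thesis using nn by (cases n) (auto simp del: of_nat_Suc)
  qed
  have sum_psi: "\<psi> (\<Sum>i\<in>A. t i) = (\<Sum>i\<in>A. \<psi> (t i))" for A and t :: "nat \<Rightarrow> 'k"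
    by (induction A rule: infinite_finite_induct) (auto simp: z add)
  have psiQ: "\<psi> (poly Q x) = poly Q (\<psi> x)" for x
  proof -
    have "\<psi> (coeff Q i) = coeff Q i" for i using prime_field[OF fixed] psi_int by (metis imageE)
    then show ?thesis by (simp add: poly_altdef sum_psi mult pw)
  qed
  have "poly Q g = 0" unfolding Q_def poly_prod using f_pos
    by (intro prod_zero) (auto intro!: bexI[of _ 0])
  then have "poly Q (\<psi> g) = 0" using psiQ[of g] z by simp
  then obtain m where m: "m < f" "\<psi> g = g ^ p ^ m"
    unfolding Q_def poly_prod by auto
  have "\<psi> x = x ^ p ^ m" for x
  proof (cases "x = 0")
    case True
    then show ?thesis using z p_gt_1 by simp
  next
    case False
    then obtain n where "x = g ^ n" using g by auto
    then show ?thesis using m pw by (simp add: mult.commute flip: power_mult)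
  qed
  then show ?thesis using m by blast
qed

text \<open>The degree gives at most p ^ d solutions. For the lower bound write p ^ f - 1 = (p ^ d -
  1) N: zero and the p ^ d - 1 distinct powers of g ^ N are all fixed.\<close>

lemma card_fixed_frob:
  assumes "d dvd f" "d > 0"
  shows "card {x::'k. x ^ p ^ d = x} = p ^ d"
proof -
  obtain g where g: "g \<noteq> (0::'k)" "\<forall>x. x \<noteq> 0 \<longrightarrow> (\<exists>n::nat. x = g ^ n)" using generator by blast
  have pd: "p ^ d > 1" using one_less_power[OF p_gt_1 assms(2)] .
  have P0: "monom (1::'k) (p ^ d) - monom 1 1 \<noteq> 0"
  proof
    assume "monom (1::'k) (p ^ d) - monom 1 1 = 0"
    then have "coeff (monom (1::'k) (p ^ d) - monom 1 1) (p ^ d) = 0" by simp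
    then show False using pd by simp
  qed
  have "degree (monom (1::'k) (p ^ d) - monom 1 1) \<le> p ^ d"
    using pd by (intro degree_diff_le) (auto intro: order_trans[OF degree_monom_le])
  then have c: "card {x::'k. x ^ p ^ d = x} \<le> p ^ d"
    using card_poly_roots_bound[OF P0] by (simp add: poly_monom)
  obtain j where j: "f = d * j" using assms by auto
  have "int (p ^ d) - 1 dvd int (p ^ d) ^ j - 1"
    by (metis power_diff_1_eq dvd_triv_left)
  then have "int (p ^ d - 1) dvd int (p ^ f - 1)"
    using p_gt_1 by (simp add: j power_mult of_nat_diff)
  then have "p ^ d - 1 dvd p ^ f - 1" by simp
  then obtain N where N: "p ^ f - 1 = (p ^ d - 1) * N" by auto
  have N0: "N > 0" using N one_less_power[OF p_gt_1 f_pos] by (cases N) auto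
  let ?A = "insert 0 ((\<lambda>i. g ^ (N * i)) ` {..<p ^ d - 1})"
  have inj: "inj_on (\<lambda>i. g ^ (N * i)) {..<p ^ d - 1}"
  proof (rule linorder_inj_onI')
    fix i i' assume i: "i \<in> {..<p ^ d - 1}" "i' \<in> {..<p ^ d - 1}" "i < i'"
    show "g ^ (N * i) \<noteq> g ^ (N * i')"
    proof
      assume "g ^ (N * i) = g ^ (N * i')"
      moreover have "g ^ (N * i) * g ^ (N * (i' - i)) = g ^ (N * i')"
        using i by (simp only: less_imp_le le_add_diff_inverse flip: power_add add_mult_distrib2)
      ultimately have "g ^ (N * (i' - i)) = 1" using g by simp
      then have "p ^ f - 1 dvd N * (i' - i)" using generator_order g by blast
      then have "p ^ d - 1 dvd i' - i" using N N0 by (simp add: mult.commute)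
      then show False using i by (auto dest!: dvd_imp_le)
    qed
  qed
  have "?A \<subseteq> {x::'k. x ^ p ^ d = x}"
  proof -
    have "(g ^ (N * i)) ^ p ^ d = g ^ (N * i)" for i
    proof -
      have "(g ^ (N * i)) ^ p ^ d = (g ^ (N * i)) ^ (p ^ d - 1) * g ^ (N * i)"
        using pd power_Suc2[of "g ^ (N * i)" "p ^ d - 1"] by (simp only: Suc_diff_1)
      also have "(g ^ (N * i)) ^ (p ^ d - 1) = (g ^ (p ^ f - 1)) ^ i"
        unfolding N by (simp only: power_mult[symmetric] ac_simps)
      finally show ?thesis using power_card_minus_1[OF g(1)] by simp
    qed
    then show ?thesis using pd p_gt_1 by auto
  qed
  moreover have "card ?A = p ^ d"
    using inj g pd by (subst card_insert_disjoint) (auto simp: card_image)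
  ultimately have "p ^ d \<le> card {x::'k. x ^ p ^ d = x}"
    by (metis card_mono finite_k finite_subset subset_UNIV)
  then show ?thesis using c by simp
qed

end

section \<open>Finite extensions of the p-adic numbers\<close>

lemma subfield_class_ringD:
  fixes F :: "'a::field set"
  assumes "subfield F class_ring"
  shows "0 \<in> F" "1 \<in> F" "x \<in> F \<Longrightarrow> y \<in> F \<Longrightarrow> x + y \<in> F" "x \<in> F \<Longrightarrow> y \<in> F \<Longrightarrow> x * y \<in> F"
    "x \<in> F \<Longrightarrow> - x \<in> F" "x \<in> F \<Longrightarrow> inverse x \<in> F" "x \<in> F \<Longrightarrow> y \<in> F \<Longrightarrow> x - y \<in> F"
    "x \<in> F \<Longrightarrow> y \<in> F \<Longrightarrow> x / y \<in> F" "x \<in> F \<Longrightarrow> x ^ n \<in> F" "of_nat n \<in> F" "of_int i \<in> F"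
proof -
  note sr = subringE[OF subfieldE(1)[OF assms]]
  show z: "0 \<in> F" and o: "1 \<in> F" using sr(2,3) by auto
  have add: "x + y \<in> F" if "x \<in> F" "y \<in> F" for x y using sr(7) that by auto
  have mult: "x * y \<in> F" if "x \<in> F" "y \<in> F" for x y using sr(6) that by auto
  have neg: "- x \<in> F" if "x \<in> F" for x using sr(5)[OF that] by (simp add: class_ring_simps)
  have inv: "inverse x \<in> F" if x: "x \<in> F" for x
  proof (cases "x = 0")
    case False
    then have "x \<in> F - {0}" using x by simp
    then have u: "x \<in> Units (class_ring\<lparr>carrier := F\<rparr>)"
      using subfield.subfield_Units[OF assms] by simp
    then obtain y where "y \<in> F" "y * x = 1" by (auto simp: Units_def)
    then show ?thesis using False by (metis inverse_unique mult.commute)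
  qed (simp add: z)
  show "x \<in> F \<Longrightarrow> y \<in> F \<Longrightarrow> x + y \<in> F" "x \<in> F \<Longrightarrow> y \<in> F \<Longrightarrow> x * y \<in> F"
    "x \<in> F \<Longrightarrow> - x \<in> F" "x \<in> F \<Longrightarrow> inverse x \<in> F" using add mult neg inv by auto
  show "x \<in> F \<Longrightarrow> y \<in> F \<Longrightarrow> x - y \<in> F" using add[of x "-y"] neg by simp
  show "x \<in> F \<Longrightarrow> y \<in> F \<Longrightarrow> x / y \<in> F" using mult[of x "inverse y"] inv by (simp add: divide_inverse)
  show "x \<in> F \<Longrightarrow> x ^ n \<in> F" by (induction n) (auto simp: o mult)
  have nat: "of_nat n \<in> F" for n by (induction n) (auto simp: z o add)
  then show "of_nat n \<in> F" .
  show "of_int i \<in> F" using nat neg by (cases i) (auto simp del: of_nat_Suc)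
qed

text \<open>The n-th root of C tends to 1. This removes the constant from an estimate v (g x) \<le>
  C v x by applying it to the powers of x.\<close>

lemma le_if_powers_le:
  fixes a b C :: real
  assumes "a \<ge> 0" "b \<ge> 0" "\<And>n. a ^ n \<le> C * b ^ n"
  shows "a \<le> b"
proof (rule ccontr)
  assume "\<not> a \<le> b"
  then have ab: "b < a" by simp
  show False
  proof (cases "b = 0")
    case True
    then show ?thesis using assms(3)[of 1] ab by simp
  next
    case False
    then have b: "b > 0" using assms by simp
    obtain n where "C < (a / b) ^ n" using real_arch_pow[of "a / b" C] ab b by auto
    then have "C * b ^ n < a ^ n" using b by (simp add: power_divide field_simps)
    then show False using assms(3)[of n] by simp
  qed
qed

text \<open>Each line extension in the inductive definition of dimension multiplies the cardinality
  by that of F. The closure properties are carried along because injectivity of (c, e) \<mapsto> c w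
  + e depends on them.\<close>

lemma dimension_card:
  fixes F E :: "'a::field set"
  assumes "ring.dimension class_ring n F E" "subfield F class_ring" "finite F"
  shows "finite E \<and> card E = card F ^ n \<and> 0 \<in> E \<and> (\<forall>x\<in>E. \<forall>y\<in>E. x - y \<in> E) \<and> (\<forall>c\<in>F. \<forall>x\<in>E. c * x \<in> E)"
  using assms
proof (induction rule: ring.dimension.induct[OF class_ring.ring_axioms, consumes 1])
  case (1 K)
  then show ?case by auto
next
  case (2 w E n F)
  note F = subfield_class_ringD[OF 2(5)]
  have fin: "finite E" "card E = card F ^ n" and z: "0 \<in> E" and sub: "\<And>x y. x \<in> E \<Longrightarrow> y \<in> E \<Longrightarrow> x - y \<in> E"
    and sc: "\<And>c x. c \<in> F \<Longrightarrow> x \<in> E \<Longrightarrow> c * x \<in> E" using 2 by auto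
  let ?h = "\<lambda>(c, e). c * w + e"
  have E': "ring.line_extension class_ring F w E = ?h ` (F \<times> E)"
    by (auto simp: ring.line_extension_mem_iff[OF class_ring.ring_axioms] image_iff) blast
  have inj: "inj_on ?h (F \<times> E)"
  proof (rule inj_onI, clarify)
    fix c e c' e' assume a: "c \<in> F" "e \<in> E" "c' \<in> F" "e' \<in> E" "c * w + e = c' * w + e'"
    have eq: "(c - c') * w = e' - e" using a(5) by (simp add: algebra_simps)
    have "c = c'"
    proof (rule ccontr)
      assume n: "c \<noteq> c'"
      then have "w = inverse (c - c') * (e' - e)" using eq by (simp add: field_simps)
      then have "w \<in> E" using sc[OF F(6)[OF F(7)[OF a(1,3)]] sub[OF a(4,2)]] by simp
      then show False using 2 by simp
    qed
    then show "c = c' \<and> e = e'" using a by simp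
  qed
  have "x - y \<in> ?h ` (F \<times> E)" if "x \<in> ?h ` (F \<times> E)" "y \<in> ?h ` (F \<times> E)" for x y
  proof -
    obtain c e c' e' where "c \<in> F" "e \<in> E" "c' \<in> F" "e' \<in> E" "x = c * w + e" "y = c' * w + e'" using \<open>x \<in> _\<close> \<open>y \<in> _\<close> by auto
    then show ?thesis using F(7) sub by (intro image_eqI[of _ _ "(c - c', e - e')"]) (auto simp: algebra_simps)
  qed
  moreover have "a * x \<in> ?h ` (F \<times> E)" if "a \<in> F" "x \<in> ?h ` (F \<times> E)" for a x
  proof -
    obtain c e where "c \<in> F" "e \<in> E" "x = c * w + e" using \<open>x \<in> _\<close> by auto
    then show ?thesis using F(4) sc \<open>a \<in> F\<close> by (intro image_eqI[of _ _ "(a * c, a * e)"]) (auto simp: algebra_simps)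
  qed
  moreover have "0 \<in> ?h ` (F \<times> E)" using F(1) z by (intro image_eqI[of _ _ "(0, 0)"]) auto
  ultimately show ?case unfolding E' using fin 2(6) inj by (auto simp: card_image card_cartesian_product)
qed

locale breuil_setting =
  fixes D :: "('a::{alg_closed_field,field_char_0}, 'k::field, 'e::field, 't::comm_ring_1) datum"
  assumes setting: "setting D"
begin

abbreviation "p \<equiv> prm D"
abbreviation "v \<equiv> absv D"
abbreviation "Qp \<equiv> fQp D"
abbreviation "L \<equiv> fL D"
abbreviation "K \<equiv> fK D"
abbreviation "\<pi> \<equiv> unif D"
abbreviation "\<rho> \<equiv> resK D"
abbreviation "OK \<equiv> int_ring v K"

lemmas setting_conjs = setting[unfolded setting_def]

lemma prime_p: "prime p"
  and odd_p: "odd p"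
  and padic: "padic_closure p v Qp"
  and L_subfield: "subfield L class_ring"
  and K_subfield: "subfield K class_ring"
  and QpL: "Qp \<subseteq> L"
  and LK: "L \<subseteq> K"
  and K_findim: "ring.finite_dimension class_ring Qp K"
  and fixed_L: "{x \<in> K. \<forall>g\<in>Gal D. g x = x} = L"
  and tame: "\<not> p dvd ram_KL D"
  and unif: "uniformiser v K \<pi>"
  and unif_pow: "\<pi> ^ ram_KL D \<in> L"
  and res: "residue_map v K \<rho>"
  and sig_hom: "\<forall>i. sig D i \<in> ring_hom class_ring class_ring"
  and sig_pow: "\<forall>i x. sig D (i + 1) x ^ p = sig D i x"
  and tensor: "is_tensor_product (inl D) (inr D)"
  using setting_conjs[THEN conjunct1]
    setting_conjs[THEN conjunct2, THEN conjunct1]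
    setting_conjs[THEN conjunct2, THEN conjunct2, THEN conjunct1]
    setting_conjs[THEN conjunct2, THEN conjunct2, THEN conjunct2, THEN conjunct1]
    setting_conjs[THEN conjunct2, THEN conjunct2, THEN conjunct2, THEN conjunct2, THEN conjunct1]
    setting_conjs[THEN conjunct2, THEN conjunct2, THEN conjunct2, THEN conjunct2, THEN conjunct2, THEN conjunct2, THEN conjunct1]
    setting_conjs[THEN conjunct2, THEN conjunct2, THEN conjunct2, THEN conjunct2, THEN conjunct2, THEN conjunct2, THEN conjunct2, THEN conjunct1]
    setting_conjs[THEN conjunct2, THEN conjunct2, THEN conjunct2, THEN conjunct2, THEN conjunct2, THEN conjunct2, THEN conjunct2, THEN conjunct2, THEN conjunct2, THEN conjunct2, THEN conjunct1]
    setting_conjs[THEN conjunct2, THEN conjunct2, THEN conjunct2, THEN conjunct2, THEN conjunct2, THEN conjunct2, THEN conjunct2, THEN conjunct2, THEN conjunct2, THEN conjunct2, THEN conjunct2, THEN conjunct2, THEN conjunct1]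
    setting_conjs[THEN conjunct2, THEN conjunct2, THEN conjunct2, THEN conjunct2, THEN conjunct2, THEN conjunct2, THEN conjunct2, THEN conjunct2, THEN conjunct2, THEN conjunct2, THEN conjunct2, THEN conjunct2, THEN conjunct2, THEN conjunct1]
    setting_conjs[THEN conjunct2, THEN conjunct2, THEN conjunct2, THEN conjunct2, THEN conjunct2, THEN conjunct2, THEN conjunct2, THEN conjunct2, THEN conjunct2, THEN conjunct2, THEN conjunct2, THEN conjunct2, THEN conjunct2, THEN conjunct2, THEN conjunct1]
    setting_conjs[THEN conjunct2, THEN conjunct2, THEN conjunct2, THEN conjunct2, THEN conjunct2, THEN conjunct2, THEN conjunct2, THEN conjunct2, THEN conjunct2, THEN conjunct2, THEN conjunct2, THEN conjunct2, THEN conjunct2, THEN conjunct2, THEN conjunct2, THEN conjunct1]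
    setting_conjs[THEN conjunct2, THEN conjunct2, THEN conjunct2, THEN conjunct2, THEN conjunct2, THEN conjunct2, THEN conjunct2, THEN conjunct2, THEN conjunct2, THEN conjunct2, THEN conjunct2, THEN conjunct2, THEN conjunct2, THEN conjunct2, THEN conjunct2, THEN conjunct2, THEN conjunct2, THEN conjunct1]
    setting_conjs[THEN conjunct2, THEN conjunct2, THEN conjunct2, THEN conjunct2, THEN conjunct2, THEN conjunct2, THEN conjunct2, THEN conjunct2, THEN conjunct2, THEN conjunct2, THEN conjunct2, THEN conjunct2, THEN conjunct2, THEN conjunct2, THEN conjunct2, THEN conjunct2, THEN conjunct2, THEN conjunct2, THEN conjunct2, THEN conjunct1]
    setting_conjs[THEN conjunct2, THEN conjunct2, THEN conjunct2, THEN conjunct2, THEN conjunct2, THEN conjunct2, THEN conjunct2, THEN conjunct2, THEN conjunct2, THEN conjunct2, THEN conjunct2, THEN conjunct2, THEN conjunct2, THEN conjunct2, THEN conjunct2, THEN conjunct2, THEN conjunct2, THEN conjunct2, THEN conjunct2, THEN conjunct2, THEN conjunct1]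
    setting_conjs[THEN conjunct2, THEN conjunct2, THEN conjunct2, THEN conjunct2, THEN conjunct2, THEN conjunct2, THEN conjunct2, THEN conjunct2, THEN conjunct2, THEN conjunct2, THEN conjunct2, THEN conjunct2, THEN conjunct2, THEN conjunct2, THEN conjunct2, THEN conjunct2, THEN conjunct2, THEN conjunct2, THEN conjunct2, THEN conjunct2, THEN conjunct2]
  by - assumption+

lemma Qp_subfield: "subfield Qp class_ring"
  by (rule padic[unfolded padic_closure_def, THEN conjunct2, THEN conjunct2, THEN conjunct2, THEN conjunct2, THEN conjunct2, THEN conjunct1])

lemma p_ge_3: "p \<ge> 3"
proof -
  have "p \<ge> 2" using prime_p prime_ge_2_nat by blast
  moreover have "p \<noteq> 2" using odd_p by auto
  ultimately show ?thesis by linarith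
qed

lemma absv_axioms:
  "\<forall>x. v x \<ge> 0" "\<forall>x. v x = 0 \<longleftrightarrow> x = 0" "\<forall>x y. v (x * y) = v x * v y"
  "\<forall>x y. v (x + y) \<le> max (v x) (v y)" "\<forall>q. v (of_rat q) = padic_abs p q"
  "\<forall>x\<in>Qp. \<forall>\<epsilon>>0. \<exists>q. v (x - of_rat q) < \<epsilon>"
  "\<forall>X. range X \<subseteq> Qp \<and> (\<forall>\<epsilon>>0. \<exists>n0. \<forall>m\<ge>n0. \<forall>n\<ge>n0. v (X m - X n) < \<epsilon>)
        \<longrightarrow> (\<exists>l\<in>Qp. \<forall>\<epsilon>>0. \<exists>n0::nat. \<forall>n\<ge>n0. v (X n - l) < \<epsilon>)"
proof -
  show "\<forall>x. v x \<ge> 0"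
    by (rule padic[unfolded padic_closure_def, THEN conjunct1])
  show "\<forall>x. v x = 0 \<longleftrightarrow> x = 0"
    by (rule padic[unfolded padic_closure_def, THEN conjunct2, THEN conjunct1])
  show "\<forall>x y. v (x * y) = v x * v y"
    by (rule padic[unfolded padic_closure_def, THEN conjunct2, THEN conjunct2, THEN conjunct1])
  show "\<forall>x y. v (x + y) \<le> max (v x) (v y)"
    by (rule padic[unfolded padic_closure_def, THEN conjunct2, THEN conjunct2, THEN conjunct2, THEN conjunct1])
  show "\<forall>q. v (of_rat q) = padic_abs p q"
    by (rule padic[unfolded padic_closure_def, THEN conjunct2, THEN conjunct2, THEN conjunct2, THEN conjunct2, THEN conjunct1])
  show "\<forall>x\<in>Qp. \<forall>\<epsilon>>0. \<exists>q. v (x - of_rat q) < \<epsilon>"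
    by (rule padic[unfolded padic_closure_def, THEN conjunct2, THEN conjunct2, THEN conjunct2, THEN conjunct2, THEN conjunct2, THEN conjunct2, THEN conjunct1])
  show "\<forall>X. range X \<subseteq> Qp \<and> (\<forall>\<epsilon>>0. \<exists>n0. \<forall>m\<ge>n0. \<forall>n\<ge>n0. v (X m - X n) < \<epsilon>)
        \<longrightarrow> (\<exists>l\<in>Qp. \<forall>\<epsilon>>0. \<exists>n0::nat. \<forall>n\<ge>n0. v (X n - l) < \<epsilon>)"
    by (rule padic[unfolded padic_closure_def, THEN conjunct2, THEN conjunct2, THEN conjunct2, THEN conjunct2, THEN conjunct2, THEN conjunct2, THEN conjunct2, THEN conjunct1])
qed

section \<open>Elementary properties of the absolute value\<close>

lemma v_nonneg: "v x \<ge> 0" and v_0_iff: "v x = 0 \<longleftrightarrow> x = 0" and v_mult: "v (x * y) = v x * v y"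
  and v_add: "v (x + y) \<le> max (v x) (v y)" and v_rat: "v (of_rat q) = padic_abs p q"
  by (rule absv_axioms(1-5)[rule_format])+

lemma Qp_dense: "x \<in> Qp \<Longrightarrow> \<epsilon> > 0 \<Longrightarrow> \<exists>q. v (x - of_rat q) < \<epsilon>"
  by (rule absv_axioms(6)[rule_format])

lemma Qp_complete: "range X \<subseteq> Qp \<Longrightarrow> (\<forall>\<epsilon>>0. \<exists>n0. \<forall>m\<ge>n0. \<forall>n\<ge>n0. v (X m - X n) < \<epsilon>)
        \<Longrightarrow> \<exists>l\<in>Qp. \<forall>\<epsilon>>0. \<exists>n0::nat. \<forall>n\<ge>n0. v (X n - l) < \<epsilon>"
  by (rule absv_axioms(7)[rule_format]) blast

lemmas Qp_closed = subfield_class_ringD[OF Qp_subfield]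
lemmas L_closed = subfield_class_ringD[OF L_subfield]
lemmas K_closed = subfield_class_ringD[OF K_subfield]

lemma v_0 [simp]: "v 0 = 0" and v_1 [simp]: "v 1 = 1"
proof -
  show "v 0 = 0" using v_0_iff by simp
  have "v 1 * v 1 = v 1" using v_mult[of 1 1] by simp
  then show "v 1 = 1" using v_0_iff[of 1] by simp
qed

lemma v_minus [simp]: "v (- x) = v x"
proof -
  have "v (-1) * v (-1) = 1" using v_mult[of "-1" "-1"] by simp
  then have "(v (-1) - 1) * (v (-1) + 1) = 0" by (simp add: algebra_simps)
  moreover have "v (-1) + 1 \<noteq> 0" using v_nonneg[of "-1"] by linarith
  ultimately have "v (-1) = 1" by simp
  then show ?thesis using v_mult[of "-1" x] by simp
qed

lemma v_diff: "v (x - y) \<le> max (v x) (v y)"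
  using v_add[of x "- y"] by simp

lemma v_power: "v (x ^ n) = v x ^ n"
  by (induction n) (auto simp: v_mult)

lemma v_inverse: "v (inverse x) = inverse (v x)"
proof (cases "x = 0")
  case False
  then have "v x * v (inverse x) = 1" using v_mult[of x "inverse x"] by simp
  then show ?thesis by (metis inverse_unique)
qed simp

lemma v_divide: "v (x / y) = v x / v y"
  by (simp add: divide_inverse v_mult v_inverse)

lemma v_pos: "x \<noteq> 0 \<Longrightarrow> v x > 0"
  using v_nonneg[of x] v_0_iff[of x] by simp

lemma v_p: "v (of_nat p) < 1"
proof -
  have "v (of_rat (of_nat p)) = padic_abs p (of_nat p)" by (rule v_rat)
  also have "quotient_of (of_nat p :: rat) = (int p, 1)" using quotient_of_int[of "int p"] by simp
  then have "padic_abs p (of_nat p) = real p powi (- 1)"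
    using prime_p unfolding padic_abs_def by (simp add: prime_gt_0_nat)
  also have "\<dots> < 1" using p_ge_3 by (simp add: power_int_minus field_simps)
  finally show ?thesis by simp
qed

lemma v_of_int: "v (of_int n) \<le> 1"
proof -
  have nat: "v (of_nat m) \<le> 1" for m
  proof (induction m)
    case (Suc m)
    then show ?case using v_add[of 1 "of_nat m"] by simp
  qed simp
  show ?thesis using nat by (cases n) (auto simp del: of_nat_Suc)
qed

subsection \<open>Automorphisms are isometries\<close>

text \<open>Equivalence of norms in the form needed here. By induction a space E of finite dimension
  over \<open>Qp\<close> is complete, hence closed, so a new vector w keeps a distance \<delta> > 0
  from E. This bounds both coordinates of c w + e by its absolute value, and completeness and
  boundedness of linear maps pass to the larger space. The base field is constrained by an equation
  so that the induction can treat it as a variable.\<close>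

lemma findim_complete_bounded:
  assumes "ring.dimension class_ring n F E" "F = Qp"
  shows "0 \<in> E \<and> (\<forall>x\<in>E. \<forall>y\<in>E. x - y \<in> E) \<and> (\<forall>c\<in>Qp. \<forall>x\<in>E. c * x \<in> E) \<and>
    (\<forall>X. range X \<subseteq> E \<longrightarrow> (\<forall>\<epsilon>>0. \<exists>n0. \<forall>m\<ge>n0. \<forall>n\<ge>n0. v (X m - X n) < \<epsilon>) \<longrightarrow>
        (\<exists>l\<in>E. \<forall>\<epsilon>>0. \<exists>n0::nat. \<forall>n\<ge>n0. v (X n - l) < \<epsilon>)) \<and>
    (\<forall>g. (\<forall>x\<in>E. \<forall>y\<in>E. g (x + y) = g x + g y) \<and> (\<forall>c\<in>Qp. \<forall>x\<in>E. g (c * x) = c * g x) \<longrightarrow>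
        (\<exists>C\<ge>0. \<forall>x\<in>E. v (g x) \<le> C * v x))"
  using assms
proof (induction rule: ring.dimension.induct[OF class_ring.ring_axioms, consumes 1])
  case (1 K)
  have g: "\<exists>C\<ge>0. v (g 0) \<le> C * v 0" if "\<forall>c\<in>Qp. g (c * 0) = c * g 0" for g
  proof -
    have "g 0 = 0 * g 0" using that Qp_closed(1) by (metis mult_zero_right)
    then show ?thesis by (auto intro: exI[of _ 0])
  qed
  have "\<exists>l\<in>{0}. \<forall>\<epsilon>>0. \<exists>n0::nat. \<forall>n\<ge>n0. v (X n - l) < \<epsilon>" if "range X \<subseteq> {0}" for X
  proof -
    have "X n = 0" for n using that by blast
    then show ?thesis by simp
  qed
  then show ?case using g by (simp del: mult_zero_right) (meson order_refl)
next
  case (2 w E n F)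
  have wE: "w \<notin> E" using 2 by simp
  have z: "0 \<in> E" and sub: "\<And>x y. x \<in> E \<Longrightarrow> y \<in> E \<Longrightarrow> x - y \<in> E"
    and sc: "\<And>c x. c \<in> Qp \<Longrightarrow> x \<in> E \<Longrightarrow> c * x \<in> E"
    and compl: "\<And>X. range X \<subseteq> E \<Longrightarrow> (\<forall>\<epsilon>>0. \<exists>n0. \<forall>m\<ge>n0. \<forall>n\<ge>n0. v (X m - X n) < \<epsilon>) \<Longrightarrow>
        (\<exists>l\<in>E. \<forall>\<epsilon>>0. \<exists>n0::nat. \<forall>n\<ge>n0. v (X n - l) < \<epsilon>)"
    and bdd: "\<And>g. \<forall>x\<in>E. \<forall>y\<in>E. g (x + y) = g x + g y \<Longrightarrow> \<forall>c\<in>Qp. \<forall>x\<in>E. g (c * x) = c * g x \<Longrightarrow>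
        (\<exists>C\<ge>0. \<forall>x\<in>E. v (g x) \<le> C * v x)"
    using 2 by simp_all
  have E': "ring.line_extension class_ring F w E = {c * w + e | c e. c \<in> Qp \<and> e \<in> E}"
    unfolding set_eq_iff ring.line_extension_mem_iff[OF class_ring.ring_axioms]
    using 2 by auto
  \<comment> \<open>Otherwise elements of E approach w; they form a Cauchy sequence, and its limit
    in E would be w.\<close>
  have "\<exists>\<delta>>0. \<forall>e\<in>E. \<delta> \<le> v (w - e)"
  proof (rule ccontr)
    assume a: "\<not> ?thesis"
    have "\<exists>e\<in>E. v (w - e) < inverse (real (Suc n))" for n
      using a by (meson inverse_positive_iff_positive not_le of_nat_0_less_iff zero_less_Suc)
    then obtain X where X: "\<And>n. X n \<in> E" "\<And>n. v (w - X n) < inverse (real (Suc n))" by metis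
    have small: "\<exists>n0. \<forall>n\<ge>n0. v (w - X n) < \<epsilon>" if "\<epsilon> > 0" for \<epsilon>
    proof -
      obtain n0 where n0: "inverse (real (Suc n0)) < \<epsilon>" using reals_Archimedean[OF \<open>\<epsilon> > 0\<close>] by auto
      have "v (w - X n) < \<epsilon>" if "n \<ge> n0" for n
      proof -
        have "inverse (real (Suc n)) \<le> inverse (real (Suc n0))" using that by (simp add: le_imp_inverse_le)
        then show ?thesis using X(2)[of n] n0 by linarith
      qed
      then show ?thesis by blast
    qed
    have "\<exists>l\<in>E. \<forall>\<epsilon>>0. \<exists>n0::nat. \<forall>n\<ge>n0. v (X n - l) < \<epsilon>"
    proof (rule compl)
      show "range X \<subseteq> E" using X by auto
      show "\<forall>\<epsilon>>0. \<exists>n0. \<forall>m\<ge>n0. \<forall>n\<ge>n0. v (X m - X n) < \<epsilon>"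
      proof (intro allI impI)
        fix \<epsilon> :: real assume "\<epsilon> > 0"
        then obtain n0 where n0: "\<forall>n\<ge>n0. v (w - X n) < \<epsilon>" using small by blast
        have "v (X m - X n) < \<epsilon>" if "m \<ge> n0" "n \<ge> n0" for m n
          using v_diff[of "w - X n" "w - X m"] n0 that by (auto simp: max_def split: if_splits intro: le_less_trans)
        then show "\<exists>n0. \<forall>m\<ge>n0. \<forall>n\<ge>n0. v (X m - X n) < \<epsilon>" by blast
      qed
    qed
    then obtain l where l: "l \<in> E" "\<And>\<epsilon>. \<epsilon> > 0 \<Longrightarrow> \<exists>n0::nat. \<forall>n\<ge>n0. v (X n - l) < \<epsilon>" by blast
    have "v (w - l) \<le> 0"
    proof (rule field_le_epsilon)
      fix \<epsilon> :: real assume "\<epsilon> > 0"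
      then obtain n0 n1 where n: "\<forall>n\<ge>n0. v (w - X n) < \<epsilon>" "\<forall>n\<ge>n1. v (X n - l) < \<epsilon>"
        using small[of \<epsilon>] l(2)[of \<epsilon>] by blast
      have "v (w - l) \<le> max (v (w - X (max n0 n1))) (v (X (max n0 n1) - l))"
        using v_add[of "w - X (max n0 n1)" "X (max n0 n1) - l"] by simp
      also have "\<dots> \<le> \<epsilon>" using n by (simp add: less_imp_le)
      finally show "v (w - l) \<le> 0 + \<epsilon>" by simp
    qed
    then have "w = l" using v_nonneg[of "w - l"] v_0_iff[of "w - l"] by simp
    then show False using l wE by simp
  qed
  then obtain \<delta> where d: "\<delta> > 0" "\<And>e. e \<in> E \<Longrightarrow> \<delta> \<le> v (w - e)" by blast
  \<comment> \<open>Dividing by c turns c w + e into w minus an element of E.\<close>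
  have b1: "v c \<le> v (c * w + e) / \<delta>" if "c \<in> Qp" "e \<in> E" for c e
  proof (cases "c = 0")
    case False
    have "- inverse c * e \<in> E" by (intro sc Qp_closed(5,6) that)
    then have "\<delta> \<le> v (w - (- inverse c * e))" using d by blast
    then have "v c * \<delta> \<le> v c * v (w - (- inverse c * e))" using v_nonneg by (intro mult_left_mono)
    also have "\<dots> = v (c * (w - (- inverse c * e)))" by (simp only: v_mult)
    also have "c * (w - (- inverse c * e)) = c * w + e" using False by (simp add: field_simps)
    finally show ?thesis using d by (simp add: field_simps)
  qed (use v_nonneg d in simp)
  define B where "B = max 1 (v w / \<delta>)"
  have B: "B \<ge> 1" by (simp add: B_def)
  have b2: "v e \<le> v (c * w + e) * B" if "c \<in> Qp" "e \<in> E" for c e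
  proof -
    have "v e \<le> max (v (c * w + e)) (v (c * w))" using v_diff[of "c * w + e" "c * w"] by simp
    moreover have "v (c * w) \<le> v (c * w + e) * B"
    proof -
      have "v (c * w) \<le> v (c * w + e) / \<delta> * v w"
        unfolding v_mult by (intro mult_right_mono b1 that v_nonneg)
      also have "\<dots> = v (c * w + e) * (v w / \<delta>)" by simp
      also have "\<dots> \<le> v (c * w + e) * B" unfolding B_def using v_nonneg by (intro mult_left_mono) auto
      finally show ?thesis .
    qed
    moreover have "v (c * w + e) * 1 \<le> v (c * w + e) * B" using B v_nonneg by (intro mult_left_mono) auto
    ultimately show ?thesis by simp
  qed
  let ?E' = "{c * w + e | c e. c \<in> Qp \<and> e \<in> E}"
  have add: "x + y \<in> E" if "x \<in> E" "y \<in> E" for x y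
    using sub[OF that(1) sub[OF z that(2)]] by simp
  have 1: "0 \<in> ?E'" using z Qp_closed(1) by force
  have 2: "x - y \<in> ?E'" if "x \<in> ?E'" "y \<in> ?E'" for x y
  proof -
    obtain c e c' e' where "c \<in> Qp" "e \<in> E" "c' \<in> Qp" "e' \<in> E" "x = c * w + e" "y = c' * w + e'"
      using \<open>x \<in> ?E'\<close> \<open>y \<in> ?E'\<close> by auto
    then show ?thesis using Qp_closed(7) sub by (intro CollectI exI[of _ "c - c'"] exI[of _ "e - e'"]) (auto simp: algebra_simps)
  qed
  have 3: "a * x \<in> ?E'" if "a \<in> Qp" "x \<in> ?E'" for a x
  proof -
    obtain c e where "c \<in> Qp" "e \<in> E" "x = c * w + e" using \<open>x \<in> ?E'\<close> by auto
    then show ?thesis using Qp_closed(4) sc \<open>a \<in> Qp\<close> by (intro CollectI exI[of _ "a * c"] exI[of _ "a * e"]) (auto simp: algebra_simps)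
  qed
  have 4: "\<exists>l\<in>?E'. \<forall>\<epsilon>>0. \<exists>n0::nat. \<forall>n\<ge>n0. v (X n - l) < \<epsilon>"
    if X: "range X \<subseteq> ?E'" and cau: "\<forall>\<epsilon>>0. \<exists>n0. \<forall>m\<ge>n0. \<forall>n\<ge>n0. v (X m - X n) < \<epsilon>" for X
  proof -
    have "\<exists>c e. c \<in> Qp \<and> e \<in> E \<and> X n = c * w + e" for n using X by blast
    then obtain c e where ce: "\<And>n. c n \<in> Qp" "\<And>n. e n \<in> E" "\<And>n. X n = c n * w + e n" by metis
    have diff: "X m - X n = (c m - c n) * w + (e m - e n)" for m n by (simp add: ce algebra_simps)
    have "\<forall>\<epsilon>>0. \<exists>n0. \<forall>m\<ge>n0. \<forall>n\<ge>n0. v (c m - c n) < \<epsilon>"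
    proof (intro allI impI)
      fix \<epsilon> :: real assume "\<epsilon> > 0"
      then have "\<epsilon> * \<delta> > 0" using d by simp
      then obtain n0 where n0: "\<forall>m\<ge>n0. \<forall>n\<ge>n0. v (X m - X n) < \<epsilon> * \<delta>" using cau by blast
      have "v (c m - c n) < \<epsilon>" if "m \<ge> n0" "n \<ge> n0" for m n
      proof -
        have "v (c m - c n) \<le> v (X m - X n) / \<delta>" unfolding diff by (intro b1 Qp_closed(7) sub ce)
        also have "\<dots> < \<epsilon>" using n0 that d by (simp add: field_simps)
        finally show ?thesis .
      qed
      then show "\<exists>n0. \<forall>m\<ge>n0. \<forall>n\<ge>n0. v (c m - c n) < \<epsilon>" by blast
    qed
    then obtain cl where cl: "cl \<in> Qp" "\<And>\<epsilon>. \<epsilon> > 0 \<Longrightarrow> \<exists>n0::nat. \<forall>n\<ge>n0. v (c n - cl) < \<epsilon>"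
      using Qp_complete[of c] ce by blast
    have "\<forall>\<epsilon>>0. \<exists>n0. \<forall>m\<ge>n0. \<forall>n\<ge>n0. v (e m - e n) < \<epsilon>"
    proof (intro allI impI)
      fix \<epsilon> :: real assume "\<epsilon> > 0"
      then have "\<epsilon> / B > 0" using B by simp
      then obtain n0 where n0: "\<forall>m\<ge>n0. \<forall>n\<ge>n0. v (X m - X n) < \<epsilon> / B" using cau by blast
      have "v (e m - e n) < \<epsilon>" if "m \<ge> n0" "n \<ge> n0" for m n
      proof -
        have "v (e m - e n) \<le> v (X m - X n) * B" unfolding diff by (intro b2 Qp_closed(7) sub ce)
        also have "\<dots> < \<epsilon>" using n0 that B by (simp add: field_simps)
        finally show ?thesis .
      qed
      then show "\<exists>n0. \<forall>m\<ge>n0. \<forall>n\<ge>n0. v (e m - e n) < \<epsilon>" by blast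
    qed
    then obtain el where el: "el \<in> E" "\<And>\<epsilon>. \<epsilon> > 0 \<Longrightarrow> \<exists>n0::nat. \<forall>n\<ge>n0. v (e n - el) < \<epsilon>"
      using compl[of e] ce by blast
    have "\<exists>n0::nat. \<forall>n\<ge>n0. v (X n - (cl * w + el)) < \<epsilon>" if eps: "\<epsilon> > 0" for \<epsilon>
    proof -
      have "\<epsilon> / (v w + 1) > 0" using eps v_nonneg[of w] by simp
      then obtain n0 n1 where n: "\<forall>n\<ge>n0. v (c n - cl) < \<epsilon> / (v w + 1)" "\<forall>n\<ge>n1. v (e n - el) < \<epsilon>"
        using cl(2)[of "\<epsilon> / (v w + 1)"] el(2)[OF eps] by blast
      have "v (X n - (cl * w + el)) < \<epsilon>" if "n \<ge> max n0 n1" for n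
      proof -
        have "v (X n - (cl * w + el)) \<le> max (v ((c n - cl) * w)) (v (e n - el))"
          using v_add[of "(c n - cl) * w" "e n - el"] by (simp add: ce algebra_simps)
        moreover have "v ((c n - cl) * w) < \<epsilon>"
        proof -
          have "v ((c n - cl) * w) \<le> v (c n - cl) * (v w + 1)" unfolding v_mult by (intro mult_left_mono v_nonneg) simp
          also have "\<dots> < \<epsilon>" using n(1) that v_nonneg[of w] by (simp add: field_simps)
          finally show ?thesis .
        qed
        moreover have "v (e n - el) < \<epsilon>" using n that by simp
        ultimately show ?thesis by simp
      qed
      then show ?thesis by blast
    qed
    then show ?thesis using cl el by blast
  qed
  have 5: "\<exists>C\<ge>0. \<forall>x\<in>?E'. v (g x) \<le> C * v x"
    if g: "\<forall>x\<in>?E'. \<forall>y\<in>?E'. g (x + y) = g x + g y" "\<forall>c\<in>Qp. \<forall>x\<in>?E'. g (c * x) = c * g x" for g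
  proof -
    have EE: "E \<subseteq> ?E'" using Qp_closed(1) by force
    have wE': "w \<in> ?E'" using Qp_closed(2) z by force
    have "\<exists>C\<ge>0. \<forall>x\<in>E. v (g x) \<le> C * v x"
    proof (rule bdd[of g])
      show "\<forall>x\<in>E. \<forall>y\<in>E. g (x + y) = g x + g y"
        by (intro ballI g(1)[rule_format] subsetD[OF EE])
      show "\<forall>c\<in>Qp. \<forall>x\<in>E. g (c * x) = c * g x"
        by (intro ballI g(2)[rule_format] subsetD[OF EE])
    qed
    then obtain C where C: "C \<ge> 0" "\<And>x. x \<in> E \<Longrightarrow> v (g x) \<le> C * v x" by blast
    have "v (g x) \<le> (v (g w) / \<delta> + C * B) * v x" if "x \<in> ?E'" for x
    proof -
      obtain c e where ce: "c \<in> Qp" "e \<in> E" "x = c * w + e" using \<open>x \<in> ?E'\<close> by auto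
      have cw: "c * w \<in> ?E'" using ce z by force
      have "g (c * w + e) = g (c * w) + g e" by (rule g(1)[rule_format, OF cw subsetD[OF EE ce(2)]])
      moreover have "g (c * w) = c * g w" by (rule g(2)[rule_format, OF ce(1) wE'])
      ultimately have gx: "g x = c * g w + g e" using ce(3) by simp
      have "v (c * g w) \<le> v x / \<delta> * v (g w)"
        unfolding v_mult ce(3) by (intro mult_right_mono b1 ce v_nonneg)
      moreover have "v (g e) \<le> C * (v x * B)"
        using C(2)[OF ce(2)] mult_left_mono[OF b2[OF ce(1,2)] C(1)] ce(3) by simp
      moreover have "0 \<le> v x / \<delta> * v (g w)" "0 \<le> C * (v x * B)" using v_nonneg d C B by auto
      ultimately have "v (g x) \<le> v x / \<delta> * v (g w) + C * (v x * B)"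
        using v_add[of "c * g w" "g e"] gx by (simp add: max_def split: if_splits)
      then show ?thesis by (simp add: algebra_simps)
    qed
    moreover have "v (g w) / \<delta> + C * B \<ge> 0" using v_nonneg d C B by simp
    ultimately show ?thesis by blast
  qed
  show ?case unfolding E'
    apply (intro conjI)
    subgoal by (rule 1)
    subgoal by (intro ballI 2)
    subgoal by (intro ballI 3)
    subgoal by (intro allI impI; rule 4; assumption)
    subgoal by (intro allI impI; elim conjE; rule 5; assumption)
    done
qed

lemma galD:
  assumes "g \<in> Gal D"
  shows "x \<in> K \<Longrightarrow> g x \<in> K" "x \<in> K \<Longrightarrow> y \<in> K \<Longrightarrow> g (x + y) = g x + g y"
    "x \<in> K \<Longrightarrow> y \<in> K \<Longrightarrow> g (x * y) = g x * g y" "g 1 = 1" "x \<in> L \<Longrightarrow> g x = x" "bij_betw g K K"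
    "g \<in> extensional K"
  using assms unfolding Gal_def galois_group_def ring_iso_def Ring.ring_hom_def by auto

lemma galI:
  assumes "g \<in> extensional K" "bij_betw g K K" "\<And>x y. x \<in> K \<Longrightarrow> y \<in> K \<Longrightarrow> g (x + y) = g x + g y"
    "\<And>x y. x \<in> K \<Longrightarrow> y \<in> K \<Longrightarrow> g (x * y) = g x * g y" "\<And>x. x \<in> L \<Longrightarrow> g x = x"
  shows "g \<in> Gal D"
  using assms L_closed(2) unfolding Gal_def galois_group_def ring_iso_def Ring.ring_hom_def
  by (auto simp: bij_betw_def)

lemma gal_zero: "g \<in> Gal D \<Longrightarrow> g 0 = 0"
  using galD(5) L_closed(1) by blast

lemma gal_minus: "g \<in> Gal D \<Longrightarrow> x \<in> K \<Longrightarrow> g (- x) = - g x"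
  using galD(2)[of g x "-x"] gal_zero[of g] K_closed by (simp add: eq_neg_iff_add_eq_0 add.commute)

lemma gal_diff: "g \<in> Gal D \<Longrightarrow> x \<in> K \<Longrightarrow> y \<in> K \<Longrightarrow> g (x - y) = g x - g y"
  using galD(2)[of g x "-y"] gal_minus[of g y] K_closed by simp

lemma gal_power: "g \<in> Gal D \<Longrightarrow> x \<in> K \<Longrightarrow> g (x ^ n) = g x ^ n"
  by (induction n) (auto simp: galD K_closed)

lemma gal_inverse: "g \<in> Gal D \<Longrightarrow> x \<in> K \<Longrightarrow> g (inverse x) = inverse (g x)"
proof (cases "x = 0")
  case False
  assume a: "g \<in> Gal D" "x \<in> K"
  then have "g x * g (inverse x) = 1" using galD(3)[of g x "inverse x"] galD(4)[of g] K_closed(6) False by simp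
  then show ?thesis by (metis inverse_unique)
qed (simp add: gal_zero)

lemma gal_divide: "g \<in> Gal D \<Longrightarrow> x \<in> K \<Longrightarrow> y \<in> K \<Longrightarrow> g (x / y) = g x / g y"
  by (simp add: divide_inverse galD K_closed gal_inverse)

lemma gal_sum:
  assumes "g \<in> Gal D"
  shows "(\<And>i. i \<in> A \<Longrightarrow> t i \<in> K) \<Longrightarrow> (\<Sum>i\<in>A. t i) \<in> K \<and> g (\<Sum>i\<in>A. t i) = (\<Sum>i\<in>A. g (t i))"
  by (induction A rule: infinite_finite_induct) (auto simp: galD[OF assms] gal_zero[OF assms] K_closed)

text \<open>Being linear over \<open>Qp\<close>, g satisfies v (g x) \<le> C v x. Applied to powers
  of x the estimate loses its constant, and applied to the inverse of x it reverses.\<close>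

lemma v_gal:
  assumes g: "g \<in> Gal D" and x: "x \<in> K"
  shows "v (g x) = v x"
proof -
  obtain n where "ring.dimension class_ring n Qp K"
    using K_findim ring.finite_dimension_def[OF class_ring.ring_axioms] by blast
  then have "(\<forall>x\<in>K. \<forall>y\<in>K. g (x + y) = g x + g y) \<and> (\<forall>c\<in>Qp. \<forall>x\<in>K. g (c * x) = c * g x) \<longrightarrow>
        (\<exists>C\<ge>0. \<forall>x\<in>K. v (g x) \<le> C * v x)" using findim_complete_bounded by blast
  moreover have "\<forall>c\<in>Qp. \<forall>x\<in>K. g (c * x) = c * g x" using galD(3,5)[OF g] QpL LK by (metis subsetD)
  ultimately obtain C where C: "\<And>x. x \<in> K \<Longrightarrow> v (g x) \<le> C * v x" using galD[OF g] by blast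
  have le: "v (g y) \<le> v y" if "y \<in> K" for y
  proof (rule le_if_powers_le[OF v_nonneg v_nonneg])
    fix n
    show "v (g y) ^ n \<le> C * v y ^ n"
      using C[of "y ^ n"] that K_closed(9) gal_power[OF g that] by (simp add: v_power)
  qed
  show ?thesis
  proof (cases "x = 0")
    case False
    have gx0: "g x \<noteq> 0"
      using galD(6)[OF g] gal_zero[OF g] False x K_closed(1) by (metis bij_betw_inv_into_left)
    have "inverse (v (g x)) \<le> inverse (v x)"
      using le[of "inverse x"] x K_closed(6) gal_inverse[OF g x] by (simp add: v_inverse)
    then have "v x \<le> v (g x)" using v_pos[OF False] v_pos[OF gx0] by (simp add: inverse_le_iff_le)
    then show ?thesis using le[OF x] by simp
  qed (use gal_zero[OF g] in simp)
qed

end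

context breuil_setting
begin

subsection \<open>The residue field\<close>

lemma OK_D: "x \<in> OK \<Longrightarrow> x \<in> K" "x \<in> OK \<Longrightarrow> v x \<le> 1"
  and OK_I: "x \<in> K \<Longrightarrow> v x \<le> 1 \<Longrightarrow> x \<in> OK"
  by (auto simp: int_ring_def)

lemma OK_closed: "0 \<in> OK" "1 \<in> OK" "x \<in> OK \<Longrightarrow> y \<in> OK \<Longrightarrow> x + y \<in> OK" "x \<in> OK \<Longrightarrow> y \<in> OK \<Longrightarrow> x * y \<in> OK"
  "x \<in> OK \<Longrightarrow> - x \<in> OK" "x \<in> OK \<Longrightarrow> y \<in> OK \<Longrightarrow> x - y \<in> OK" "x \<in> OK \<Longrightarrow> x ^ n \<in> OK" "of_nat n \<in> OK" "of_int i \<in> OK"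
proof -
  show "0 \<in> OK" and o: "1 \<in> OK" by (auto simp: int_ring_def K_closed)
  show "x \<in> OK \<Longrightarrow> y \<in> OK \<Longrightarrow> x + y \<in> OK"
    using v_add[of x y] by (auto simp: int_ring_def K_closed)
  show "- x \<in> OK" if "x \<in> OK" using that by (auto simp: int_ring_def K_closed)
  show mult: "x \<in> OK \<Longrightarrow> y \<in> OK \<Longrightarrow> x * y \<in> OK" for x y
    using v_nonneg by (auto simp: int_ring_def K_closed v_mult mult_le_one)
  show "x \<in> OK \<Longrightarrow> y \<in> OK \<Longrightarrow> x - y \<in> OK"
    using v_diff[of x y] by (auto simp: int_ring_def K_closed)
  show "x \<in> OK \<Longrightarrow> x ^ n \<in> OK" by (induction n) (auto simp: o mult)
  show "of_int i \<in> OK" for i by (auto simp: int_ring_def K_closed v_of_int)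
  from this[of "int n"] show "of_nat n \<in> OK" by simp
qed

lemma OK_sum: "(\<And>i. i \<in> A \<Longrightarrow> t i \<in> OK) \<Longrightarrow> (\<Sum>i\<in>A. t i) \<in> OK"
  by (induction A rule: infinite_finite_induct) (auto simp: OK_closed)

lemma rho_1: "\<rho> 1 = 1" and rho_add: "x \<in> OK \<Longrightarrow> y \<in> OK \<Longrightarrow> \<rho> (x + y) = \<rho> x + \<rho> y"
  and rho_mult: "x \<in> OK \<Longrightarrow> y \<in> OK \<Longrightarrow> \<rho> (x * y) = \<rho> x * \<rho> y"
  and rho_surj: "\<exists>y\<in>OK. \<rho> y = z" and rho_0_iff: "x \<in> OK \<Longrightarrow> \<rho> x = 0 \<longleftrightarrow> v x < 1"
proof -
  have h: "\<rho> \<in> ring_hom (class_ring\<lparr>carrier := OK\<rparr>) class_ring" "\<rho> ` OK = UNIV"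
    "{x \<in> OK. \<rho> x = 0} = max_ideal v K"
    using res unfolding residue_map_def by auto
  show "\<rho> 1 = 1" "x \<in> OK \<Longrightarrow> y \<in> OK \<Longrightarrow> \<rho> (x + y) = \<rho> x + \<rho> y"
    "x \<in> OK \<Longrightarrow> y \<in> OK \<Longrightarrow> \<rho> (x * y) = \<rho> x * \<rho> y"
    using h(1) by (auto simp: Ring.ring_hom_def)
  show "\<exists>y\<in>OK. \<rho> y = z" using h(2) by (metis UNIV_I imageE)
  show "x \<in> OK \<Longrightarrow> \<rho> x = 0 \<longleftrightarrow> v x < 1" using h(3) by (auto simp: max_ideal_def int_ring_def)
qed

lemma rho_0: "\<rho> 0 = 0"
  using rho_0_iff OK_closed(1) by simp

lemma rho_minus: "x \<in> OK \<Longrightarrow> \<rho> (- x) = - \<rho> x"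
  using rho_add[of x "- x"] rho_0 OK_closed(5) by (simp add: eq_neg_iff_add_eq_0 add.commute)

lemma rho_diff: "x \<in> OK \<Longrightarrow> y \<in> OK \<Longrightarrow> \<rho> (x - y) = \<rho> x - \<rho> y"
  using rho_add[of x "- y"] rho_minus[of y] OK_closed(5) by simp

lemma rho_power: "x \<in> OK \<Longrightarrow> \<rho> (x ^ n) = \<rho> x ^ n"
  by (induction n) (auto simp: rho_1 rho_mult OK_closed)

lemma rho_sum: "(\<And>i. i \<in> A \<Longrightarrow> t i \<in> OK) \<Longrightarrow> \<rho> (\<Sum>i\<in>A. t i) = (\<Sum>i\<in>A. \<rho> (t i))"
  by (induction A rule: infinite_finite_induct) (auto simp: rho_0 rho_add OK_sum)

lemma rho_of_nat: "\<rho> (of_nat n) = of_nat n"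
  by (induction n) (auto simp: rho_0 rho_1 rho_add OK_closed)

lemma rho_of_int: "\<rho> (of_int n) = of_int n"
proof (cases n)
  case (neg m)
  then show ?thesis using rho_minus[OF OK_closed(8)[of "Suc m"]] rho_of_nat[of "Suc m"]
    by (simp del: of_nat_Suc)
qed (simp add: rho_of_nat)

lemma rho_eq_iff: "x \<in> OK \<Longrightarrow> y \<in> OK \<Longrightarrow> \<rho> x = \<rho> y \<longleftrightarrow> v (x - y) < 1"
  using rho_0_iff[of "x - y"] rho_diff[of x y] OK_closed(6)[of x y] by simp

lemma char_k: "of_nat p = (0::'k)"
  using rho_of_nat[of p] rho_0_iff[OF OK_closed(8)[of p]] v_p by simp

abbreviation Fp :: "'k set" where "Fp \<equiv> range of_int"

lemma CHAR_k: "CHAR('k) = p"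
proof -
  have "CHAR('k) dvd p" using char_k of_nat_eq_0_iff_char_dvd by blast
  moreover have "CHAR('k) \<noteq> 1" by simp
  ultimately show ?thesis using prime_p by (auto simp: prime_nat_iff)
qed

lemma Fp_inverse: "inverse (of_int n :: 'k) \<in> Fp"
proof (cases "of_int n = (0::'k)")
  case True
  then show ?thesis by (metis inverse_zero of_int_0 rangeI)
next
  case False
  then have "\<not> int p dvd n" using CHAR_k of_int_eq_0_iff_char_dvd[of n, where ?'a = 'k] by simp
  then have "coprime (int p) n" using prime_p prime_imp_coprime by (metis prime_nat_int_transfer)
  then obtain x where x: "[n * x = 1] (mod int p)" by (metis coprime_commute cong_solve_coprime_int)
  then have "(of_int (n * x) :: 'k) = of_int 1" using of_int_eq_iff_cong_CHAR CHAR_k by metis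
  then have "inverse (of_int n :: 'k) = of_int x" by (simp add: inverse_unique)
  then show ?thesis by simp
qed

lemma Fp_eq: "Fp = of_int ` {0..<int p}"
proof -
  have "(of_int n :: 'k) = of_int (n mod int p)" for n
    using of_int_eq_iff_cong_CHAR[of n "n mod int p", where ?'a = 'k] CHAR_k by (simp add: cong_def)
  moreover have "n mod int p \<in> {0..<int p}" for n using p_ge_3 by simp
  ultimately show ?thesis by blast
qed

lemma card_Fp: "finite Fp" "card Fp = p"
proof -
  have "inj_on (of_int :: int \<Rightarrow> 'k) {0..<int p}"
  proof
    fix a b assume ab: "a \<in> {0..<int p}" "b \<in> {0..<int p}" "of_int a = (of_int b :: 'k)"
    then have "[a = b] (mod int p)" using of_int_eq_iff_cong_CHAR CHAR_k by metis
    then show "a = b" using ab by (auto simp: cong_def)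
  qed
  then show "card Fp = p" unfolding Fp_eq by (simp add: card_image)
  show "finite Fp" unfolding Fp_eq by simp
qed

lemma Fp_subfield: "subfield Fp class_ring"
proof (rule ring.subfieldI[OF class_ring.ring_axioms[where 'a = 'k]])
  have neg: "- h \<in> Fp" if "h \<in> Fp" for h :: 'k
  proof -
    obtain n where "h = of_int n" using \<open>h \<in> Fp\<close> by auto
    then have "- h = of_int (- n)" by simp
    then show ?thesis by (simp only: rangeI)
  qed
  have mult: "h1 * h2 \<in> Fp" and add: "h1 + h2 \<in> Fp" if h: "h1 \<in> Fp" "h2 \<in> Fp" for h1 h2 :: 'k
  proof -
    obtain m n where "h1 = of_int m" "h2 = of_int n" using h by auto
    then have "h1 * h2 = of_int (m * n)" "h1 + h2 = of_int (m + n)" by simp_all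
    then show "h1 * h2 \<in> Fp" "h1 + h2 \<in> Fp" by (simp_all only: rangeI)
  qed
  have "1 = (of_int 1 :: 'k)" by simp
  then have one: "(1::'k) \<in> Fp" by (rule range_eqI)
  have "subring Fp (class_ring :: 'k ring)"
    apply (rule ring.subringI[OF class_ring.ring_axioms[where 'a = 'k]])
    subgoal by simp
    subgoal using one by simp
    subgoal using neg by (simp add: class_ring_simps)
    subgoal using mult by simp
    subgoal using add by simp
    done
  then show "subcring Fp (class_ring :: 'k ring)"
    by (rule ring.subcringI[OF class_ring.ring_axioms[where 'a = 'k]]) auto
  have "k \<in> Units ((class_ring :: 'k ring)\<lparr>carrier := Fp\<rparr>) \<longleftrightarrow> k \<in> Fp - {0}" for k
  proof
    assume "k \<in> Units ((class_ring :: 'k ring)\<lparr>carrier := Fp\<rparr>)"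
    then show "k \<in> Fp - {0}" by (auto simp: Units_def)
  next
    assume k: "k \<in> Fp - {0}"
    then have "inverse k \<in> Fp" using Fp_inverse by auto
    moreover have "inverse k * k = 1" "k * inverse k = 1" "k \<in> Fp" using k by auto
    ultimately show "k \<in> Units ((class_ring :: 'k ring)\<lparr>carrier := Fp\<rparr>)"
      unfolding Units_def by (intro CollectI conjI bexI[of _ "inverse k"]) simp_all
  qed
  then show "Units ((class_ring :: 'k ring)\<lparr>carrier := Fp\<rparr>) = Fp - {\<zero>\<^bsub>class_ring\<^esub>}" by auto
qed

text \<open>A rational number at distance less than 1 from x has the same residue. It is integral,
  so its reduced denominator is prime to p and has an invertible residue in the prime field.\<close>

lemma rho_Qp: "x \<in> Qp \<Longrightarrow> v x \<le> 1 \<Longrightarrow> \<rho> x \<in> Fp"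
proof -
  assume x: "x \<in> Qp" "v x \<le> 1"
  then obtain q where q: "v (x - of_rat q) < 1" using Qp_dense[of x 1] x by auto
  obtain a b where ab: "quotient_of q = (a, b)" by force
  then have b: "b > 0" "coprime a b" "q = of_int a / of_int b"
    using quotient_of_denom_pos quotient_of_coprime quotient_of_div by auto
  have "v (of_rat q) \<le> max (v x) (v (x - of_rat q))" using v_diff[of x "x - of_rat q"] by simp
  then have vq: "v (of_rat q) \<le> 1" using x q by simp
  have xK: "x \<in> OK" using x QpL LK by (auto simp: int_ring_def)
  have nb: "\<not> int p dvd b"
  proof
    assume pb: "int p dvd b"
    then have pa: "\<not> int p dvd a" using b(2) prime_p
      by (metis coprime_common_divisor not_prime_unit prime_nat_int_transfer)
    have "q \<noteq> 0" using pa b by auto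
    then have "v (of_rat q) = real p powi (int (multiplicity (int p) b) - int (multiplicity (int p) a))"
      using v_rat[of q] ab by (simp add: padic_abs_def)
    also have "multiplicity (int p) a = 0" using pa by (simp add: not_dvd_imp_multiplicity_0)
    finally have e: "v (of_rat q) = real p ^ multiplicity (int p) b" by simp
    have "multiplicity (int p) b > 0" using pb b(1) prime_p by (intro multiplicity_gt_zero_iff[THEN iffD2]) auto
    then have "real p ^ multiplicity (int p) b > 1" using p_ge_3 by (intro one_less_power) auto
    then show False using e vq by simp
  qed
  have vb: "\<rho> (of_int b) \<noteq> 0"
    using nb rho_of_int[of b] CHAR_k of_int_eq_0_iff_char_dvd[of b, where ?'a = 'k] by simp
  have qK: "of_rat q \<in> OK" using b vq K_closed(8)[OF K_closed(11) K_closed(11), of a b]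
    by (simp add: int_ring_def of_rat_divide)
  have "of_rat q * of_int b = (of_int a :: 'a)" using b by (simp add: of_rat_divide)
  then have "\<rho> (of_rat q) * of_int b = of_int a"
    using rho_mult[OF qK OK_closed(9)[of b]] by (simp add: rho_of_int)
  then have "\<rho> (of_rat q) = of_int a * inverse (of_int b)" using vb by (simp add: rho_of_int field_simps)
  moreover obtain c where "inverse (of_int b :: 'k) = of_int c" using Fp_inverse by (metis imageE)
  ultimately have "\<rho> (of_rat q) = of_int (a * c)" by simp
  moreover have "\<rho> x = \<rho> (of_rat q)" using rho_eq_iff[OF xK qK] q by simp
  ultimately show ?thesis by (metis rangeI)
qed

lemma combine_in_OK:
  assumes "set ks \<subseteq> OK" "set us \<subseteq> OK"
  shows "ring.combine class_ring ks us \<in> OK \<and>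
    \<rho> (ring.combine class_ring ks us) = ring.combine class_ring (map \<rho> ks) (map \<rho> us)"
  using assms
proof (induction ks us rule: list_induct2')
qed (auto simp: ring.combine.simps[OF class_ring.ring_axioms] OK_closed rho_0 rho_add rho_mult)

text \<open>Dividing a relation over \<open>Qp\<close> by a coefficient of largest absolute value
  makes all coefficients integral and one of them 1; the residues then form a nontrivial relation
  over the prime field.\<close>

lemma independent_lift:
  assumes us: "set us \<subseteq> OK" and ind: "ring.independent class_ring Fp (map \<rho> us)"
  shows "ring.independent class_ring Qp us"
proof (rule ccontr)
  assume dep: "\<not> ?thesis"
  have ne: "us \<noteq> []" using dep ring.independent.li_Nil[OF class_ring.ring_axioms] by auto
  obtain ks where ks: "length ks = length us" "ring.combine class_ring ks us = 0" "set ks \<subseteq> Qp" "set ks \<noteq> {0}"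
    using ring.dependent_imp_non_trivial_combine[OF class_ring.ring_axioms Qp_subfield _ dep] by auto
  have ks_ne: "ks \<noteq> []" using ne ks(1) by auto
  then have fin: "finite (v ` set ks)" "v ` set ks \<noteq> {}" by auto
  then obtain k0 where k0: "k0 \<in> set ks" "v k0 = Max (v ` set ks)" using Max_in by (metis imageE)
  have mx: "v k \<le> v k0" if "k \<in> set ks" for k using that k0 fin by auto
  have k00: "k0 \<noteq> 0"
  proof
    assume "k0 = 0"
    then have "\<forall>k\<in>set ks. k = 0" using mx v_nonneg v_0_iff by (metis order_antisym v_0)
    then show False using ks(4) k0(1) by auto
  qed
  let ?ks = "map (\<lambda>k. k / k0) ks"
  have ksQ: "set ?ks \<subseteq> {x \<in> Qp. v x \<le> 1}"
    using ks(3) k0 k00 mx v_pos[OF k00] by (auto simp: v_divide Qp_closed(8) subset_iff)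
  have "ring.combine class_ring (map (\<lambda>k. k / k0) ks) us = ring.combine class_ring ks us / k0" for ks us
    by (induction ks us rule: list_induct2')
      (auto simp: ring.combine.simps[OF class_ring.ring_axioms] add_divide_distrib)
  then have c0: "ring.combine class_ring ?ks us = 0" using ks by simp
  have ksOK: "set ?ks \<subseteq> OK" using ksQ QpL LK unfolding int_ring_def by blast
  have "ring.combine class_ring (map \<rho> ?ks) (map \<rho> us) = 0"
    using combine_in_OK[OF ksOK us] c0 rho_0 by simp
  moreover have "set (map \<rho> ?ks) \<subseteq> Fp" using ksQ rho_Qp by (auto simp: subset_iff)
  ultimately have "set (take (length (map \<rho> us)) (map \<rho> ?ks)) \<subseteq> {0}"
    using ring.independent_imp_trivial_combine[OF class_ring.ring_axioms Fp_subfield ind] by simp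
  moreover have "1 \<in> set (map \<rho> ?ks)" using k0(1) k00 rho_1 by (force simp: image_iff)
  ultimately show False using ks(1) by auto
qed

text \<open>Independent residues lift to independent elements of \<open>K\<close>, so their number
  is bounded by the degree of \<open>K\<close> over \<open>Qp\<close>, and a longest independent
  list spans. The finiteness of the residue field, on which all counting rests, comes from
  here.\<close>

lemma k_dimension: "ring.dimension class_ring (resdegK D) Fp UNIV"
proof -
  obtain n where n: "ring.dimension class_ring n Qp K"
    using K_findim ring.finite_dimension_def[OF class_ring.ring_axioms] by blast
  let ?P = "\<lambda>us :: 'k list. ring.independent class_ring Fp us"
  have bound: "length us \<le> n" if "?P us" for us
  proof -
    have "\<exists>l. \<forall>z. l z \<in> OK \<and> \<rho> (l z) = z" using rho_surj by metis
    then obtain l where l: "\<And>z. l z \<in> OK" "\<And>z. \<rho> (l z) = z" by blast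
    have "map \<rho> (map l us) = us" using l by (simp add: map_idI)
    then have "ring.independent class_ring Qp (map l us)"
      using that l by (intro independent_lift) auto
    then have "length (map l us) \<le> n"
      using l OK_D by (intro ring.independent_length_le_dimension[OF class_ring.ring_axioms Qp_subfield n]) auto
    then show ?thesis by simp
  qed
  have "?P []" by (rule ring.independent.li_Nil[OF class_ring.ring_axioms])
  then obtain us where us: "?P us" "\<And>ws. ?P ws \<Longrightarrow> length ws \<le> length us"
    using ex_has_greatest_nat[of ?P "[]" length "Suc n"] bound by (metis less_Suc_eq_le)
  have "x \<in> ring.Span class_ring Fp us" for x
  proof (rule ccontr)
    assume "x \<notin> ring.Span class_ring Fp us"
    then have "?P (x # us)" using us(1) by (intro ring.independent.li_Cons[OF class_ring.ring_axioms]) auto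
    then show False using us(2) by fastforce
  qed
  then have "ring.Span class_ring Fp us = UNIV" by auto
  then have d: "ring.dimension class_ring (length us) Fp UNIV"
    using ring.dimension_independent[OF class_ring.ring_axioms us(1)] by simp
  have "z \<in> \<rho> ` OK" for z using rho_surj[of z] by auto
  then have "\<rho> ` OK = UNIV" by auto
  then have "resdegK D = length us"
    using ring.dimI[OF class_ring.ring_axioms Fp_subfield d] unfolding resdegK_def over_def by simp
  then show ?thesis using d by simp
qed

lemma finite_k: "finite (UNIV :: 'k set)" and card_k: "card (UNIV :: 'k set) = p ^ resdegK D"
  using dimension_card[OF k_dimension Fp_subfield card_Fp(1)] card_Fp by auto

sublocale kf: finite_prime_field p "resdegK D" "TYPE('k)"
  by unfold_locales (use prime_p char_k finite_k card_k in auto)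

abbreviation "OL \<equiv> int_ring v L"

lemma OL_OK: "OL \<subseteq> OK"
  using LK by (auto simp: int_ring_def)

text \<open>The residue field of \<open>L\<close> is treated as a subspace of that of
  \<open>K\<close>; this makes its dimension over the prime field finite, and \<open>resdegL\<close>
  counts its elements.\<close>

lemma card_kL: "card (\<rho> ` OL) = p ^ resdegL D"
proof -
  have OLc: "x + y \<in> OL" "x * y \<in> OL" "- x \<in> OL" "of_int i \<in> OL" if "x \<in> OL" "y \<in> OL" for x y i
    using that OK_closed(3,4,5,9) OL_OK L_closed(3,4,5,11) by (auto simp: int_ring_def subset_iff)
  have z: "0 \<in> OL" by (auto simp: int_ring_def L_closed)
  have sub: "subalgebra Fp (\<rho> ` OL) (class_ring :: 'k ring)"
  proof (intro subalgebra.intro subalgebra_axioms.intro group.subgroupI[OF abelian_group.a_group[OF class_ring.abelian_group_axioms]])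
    show "\<rho> ` OL \<noteq> {}" using z by auto
    fix a b assume "a \<in> \<rho> ` OL" "b \<in> \<rho> ` OL"
    then obtain x y where xy: "x \<in> OL" "y \<in> OL" "a = \<rho> x" "b = \<rho> y" by auto
    have "a + b = \<rho> (x + y)" using xy OL_OK by (simp add: rho_add subset_iff)
    then show "a \<otimes>\<^bsub>add_monoid class_ring\<^esub> b \<in> \<rho> ` OL" using OLc[OF xy(1,2)] by auto
  next
    fix a assume "a \<in> \<rho> ` OL"
    then obtain x where xy: "x \<in> OL" "a = \<rho> x" by auto
    have "- a = \<rho> (- x)" using xy OL_OK by (simp add: rho_minus subset_iff)
    then have "- a \<in> \<rho> ` OL" using OLc[OF xy(1,1)] by auto
    then show "inv\<^bsub>add_monoid class_ring\<^esub> a \<in> \<rho> ` OL"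
      by (simp only: a_inv_def[symmetric], simp only: class_ring_simps)
  next
    fix c a :: 'k assume "c \<in> Fp" "a \<in> \<rho> ` OL"
    then obtain x n where xy: "x \<in> OL" "a = \<rho> x" "c = of_int n" by auto
    have "c * a = \<rho> (of_int n * x)" using xy OL_OK by (simp add: rho_mult rho_of_int OK_closed subset_iff)
    then show "c \<otimes>\<^bsub>class_ring\<^esub> a \<in> \<rho> ` OL" using OLc(2)[OF OLc(4)[OF xy(1,1)] xy(1)] by auto
  qed auto
  have "ring.finite_dimension class_ring Fp (UNIV :: 'k set)"
    using ring.finite_dimensionI[OF class_ring.ring_axioms k_dimension] .
  then have "ring.finite_dimension class_ring Fp (\<rho> ` OL)"
    using ring.subalbegra_incl_imp_finite_dimension[OF class_ring.ring_axioms Fp_subfield _ sub] by auto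
  then have "ring.dimension class_ring (resdegL D) Fp (\<rho> ` OL)"
    using ring.finite_dimensionE[OF class_ring.ring_axioms Fp_subfield] unfolding resdegL_def over_def by blast
  then show ?thesis using dimension_card[OF _ Fp_subfield card_Fp(1)] card_Fp by auto
qed

lemma resdegL_pos: "resdegL D > 0"
proof (rule ccontr)
  assume "\<not> resdegL D > 0"
  then have "card (\<rho> ` OL) = 1" using card_kL by simp
  moreover have "0 \<in> OL" "1 \<in> OL" by (auto simp: int_ring_def L_closed)
  then have "{0, 1} \<subseteq> \<rho> ` OL" using rho_0 rho_1 by (metis empty_subsetI image_eqI insert_subset)
  ultimately have "card {0, 1::'k} \<le> 1" using card_mono finite_subset[OF subset_UNIV finite_k] by metis
  then show False by simp
qed

subsection \<open>Uniformisers\<close>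

lemma unifD:
  assumes "subfield F class_ring" "uniformiser v F w"
  shows "w \<in> F" "w \<noteq> 0" "v w < 1" "x \<in> F \<Longrightarrow> v x < 1 \<Longrightarrow> v x \<le> v w"
proof -
  note Fc = subfield_class_ringD[OF assms(1)]
  show w: "w \<in> F" using assms by (simp add: uniformiser_def)
  have e: "{x \<in> F. v x < 1} = (\<lambda>y. w * y) ` int_ring v F"
    using assms by (simp add: uniformiser_def max_ideal_def)
  have "of_nat p \<in> {x \<in> F. v x < 1}" using v_p Fc by auto
  then have "(of_nat p :: 'a) \<in> (\<lambda>y. w * y) ` int_ring v F" using e by blast
  then show "w \<noteq> 0" using prime_p by auto
  have "w * 1 \<in> (\<lambda>y. w * y) ` int_ring v F" using Fc by (intro imageI) (auto simp: int_ring_def)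
  then have "w \<in> {x \<in> F. v x < 1}" unfolding e by simp
  then show "v w < 1" by simp
  show "v x \<le> v w" if "x \<in> F" "v x < 1"
  proof -
    have "x \<in> (\<lambda>y. w * y) ` int_ring v F" using e that by blast
    then obtain y where "x = w * y" "v y \<le> 1" by (auto simp: int_ring_def)
    then show ?thesis using v_nonneg[of w] by (simp add: v_mult mult_left_le)
  qed
qed

text \<open>No element of F has absolute value strictly between v w and 1. Hence dividing x by w ^
  n, with n the largest exponent such that v x \<le> v w ^ n, leaves absolute value 1.\<close>

lemma unif_value:
  assumes "subfield F class_ring" "uniformiser v F w" "x \<in> F" "x \<noteq> 0" "v x \<le> 1"
  shows "\<exists>n. v x = v w ^ n"
proof -
  note w = unifD[OF assms(1,2)]
  have w0: "v w > 0" using w v_pos by blast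
  obtain N where "v w ^ N < v x" using real_arch_pow_inv[OF v_pos[OF assms(4)] w(3)] by blast
  then have ex: "\<exists>N. v w ^ Suc N < v x"
    using w0 w(3) power_decreasing[of N "Suc N" "v w"] by (intro exI[of _ N]) linarith
  define n where "n = (LEAST N. v w ^ Suc N < v x)"
  have n: "v w ^ Suc n < v x" unfolding n_def using ex by (rule LeastI_ex)
  have n': "v x \<le> v w ^ n"
  proof (cases n)
    case (Suc m)
    then have "\<not> v w ^ Suc m < v x" using not_less_Least[of m "\<lambda>N. v w ^ Suc N < v x"] n_def by simp
    then show ?thesis using Suc by simp
  qed (use assms in simp)
  have "x / w ^ n \<in> F" by (intro subfield_class_ringD(8,9)[OF assms(1)] w(1) assms(3))
  moreover have "v (x / w ^ n) > v w" using n w0 by (simp add: v_divide v_power field_simps)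
  ultimately have "\<not> v (x / w ^ n) < 1" using w(4) by fastforce
  moreover have "v (x / w ^ n) \<le> 1" using n' w0 by (simp add: v_divide v_power field_simps)
  ultimately have "v (x / w ^ n) = 1" by simp
  then show ?thesis using w0 by (auto simp: v_divide v_power intro!: exI[of _ n])
qed

lemmas pi = unifD[OF K_subfield unif]

lemma v_pi_pos: "v \<pi> > 0"
  using pi v_pos by blast

lemma v_pi_inj: "v \<pi> ^ m = v \<pi> ^ n \<Longrightarrow> m = n"
  using v_pi_pos pi(3) by (metis linorder_neqE_nat power_strict_decreasing less_irrefl)

text \<open>A uniformiser of F is an element whose absolute value is v \<pi> to the least positive
  exponent occurring on F; the number p shows that there is such an exponent. Uniformisers of the
  same field share their absolute value, so the description defining \<open>ram_index\<close> has a
  unique solution.\<close>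

lemma ram_index_K:
  assumes "subfield F class_ring" "F \<subseteq> K"
  shows "\<exists>w. uniformiser v F w \<and> v w = v \<pi> ^ ram_index v F K \<and> ram_index v F K > 0"
proof -
  note Fc = subfield_class_ringD[OF assms(1)]
  let ?P = "\<lambda>n. n > 0 \<and> (\<exists>x\<in>F. v x = v \<pi> ^ n)"
  obtain N where N: "v (of_nat p) = v \<pi> ^ N"
    using unif_value[OF K_subfield unif K_closed(10)[of p]] v_p prime_p by auto
  have "N > 0" using N v_p by (cases N) auto
  then have ex: "\<exists>n. ?P n" using N Fc(10)[of p] by blast
  define n where "n = (LEAST n. ?P n)"
  have n: "?P n" unfolding n_def using ex by (rule LeastI_ex)
  then obtain w where w: "w \<in> F" "v w = v \<pi> ^ n" "n > 0" by blast
  have w0: "w \<noteq> 0" using w(2) v_pi_pos by auto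
  have vw: "v w < 1" using w pi(3) v_pi_pos by (simp add: power_Suc_less_one power_less_one_iff)
  have u: "uniformiser v F w"
    unfolding uniformiser_def
  proof (intro conjI w(1) equalityI subsetI)
    fix x assume "x \<in> max_ideal v F"
    then have x: "x \<in> F" "v x < 1" by (auto simp: max_ideal_def)
    show "x \<in> (\<lambda>y. w * y) ` int_ring v F"
    proof (intro image_eqI[of _ _ "x / w"])
      show "x = w * (x / w)" using w0 by simp
      have "v (x / w) \<le> 1"
      proof (cases "x = 0")
        case False
        then obtain m where m: "v x = v \<pi> ^ m"
          using unif_value[OF K_subfield unif] x assms(2) by (meson less_imp_le subsetD)
        have "m > 0" using m x by (cases m) auto
        then have "n \<le> m" unfolding n_def using m x by (intro Least_le) blast
        then have "v x \<le> v w" unfolding m w(2) using v_pi_pos pi(3) by (intro power_decreasing) auto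
        then show ?thesis using v_pos[OF w0] by (simp add: v_divide)
      qed simp
      then show "x / w \<in> int_ring v F" using x w Fc by (simp add: int_ring_def)
    qed
  next
    fix x assume "x \<in> (\<lambda>y. w * y) ` int_ring v F"
    then obtain y where y: "x = w * y" "y \<in> F" "v y \<le> 1" by (auto simp: int_ring_def)
    have "v x \<le> v w" using y v_nonneg[of w] by (simp add: v_mult mult_left_le)
    then show "x \<in> max_ideal v F" using y w vw Fc by (simp add: max_ideal_def)
  qed
  have "ram_index v F K = n"
    unfolding ram_index_def
  proof (rule the_equality)
    show "\<exists>w w'. uniformiser v F w \<and> uniformiser v K w' \<and> v w = v w' ^ n" using u unif w by blast
    fix m assume "\<exists>w w'. uniformiser v F w \<and> uniformiser v K w' \<and> v w = v w' ^ m"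
    then obtain w1 w2 where w12: "uniformiser v F w1" "uniformiser v K w2" "v w1 = v w2 ^ m" by blast
    have "v w1 = v w" using unifD[OF assms(1) u] unifD[OF assms(1) w12(1)] by (meson order_antisym)
    moreover have "v w2 = v \<pi>" using pi unifD[OF K_subfield w12(2)] by (meson order_antisym)
    ultimately show "m = n" using w12 w v_pi_inj by simp
  qed
  then show ?thesis using u w by blast
qed

lemma ramK_pos: "ramK D > 0"
  using ram_index_K[OF Qp_subfield] QpL LK unfolding ramK_def by blast

lemma ram_KL_pos: "ram_KL D > 0"
  using ram_index_K[OF L_subfield LK] unfolding ram_KL_def by blast

lemma ram_KL_dvd:
  assumes "x \<in> L" "v x = v \<pi> ^ n"
  shows "ram_KL D dvd n"
proof -
  obtain w where w: "uniformiser v L w" "v w = v \<pi> ^ ram_KL D"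
    using ram_index_K[OF L_subfield LK] unfolding ram_KL_def by blast
  have "x \<noteq> 0" "v x \<le> 1" using assms v_pi_pos pi(3) by (auto simp: power_le_one)
  then obtain m where "v x = v w ^ m" using unif_value[OF L_subfield w(1) assms(1)] by blast
  then have "v \<pi> ^ n = v \<pi> ^ (ram_KL D * m)" using w assms by (simp add: power_mult)
  then show ?thesis using v_pi_inj[of n "ram_KL D * m"] by simp
qed

end

context breuil_setting
begin

subsection \<open>The Galois group\<close>

lemma gal_OK: "g \<in> Gal D \<Longrightarrow> x \<in> OK \<Longrightarrow> g x \<in> OK"
  using galD(1) v_gal by (simp add: int_ring_def)

text \<open>\<open>gal_res\<close> is a definite description over all lifts of a residue. Two lifts
  differ by an element of absolute value less than 1, and the isometry g keeps it so.\<close>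

lemma gal_res_rho:
  assumes g: "g \<in> Gal D" and y: "y \<in> OK"
  shows "gal_res D g (\<rho> y) = \<rho> (g y)"
  unfolding gal_res_def
proof (rule the_equality)
  show "\<exists>y'\<in>OK. \<rho> y' = \<rho> y \<and> \<rho> (g y) = \<rho> (g y')" using y by blast
  fix z assume "\<exists>y'\<in>OK. \<rho> y' = \<rho> y \<and> z = \<rho> (g y')"
  then obtain y' where y': "y' \<in> OK" "\<rho> y' = \<rho> y" "z = \<rho> (g y')" by blast
  then have "v (y' - y) < 1" using rho_eq_iff[OF y'(1) y] by simp
  moreover have "v (g y' - g y) = v (y' - y)"
    using v_gal[OF g OK_D(1)[OF OK_closed(6)[OF y'(1) y]]]
    unfolding gal_diff[OF g OK_D(1)[OF y'(1)] OK_D(1)[OF y]] .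
  ultimately have "v (g y' - g y) < 1" by linarith
  then show "z = \<rho> (g y)" using rho_eq_iff[OF gal_OK[OF g y'(1)] gal_OK[OF g y]] y' by simp
qed

lemma gal_res_add: "g \<in> Gal D \<Longrightarrow> gal_res D g (x + y) = gal_res D g x + gal_res D g y"
  and gal_res_mult: "g \<in> Gal D \<Longrightarrow> gal_res D g (x * y) = gal_res D g x * gal_res D g y"
  and gal_res_1: "g \<in> Gal D \<Longrightarrow> gal_res D g 1 = 1"
proof -
  assume g: "g \<in> Gal D"
  obtain x' y' where xy: "x' \<in> OK" "y' \<in> OK" "\<rho> x' = x" "\<rho> y' = y" using rho_surj[of x] rho_surj[of y] by blast
  note r = gal_res_rho[OF g]
  have "gal_res D g (\<rho> (x' + y')) = \<rho> (g (x' + y'))" using r[OF OK_closed(3)[OF xy(1,2)]] .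
  then show "gal_res D g (x + y) = gal_res D g x + gal_res D g y"
    using xy r galD(2)[OF g] OK_D gal_OK[OF g] by (simp add: rho_add) (metis r)
  have "gal_res D g (\<rho> (x' * y')) = \<rho> (g (x' * y'))" using r[OF OK_closed(4)[OF xy(1,2)]] .
  then show "gal_res D g (x * y) = gal_res D g x * gal_res D g y"
    using xy r galD(3)[OF g] OK_D gal_OK[OF g] by (simp add: rho_mult) (metis r)
  show "gal_res D g 1 = 1" using r[OF OK_closed(2)] galD(4)[OF g] by (simp add: rho_1)
qed

lemma gal_id: "(\<lambda>y\<in>K. y) \<in> Gal D"
proof (rule galI)
  show "bij_betw (\<lambda>y\<in>K. y) K K" by (auto simp: bij_betw_def inj_on_def)
qed (use LK K_closed in auto)

lemma gal_comp: "g \<in> Gal D \<Longrightarrow> h \<in> Gal D \<Longrightarrow> compose K g h \<in> Gal D"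
proof (rule galI)
  assume g: "g \<in> Gal D" and h: "h \<in> Gal D"
  show "compose K g h \<in> extensional K" by simp
  show "bij_betw (compose K g h) K K"
    using bij_betw_trans[OF galD(6)[OF h] galD(6)[OF g]]
    by (rule bij_betw_cong[THEN iffD1, rotated]) (simp add: compose_def)
  show "compose K g h (x + y) = compose K g h x + compose K g h y" if "x \<in> K" "y \<in> K" for x y
    using that g h by (simp add: compose_def K_closed galD)
  show "compose K g h (x * y) = compose K g h x * compose K g h y" if "x \<in> K" "y \<in> K" for x y
    using that g h by (simp add: compose_def K_closed galD)
  show "compose K g h x = x" if "x \<in> L" for x
    using that g h LK by (auto simp: compose_def galD)
qed

lemma gal_inv:
  assumes g: "g \<in> Gal D"
  obtains h where "h \<in> Gal D" "compose K g h = (\<lambda>y\<in>K. y)" "compose K h g = (\<lambda>y\<in>K. y)"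
proof -
  let ?h = "restrict (inv_into K g) K"
  note b = galD(6)[OF g]
  have hK: "inv_into K g x \<in> K" if "x \<in> K" for x using that b by (metis bij_betw_def inv_into_into)
  have gh: "g (inv_into K g x) = x" if "x \<in> K" for x using that b by (metis bij_betw_inv_into_right)
  have hg: "inv_into K g (g x) = x" if "x \<in> K" for x using that b by (metis bij_betw_inv_into_left)
  have inj: "x = y" if "x \<in> K" "y \<in> K" "g x = g y" for x y using that b by (auto simp: bij_betw_def inj_on_def)
  have "?h \<in> Gal D"
  proof (rule galI)
    show "bij_betw ?h K K" using bij_betw_inv_into[OF b] by (rule bij_betw_cong[THEN iffD1, rotated]) simp
    fix x y assume xy: "x \<in> K" "y \<in> K"
    have "inv_into K g (x + y) = inv_into K g x + inv_into K g y"
      by (rule inj) (use xy hK gh K_closed(3) galD(2)[OF g] in auto)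
    then show "?h (x + y) = ?h x + ?h y" using xy K_closed(3) by simp
    have "inv_into K g (x * y) = inv_into K g x * inv_into K g y"
      by (rule inj) (use xy hK gh K_closed(4) galD(3)[OF g] in auto)
    then show "?h (x * y) = ?h x * ?h y" using xy K_closed(4) by simp
  next
    fix x assume x: "x \<in> L"
    then have xK: "x \<in> K" using LK by auto
    have "inv_into K g (g x) = x" by (rule hg[OF xK])
    then show "?h x = x" using galD(5)[OF g x] xK by simp
  qed simp
  moreover have "compose K g ?h = (\<lambda>y\<in>K. y)" using gh by (auto simp: compose_def fun_eq_iff)
  moreover have "compose K ?h g = (\<lambda>y\<in>K. y)" using hg galD(1)[OF g] by (auto simp: compose_def fun_eq_iff)
  ultimately show ?thesis using that by blast
qed

lemma gal_res_comp:
  assumes "g \<in> Gal D" "h \<in> Gal D"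
  shows "gal_res D (compose K g h) x = gal_res D g (gal_res D h x)"
proof -
  obtain y where y: "y \<in> OK" "\<rho> y = x" using rho_surj by blast
  show ?thesis using gal_res_rho[OF gal_comp[OF assms] y(1)] gal_res_rho[OF assms(2) y(1)]
      gal_res_rho[OF assms(1) gal_OK[OF assms(2) y(1)]] y OK_D(1)[OF y(1)] by (simp add: compose_def)
qed

lemma gal_res_id: "gal_res D (\<lambda>y\<in>K. y) x = x"
proof -
  obtain y where y: "y \<in> OK" "\<rho> y = x" using rho_surj by blast
  show ?thesis using gal_res_rho[OF gal_id y(1)] y OK_D(1)[OF y(1)] by simp
qed

abbreviation "zt g \<equiv> g \<pi> / \<pi>"

lemma zt_OK: "g \<in> Gal D \<Longrightarrow> zt g \<in> OK" "g \<in> Gal D \<Longrightarrow> v (zt g) = 1"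
  using v_gal[OF _ pi(1)] galD(1)[OF _ pi(1)] pi(1) v_pi_pos K_closed(8)
  by (auto simp: int_ring_def v_divide)

lemma etabar_rho: "etabar D g = \<rho> (zt g)"
  by (simp add: etabar_def)

lemma gal_pi_nonzero: "g \<in> Gal D \<Longrightarrow> g \<pi> \<noteq> 0"
  using zt_OK(2)[of g] by auto

lemma zt_power:
  assumes g: "g \<in> Gal D"
  shows "zt g ^ ram_KL D = 1"
proof -
  have "g \<pi> ^ ram_KL D = \<pi> ^ ram_KL D"
    using gal_power[OF g pi(1), of "ram_KL D"] galD(5)[OF g unif_pow] by simp
  then show ?thesis using pi(2) by (simp add: power_divide)
qed

lemma etabar_power: "g \<in> Gal D \<Longrightarrow> etabar D g ^ ram_KL D = 1"
  using zt_power rho_power[OF zt_OK(1)] by (metis etabar_rho rho_1)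

lemma etabar_nonzero: "g \<in> Gal D \<Longrightarrow> etabar D g \<noteq> 0"
  using etabar_power ram_KL_pos by (metis power_0_left zero_neq_one less_numeral_extra(3))

lemma etabar_id: "etabar D (\<lambda>y\<in>K. y) = 1"
  using pi(1,2) by (simp add: etabar_rho rho_1)

text \<open>A crossed homomorphism; on inertia, which fixes residues, it becomes an ordinary
  one.\<close>

lemma etabar_comp:
  assumes g: "g \<in> Gal D" and h: "h \<in> Gal D"
  shows "etabar D (compose K g h) = gal_res D g (etabar D h) * etabar D g"
proof -
  have hp: "h \<pi> \<in> K" using galD(1)[OF h pi(1)] .
  have "g (zt h) = g (h \<pi>) / g \<pi>" by (rule gal_divide[OF g hp pi(1)])
  then have "zt (compose K g h) = g (zt h) * zt g"
    using pi(1) gal_pi_nonzero[OF g] by (simp add: compose_def)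
  then show ?thesis
    by (simp only: etabar_rho rho_mult[OF gal_OK[OF g zt_OK(1)[OF h]] zt_OK(1)[OF g]] gal_res_rho[OF g zt_OK(1)[OF h]])
qed

text \<open>Tame ramification enters here: an automorphism trivial on the residue field and on the leading
  coefficient of the uniformiser moves every integer by less than any power of the uniformiser, because
  every residue class is a \<open>p\<close>-th power.\<close>

lemma gal_trivial:
  assumes g: "g \<in> Gal D" and r: "\<And>x. gal_res D g x = x" and e: "etabar D g = 1"
  shows "g = (\<lambda>y\<in>K. y)"
proof -
  define \<zeta> where "\<zeta> = zt g"
  have zO: "\<zeta> \<in> OK" and zp: "\<zeta> ^ ram_KL D = 1" and zr: "\<rho> \<zeta> = 1"
    using zt_OK(1)[OF g] zt_power[OF g] e by (simp_all only: \<zeta>_def etabar_rho)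
  \<comment> \<open>Tameness: if \<zeta> were not 1, the sum of its powers would vanish, but the
    residue of that sum is the ramification index, which p does not divide.\<close>
  have "\<zeta> = 1"
  proof (rule ccontr)
    assume n: "\<zeta> \<noteq> 1"
    have "(\<Sum>i<ram_KL D. \<zeta> ^ i) = 0"
      using power_diff_1_eq[of \<zeta> "ram_KL D"] zp n by simp
    then have "\<rho> (\<Sum>i<ram_KL D. \<zeta> ^ i) = 0" using rho_0 by simp
    then have "(\<Sum>i<ram_KL D. \<rho> (\<zeta> ^ i)) = 0"
      using rho_sum[of "{..<ram_KL D}" "\<lambda>i. \<zeta> ^ i"] OK_closed(7)[OF zO] by simp
    moreover have "\<rho> (\<zeta> ^ i) = 1" for i using rho_power[OF zO] zr by simp
    ultimately have "of_nat (ram_KL D) = (0::'k)" by simp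
    then show False using tame CHAR_k of_nat_eq_0_iff_char_dvd[where 'a = 'k] by simp
  qed
  then have gpi: "g \<pi> = \<pi>" using pi(2) by (simp add: \<zeta>_def)
  have step: "\<forall>x\<in>OK. v (g x - x) \<le> v \<pi> ^ n" for n
  proof (induction n)
    case 0
    then show ?case using OK_D(2)[OF OK_closed(6)[OF gal_OK[OF g]]] by simp
  next
    case (Suc n)
    show ?case
    proof
      fix x assume x: "x \<in> OK"
      \<comment> \<open>The aim is x = y ^ p + \<pi> z. On the second summand the factor \<pi>,
        fixed by g, improves the estimate by one power.\<close>
      obtain y' where y': "y' ^ p = \<rho> x" using kf.frob_surj by blast
      obtain y where y: "y \<in> OK" "\<rho> y = y'" using rho_surj by blast
      define z where "z = (x - y ^ p) / \<pi>"
      have yp: "y ^ p \<in> OK" using OK_closed(7)[OF y(1)] .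
      have "\<rho> x = \<rho> (y ^ p)" using y y' rho_power[OF y(1)] by simp
      then have "v (x - y ^ p) < 1" using rho_eq_iff[OF x yp] by simp
      then have "v (x - y ^ p) \<le> v \<pi>" by (rule pi(4)[OF OK_D(1)[OF OK_closed(6)[OF x yp]]])
      then have z: "z \<in> OK" using v_pi_pos K_closed(8)[OF OK_D(1)[OF OK_closed(6)[OF x yp]] pi(1)]
        by (simp add: z_def int_ring_def v_divide)
      have xz: "x = y ^ p + \<pi> * z" using pi(2) by (simp add: z_def)
      have "g x = g (y ^ p) + g (\<pi> * z)" unfolding xz
        by (rule galD(2)[OF g OK_D(1)[OF yp] K_closed(4)[OF pi(1) OK_D(1)[OF z]]])
      also have "g (y ^ p) = g y ^ p" by (rule gal_power[OF g OK_D(1)[OF y(1)]])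
      also have "g (\<pi> * z) = \<pi> * g z" using galD(3)[OF g pi(1) OK_D(1)[OF z]] gpi by simp
      finally have gx: "g x - x = (g y ^ p - y ^ p) + \<pi> * (g z - z)" using xz by (simp add: algebra_simps)
      have 1: "v (\<pi> * (g z - z)) \<le> v \<pi> ^ Suc n"
        using Suc z v_pi_pos by (simp add: v_mult)
      \<comment> \<open>The cofactor of g y - y in g y ^ p - y ^ p. It is a sum of p terms with
        equal residues, so its residue is 0, and the first summand gains its power of v
        \<pi>.\<close>
      define s where "s = (\<Sum>i<p. y ^ (p - Suc i) * g y ^ i)"
      have gy: "g y \<in> OK" using gal_OK[OF g y(1)] .
      have d: "g y ^ p - y ^ p = (g y - y) * s" unfolding s_def by (rule power_diff_sumr2)
      have sO: "s \<in> OK" unfolding s_def by (intro OK_sum OK_closed(4,7) gy y(1))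
      have rgy: "\<rho> (g y) = \<rho> y" using gal_res_rho[OF g y(1)] r by simp
      have "\<rho> s = (\<Sum>i<p. \<rho> (y ^ (p - Suc i) * g y ^ i))"
        unfolding s_def by (rule rho_sum) (intro OK_closed(4,7) gy y(1))
      also have "\<dots> = (\<Sum>i<p. \<rho> y ^ (p - 1))"
      proof (rule sum.cong[OF refl])
        fix i assume "i \<in> {..<p}"
        then have "p - 1 = (p - Suc i) + i" by auto
        moreover have "\<rho> (y ^ (p - Suc i) * g y ^ i) = \<rho> y ^ (p - Suc i) * \<rho> y ^ i"
          using rho_mult[OF OK_closed(7)[OF y(1)] OK_closed(7)[OF gy]] rho_power[OF gy] rho_power[OF y(1)] rgy by simp
        ultimately show "\<rho> (y ^ (p - Suc i) * g y ^ i) = \<rho> y ^ (p - 1)" by (simp only: power_add)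
      qed
      also have "\<dots> = 0" using char_k by simp
      finally have "v s < 1" using rho_0_iff[OF sO] by simp
      then have vs: "v s \<le> v \<pi>" by (rule pi(4)[OF OK_D(1)[OF sO]])
      have "v (g y - y) * v s \<le> v \<pi> ^ n * v \<pi>"
        using Suc y(1) vs v_nonneg v_pi_pos by (intro mult_mono) auto
      then have 2: "v (g y ^ p - y ^ p) \<le> v \<pi> ^ Suc n" unfolding d v_mult by (simp add: mult.commute)
      show "v (g x - x) \<le> v \<pi> ^ Suc n"
        unfolding gx using v_add[of "g y ^ p - y ^ p" "\<pi> * (g z - z)"] 1 2 by linarith
    qed
  qed
  have fixO: "g x = x" if x: "x \<in> OK" for x
  proof (rule ccontr)
    assume "g x \<noteq> x"
    then have "v (g x - x) > 0" using v_pos[of "g x - x"] by simp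
    then obtain n where "v \<pi> ^ n < v (g x - x)" using real_arch_pow_inv[OF _ pi(3)] by blast
    then show False using step[of n] x by force
  qed
  have "g x = x" if x: "x \<in> K" for x
  proof (cases "v x \<le> 1")
    case True
    then show ?thesis using fixO x by (simp add: int_ring_def)
  next
    case False
    then have "inverse x \<in> OK" using K_closed(6)[OF x] by (auto simp: int_ring_def v_inverse inverse_le_1_iff)
    then have "inverse (g x) = inverse x" using fixO gal_inverse[OF g x] by simp
    then show ?thesis by simp
  qed
  then show ?thesis using galD(7)[OF g] by (auto simp: extensional_def fun_eq_iff)
qed

lemma gal_eqI:
  assumes g: "g \<in> Gal D" and h: "h \<in> Gal D" and r: "\<And>x. gal_res D g x = gal_res D h x"
    and e: "etabar D g = etabar D h"
  shows "g = h"
proof -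
  obtain i where i: "i \<in> Gal D" "compose K g i = (\<lambda>y\<in>K. y)" "compose K i g = (\<lambda>y\<in>K. y)" using gal_inv[OF g] by blast
  have c: "compose K i h \<in> Gal D" by (rule gal_comp[OF i(1) h])
  have ri: "gal_res D i (gal_res D g x) = x" for x
    using gal_res_comp[OF i(1) g, of x] i(3) gal_res_id by simp
  have "gal_res D (compose K i h) x = x" for x
    using gal_res_comp[OF i(1) h, of x] ri[of x] r[of x] by simp
  moreover have "etabar D (compose K i h) = 1"
    using etabar_comp[OF i(1) h] etabar_comp[OF i(1) g] i(3) etabar_id e by simp
  ultimately have t: "compose K i h = (\<lambda>y\<in>K. y)" using gal_trivial[OF c] by blast
  have "g x = h x" if "x \<in> K" for x
  proof -
    have hx: "h x \<in> K" using galD(1)[OF h that] .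
    have "i (h x) = x" using t that by (metis compose_eq restrict_apply')
    then have "g x = g (i (h x))" by simp
    also have "\<dots> = h x" using i(2) hx by (metis compose_eq restrict_apply')
    finally show ?thesis .
  qed
  then show ?thesis using galD(7)[OF g] galD(7)[OF h] by (intro extensionalityI[of g K h]) auto
qed

lemma gal_reindex:
  assumes g: "g \<in> Gal D"
  shows "bij_betw (compose K g) (Gal D) (Gal D)"
proof -
  obtain i where i: "i \<in> Gal D" "compose K g i = (\<lambda>y\<in>K. y)" "compose K i g = (\<lambda>y\<in>K. y)" using gal_inv[OF g] by blast
  have c: "compose K (compose K a b) h = compose K a (compose K b h)" if "h \<in> Gal D" for a b h
    using galD(1)[OF that] by (auto simp: compose_def fun_eq_iff)
  have l: "compose K (\<lambda>y\<in>K. y) h = h" if "h \<in> Gal D" for h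
    using galD(1)[OF that] galD(7)[OF that] by (auto simp: compose_def fun_eq_iff extensional_def)
  show ?thesis
  proof (rule bij_betwI[where g = "compose K i"])
    show "compose K g \<in> Gal D \<rightarrow> Gal D" "compose K i \<in> Gal D \<rightarrow> Gal D" using gal_comp g i(1) by auto
    show "compose K i (compose K g x) = x" if "x \<in> Gal D" for x using c[OF that, of i g] i(3) l[OF that] by simp
    show "compose K g (compose K i x) = x" if "x \<in> Gal D" for x using c[OF that, of g i] i(2) l[OF that] by simp
  qed
qed

section \<open>Frobenius exponents and the inertia group\<close>

lemma gal_res_frob0: "g \<in> Gal D \<Longrightarrow> \<exists>m<resdegK D. \<forall>x. gal_res D g x = x ^ p ^ m"
  by (rule kf.automorphism_is_frob) (auto simp: gal_res_add gal_res_mult gal_res_1)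

definition frobexp :: "('a \<Rightarrow> 'a) \<Rightarrow> nat" where
  "frobexp g = (SOME m. m < resdegK D \<and> (\<forall>x. gal_res D g x = x ^ p ^ m))"

lemma frobexp: "g \<in> Gal D \<Longrightarrow> frobexp g < resdegK D" "g \<in> Gal D \<Longrightarrow> gal_res D g x = x ^ p ^ frobexp g"
  using someI_ex[OF gal_res_frob0[of g]] unfolding frobexp_def[symmetric] by blast+

text \<open>An automorphism is determined by its Frobenius exponent together with its value under
  \<open>etabar\<close>, and there are finitely many such pairs.\<close>

lemma finite_gal: "finite (Gal D)"
proof -
  have "inj_on (\<lambda>g. (frobexp g, etabar D g)) (Gal D)"
  proof (rule inj_onI)
    fix g h assume gh: "g \<in> Gal D" "h \<in> Gal D" "(frobexp g, etabar D g) = (frobexp h, etabar D h)"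
    show "g = h" by (rule gal_eqI[OF gh(1,2)]) (use gh(3) in \<open>simp_all add: frobexp(2)[OF gh(1)] frobexp(2)[OF gh(2)]\<close>)
  qed
  moreover have "(\<lambda>g. (frobexp g, etabar D g)) ` Gal D \<subseteq> {..<resdegK D} \<times> UNIV" using frobexp(1) by auto
  then have "finite ((\<lambda>g. (frobexp g, etabar D g)) ` Gal D)"
    by (rule finite_subset) (simp add: finite_k)
  ultimately show ?thesis by (rule finite_imageD[rotated])
qed

definition inertia :: "('a \<Rightarrow> 'a) set" where
  "inertia = {g \<in> Gal D. frobexp g = 0}"

lemma inertiaD: "g \<in> inertia \<Longrightarrow> g \<in> Gal D" "g \<in> inertia \<Longrightarrow> gal_res D g x = x"
  using frobexp(2)[of g x] by (simp_all add: inertia_def)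

lemma inertiaI:
  assumes g: "g \<in> Gal D" and r: "\<And>x. gal_res D g x = x"
  shows "g \<in> inertia"
proof -
  have "\<forall>x::'k. x ^ p ^ frobexp g = x ^ p ^ 0" using frobexp(2)[OF g] r by simp
  then have "frobexp g = 0" by (rule kf.frob_distinct[OF frobexp(1)[OF g] kf.f_pos])
  then show ?thesis using g by (simp add: inertia_def)
qed

abbreviation "mu \<equiv> etabar D ` inertia"

lemma inj_etabar: "inj_on (etabar D) inertia"
proof (rule inj_onI)
  fix g h assume gh: "g \<in> inertia" "h \<in> inertia" "etabar D g = etabar D h"
  show "g = h"
    by (rule gal_eqI[OF inertiaD(1)[OF gh(1)] inertiaD(1)[OF gh(2)] _ gh(3)])
      (simp add: inertiaD(2)[OF gh(1)] inertiaD(2)[OF gh(2)])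
qed

lemma finite_inertia: "finite inertia"
  using finite_gal by (simp add: inertia_def)

lemma inertia_id: "(\<lambda>y\<in>K. y) \<in> inertia"
  by (rule inertiaI[OF gal_id gal_res_id])

text \<open>\<open>mu\<close> is closed under multiplication because \<open>etabar\<close> is
  multiplicative on inertia. Multiplication by x permutes \<open>mu\<close>, and the product of all
  its elements cancels.\<close>

lemma mu_power: "x \<in> mu \<Longrightarrow> x ^ card inertia = 1"
proof -
  assume x: "x \<in> mu"
  have x0: "x \<noteq> 0" using x etabar_nonzero inertiaD(1) by auto
  have sub: "(*) x ` mu \<subseteq> mu"
  proof
    fix z assume "z \<in> (*) x ` mu"
    then obtain g h where gh: "g \<in> inertia" "h \<in> inertia" "x = etabar D g" "z = x * etabar D h" using x by auto
    have "compose K g h \<in> inertia"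
      by (rule inertiaI[OF gal_comp[OF inertiaD(1)[OF gh(1)] inertiaD(1)[OF gh(2)]]])
        (simp add: gal_res_comp[OF inertiaD(1)[OF gh(1)] inertiaD(1)[OF gh(2)]] inertiaD(2)[OF gh(1)] inertiaD(2)[OF gh(2)])
    moreover have "etabar D (compose K g h) = z"
      using etabar_comp[OF inertiaD(1)[OF gh(1)] inertiaD(1)[OF gh(2)]] inertiaD(2)[OF gh(1)] gh by (simp add: mult.commute)
    ultimately show "z \<in> mu" by blast
  qed
  have fin: "finite mu" using finite_inertia by simp
  have inj: "inj_on ((*) x) mu" using x0 by (auto simp: inj_on_def)
  have im: "(*) x ` mu = mu"
    by (rule card_subset_eq[OF fin sub]) (simp add: card_image[OF inj])
  have "\<Prod>mu = (\<Prod>y\<in>mu. x * y)"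
    using prod.reindex[OF inj, of "\<lambda>y. y"] im by simp
  also have "\<dots> = x ^ card mu * \<Prod>mu" by (simp add: prod.distrib)
  finally have "x ^ card mu * \<Prod>mu = 1 * \<Prod>mu" by simp
  moreover have "\<Prod>mu \<noteq> 0" using fin etabar_nonzero inertiaD(1) by auto
  ultimately have "x ^ card mu = 1" by (simp only: mult_cancel_right) simp
  then show ?thesis by (simp add: card_image[OF inj_etabar])
qed

lemma card_inertia_pos: "card inertia > 0"
  using finite_inertia inertia_id by (auto simp: card_gt_0_iff)

text \<open>If the order were p j, then x ^ (p j) = 1 would imply x ^ j = 1 for all x in
  \<open>mu\<close> by injectivity of Frobenius, leaving at most j elements.\<close>

lemma card_inertia_char: "of_nat (card inertia) \<noteq> (0::'k)"
proof
  assume "of_nat (card inertia) = (0::'k)"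
  then have "p dvd card inertia" using CHAR_k of_nat_eq_0_iff_char_dvd[where 'a = 'k] by simp
  then obtain j where j: "card inertia = p * j" by auto
  have j0: "j > 0" using j card_inertia_pos by (cases j) auto
  have "mu \<subseteq> {x. x ^ j = 1}"
  proof
    fix x assume "x \<in> mu"
    then have "(x ^ j) ^ p ^ 1 = 1 ^ p ^ 1" using mu_power[of x] j by (simp add: mult.commute flip: power_mult)
    then show "x \<in> {x. x ^ j = 1}" using kf.frob_inj by blast
  qed
  then have "card mu \<le> card {x::'k. x ^ j = 1}" by (intro card_mono finite_subset[OF subset_UNIV finite_k])
  then have "card inertia \<le> j"
    using kf.card_roots_of_unity_le[OF j0] by (simp add: card_image[OF inj_etabar])
  then show False using j j0 p_ge_3 by simp
qed

text \<open>\<pi> ^ n times the sum is the trace of y \<pi> ^ n. The sum itself is integral with a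
  computable residue, so elements of \<open>L\<close> of controlled valuation can be
  produced.\<close>

lemma trace_in_L:
  assumes y: "y \<in> OK"
  shows "\<pi> ^ n * (\<Sum>g\<in>Gal D. g y * zt g ^ n) \<in> L"
    and "(\<Sum>g\<in>Gal D. g y * zt g ^ n) \<in> OK"
    and "\<rho> (\<Sum>g\<in>Gal D. g y * zt g ^ n) = (\<Sum>g\<in>Gal D. gal_res D g (\<rho> y) * etabar D g ^ n)"
proof -
  have t: "g y * zt g ^ n \<in> OK" if "g \<in> Gal D" for g by (intro OK_closed(4,7) gal_OK[OF that y] zt_OK(1)[OF that])
  show "(\<Sum>g\<in>Gal D. g y * zt g ^ n) \<in> OK" by (rule OK_sum) (rule t)
  have "\<rho> (g y * zt g ^ n) = gal_res D g (\<rho> y) * etabar D g ^ n" if "g \<in> Gal D" for g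
    using rho_mult[OF gal_OK[OF that y] OK_closed(7)[OF zt_OK(1)[OF that]]] rho_power[OF zt_OK(1)[OF that]]
      gal_res_rho[OF that y] by (simp add: etabar_rho)
  then show "\<rho> (\<Sum>g\<in>Gal D. g y * zt g ^ n) = (\<Sum>g\<in>Gal D. gal_res D g (\<rho> y) * etabar D g ^ n)"
    using rho_sum[of "Gal D" "\<lambda>g. g y * zt g ^ n", OF t] by simp
  have xK: "y * \<pi> ^ n \<in> K" by (intro K_closed(4,9) OK_D(1)[OF y] pi(1))
  have e: "\<pi> ^ n * (\<Sum>g\<in>Gal D. g y * zt g ^ n) = (\<Sum>g\<in>Gal D. g (y * \<pi> ^ n))"
    unfolding sum_distrib_left
  proof (rule sum.cong[OF refl])
    fix g assume g: "g \<in> Gal D"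
    have "g (y * \<pi> ^ n) = g y * g \<pi> ^ n"
      using galD(3)[OF g OK_D(1)[OF y] K_closed(9)[OF pi(1)]] gal_power[OF g pi(1)] by simp
    then show "\<pi> ^ n * (g y * zt g ^ n) = g (y * \<pi> ^ n)" using pi(2) by (simp add: power_divide)
  qed
  have "(\<Sum>g\<in>Gal D. g (y * \<pi> ^ n)) \<in> {x \<in> K. \<forall>g\<in>Gal D. g x = x}"
  proof (intro CollectI conjI ballI)
    have gK: "g (y * \<pi> ^ n) \<in> K" if "g \<in> Gal D" for g using galD(1)[OF that xK] .
    show "(\<Sum>g\<in>Gal D. g (y * \<pi> ^ n)) \<in> K" using gal_sum[OF gal_id, of "Gal D" "\<lambda>g. g (y * \<pi> ^ n)"] gK by blast
    fix h assume h: "h \<in> Gal D"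
    have "h (\<Sum>g\<in>Gal D. g (y * \<pi> ^ n)) = (\<Sum>g\<in>Gal D. h (g (y * \<pi> ^ n)))"
      using gal_sum[OF h, of "Gal D" "\<lambda>g. g (y * \<pi> ^ n)"] gK by blast
    also have "\<dots> = (\<Sum>g\<in>Gal D. compose K h g (y * \<pi> ^ n))" using xK by (simp add: compose_def)
    also have "\<dots> = (\<Sum>g\<in>Gal D. g (y * \<pi> ^ n))"
      using sum.reindex_bij_betw[OF gal_reindex[OF h], of "\<lambda>g. g (y * \<pi> ^ n)"] .
    finally show "h (\<Sum>g\<in>Gal D. g (y * \<pi> ^ n)) = (\<Sum>g\<in>Gal D. g (y * \<pi> ^ n))" .
  qed
  then show "\<pi> ^ n * (\<Sum>g\<in>Gal D. g y * zt g ^ n) \<in> L" using e fixed_L by simp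
qed

text \<open>Grouping the automorphisms by Frobenius exponent turns the sum into an additive
  polynomial in y. Its linear coefficient comes from inertia; under the hypothesis it is the order
  of inertia, which is nonzero in the residue field.\<close>

lemma trace_nonzero:
  assumes n: "\<And>g. g \<in> inertia \<Longrightarrow> etabar D g ^ n = 1"
  shows "\<exists>y. (\<Sum>g\<in>Gal D. gal_res D g y * etabar D g ^ n) \<noteq> 0"
proof -
  define c where "c = (\<lambda>m. \<Sum>g\<in>{g \<in> Gal D. frobexp g = m}. etabar D g ^ n)"
  have "c 0 = of_nat (card inertia)" using n by (simp add: c_def inertia_def)
  then obtain y where y: "(\<Sum>m<resdegK D. c m * y ^ p ^ m) \<noteq> 0"
    using kf.additive_poly_nonzero[of c] card_inertia_char by auto
  have "(\<Sum>g\<in>Gal D. gal_res D g y * etabar D g ^ n)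
      = (\<Sum>m<resdegK D. \<Sum>g\<in>{g \<in> Gal D. frobexp g = m}. gal_res D g y * etabar D g ^ n)"
    using frobexp(1) by (intro sum.group[symmetric] finite_gal) auto
  also have "\<dots> = (\<Sum>m<resdegK D. c m * y ^ p ^ m)"
    unfolding c_def sum_distrib_right
    by (intro sum.cong refl) (simp add: frobexp(2) mult.commute)
  finally show ?thesis using y by metis
qed

text \<open>With n the order of inertia, the trace of a suitable y \<pi> ^ n has valuation exactly
  n, so the ramification index of K/L divides n. Conversely \<open>etabar\<close> embeds inertia
  into the roots of unity of order dividing that index.\<close>

lemma card_inertia: "card inertia = ram_KL D"
proof -
  obtain y' where y': "(\<Sum>g\<in>Gal D. gal_res D g y' * etabar D g ^ card inertia) \<noteq> 0"
    using trace_nonzero[of "card inertia"] mu_power by blast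
  obtain y where y: "y \<in> OK" "\<rho> y = y'" using rho_surj by blast
  let ?s = "\<Sum>g\<in>Gal D. g y * zt g ^ card inertia"
  have "\<rho> ?s \<noteq> 0" using y y' trace_in_L(3)[OF y(1)] by simp
  then have "v ?s = 1"
    using rho_0_iff[OF trace_in_L(2)[OF y(1), of "card inertia"]] OK_D(2)[OF trace_in_L(2)[OF y(1), of "card inertia"]]
    by linarith
  then have "v (\<pi> ^ card inertia * ?s) = v \<pi> ^ card inertia" by (simp add: v_mult v_power)
  then have d: "ram_KL D dvd card inertia" using ram_KL_dvd[OF trace_in_L(1)[OF y(1)]] by blast
  have "mu \<subseteq> {x. x ^ ram_KL D = 1}" using etabar_power inertiaD(1) by auto
  then have "card mu \<le> card {x::'k. x ^ ram_KL D = 1}" by (intro card_mono finite_subset[OF subset_UNIV finite_k])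
  then have "card inertia \<le> ram_KL D"
    using kf.card_roots_of_unity_le[OF ram_KL_pos] by (simp add: card_image[OF inj_etabar])
  then show ?thesis using d card_inertia_pos by (simp add: dvd_imp_le le_antisym)
qed

lemma mu_eq: "mu = {x. x ^ ram_KL D = 1}"
proof (rule card_seteq)
  show "finite {x::'k. x ^ ram_KL D = 1}" by (rule finite_subset[OF subset_UNIV finite_k])
  show "mu \<subseteq> {x. x ^ ram_KL D = 1}" using etabar_power inertiaD(1) by auto
  show "card {x::'k. x ^ ram_KL D = 1} \<le> card mu"
    using kf.card_roots_of_unity_le[OF ram_KL_pos] by (simp add: card_image[OF inj_etabar] card_inertia)
qed

text \<open>\<open>etabar\<close> takes on inertia all roots of unity of order dividing the
  ramification index, so an exponent killing all its values is a multiple of the index. Equivariance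
  thereby becomes a congruence on degrees.\<close>

lemma inertia_exponent:
  assumes "\<And>g. g \<in> Gal D \<Longrightarrow> (\<And>x. gal_res D g x = x) \<Longrightarrow> etabar D g powi n = 1"
  shows "int (ram_KL D) dvd n"
proof (rule ccontr)
  assume nd: "\<not> ?thesis"
  define r where "r = nat (n mod int (ram_KL D))"
  have r: "int r = n mod int (ram_KL D)" using ram_KL_pos by (simp add: r_def)
  have "r \<noteq> 0" using nd r by (auto simp: dvd_eq_mod_eq_0)
  then have r0: "r > 0" by simp
  have "int r < int (ram_KL D)" unfolding r using ram_KL_pos by simp
  then have rl: "r < ram_KL D" by simp
  have "mu \<subseteq> {x. x ^ r = 1}"
  proof
    fix x assume x: "x \<in> mu"
    then obtain g where g: "g \<in> inertia" "x = etabar D g" by blast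
    have x0: "x \<noteq> 0" using g etabar_nonzero inertiaD(1) by auto
    have "x powi n = 1" using assms[of g] g inertiaD by auto
    moreover have "n = int (ram_KL D) * (n div int (ram_KL D)) + int r" using r by simp
    then have "x powi n = (x powi int (ram_KL D)) powi (n div int (ram_KL D)) * x powi int r"
      using x0 by (metis power_int_add power_int_mult)
    moreover have "x powi int (ram_KL D) = 1" using etabar_power g inertiaD(1) by simp
    ultimately show "x \<in> {x. x ^ r = 1}" by simp
  qed
  then have "card mu \<le> card {x::'k. x ^ r = 1}" by (intro card_mono finite_subset[OF subset_UNIV finite_k])
  then have "ram_KL D \<le> r"
    using kf.card_roots_of_unity_le[OF r0] by (simp add: card_image[OF inj_etabar] card_inertia)
  then show False using rl by simp
qed

text \<open>The trace is linear over the invariants, so an invariant x is the trace of x y / tr y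
  once tr y is nonzero. Lifting that element and taking the trace inside \<open>K\<close> shows that
  x comes from \<open>OL\<close>.\<close>

lemma trace_one: "\<exists>y. (\<Sum>g\<in>Gal D. gal_res D g y) = 1"
  and fixed_in_kL: "(\<And>g. g \<in> Gal D \<Longrightarrow> gal_res D g x = x) \<Longrightarrow> x \<in> \<rho> ` OL"
proof -
  obtain y where y: "(\<Sum>g\<in>Gal D. gal_res D g y) \<noteq> 0" using trace_nonzero[of 0] by auto
  let ?s = "\<Sum>g\<in>Gal D. gal_res D g y"
  have fx: "gal_res D h (\<Sum>g\<in>Gal D. gal_res D g z) = (\<Sum>g\<in>Gal D. gal_res D g z)" if h: "h \<in> Gal D" for h z
  proof -
    have z: "gal_res D h 0 = 0" using gal_res_add[OF h, of 0 0] by (metis add_cancel_left_left)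
    have "gal_res D h (\<Sum>g\<in>Gal D. gal_res D g z) = (\<Sum>g\<in>Gal D. gal_res D h (gal_res D g z))"
      by (rule hom_sum[OF z gal_res_add[OF h]])
    also have "\<dots> = (\<Sum>g\<in>Gal D. gal_res D (compose K h g) z)" using gal_res_comp[OF h] by simp
    also have "\<dots> = (\<Sum>g\<in>Gal D. gal_res D g z)"
      using sum.reindex_bij_betw[OF gal_reindex[OF h], of "\<lambda>g. gal_res D g z"] .
    finally show ?thesis .
  qed
  have gi: "gal_res D h (inverse z) = inverse (gal_res D h z)" if h: "h \<in> Gal D" "z \<noteq> 0" for h z
    using gal_res_mult[OF h(1), of z "inverse z"] gal_res_1[OF h(1)] h(2) by (simp add: inverse_unique[symmetric])
  have key: "(\<Sum>g\<in>Gal D. gal_res D g (x * y * inverse ?s)) = x" if x: "\<And>g. g \<in> Gal D \<Longrightarrow> gal_res D g x = x" for x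
  proof -
    have "(\<Sum>g\<in>Gal D. gal_res D g (x * y * inverse ?s)) = (\<Sum>g\<in>Gal D. x * inverse ?s * gal_res D g y)"
      by (rule sum.cong[OF refl]) (simp add: gal_res_mult gi[OF _ y] fx x)
    also have "\<dots> = x * inverse ?s * ?s" by (simp add: sum_distrib_left)
    finally show ?thesis using y by simp
  qed
  show "\<exists>y. (\<Sum>g\<in>Gal D. gal_res D g y) = 1" using key[of 1] gal_res_1 by blast
  assume x: "\<And>g. g \<in> Gal D \<Longrightarrow> gal_res D g x = x"
  obtain y0 where y0: "y0 \<in> OK" "\<rho> y0 = x * y * inverse ?s" using rho_surj by blast
  have "(\<Sum>g\<in>Gal D. g y0) \<in> L" "(\<Sum>g\<in>Gal D. g y0) \<in> OK" "\<rho> (\<Sum>g\<in>Gal D. g y0) = x"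
    using trace_in_L[OF y0(1), of 0] key[OF x] y0(2) by simp_all
  then show "x \<in> \<rho> ` OL" by (intro image_eqI[of _ _ "\<Sum>g\<in>Gal D. g y0"]) (auto simp: int_ring_def)
qed

lemma frob_multiples: "(x::'k) ^ p ^ d = x \<Longrightarrow> x ^ p ^ (d * j) = x"
proof (induction j)
  case (Suc j)
  have "x ^ p ^ (d * Suc j) = (x ^ p ^ d) ^ p ^ (d * j)" by (simp add: power_add power_mult)
  then show ?case using Suc by simp
qed simp

text \<open>\<open>H\<close> collects the exponents m for which x \<mapsto> x ^ p ^ m comes from the
  Galois group, and its least positive element d divides all others. So the residues fixed by the
  group are the p ^ d solutions of x ^ p ^ d = x. They are also the residues of \<open>OL\<close>,
  and comparing cardinalities gives d = \<open>resdegL D\<close>.\<close>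

lemma resdegL_frob:
  shows resdegL_dvd: "resdegL D dvd resdegK D"
    and gal_frobenius: "\<exists>g\<in>Gal D. \<forall>x. gal_res D g x = x ^ p ^ resdegL D"
    and resdegL_frobexp: "g \<in> Gal D \<Longrightarrow> resdegL D dvd frobexp g"
proof -
  let ?f = "resdegK D"
  define H where "H = {m. \<exists>g\<in>Gal D. \<forall>x. gal_res D g x = x ^ p ^ m}"
  have fH: "?f \<in> H" unfolding H_def
    using gal_id gal_res_id kf.power_card by (intro CollectI bexI[OF _ gal_id]) auto
  have addH: "m + n \<in> H" if "m \<in> H" "n \<in> H" for m n
  proof -
    obtain g h where "g \<in> Gal D" "\<forall>x. gal_res D g x = x ^ p ^ m" "h \<in> Gal D" "\<forall>x. gal_res D h x = x ^ p ^ n"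
      using \<open>m \<in> H\<close> \<open>n \<in> H\<close> by (auto simp: H_def)
    then have "\<forall>x. gal_res D (compose K g h) x = x ^ p ^ (m + n)" "compose K g h \<in> Gal D"
      by (auto simp: gal_res_comp gal_comp power_add mult.commute simp flip: power_mult)
    then show ?thesis by (auto simp: H_def)
  qed
  have multH: "m * j \<in> H" if "m \<in> H" "j > 0" for m j
    using that(2)
  proof (induction j rule: nat_induct_non_zero)
    case (Suc j)
    then show ?case using addH[OF that(1)] by simp
  qed (use that in simp)
  have congH: "n \<in> H" if "m \<in> H" "\<forall>x::'k. x ^ p ^ m = x ^ p ^ n" for m n
    using that unfolding H_def by auto
  define d where "d = (LEAST m. m > 0 \<and> m \<in> H)"
  have d: "d > 0 \<and> d \<in> H" unfolding d_def by (rule LeastI[of _ ?f]) (use fH kf.f_pos in simp)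
  have dmin: "d \<le> m" if "m > 0" "m \<in> H" for m unfolding d_def by (rule Least_le) (use that in simp)
  have ddvd: "d dvd m" if m: "m \<in> H" for m
  proof (rule ccontr)
    assume nd: "\<not> d dvd m"
    define r q where "r = m mod d" and "q = m div d"
    have mm: "m = d * q + r" by (simp add: r_def q_def)
    have r0: "r > 0" using nd by (simp add: r_def mod_greater_zero_iff_not_dvd)
    \<comment> \<open>\<open>H\<close> is closed under addition only, so subtracting d q is replaced
      by adding d q (f - 1); exponents matter only modulo f.\<close>
    have "m + ?f * (d * q * 1) - d * q \<in> H"
    proof (cases "q = 0")
      case False
      have "m + d * (q * (?f - 1)) \<in> H"
      proof (cases "?f = 1")
        case True
        then show ?thesis using m by simp
      next
        case ff: False
        then have "q * (?f - 1) > 0" using False kf.f_pos by simp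
        then show ?thesis using addH[OF m multH[OF conjunct2[OF d]]] by blast
      qed
      moreover have "m + d * (q * (?f - 1)) = m + ?f * (d * q * 1) - d * q"
        using kf.f_pos by (simp add: algebra_simps diff_mult_distrib2)
      ultimately show ?thesis by simp
    qed (use m in simp)
    moreover have "m + ?f * (d * q * 1) - d * q = r + ?f * (d * q)" using mm by simp
    ultimately have "r + ?f * (d * q) \<in> H" by simp
    then have "r \<in> H" using congH kf.frob_period by blast
    then have "d \<le> r" using dmin r0 by blast
    moreover have "r < d" using d by (simp add: r_def)
    ultimately show False by simp
  qed
  have df: "d dvd ?f" using ddvd fH by blast
  have fexp: "frobexp g \<in> H" if "g \<in> Gal D" for g using frobexp(2)[OF that] that unfolding H_def by blast
  have "\<rho> ` OL = {x. x ^ p ^ d = x}"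
  proof (intro equalityI subsetI)
    fix x assume "x \<in> \<rho> ` OL"
    then obtain y where y: "y \<in> OL" "x = \<rho> y" by blast
    obtain g where g: "g \<in> Gal D" "\<forall>x. gal_res D g x = x ^ p ^ d" using d unfolding H_def by blast
    have "g y = y" using galD(5)[OF g(1)] y by (simp add: int_ring_def)
    then have "gal_res D g x = x" using gal_res_rho[OF g(1)] y OL_OK by auto
    then show "x \<in> {x. x ^ p ^ d = x}" using g by simp
  next
    fix x :: 'k assume "x \<in> {x. x ^ p ^ d = x}"
    then have x: "x ^ p ^ d = x" by simp
    show "x \<in> \<rho> ` OL"
    proof (rule fixed_in_kL)
      fix g assume g: "g \<in> Gal D"
      obtain j where "frobexp g = d * j" using ddvd[OF fexp[OF g]] by blast
      then show "gal_res D g x = x" using frobexp(2)[OF g] frob_multiples[OF x] by simp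
    qed
  qed
  then have "p ^ resdegL D = p ^ d"
    using card_kL kf.card_fixed_frob[OF df] d by simp
  then have e: "resdegL D = d" using p_ge_3 by (simp add: power_inject_exp)
  show "resdegL D dvd ?f" using e df by simp
  show "\<exists>g\<in>Gal D. \<forall>x. gal_res D g x = x ^ p ^ resdegL D" using e d unfolding H_def by blast
  show "g \<in> Gal D \<Longrightarrow> resdegL D dvd frobexp g" using e ddvd fexp by simp
qed

text \<open>Any lift of the Frobenius can be normalised by composing it with an inertia element;
  \<open>z\<close> is the required value of \<open>etabar\<close> there, its p ^
  \<open>resdegL D\<close> power being the inverse of \<open>etabar D g0\<close>. As the result
  leaves u unscaled, it later forces exact periodicity of components.\<close>

lemma gal_frobenius_unif: "\<exists>g\<in>Gal D. (\<forall>x. gal_res D g x = x ^ p ^ resdegL D) \<and> etabar D g = 1"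
proof -
  obtain g0 where g0: "g0 \<in> Gal D" "\<forall>x. gal_res D g0 x = x ^ p ^ resdegL D" using gal_frobenius by blast
  have le: "resdegL D \<le> resdegK D" using resdegL_dvd kf.f_pos by (simp add: dvd_imp_le)
  define z where "z = inverse (etabar D g0) ^ p ^ (resdegK D - resdegL D)"
  have "z ^ p ^ resdegL D = inverse (etabar D g0) ^ p ^ (resdegK D - resdegL D + resdegL D)"
    unfolding z_def by (simp add: power_add power_mult)
  then have z: "z ^ p ^ resdegL D = inverse (etabar D g0)" using le kf.power_card by simp
  have "z ^ ram_KL D = inverse (etabar D g0 ^ ram_KL D) ^ p ^ (resdegK D - resdegL D)"
    unfolding z_def by (simp add: power_inverse mult.commute flip: power_mult)
  then have "z ^ ram_KL D = 1" using etabar_power[OF g0(1)] by simp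
  then have "z \<in> mu" unfolding mu_eq by simp
  then obtain t where t: "t \<in> inertia" "etabar D t = z" by blast
  have "gal_res D (compose K g0 t) x = x ^ p ^ resdegL D" for x
    using gal_res_comp[OF g0(1) inertiaD(1)[OF t(1)]] inertiaD(2)[OF t(1)] g0(2) by simp
  moreover have "etabar D (compose K g0 t) = 1"
    using etabar_comp[OF g0(1) inertiaD(1)[OF t(1)]] t z g0(2) etabar_nonzero[OF g0(1)] by simp
  ultimately show ?thesis using gal_comp[OF g0(1) inertiaD(1)[OF t(1)]] by blast
qed

end

section \<open>The tensor product and the coefficient ring\<close>

text \<open>\<open>tensor_eval\<close> with an arbitrary map on pairs in place of the product, so
  that maps out of the tensor product can be constructed from biadditive ones.\<close>

definition biadd_eval :: "(('k::field \<times> 'e::field) \<Rightarrow> 'r::comm_ring_1) \<Rightarrow> (('k \<times> 'e) \<Rightarrow>\<^sub>0 int) \<Rightarrow> 'r" where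
  "biadd_eval \<beta> z = (\<Sum>k\<in>Poly_Mapping.keys z. of_int (Poly_Mapping.lookup z k) * \<beta> k)"

lemma biadd_eval_superset:
  assumes "finite A" "Poly_Mapping.keys z \<subseteq> A"
  shows "biadd_eval \<beta> z = (\<Sum>k\<in>A. of_int (Poly_Mapping.lookup z k) * \<beta> k)"
  unfolding biadd_eval_def by (rule sum.mono_neutral_left) (use assms in \<open>auto simp: in_keys_iff\<close>)

lemma biadd_eval_diff: "biadd_eval \<beta> (z - z') = biadd_eval \<beta> z - biadd_eval \<beta> z'"
proof -
  let ?A = "Poly_Mapping.keys z \<union> Poly_Mapping.keys z'"
  have A: "finite ?A" by simp
  have "Poly_Mapping.keys (z - z') \<subseteq> ?A" by (rule keys_diff)
  then show ?thesis
    by (simp add: biadd_eval_superset[OF A] lookup_minus left_diff_distrib sum_subtractf)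
qed

lemma biadd_eval_single [simp]: "biadd_eval \<beta> (Poly_Mapping.single k 1) = \<beta> k"
  by (simp add: biadd_eval_def)

lemma biadd_eval_0 [simp]: "biadd_eval \<beta> 0 = 0"
  by (simp add: biadd_eval_def)

lemma biadd_eval_add: "biadd_eval \<beta> (z + z') = biadd_eval \<beta> z + biadd_eval \<beta> z'"
  using biadd_eval_diff[of \<beta> z "0 - z'"] biadd_eval_diff[of \<beta> 0 z'] by simp

lemma biadd_eval_relations:
  assumes "\<And>x x' y. \<beta> (x + x', y) = \<beta> (x, y) + \<beta> (x', y)" "\<And>x y y'. \<beta> (x, y + y') = \<beta> (x, y) + \<beta> (x, y')"
    and "\<And>n x y. \<beta> (of_int n * x, y) = \<beta> (x, of_int n * y)"
  shows "z \<in> tensor_relations \<Longrightarrow> biadd_eval \<beta> z = 0"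
  by (induction rule: tensor_relations.induct) (simp_all add: biadd_eval_diff assms)

context breuil_setting
begin

abbreviation "f \<equiv> resdegK D"
abbreviation "T \<equiv> trunc D"
abbreviation "\<sigma> \<equiv> sig D"
abbreviation "il \<equiv> inl D"
abbreviation "ir \<equiv> inr D"

lemma sig_1 [simp]: "\<sigma> i 1 = 1" and sig_add: "\<sigma> i (x + y) = \<sigma> i x + \<sigma> i y"
  and sig_mult: "\<sigma> i (x * y) = \<sigma> i x * \<sigma> i y"
  using sig_hom[rule_format, of i] by (auto simp: Ring.ring_hom_def)

lemma sig_0 [simp]: "\<sigma> i 0 = 0"
  using sig_add[of i 0 0] by (metis add_cancel_left_left add.right_neutral)

lemma sig_minus: "\<sigma> i (- x) = - \<sigma> i x"
  using sig_add[of i x "- x"] by (simp add: eq_neg_iff_add_eq_0 add.commute)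

lemma sig_power: "\<sigma> i (x ^ n) = \<sigma> i x ^ n"
  by (induction n) (auto simp: sig_mult)

lemma sig_of_nat: "\<sigma> i (of_nat n) = of_nat n"
  by (induction n) (auto simp: sig_add)

lemma sig_of_int: "\<sigma> i (of_int n) = of_int n"
  by (cases n) (auto simp: sig_of_nat sig_minus simp del: of_nat_Suc)

lemma sig_sum: "\<sigma> i (\<Sum>a\<in>A. t a) = (\<Sum>a\<in>A. \<sigma> i (t a))"
  by (rule hom_sum[OF sig_0 sig_add])

lemma sig_eq_0_iff: "\<sigma> i x = 0 \<longleftrightarrow> x = 0"
proof
  assume "\<sigma> i x = 0"
  then have "\<sigma> i (x * inverse x) = 0" by (simp add: sig_mult)
  then show "x = 0" by (cases "x = 0") auto
qed simp

lemma sig_inverse: "\<sigma> i (inverse x) = inverse (\<sigma> i x)"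
proof (cases "x = 0")
  case False
  then have "\<sigma> i x * \<sigma> i (inverse x) = 1" by (simp flip: sig_mult)
  then show ?thesis by (metis inverse_unique)
qed simp

lemma sig_inj: "\<sigma> i x = \<sigma> i y \<Longrightarrow> x = y"
proof -
  assume "\<sigma> i x = \<sigma> i y"
  then have "\<sigma> i (x - y) = 0" using sig_add[of i x "- y"] sig_minus[of i y] by simp
  then show ?thesis using sig_eq_0_iff by simp
qed

lemma sig_powi: "\<sigma> i (x powi n) = \<sigma> i x powi n"
  by (simp add: power_int_def sig_power sig_inverse)

lemma sig_frob: "\<sigma> i (x ^ p ^ n) = \<sigma> (i - int n) x"
proof (induction n arbitrary: x)
  case (Suc n)
  have "\<sigma> i (x ^ p ^ Suc n) = \<sigma> i ((x ^ p) ^ p ^ n)" by (simp add: power_mult)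
  also have "\<dots> = \<sigma> (i - int n) x ^ p" by (simp only: Suc sig_power[of "i - int n"])
  also have "\<dots> = \<sigma> (i - int (Suc n)) x" using sig_pow[rule_format, of "i - int (Suc n)" x] by simp
  finally show ?case .
qed simp

lemma sig_period: "\<sigma> (i + int f * j) x = \<sigma> i x"
proof -
  have *: "\<sigma> (i - int (f * n)) x = \<sigma> i x" for n i
    using sig_frob[of i x "f * n"] kf.frob_period[of x 0 n] by simp
  show ?thesis
  proof (cases "j \<ge> 0")
    case True
    then show ?thesis using *[of "i + int f * j" "nat j"] by simp
  next
    case False
    then show ?thesis using *[of i "nat (- j)"] by simp
  qed
qed

lemma sig_cong: "i mod int f = j mod int f \<Longrightarrow> \<sigma> i = \<sigma> j"
proof
  fix x assume a: "i mod int f = j mod int f"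
  have "\<sigma> i x = \<sigma> (i mod int f) x" for i
    using sig_period[of "i mod int f" "i div int f" x] by simp
  then show "\<sigma> i x = \<sigma> j x" using a by metis
qed

lemma sig_distinct:
  assumes "\<And>x. \<sigma> i x = \<sigma> j x"
  shows "i mod int f = j mod int f"
proof -
  define n where "n = nat ((i - j) mod int f)"
  have fp: "int f > 0" using kf.f_pos by simp
  have n: "int n = (i - j) mod int f" using fp by (simp add: n_def)
  have "int n < int f" unfolding n using fp by simp
  then have nf: "n < f" by simp
  have "(i - int n) mod int f = j mod int f" unfolding n by (metis diff_diff_eq2 diff_add_cancel mod_diff_right_eq add_diff_cancel_left' diff_add_eq)
  then have "\<sigma> i (x ^ p ^ n) = \<sigma> j x" for x using sig_frob[of i x n] sig_cong by metis
  then have "\<sigma> i (x ^ p ^ n) = \<sigma> i x" for x by (simp only: assms)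
  note e = this
  have "x ^ p ^ n = x" for x :: 'k by (rule sig_inj[OF e])
  then have "x ^ p ^ n = x ^ p ^ 0" for x :: 'k by simp
  then have "n = 0" using kf.frob_distinct[OF nf kf.f_pos] by blast
  then have "(i - j) mod int f = 0" using n by simp
  then show ?thesis by (simp add: mod_eq_dvd_iff dvd_eq_mod_eq_0)
qed

lemma char_e: "of_nat p = (0::'e)"
  using sig_of_nat[of 0 p] char_k by simp

lemma il_1 [simp]: "il 1 = 1" and il_add: "il (x + y) = il x + il y" and il_mult: "il (x * y) = il x * il y"
  and ir_1 [simp]: "ir 1 = 1" and ir_add: "ir (z + w) = ir z + ir w" and ir_mult: "ir (z * w) = ir z * ir w"
  using tensor unfolding is_tensor_product_def by (auto simp: Ring.ring_hom_def)

lemma il_0 [simp]: "il 0 = 0" and ir_0 [simp]: "ir 0 = 0"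
  using il_add[of 0 0] ir_add[of 0 0] by (metis add_cancel_left_left add.right_neutral)+

lemma ir_minus: "ir (- x) = - ir x"
  using ir_add[of x "- x"] by (simp add: eq_neg_iff_add_eq_0 add.commute)

lemma il_minus: "il (- x) = - il x"
  using il_add[of x "- x"] by (simp add: eq_neg_iff_add_eq_0 add.commute)

lemma il_of_int: "il (of_int n) = of_int n" and ir_of_int: "ir (of_int n) = of_int n"
proof -
  have "il (of_nat m) = of_nat m" "ir (of_nat m) = of_nat m" for m by (induction m) (auto simp: il_add ir_add)
  then show "il (of_int n) = of_int n" "ir (of_int n) = of_int n"
    by (cases n; auto simp: il_minus ir_minus simp del: of_nat_Suc)+
qed

lemma il_sum: "il (\<Sum>a\<in>A. t a) = (\<Sum>a\<in>A. il (t a))"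
  by (rule hom_sum[OF il_0 il_add])

lemma ir_sum: "ir (\<Sum>a\<in>A. t a) = (\<Sum>a\<in>A. ir (t a))"
  by (rule hom_sum[OF ir_0 ir_add])

abbreviation "gen \<equiv> (\<lambda>(x, y). il x * ir y)"

lemma tensor_eval_eq: "tensor_eval il ir = biadd_eval gen"
  by (rule ext) (simp add: tensor_eval_def biadd_eval_def case_prod_unfold)

lemma tensor_surj: "\<exists>z. biadd_eval gen z = t"
  and tensor_kernel: "biadd_eval gen z = 0 \<Longrightarrow> z \<in> tensor_relations"
  using tensor unfolding is_tensor_product_def tensor_eval_eq surj_def by metis+

text \<open>Integer coefficients are absorbed into the left factor, so sums of pure tensors exhaust
  the ring.\<close>

lemma tensor_induct:
  assumes gen: "\<And>x y. P (il x * ir y)" and add: "\<And>s t. P s \<Longrightarrow> P t \<Longrightarrow> P (s + t)"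
  shows "P t"
proof -
  obtain z where z: "biadd_eval gen z = t" using tensor_surj by blast
  have z0: "P 0" using gen[of 0 0] by simp
  have "P (\<Sum>k\<in>A. of_int (Poly_Mapping.lookup z k) * gen k)" if "finite A" for A
    using that
  proof (induction A rule: finite_induct)
    case (insert k A)
    obtain x y where k: "k = (x, y)" by force
    have "of_int (Poly_Mapping.lookup z k) * gen k = il (of_int (Poly_Mapping.lookup z k) * x) * ir y"
      by (simp add: k il_mult il_of_int mult.assoc)
    then have "P (of_int (Poly_Mapping.lookup z k) * gen k)" using gen by metis
    then show ?case using insert add by simp
  qed (simp add: z0)
  then show ?thesis using z unfolding biadd_eval_def by force
qed

text \<open>The universal property: for a biadditive balanced \<beta> the choice of preimage is
  immaterial, because \<beta> then vanishes on \<open>tensor_relations\<close>.\<close>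

definition tlift :: "(('k \<times> 'e) \<Rightarrow> 'r::comm_ring_1) \<Rightarrow> 't \<Rightarrow> 'r" where
  "tlift \<beta> t = biadd_eval \<beta> (SOME z. biadd_eval gen z = t)"

lemma tlift:
  assumes b: "\<And>x x' y. \<beta> (x + x', y) = \<beta> (x, y) + \<beta> (x', y)" "\<And>x y y'. \<beta> (x, y + y') = \<beta> (x, y) + \<beta> (x, y')"
    "\<And>n x y. \<beta> (of_int n * x, y) = \<beta> (x, of_int n * y)"
  shows "tlift \<beta> (il x * ir y) = \<beta> (x, y)" "tlift \<beta> (s + t) = tlift \<beta> s + tlift \<beta> t"
proof -
  have *: "tlift \<beta> (biadd_eval gen z) = biadd_eval \<beta> z" for z
  proof -
    let ?z = "SOME z'. biadd_eval gen z' = biadd_eval gen z"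
    have "biadd_eval gen ?z = biadd_eval gen z" by (rule someI) (rule refl)
    then have "biadd_eval gen (?z - z) = 0" by (simp add: biadd_eval_diff)
    then have "biadd_eval \<beta> (?z - z) = 0" by (intro biadd_eval_relations[OF b] tensor_kernel)
    then show ?thesis by (simp add: biadd_eval_diff tlift_def)
  qed
  show "tlift \<beta> (il x * ir y) = \<beta> (x, y)" using *[of "Poly_Mapping.single (x, y) 1"] by simp
  obtain z z' where "biadd_eval gen z = s" "biadd_eval gen z' = t" using tensor_surj by metis
  then show "tlift \<beta> (s + t) = tlift \<beta> s + tlift \<beta> t"
    using *[of z] *[of z'] *[of "z + z'"] by (simp add: biadd_eval_add)
qed

text \<open>The ring homomorphism to k_E sending x \<otimes> y to \<sigma> i x times y. Together
  these homomorphisms separate elements (\<open>chi_eqI\<close>), so identities in the tensor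
  product are checked one component at a time.\<close>

definition chi :: "int \<Rightarrow> 't \<Rightarrow> 'e" where
  "chi i = tlift (\<lambda>(x, y). \<sigma> i x * y)"

lemma chi_gen: "chi i (il x * ir y) = \<sigma> i x * y" and chi_add: "chi i (s + t) = chi i s + chi i t"
proof -
  let ?b = "\<lambda>(x, y). \<sigma> i x * y"
  have b: "?b (x + x', y) = ?b (x, y) + ?b (x', y)" "?b (x, y + y') = ?b (x, y) + ?b (x, y')"
    "?b (of_int n * x, y) = ?b (x, of_int n * y)" for x x' y y' n
    by (auto simp: sig_add sig_mult sig_of_int algebra_simps)
  show "chi i (il x * ir y) = \<sigma> i x * y" "chi i (s + t) = chi i s + chi i t"
    unfolding chi_def using tlift[OF b] by auto
qed

lemma chi_il: "chi i (il x) = \<sigma> i x" and chi_ir: "chi i (ir y) = y"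
  using chi_gen[of i x 1] chi_gen[of i 1 y] by auto

lemma chi_0 [simp]: "chi i 0 = 0" and chi_1 [simp]: "chi i 1 = 1"
  using chi_il[of i 0] chi_il[of i 1] by auto

lemma chi_mult: "chi i (s * t) = chi i s * chi i t"
proof (induction s rule: tensor_induct)
  case (1 x y)
  show ?case
  proof (induction t rule: tensor_induct)
    case (1 x' y')
    have "il x * ir y * (il x' * ir y') = il (x * x') * ir (y * y')" by (simp add: il_mult ir_mult ac_simps)
    then show ?case by (simp only: chi_gen sig_mult) (simp add: ac_simps)
  qed (simp add: chi_add distrib_left)
qed (simp add: chi_add distrib_right)

lemma chi_sum: "chi i (\<Sum>a\<in>A. t a) = (\<Sum>a\<in>A. chi i (t a))"
  by (rule hom_sum[OF chi_0 chi_add])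

lemma chi_minus: "chi i (- x) = - chi i x"
  using chi_add[of i x "- x"] by (simp add: eq_neg_iff_add_eq_0 add.commute)

lemma chi_cong: "i mod int f = j mod int f \<Longrightarrow> chi i = chi j"
  unfolding chi_def by (simp only: sig_cong[of i j])

text \<open>Orthogonality of the characters \<open>\<sigma> i\<close> of the multiplicative group yields the idempotents.\<close>

definition ee :: "int \<Rightarrow> 't" where
  "ee i = - (\<Sum>x\<in>UNIV - {0}. il x * ir (inverse (\<sigma> i x)))"

lemma il_ee: "il y * ee i = ir (\<sigma> i y) * ee i"
proof (cases "y = 0")
  case False
  have bij: "bij_betw ((*) y) (UNIV - {0}) (UNIV - {0})"
    using False by (intro bij_betwI[where g = "\<lambda>x. x / y"]) auto
  have "ir (\<sigma> i y) * ee i = - (\<Sum>x\<in>UNIV - {0}. il x * ir (\<sigma> i y * inverse (\<sigma> i x)))"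
    by (simp add: ee_def sum_distrib_left ir_mult ac_simps)
  also have "\<dots> = - (\<Sum>x\<in>UNIV - {0}. il (y * x) * ir (\<sigma> i y * inverse (\<sigma> i (y * x))))"
    by (subst sum.reindex_bij_betw[OF bij, symmetric]) (rule refl)
  also have "\<dots> = il y * ee i"
    unfolding ee_def mult_minus_right sum_distrib_left
  proof (intro arg_cong[where f = uminus] sum.cong refl)
    fix x :: 'k assume "x \<in> UNIV - {0}"
    have "\<sigma> i y * inverse (\<sigma> i (y * x)) = inverse (\<sigma> i x)"
      using False sig_eq_0_iff[of i y] by (simp add: sig_mult)
    then show "il (y * x) * ir (\<sigma> i y * inverse (\<sigma> i (y * x))) = il y * (il x * ir (inverse (\<sigma> i x)))"
      by (simp add: il_mult mult.assoc)
  qed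
  finally show ?thesis by simp
qed simp

lemma mult_ee: "t * ee i = ir (chi i t) * ee i"
proof (induction t rule: tensor_induct)
  case (1 x y)
  have "il x * ir y * ee i = ir y * (il x * ee i)" by (simp add: ac_simps)
  then show ?case by (simp add: il_ee chi_gen ir_mult ac_simps)
qed (simp add: chi_add ir_add distrib_right)

text \<open>Orthogonality of characters. If i and j agree modulo f, all p ^ f - 1 summands equal 1
  and add up to -1 in characteristic p, which explains the sign in \<open>ee\<close>.\<close>

lemma chi_ee: "chi j (ee i) = (if i mod int f = j mod int f then 1 else 0)"
proof -
  have e: "chi j (ee i) = - (\<Sum>x\<in>UNIV - {0}. \<sigma> j x * inverse (\<sigma> i x))"
    by (simp add: ee_def chi_minus chi_sum chi_gen)
  show ?thesis
  proof (cases "i mod int f = j mod int f")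
    case True
    then have "\<sigma> j x * inverse (\<sigma> i x) = 1" if "x \<noteq> 0" for x using sig_cong[OF True] sig_eq_0_iff that by simp
    then have "chi j (ee i) = - of_nat (card (UNIV - {0::'k}))" unfolding e by simp
    also have "card (UNIV - {0::'k}) = p ^ f - 1" using finite_k card_k by (simp add: card_Diff_singleton)
    also have "(of_nat (p ^ f - 1) :: 'e) = of_nat (p ^ f) - 1" using p_ge_3 by (simp add: of_nat_diff)
    also have "(of_nat (p ^ f) :: 'e) = 0" using char_e kf.f_pos by simp
    finally show ?thesis using True by simp
  next
    case False
    then obtain y where y: "\<sigma> i y \<noteq> \<sigma> j y" using sig_distinct by blast
    then have y0: "y \<noteq> 0" by auto
    have bij: "bij_betw ((*) y) (UNIV - {0}) (UNIV - {0})"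
      using y0 by (intro bij_betwI[where g = "\<lambda>x. x / y"]) auto
    let ?s = "\<Sum>x\<in>UNIV - {0}. \<sigma> j x * inverse (\<sigma> i x)"
    have "?s = (\<Sum>x\<in>UNIV - {0}. \<sigma> j (y * x) * inverse (\<sigma> i (y * x)))"
      by (subst sum.reindex_bij_betw[OF bij, symmetric]) (rule refl)
    also have "\<dots> = \<sigma> j y * inverse (\<sigma> i y) * ?s"
      by (simp add: sum_distrib_left sig_mult ac_simps)
    finally have "(1 - \<sigma> j y * inverse (\<sigma> i y)) * ?s = 0" by (simp add: algebra_simps)
    moreover have "1 - \<sigma> j y * inverse (\<sigma> i y) \<noteq> 0"
    proof
      assume "1 - \<sigma> j y * inverse (\<sigma> i y) = 0"
      then have "\<sigma> j y = \<sigma> i y" using y0 sig_eq_0_iff[of i y] by (simp add: field_simps)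
      then show False using y by simp
    qed
    ultimately show ?thesis using False e by simp
  qed
qed

lemma trace_prime: "(\<Sum>i<f. (x::'k) ^ p ^ i) \<in> Fp"
proof -
  let ?t = "\<Sum>i<f. x ^ p ^ i"
  have "?t ^ p = (\<Sum>i<f. (x ^ p ^ i) ^ p)" using kf.frob_sum[of "\<lambda>i. x ^ p ^ i" "{..<f}" 1] by simp
  also have "\<dots> = (\<Sum>i<f. x ^ p ^ Suc i)" by (simp add: mult.commute flip: power_mult)
  also have "\<dots> = ?t - x ^ p ^ 0 + x ^ p ^ f"
    using sum.lessThan_Suc_shift[of "\<lambda>i. x ^ p ^ i" f] sum.lessThan_Suc[of "\<lambda>i. x ^ p ^ i" f] by (simp add: algebra_simps)
  finally have t: "?t ^ p = ?t" using kf.power_card[of x] by simp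
  have P0: "monom (1::'k) p - monom 1 1 \<noteq> 0"
  proof
    assume "monom (1::'k) p - monom 1 1 = 0"
    then have "coeff (monom (1::'k) p - monom 1 1) p = 0" by simp
    then show False using kf.p_gt_1 by simp
  qed
  have "degree (monom (1::'k) p - monom 1 1) \<le> p"
    using kf.p_gt_1 by (intro degree_diff_le) (auto intro: order_trans[OF degree_monom_le])
  then have c: "card {x::'k. x ^ p = x} \<le> p"
    using card_poly_roots_bound[OF P0] by (simp add: poly_monom)
  have "Fp \<subseteq> {x::'k. x ^ p = x}"
  proof
    fix y :: 'k assume "y \<in> Fp"
    then obtain n where n: "y = of_int n" by auto
    have nn: "(of_nat m :: 'k) ^ p = of_nat m" for m
      by (induction m) (use kf.p_gt_1 kf.frob_add[of 1 _ 1] in auto)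
    have "y ^ p = y"
    proof (cases n)
      case (neg m)
      then show ?thesis using n nn[of "Suc m"] minus_power_prime_CHAR[of p "of_nat (Suc m) :: 'k"] CHAR_k prime_p
        by (simp del: of_nat_Suc)
    qed (use n nn in simp)
    then show "y \<in> {x. x ^ p = x}" by simp
  qed
  then have "Fp = {x::'k. x ^ p = x}"
    using c card_Fp by (intro card_seteq finite_subset[OF subset_UNIV finite_k]) auto
  then show ?thesis using t by blast
qed

text \<open>Summing \<sigma> i over all i gives the trace to the prime field, which may cross the
  tensor sign. What remains are the sums of x times the p ^ i-th power of its inverse over nonzero
  x; they vanish unless i = 0, where the value is -1.\<close>

lemma sum_ee: "(\<Sum>i<f. ee (int i)) = 1"
proof -
  have tr: "(\<Sum>i<f. ir (\<sigma> (int i) y)) = il (\<Sum>i<f. y ^ p ^ i)" for y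
  proof -
    have "(\<Sum>i<f. \<sigma> (int i) y) = (\<Sum>i<f. \<sigma> (int f - 1) (y ^ p ^ i))"
    proof -
      have "(\<Sum>i<f. \<sigma> (int f - 1) (y ^ p ^ i)) = (\<Sum>i<f. \<sigma> (int f - 1 - int i) y)" by (simp add: sig_frob)
      also have "\<dots> = (\<Sum>i<f. \<sigma> (int (f - Suc i)) y)" by (intro sum.cong refl) (simp add: of_nat_diff algebra_simps)
      also have "\<dots> = (\<Sum>i<f. \<sigma> (int i) y)" by (rule sum.nat_diff_reindex)
      finally show ?thesis by simp
    qed
    also have "\<dots> = \<sigma> (int f - 1) (\<Sum>i<f. y ^ p ^ i)" by (simp add: sig_sum)
    finally have s: "(\<Sum>i<f. ir (\<sigma> (int i) y)) = ir (\<sigma> (int f - 1) (\<Sum>i<f. y ^ p ^ i))" by (simp flip: ir_sum)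
    obtain n where "(\<Sum>i<f. y ^ p ^ i) = of_int n" using trace_prime[of y] by blast
    then show ?thesis using s by (simp add: sig_of_int ir_of_int il_of_int)
  qed
  have "(\<Sum>i<f. ee (int i)) = - (\<Sum>x\<in>UNIV - {0}. il x * (\<Sum>i<f. ir (\<sigma> (int i) (inverse x))))"
    unfolding ee_def sum_negf sum_distrib_left by (subst sum.swap) (simp add: sig_inverse)
  also have "\<dots> = - il (\<Sum>x\<in>UNIV - {0}. \<Sum>i<f. x * inverse x ^ p ^ i)"
    by (simp only: tr sum_distrib_left il_sum il_mult)
  also have "(\<Sum>x\<in>UNIV - {0::'k}. \<Sum>i<f. x * inverse x ^ p ^ i) = (\<Sum>i<f. if i = 0 then - 1 else 0)"
  proof (subst sum.swap, rule sum.cong[OF refl])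
    fix i assume i: "i \<in> {..<f}"
    show "(\<Sum>x\<in>UNIV - {0::'k}. x * inverse x ^ p ^ i) = (if i = 0 then - 1 else 0)"
    proof (cases "i = 0")
      case True
      have "(\<Sum>x\<in>UNIV - {0::'k}. x * inverse x ^ p ^ i) = of_nat (card (UNIV - {0::'k}))" using True by simp
      also have "card (UNIV - {0::'k}) = p ^ f - 1" using finite_k card_k by (simp add: card_Diff_singleton)
      also have "(of_nat (p ^ f - 1) :: 'k) = of_nat (p ^ f) - 1" using p_ge_3 by (simp add: of_nat_diff)
      also have "(of_nat (p ^ f) :: 'k) = 0" using char_k kf.f_pos by simp
      finally show ?thesis using True by simp
    next
      case False
      have "\<exists>y::'k. y ^ p ^ i \<noteq> y"
      proof (rule ccontr)
        assume "\<not> ?thesis"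
        then have "\<forall>x::'k. x ^ p ^ i = x ^ p ^ 0" by simp
        then show False using kf.frob_distinct[of i 0] i kf.f_pos False by auto
      qed
      then obtain y :: 'k where y: "y ^ p ^ i \<noteq> y" by blast
      then have y0: "y \<noteq> 0" using kf.p_gt_1 by (intro notI) simp
      have bij: "bij_betw ((*) y) (UNIV - {0}) (UNIV - {0})"
        using y0 by (intro bij_betwI[where g = "\<lambda>x. x / y"]) auto
      let ?s = "\<Sum>x\<in>UNIV - {0::'k}. x * inverse x ^ p ^ i"
      have "?s = (\<Sum>x\<in>UNIV - {0}. (y * x) * inverse (y * x) ^ p ^ i)"
        by (subst sum.reindex_bij_betw[OF bij, symmetric]) (rule refl)
      also have "\<dots> = y * inverse y ^ p ^ i * ?s"
        by (simp add: sum_distrib_left power_mult_distrib ac_simps)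
      finally have "(1 - y * inverse y ^ p ^ i) * ?s = 0" by (simp add: algebra_simps)
      moreover have "1 - y * inverse y ^ p ^ i \<noteq> 0"
      proof
        assume "1 - y * inverse y ^ p ^ i = 0"
        then have "y * (inverse y ^ p ^ i * y ^ p ^ i) = y ^ p ^ i" by simp
        then show False using y y0 by (simp flip: power_mult_distrib)
      qed
      ultimately show ?thesis using False by simp
    qed
  qed
  also have "\<dots> = - 1" using kf.f_pos by simp
  finally show ?thesis by (simp add: il_minus)
qed

lemma tensor_decomp: "t = (\<Sum>i<f. ir (chi (int i) t) * ee (int i))"
proof -
  have "(\<Sum>i<f. ir (chi (int i) t) * ee (int i)) = t * (\<Sum>i<f. ee (int i))"
    unfolding sum_distrib_left by (rule sum.cong[OF refl]) (rule mult_ee[symmetric])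
  then show ?thesis by (simp add: sum_ee)
qed

lemma chi_eqI: "(\<And>i. chi i s = chi i t) \<Longrightarrow> s = t"
  using tensor_decomp[of s] tensor_decomp[of t] by simp

lemma int_mod_f: "i mod int f = int (nat (i mod int f))" "nat (i mod int f) < f"
  using kf.f_pos by (auto simp: nat_less_iff)

text \<open>An element on which k acts through \<sigma> i has zero components away from i, and its
  component at i is an idempotent of a field, hence 1 if the element is nonzero. So the description
  has only one solution.\<close>

lemma idem_eq: "idem D i = ee i"
  unfolding idem_def
proof (rule the_equality)
  have "chi i (ee i) = 1" by (simp add: chi_ee)
  then have "ee i \<noteq> 0" by auto
  moreover have "ee i * ee i = ee i"
    by (rule chi_eqI) (simp add: chi_mult chi_ee)
  ultimately show "ee i \<noteq> 0 \<and> ee i * ee i = ee i \<and> (\<forall>x. il x * ee i = ir (\<sigma> i x) * ee i)"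
    using il_ee by blast
  fix \<epsilon> assume a: "\<epsilon> \<noteq> 0 \<and> \<epsilon> * \<epsilon> = \<epsilon> \<and> (\<forall>x. il x * \<epsilon> = ir (\<sigma> i x) * \<epsilon>)"
  have z: "chi j \<epsilon> = 0" if ij: "i mod int f \<noteq> j mod int f" for j
  proof -
    obtain x where x: "\<sigma> i x \<noteq> \<sigma> j x" using sig_distinct ij by blast
    have "chi j (il x * \<epsilon>) = chi j (ir (\<sigma> i x) * \<epsilon>)" using a by simp
    then have "(\<sigma> j x - \<sigma> i x) * chi j \<epsilon> = 0" by (simp add: chi_mult chi_il chi_ir algebra_simps)
    then show ?thesis using x by simp
  qed
  have id: "chi j \<epsilon> * chi j \<epsilon> = chi j \<epsilon>" for j using a chi_mult[of j \<epsilon> \<epsilon>] by simp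
  have "chi i \<epsilon> \<noteq> 0"
  proof
    assume "chi i \<epsilon> = 0"
    then have "chi j \<epsilon> = 0" for j using z chi_cong by (metis (full_types))
    then have "\<epsilon> = 0" by (intro chi_eqI) simp
    then show False using a by simp
  qed
  then have "chi i \<epsilon> = 1" using id[of i] by simp
  then have "chi j \<epsilon> = chi j (ee i)" for j using z[of j] chi_cong[of i j] by (auto simp: chi_ee)
  then show "\<epsilon> = ee i" by (intro chi_eqI) simp
qed

lemma tensor_map_props:
  assumes "\<And>x y. \<psi> (x + y) = \<psi> x + \<psi> y" "\<And>x y. \<psi> (x * y) = \<psi> x * \<psi> y" "\<psi> 1 = 1"
  shows "tensor_map D \<psi> (s + t) = tensor_map D \<psi> s + tensor_map D \<psi> t"
    and "tensor_map D \<psi> (il x * ir y) = il (\<psi> x) * ir y"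
proof -
  have z: "\<psi> 0 = 0" using assms(1)[of 0 0] by (metis add_cancel_left_left add.right_neutral)
  have neg: "\<psi> (- x) = - \<psi> x" for x using assms(1)[of x "- x"] z by (simp add: eq_neg_iff_add_eq_0 add.commute)
  have nat: "\<psi> (of_nat n) = of_nat n" for n by (induction n) (auto simp: z assms)
  have int: "\<psi> (of_int n) = of_int n" for n using nat neg by (cases n) (auto simp del: of_nat_Suc)
  let ?b = "\<lambda>(x, y). il (\<psi> x) * ir y"
  have b: "?b (x + x', y) = ?b (x, y) + ?b (x', y)" "?b (x, y + y') = ?b (x, y) + ?b (x, y')"
    "?b (of_int n * x, y) = ?b (x, of_int n * y)" for x x' y y' n
    by (auto simp: assms il_add ir_add il_mult ir_mult int il_of_int ir_of_int algebra_simps)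
  have "\<exists>!F. (\<forall>s t. F (s + t) = F s + F t) \<and> (\<forall>x y. F (il x * ir y) = il (\<psi> x) * ir y)"
  proof (rule ex1I[of _ "tlift ?b"])
    show "(\<forall>s t. tlift ?b (s + t) = tlift ?b s + tlift ?b t) \<and> (\<forall>x y. tlift ?b (il x * ir y) = il (\<psi> x) * ir y)"
      using tlift[OF b] by auto
    fix F :: "'t \<Rightarrow> 't" assume F: "(\<forall>s t. F (s + t) = F s + F t) \<and> (\<forall>x y. F (il x * ir y) = il (\<psi> x) * ir y)"
    have "F t = tlift ?b t" for t
      by (induction t rule: tensor_induct) (use F tlift[OF b] in auto)
    then show "F = tlift ?b" by auto
  qed
  from theI'[OF this] show "tensor_map D \<psi> (s + t) = tensor_map D \<psi> s + tensor_map D \<psi> t"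
    "tensor_map D \<psi> (il x * ir y) = il (\<psi> x) * ir y"
    unfolding tensor_map_def[symmetric] by auto
qed

lemma chi_tensor_map:
  assumes m: "\<And>x. \<psi> x = x ^ p ^ m"
  shows "chi i (tensor_map D \<psi> t) = chi (i - int m) t"
proof -
  have "\<psi> (x + y) = \<psi> x + \<psi> y" "\<psi> (x * y) = \<psi> x * \<psi> y" "\<psi> 1 = 1" for x y
    by (auto simp: m kf.frob_add power_mult_distrib)
  note tm = tensor_map_props[OF this]
  show ?thesis
  proof (induction t rule: tensor_induct)
    case (1 x y)
    show ?case unfolding tm(2) chi_gen unfolding m sig_frob ..
  next
    case (2 s t)
    then show ?case by (simp only: tm(1) chi_add)
  qed
qed

end

subsection \<open>Truncated polynomials\<close>

lemma poly_cutoff_idem [simp]: "poly_cutoff n (poly_cutoff n q) = poly_cutoff n q"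
  by (rule poly_eqI) (simp add: coeff_poly_cutoff)

lemma poly_cutoff_add: "poly_cutoff n (x + y) = poly_cutoff n x + poly_cutoff n y"
  by (rule poly_eqI) (simp add: coeff_poly_cutoff)

lemma poly_cutoff_diff:
  fixes x y :: "'r::comm_ring_1 poly"
  shows "poly_cutoff n (x - y) = poly_cutoff n x - poly_cutoff n y"
  by (rule poly_eqI) (simp add: coeff_poly_cutoff)

lemma poly_cutoff_mult_left [simp]: "poly_cutoff n (poly_cutoff n x * y) = poly_cutoff n (x * y)"
proof (rule poly_eqI)
  fix k
  show "coeff (poly_cutoff n (poly_cutoff n x * y)) k = coeff (poly_cutoff n (x * y)) k"
    unfolding coeff_poly_cutoff coeff_mult by (auto intro!: sum.cong)
qed

lemma poly_cutoff_mult_right [simp]: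
  fixes x y :: "'r::comm_semiring_1 poly"
  shows "poly_cutoff n (x * poly_cutoff n y) = poly_cutoff n (x * y)"
  using poly_cutoff_mult_left[of n y x] by (simp add: mult.commute)

lemma coeff_pcompose_monom:
  fixes q :: "'r::comm_ring_1 poly"
  assumes "m > 0"
  shows "coeff (pcompose q (monom 1 m)) n = (if m dvd n then coeff q (n div m) else 0)"
proof (induction q arbitrary: n)
  case (pCons a q)
  show ?case
  proof (cases "n < m")
    case True
    then have "m dvd n \<longleftrightarrow> n = 0" using nat_dvd_not_less by auto
    then show ?thesis using True assms by (auto simp: pcompose_pCons coeff_monom_mult coeff_pCons split: nat.splits)
  next
    case False
    have "m dvd n - m \<longleftrightarrow> m dvd n" using False by (simp add: dvd_minus_self)
    moreover have "n div m = Suc ((n - m) div m)" using False assms by (simp add: le_div_geq)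
    ultimately show ?thesis using False assms pCons
      by (auto simp: pcompose_pCons coeff_monom_mult coeff_pCons split: nat.splits)
  qed
qed simp

text \<open>Inversion of a power series with nonzero constant term, one coefficient at a
  time.\<close>

lemma inverse_mod_monom:
  fixes a :: "'r::field poly"
  assumes "coeff a 0 \<noteq> 0"
  shows "\<exists>y. poly_cutoff n (a * y) = poly_cutoff n 1"
proof -
  have "\<exists>y q. a * y = 1 + monom 1 n * q"
  proof (induction n)
    case 0
    then show ?case by (intro exI[of _ 0] exI[of _ "- 1"]) simp
  next
    case (Suc n)
    then obtain y q where yq: "a * y = 1 + monom 1 n * q" by blast
    define c where "c = coeff q 0 / coeff a 0"
    have "coeff (q - Polynomial.smult c a) 0 = 0" using assms by (simp add: c_def)
    then obtain q' where q': "q - Polynomial.smult c a = pCons 0 q'" by (cases "q - Polynomial.smult c a") auto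
    have "a * (y - Polynomial.smult c (monom 1 n)) = 1 + monom 1 n * (q - Polynomial.smult c a)"
      using yq by (simp add: algebra_simps)
    also have "\<dots> = 1 + monom 1 (Suc n) * q'"
      unfolding q' by (simp add: monom_Suc)
    finally show ?case by blast
  qed
  then obtain y q where "a * y = 1 + monom 1 n * q" by blast
  then show ?thesis
    by (intro exI[of _ y] poly_eqI) (simp add: coeff_poly_cutoff coeff_monom_mult)
qed

context breuil_setting
begin

section \<open>The coefficient ring and its components\<close>

abbreviation "f' \<equiv> resdegL D"
abbreviation "e \<equiv> ramK D"
abbreviation "eKL \<equiv> ram_KL D"
abbreviation "S \<equiv> breuil_ring D"
abbreviation "ct \<equiv> poly_cutoff T"
abbreviation S_times (infixl "\<star>" 70) where "x \<star> y \<equiv> x \<otimes>\<^bsub>S\<^esub> y"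

lemma T_eq: "T = e * p"
  by (simp add: trunc_def)

text \<open>Since p \<ge> 3, a degree below e can be raised by r i and by s i, both at most e, and
  still stay below the truncation.\<close>

lemma T_bounds: "3 * e \<le> T" "T > 0"
proof -
  show "3 * e \<le> T" using mult_le_mono1[OF p_ge_3, of e] by (simp add: T_eq mult.commute)
  then show "T > 0" using ramK_pos by simp
qed

lemma T_pos [simp]: "0 < T" "T \<noteq> 0"
  using T_bounds by auto

lemma ct_1 [simp]: "ct 1 = 1"
  using T_bounds by simp

text \<open>The component a_i of the informal notation, with i ranging over all integers and
  mattering modulo f.\<close>

definition cmp :: "int \<Rightarrow> 't poly \<Rightarrow> 'e poly" where
  "cmp i = map_poly (chi i)"

lemma coeff_cmp [simp]: "coeff (cmp i q) n = chi i (coeff q n)"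
  by (simp add: cmp_def coeff_map_poly)

lemma cmp_0 [simp]: "cmp i 0 = 0" and cmp_1 [simp]: "cmp i 1 = 1"
  by (auto simp: cmp_def map_poly_1)

lemma cmp_add: "cmp i (x + y) = cmp i x + cmp i y"
  unfolding cmp_def by (rule map_poly_hom_add[OF chi_0 chi_add])

lemma cmp_minus: "cmp i (- x) = - cmp i x"
  by (rule poly_eqI) (simp add: chi_minus)

lemma cmp_diff: "cmp i (x - y) = cmp i x - cmp i y"
  using cmp_add[of i x "- y"] cmp_minus[of i y] by simp

lemma cmp_mult: "cmp i (x * y) = cmp i x * cmp i y"
  unfolding cmp_def by (rule map_poly_hom_mult[OF chi_0 chi_add chi_mult])

lemma cmp_sum: "cmp i (\<Sum>a\<in>A. x a) = (\<Sum>a\<in>A. cmp i (x a))"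
  by (rule hom_sum[OF cmp_0 cmp_add])

lemma cmp_cut: "cmp i (ct x) = ct (cmp i x)"
  by (rule poly_eqI) (simp add: coeff_poly_cutoff)

lemma cmp_eqI: "(\<And>i. cmp i x = cmp i y) \<Longrightarrow> x = y"
proof (rule poly_eqI, rule chi_eqI)
  fix n i assume a: "\<And>i. cmp i x = cmp i y"
  show "chi i (coeff x n) = chi i (coeff y n)" using arg_cong[OF a[of i], of "\<lambda>q. coeff q n"] by simp
qed

lemma cmp_cong: "i mod int f = j mod int f \<Longrightarrow> cmp i = cmp j"
  unfolding cmp_def using chi_cong by metis

lemma cmp_const_ir [simp]: "cmp i [:ir l:] = [:l:]" and cmp_const_il [simp]: "cmp i [:il x:] = [:\<sigma> i x:]"
  by (rule poly_eqI, simp add: coeff_pCons chi_ir chi_il split: nat.splits)+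

lemma cmp_assemble: "cmp i (assemble D x) = cmp i (x (i mod int f))"
proof -
  have c: "cmp i [:ee j:] = [:chi i (ee j):]" for i j
    by (rule poly_eqI) (simp add: coeff_pCons split: nat.splits)
  have "cmp i (assemble D x) = (\<Sum>j<f. cmp i (x (int j)) * [:chi i (ee (int j)):])"
    unfolding assemble_def idem_eq cmp_sum cmp_mult c ..
  also have "\<dots> = (\<Sum>j<f. if j = nat (i mod int f) then cmp i (x (int j)) else 0)"
  proof (rule sum.cong[OF refl])
    fix j assume "j \<in> {..<f}"
    then have "int j mod int f = int j" by simp
    moreover have "int j = i mod int f \<longleftrightarrow> j = nat (i mod int f)" using int_mod_f[of i] by auto
    ultimately show "cmp i (x (int j)) * [:chi i (ee (int j)):] = (if j = nat (i mod int f) then cmp i (x (int j)) else 0)"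
      by (auto simp: chi_ee)
  qed
  also have "\<dots> = cmp i (x (i mod int f))" using int_mod_f[of i] by simp
  finally show ?thesis .
qed

lemma cmp_und_poly: "cmp i (und_poly D F) = F (i mod int f)"
  unfolding und_poly_def cmp_assemble by (rule poly_eqI) (simp add: coeff_map_poly chi_ir)

lemma S_simps [simp]: "mult S = (\<lambda>x y. ct (x * y))" "one S = 1" "zero S = 0" "add S = (+)"
  by (simp_all add: breuil_ring_def)

lemma S_carrier: "x \<in> carrier S \<longleftrightarrow> ct x = x"
  by (auto simp: breuil_ring_def image_iff intro: poly_cutoff_idem[symmetric]) metis

lemma S_carrier_cmp: "x \<in> carrier S \<longleftrightarrow> (\<forall>i. ct (cmp i x) = cmp i x)"
proof
  assume "\<forall>i. ct (cmp i x) = cmp i x"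
  then have "ct x = x" by (intro cmp_eqI) (simp add: cmp_cut)
  then show "x \<in> carrier S" by (simp add: S_carrier)
next
  assume "x \<in> carrier S"
  then have "ct x = x" by (simp add: S_carrier)
  then show "\<forall>i. ct (cmp i x) = cmp i x" using cmp_cut by metis
qed

lemma S_ct [simp, intro]: "ct x \<in> carrier S"
  by (simp add: S_carrier)

lemma S_zero [simp, intro]: "0 \<in> carrier S" and S_one [simp, intro]: "1 \<in> carrier S"
  by (simp_all add: S_carrier)

lemma S_add [intro]: "x \<in> carrier S \<Longrightarrow> y \<in> carrier S \<Longrightarrow> x + y \<in> carrier S"
  by (simp add: S_carrier poly_cutoff_add)

lemma S_minus [intro]: "x \<in> carrier S \<Longrightarrow> - x \<in> carrier S"
  using poly_cutoff_diff[of T 0 x] by (simp add: S_carrier)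

lemma S_diff [intro]: "x \<in> carrier S \<Longrightarrow> y \<in> carrier S \<Longrightarrow> x - y \<in> carrier S"
  by (simp add: S_carrier poly_cutoff_diff)

lemma S_const [simp, intro]: "[:c:] \<in> carrier S"
  unfolding S_carrier by (rule poly_eqI) (use T_bounds in \<open>auto simp: coeff_poly_cutoff coeff_pCons split: nat.splits\<close>)

lemma S_coeff: "x \<in> carrier S \<Longrightarrow> n \<ge> T \<Longrightarrow> coeff x n = 0"
  by (metis S_carrier coeff_poly_cutoff not_less)

lemma S_cring: "cring S"
proof (rule cringI)
  show "abelian_group S"
  proof (rule abelian_groupI)
    show "\<exists>y\<in>carrier S. y \<oplus>\<^bsub>S\<^esub> x = \<zero>\<^bsub>S\<^esub>" if "x \<in> carrier S" for x
      using S_minus[OF that] by (intro bexI[of _ "- x"]) auto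
  qed (auto simp: add.assoc add.commute add.left_commute)
  show "comm_monoid S"
    by (rule comm_monoidI) (auto simp: S_carrier ac_simps)
qed (auto simp: distrib_right poly_cutoff_add)

lemma cmp_S_mult: "cmp i (x \<star> y) = ct (cmp i x * cmp i y)"
  by (simp add: cmp_cut cmp_mult)

lemma cmp_frob: "cmp i (frob D q) = ct (pcompose (cmp (i - 1) q) (monom 1 p))"
proof (rule poly_eqI)
  fix n
  have c: "chi i (tensor_map D (\<lambda>x. x ^ p) t) = chi (i - 1) t" for t
    using chi_tensor_map[of "\<lambda>x. x ^ p" 1 i t] by simp
  have p0: "p > 0" using p_ge_3 by simp
  show "coeff (cmp i (frob D q)) n = coeff (ct (pcompose (cmp (i - 1) q) (monom 1 p))) n"
  proof (cases "n < T")
    case True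
    have "coeff (cmp i (frob D q)) n = (\<Sum>j<T. if p * j = n then chi (i - 1) (coeff q j) else 0)"
      using True by (simp add: frob_def coeff_poly_cutoff coeff_sum chi_sum if_distrib[of "chi i"] c cong: if_cong)
    also have "\<dots> = (if p dvd n then chi (i - 1) (coeff q (n div p)) else 0)"
    proof (cases "p dvd n")
      case d: True
      then have e: "p * j = n \<longleftrightarrow> j = n div p" for j using p0 by auto
      have "n div p < T" using True by (meson div_le_dividend le_less_trans)
      then show ?thesis using d unfolding e by simp
    next
      case False
      then have "p * j \<noteq> n" for j by auto
      then show ?thesis using False by simp
    qed
    finally show ?thesis using True p0 by (simp add: coeff_poly_cutoff coeff_pcompose_monom)
  qed (simp add: frob_def coeff_poly_cutoff)
qed

lemma cmp_gal:
  assumes "\<And>x. gal_res D g x = x ^ p ^ m"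
  shows "cmp i (gal_S D g q) = ct (pcompose (cmp (i - int m) q) [:0, \<sigma> i (etabar D g):])"
proof (rule poly_eqI)
  fix n
  have "coeff (cmp i (gal_S D g q)) n
      = (\<Sum>j<T. if j = n then chi (i - int m) (coeff q j) * \<sigma> i (etabar D g) ^ j else 0)"
    by (simp add: gal_S_def coeff_sum chi_sum if_distrib[of "chi i"] chi_mult chi_il sig_power
        chi_tensor_map[OF assms] cong: if_cong)
  also have "\<dots> = (if n < T then chi (i - int m) (coeff q n) * \<sigma> i (etabar D g) ^ n else 0)"
    by simp
  finally show "coeff (cmp i (gal_S D g q)) n = coeff (ct (pcompose (cmp (i - int m) q) [:0, \<sigma> i (etabar D g):])) n"
    by (simp add: coeff_poly_cutoff coeff_pcompose_linear mult.commute)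
qed

lemma ct_pcompose_monom [simp]:
  "ct (pcompose (ct a) (monom 1 p)) = ct (pcompose (a :: 'e poly) (monom 1 p))"
proof (rule poly_eqI)
  fix n
  have "n < T \<Longrightarrow> n div p < T" by (meson div_le_dividend le_less_trans)
  then show "coeff (ct (pcompose (ct a) (monom 1 p))) n = coeff (ct (pcompose a (monom 1 p))) n"
    using p_ge_3 by (auto simp: coeff_poly_cutoff coeff_pcompose_monom)
qed

lemma ct_pcompose_scale [simp]:
  "ct (pcompose (ct a) [:0, z:]) = ct (pcompose (a :: 'e poly) [:0, z:])"
  by (rule poly_eqI) (simp add: coeff_poly_cutoff coeff_pcompose_linear)

section \<open>Frobenius and the Galois action on the coefficient ring\<close>

lemma frob_S [simp, intro]: "frob D x \<in> carrier S"
  by (simp add: frob_def)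

lemma frob_add: "frob D (x + y) = frob D x + frob D y"
  by (rule cmp_eqI) (simp add: cmp_frob cmp_add pcompose_add poly_cutoff_add)

lemma frob_mult: "frob D (x \<star> y) = frob D x \<star> frob D y"
  by (rule cmp_eqI) (simp add: cmp_frob cmp_cut cmp_mult pcompose_mult)

lemma frob_1 [simp]: "frob D 1 = 1"
  by (rule cmp_eqI) (simp add: cmp_frob pcompose_1)

lemma frob_const [simp]: "frob D [:ir l:] = [:ir l:]"
  by (rule cmp_eqI) (metis cmp_const_ir cmp_frob pcompose_const S_const S_carrier_cmp)

lemma gal_S_S [simp, intro]:
  assumes g: "g \<in> Gal D"
  shows "gal_S D g x \<in> carrier S"
  unfolding S_carrier_cmp by (simp add: cmp_gal[OF frobexp(2)[OF g]])

lemma gal_S_add: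
  assumes g: "g \<in> Gal D"
  shows "gal_S D g (x + y) = gal_S D g x + gal_S D g y"
  by (rule cmp_eqI) (simp add: cmp_gal[OF frobexp(2)[OF g]] cmp_add pcompose_add poly_cutoff_add)

lemma gal_S_mult:
  assumes g: "g \<in> Gal D"
  shows "gal_S D g (x \<star> y) = gal_S D g x \<star> gal_S D g y"
  by (rule cmp_eqI) (simp add: cmp_gal[OF frobexp(2)[OF g]] cmp_cut cmp_mult pcompose_mult)

lemma gal_S_1:
  assumes g: "g \<in> Gal D"
  shows "gal_S D g 1 = 1"
  by (rule cmp_eqI) (simp add: cmp_gal[OF frobexp(2)[OF g]] pcompose_1)

lemma gal_S_const:
  assumes g: "g \<in> Gal D"
  shows "gal_S D g [:ir l:] = [:ir l:]"
  by (rule cmp_eqI) (metis cmp_const_ir cmp_gal[OF frobexp(2)[OF g]] pcompose_const S_const S_carrier_cmp)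

lemma gal_S_il:
  assumes g: "g \<in> Gal D"
  shows "gal_S D g [:il y:] = [:il (gal_res D g y):]"
proof (rule cmp_eqI)
  fix i
  have "cmp i (gal_S D g [:il y:]) = ct [:\<sigma> i (gal_res D g y):]"
    unfolding cmp_gal[OF frobexp(2)[OF g]] frobexp(2)[OF g] by (simp add: sig_frob)
  also have "\<dots> = cmp i [:il (gal_res D g y):]" using S_const[of "il (gal_res D g y)"] unfolding S_carrier_cmp by simp
  finally show "cmp i (gal_S D g [:il y:]) = cmp i [:il (gal_res D g y):]" .
qed

lemma pcompose_scale_commute:
  "pcompose (pcompose a (monom 1 p)) [:0, z :: 'e:] = pcompose (pcompose a [:0, z ^ p:]) (monom 1 p)"
proof (rule poly_eqI)
  fix n
  have "p dvd n \<Longrightarrow> (z ^ p) ^ (n div p) = z ^ n" by (simp flip: power_mult)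
  then show "coeff (pcompose (pcompose a (monom 1 p)) [:0, z:]) n = coeff (pcompose (pcompose a [:0, z ^ p:]) (monom 1 p)) n"
    using p_ge_3 by (auto simp: coeff_pcompose_monom coeff_pcompose_linear)
qed

lemma gal_frob:
  assumes g: "g \<in> Gal D"
  shows "gal_S D g (frob D x) = frob D (gal_S D g x)"
proof (rule cmp_eqI)
  fix i
  have s: "\<sigma> i (etabar D g) ^ p = \<sigma> (i - 1) (etabar D g)" using sig_pow[rule_format, of "i - 1"] by simp
  show "cmp i (gal_S D g (frob D x)) = cmp i (frob D (gal_S D g x))"
    by (simp add: cmp_gal[OF frobexp(2)[OF g]] cmp_frob pcompose_scale_commute s algebra_simps)
qed

lemma gal_gal:
  assumes g: "g \<in> Gal D" and h: "h \<in> Gal D"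
  shows "gal_S D g (gal_S D h x) = gal_S D (compose K g h) x"
proof (rule cmp_eqI)
  fix i
  have r: "gal_res D (compose K g h) x = x ^ p ^ (frobexp h + frobexp g)" for x
    by (simp add: gal_res_comp[OF g h] frobexp(2)[OF g] frobexp(2)[OF h] power_add power_mult)
  have e: "\<sigma> i (etabar D (compose K g h)) = \<sigma> (i - int (frobexp g)) (etabar D h) * \<sigma> i (etabar D g)"
    by (simp add: etabar_comp[OF g h] sig_mult frobexp(2)[OF g] sig_frob)
  show "cmp i (gal_S D g (gal_S D h x)) = cmp i (gal_S D (compose K g h) x)"
    unfolding cmp_gal[OF r] cmp_gal[OF frobexp(2)[OF g]] cmp_gal[OF frobexp(2)[OF h]] e
    by (rule poly_eqI) (simp add: coeff_poly_cutoff coeff_pcompose_linear power_mult_distrib algebra_simps)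
qed

lemma gal_S_id: "x \<in> carrier S \<Longrightarrow> gal_S D (\<lambda>y\<in>K. y) x = x"
proof (rule cmp_eqI)
  fix i assume x: "x \<in> carrier S"
  have r: "gal_res D (\<lambda>y\<in>K. y) x = x ^ p ^ 0" for x by (simp add: gal_res_id)
  show "cmp i (gal_S D (\<lambda>y\<in>K. y) x) = cmp i x"
    using x unfolding cmp_gal[OF r] S_carrier_cmp by (simp add: etabar_id)
qed

subsection \<open>Families periodic with period dividing \<open>f'\<close>\<close>

definition periodic :: "(int \<Rightarrow> 'b) \<Rightarrow> bool" where
  "periodic F \<longleftrightarrow> (\<forall>i. F (i + int f') = F i)"

definition cong_periodic :: "(int \<Rightarrow> int) \<Rightarrow> bool" where
  "cong_periodic c \<longleftrightarrow> (\<forall>i. [c (i + int f') = c i] (mod int eKL))"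

lemma periodic_mult: "periodic F \<Longrightarrow> F (i + int f' * j) = F i"
proof -
  assume F: "periodic F"
  have n: "F (i + int f' * int n) = F i" for n i
  proof (induction n)
    case (Suc n)
    have "i + int f' * int (Suc n) = (i + int f' * int n) + int f'" by (simp add: algebra_simps)
    then show ?case using F Suc unfolding periodic_def by metis
  qed simp
  show ?thesis
  proof (cases "j \<ge> 0")
    case True
    then show ?thesis using n[of i "nat j"] by simp
  next
    case False
    then show ?thesis using n[of "i + int f' * j" "nat (- j)"] by simp
  qed
qed

lemma periodic_dvd: "periodic F \<Longrightarrow> int f' dvd i - j \<Longrightarrow> F i = F j"
  using periodic_mult[of F j "(i - j) div int f'"] by simp

lemma cong_periodic_dvd:
  assumes c: "cong_periodic c" and d: "int f' dvd i - j"
  shows "[c i = c j] (mod int eKL)"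
proof -
  have "periodic (\<lambda>i. c i mod int eKL)" using c by (simp add: periodic_def cong_periodic_def cong_def)
  from periodic_dvd[OF this d] show ?thesis by (simp add: cong_def)
qed

lemma f'_dvd_f: "int f' dvd int f"
  using resdegL_dvd by simp

lemma f'_dvd_mod: "int f' dvd i mod int f - i"
proof -
  have "int f dvd i mod int f - i" by (simp add: mod_eq_dvd_iff[symmetric])
  then show ?thesis using f'_dvd_f dvd_trans by blast
qed

text \<open>A Galois element shifts the index of components by its Frobenius exponent. As this is a
  multiple of f', data of period f' are stable under the whole group.\<close>

lemma f'_dvd_frobexp: "g \<in> Gal D \<Longrightarrow> int f' dvd (i - int (frobexp g)) - i"
  using resdegL_frobexp by simp

lemma periodic_mod_f: "periodic F \<Longrightarrow> F (i mod int f) = F i"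
  by (rule periodic_dvd[OF _ f'_dvd_mod])

lemma etabar_powi_cong:
  assumes g: "g \<in> Gal D" and c: "[a = b] (mod int eKL)"
  shows "etabar D g powi a = etabar D g powi b"
proof -
  obtain k where "a = b + int eKL * k" using c by (metis cong_iff_lin cong_sym mult.commute)
  then have "etabar D g powi a = etabar D g powi b * (etabar D g powi int eKL) powi k"
    using etabar_nonzero[OF g] by (simp add: power_int_add power_int_mult)
  then show ?thesis using etabar_power[OF g] by simp
qed

lemma cmp_u_pow: "periodic r \<Longrightarrow> cmp i (u_pow D r) = monom 1 (r i)"
proof -
  assume r: "periodic r"
  have "cmp i (monom 1 n) = monom 1 n" for n by (rule poly_eqI) simp
  then show ?thesis by (simp add: u_pow_def cmp_assemble periodic_mod_f[OF r])
qed

lemma cmp_und_poly_periodic: "periodic h \<Longrightarrow> cmp i (und_poly D h) = h i"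
  by (simp add: cmp_und_poly periodic_mod_f)

lemma cmp_und_const: "periodic a \<Longrightarrow> cmp i (und_const D a) = [:a i:]"
  by (simp add: und_const_def cmp_und_poly periodic_mod_f)

lemma cmp_eta_pow:
  assumes c: "cong_periodic c" and g: "g \<in> Gal D"
  shows "cmp i (eta_pow D c g) = [:\<sigma> i (etabar D g) powi c i:]"
  unfolding eta_pow_def cmp_assemble cmp_const_il sig_powi
  using etabar_powi_cong[OF g cong_periodic_dvd[OF c f'_dvd_mod[of i]]] by (metis sig_powi)

lemma u_pow_S: "periodic r \<Longrightarrow> (\<And>i. r i < T) \<Longrightarrow> u_pow D r \<in> carrier S"
  unfolding S_carrier_cmp by (auto simp: cmp_u_pow intro!: poly_eqI simp: coeff_poly_cutoff)

lemma und_poly_S: "(\<And>i. ct (h i) = h i) \<Longrightarrow> und_poly D h \<in> carrier S"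
  unfolding S_carrier_cmp by (simp add: cmp_und_poly)

lemma ct_const: "ct [:c :: 'e:] = [:c:]"
  by (rule poly_eqI) (use T_bounds in \<open>auto simp: coeff_poly_cutoff coeff_pCons split: nat.splits\<close>)

lemma und_const_S: "und_const D a \<in> carrier S"
  unfolding und_const_def by (rule und_poly_S) (simp add: ct_const)

lemma eta_pow_S: "eta_pow D c g \<in> carrier S"
  unfolding S_carrier_cmp eta_pow_def cmp_assemble by (simp add: ct_const)

lemma gal_und_const:
  assumes a: "periodic a" and g: "g \<in> Gal D"
  shows "gal_S D g (und_const D a) = und_const D a"
  by (rule cmp_eqI)
    (simp add: cmp_gal[OF frobexp(2)[OF g]] cmp_und_const[OF a] ct_const periodic_dvd[OF a f'_dvd_frobexp[OF g]])

lemma gal_u_pow: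
  assumes r: "periodic r" and g: "g \<in> Gal D"
  shows "gal_S D g (u_pow D r) = u_pow D r \<star> eta_pow D (\<lambda>i. int (r i)) g"
proof (rule cmp_eqI)
  fix i
  have c: "cong_periodic (\<lambda>i. int (r i))" using r by (simp add: periodic_def cong_periodic_def)
  show "cmp i (gal_S D g (u_pow D r)) = cmp i (u_pow D r \<star> eta_pow D (\<lambda>i. int (r i)) g)"
    unfolding cmp_S_mult cmp_gal[OF frobexp(2)[OF g]] cmp_u_pow[OF r] cmp_eta_pow[OF c g]
      periodic_dvd[OF r f'_dvd_frobexp[OF g]]
    by (rule poly_eqI) (simp add: coeff_poly_cutoff coeff_pcompose_linear)
qed

lemma eta_pow_mult:
  assumes c: "cong_periodic c" and d: "cong_periodic d" and g: "g \<in> Gal D"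
  shows "eta_pow D c g \<star> eta_pow D d g = eta_pow D (\<lambda>i. c i + d i) g"
proof (rule cmp_eqI)
  fix i
  have cd: "cong_periodic (\<lambda>i. c i + d i)" using c d by (simp add: cong_periodic_def cong_add)
  have "\<sigma> i (etabar D g) \<noteq> 0" using etabar_nonzero[OF g] sig_eq_0_iff by simp
  then show "cmp i (eta_pow D c g \<star> eta_pow D d g) = cmp i (eta_pow D (\<lambda>i. c i + d i) g)"
    unfolding cmp_S_mult cmp_eta_pow[OF c g] cmp_eta_pow[OF d g] cmp_eta_pow[OF cd g]
    by (simp add: power_int_add ct_const)
qed

lemma eta_pow_0:
  assumes g: "g \<in> Gal D"
  shows "eta_pow D (\<lambda>i. 0) g = 1"
proof -
  have "cong_periodic (\<lambda>i. 0)" by (simp add: cong_periodic_def)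
  then show ?thesis by (intro cmp_eqI) (simp add: cmp_eta_pow[OF _ g] pCons_one)
qed

lemma eta_pow_cong:
  assumes c: "cong_periodic c" and d: "cong_periodic d" and g: "g \<in> Gal D" and cd: "\<And>i. [c i = d i] (mod int eKL)"
  shows "eta_pow D c g = eta_pow D d g"
  by (rule cmp_eqI) (simp add: cmp_eta_pow[OF c g] cmp_eta_pow[OF d g] etabar_powi_cong[OF g cd] flip: sig_powi)

lemma eta_pow_id: "cong_periodic c \<Longrightarrow> eta_pow D c (\<lambda>y\<in>K. y) = 1"
  by (rule cmp_eqI) (simp add: cmp_eta_pow[OF _ gal_id] etabar_id pCons_one)

lemma eta_pow_comp:
  assumes c: "cong_periodic c" and g: "g \<in> Gal D" and h: "h \<in> Gal D"
  shows "gal_S D g (eta_pow D c h) \<star> eta_pow D c g = eta_pow D c (compose K g h)"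
proof (rule cmp_eqI)
  fix i
  have e: "\<sigma> i (etabar D (compose K g h)) = \<sigma> (i - int (frobexp g)) (etabar D h) * \<sigma> i (etabar D g)"
    by (simp add: etabar_comp[OF g h] sig_mult frobexp(2)[OF g] sig_frob)
  have "\<sigma> (i - int (frobexp g)) (etabar D h) powi c (i - int (frobexp g)) = \<sigma> (i - int (frobexp g)) (etabar D h) powi c i"
    using etabar_powi_cong[OF h cong_periodic_dvd[OF c f'_dvd_frobexp[OF g, of i]]] by (metis sig_powi)
  then show "cmp i (gal_S D g (eta_pow D c h) \<star> eta_pow D c g) = cmp i (eta_pow D c (compose K g h))"
    unfolding cmp_S_mult cmp_gal[OF frobexp(2)[OF g]] cmp_eta_pow[OF c g] cmp_eta_pow[OF c h]
      cmp_eta_pow[OF c gal_comp[OF g h]] e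
    by (simp add: ct_const power_int_mult_distrib)
qed

text \<open>Frobenius carries the constant at index i to index i + 1 unchanged, and \<sigma> i is
  the p-th power of \<sigma> (i + 1), so the exponent is multiplied by p. The recursion imposed on
  the c i of rank one data is exactly what makes this consistent.\<close>

lemma frob_eta_pow:
  assumes w: "cong_periodic w" and c: "cong_periodic c" and g: "g \<in> Gal D"
    and cw: "\<And>i. [c (i + 1) = int p * w i] (mod int eKL)"
  shows "frob D (eta_pow D w g) = eta_pow D c g"
proof (rule cmp_eqI)
  fix i
  have "\<sigma> (i - 1) (etabar D g) powi w (i - 1) = \<sigma> i (etabar D g) powi (int p * w (i - 1))"
    using sig_pow[rule_format, of "i - 1" "etabar D g"] by (simp add: power_int_mult)
  also have "\<dots> = \<sigma> i (etabar D g powi (int p * w (i - 1)))" by (simp add: sig_powi)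
  also have "\<dots> = \<sigma> i (etabar D g powi c i)"
    using etabar_powi_cong[OF g cw[of "i - 1"]] by simp
  finally have "\<sigma> (i - 1) (etabar D g) powi w (i - 1) = \<sigma> i (etabar D g) powi c i" by (simp add: sig_powi)
  then show "cmp i (frob D (eta_pow D w g)) = cmp i (eta_pow D c g)"
    by (simp add: cmp_frob cmp_eta_pow[OF w g] cmp_eta_pow[OF c g] ct_const)
qed

section \<open>Eigenvectors of the Galois action\<close>

definition weight :: "(int \<Rightarrow> int) \<Rightarrow> 't poly \<Rightarrow> bool" where
  "weight w x \<longleftrightarrow> (\<forall>g\<in>Gal D. gal_S D g x = x \<star> eta_pow D w g)"

text \<open>The automorphism inducing the p ^ f' power map with \<open>etabar\<close> equal to 1
  gives periodicity, and inertia gives the congruence on degrees. Conversely every g shifts indices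
  by a multiple of f' and rescales u by a root of unity, so the two conditions suffice.\<close>

lemma weight_iff:
  assumes w: "cong_periodic w" and x: "x \<in> carrier S"
  shows "weight w x \<longleftrightarrow> periodic (\<lambda>i. cmp i x) \<and>
    (\<forall>i n. coeff (cmp i x) n \<noteq> 0 \<longrightarrow> [int n = w i] (mod int eKL))"
proof
  assume wt: "weight w x"
  have xc: "ct (cmp i x) = cmp i x" for i using x by (simp add: S_carrier_cmp)
  show "periodic (\<lambda>i. cmp i x) \<and> (\<forall>i n. coeff (cmp i x) n \<noteq> 0 \<longrightarrow> [int n = w i] (mod int eKL))"
  proof (intro conjI allI impI)
    obtain g where g: "g \<in> Gal D" "\<And>x. gal_res D g x = x ^ p ^ f'" "etabar D g = 1"
      using gal_frobenius_unif by blast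
    have "cmp (i + int f') (gal_S D g x) = cmp (i + int f') (x \<star> eta_pow D w g)" for i
      using wt g(1) by (simp add: weight_def)
    then show "periodic (\<lambda>i. cmp i x)"
      unfolding periodic_def cmp_gal[OF g(2)] cmp_S_mult cmp_eta_pow[OF w g(1)] by (simp add: g(3) xc)
    fix i n assume n: "coeff (cmp i x) n \<noteq> 0"
    then have nT: "n < T" using xc by (metis coeff_poly_cutoff)
    have "int eKL dvd int n - w i"
    proof (rule inertia_exponent)
      fix g assume g: "g \<in> Gal D" and r: "\<And>x. gal_res D g x = x"
      then have r': "\<And>x. gal_res D g x = x ^ p ^ 0" by simp
      have "coeff (cmp i (gal_S D g x)) n = coeff (cmp i (x \<star> eta_pow D w g)) n"
        using wt g by (simp add: weight_def)
      then have "\<sigma> i (etabar D g) ^ n * coeff (cmp i x) n = coeff (cmp i x) n * \<sigma> i (etabar D g) powi w i"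
        using nT unfolding cmp_gal[OF r'] cmp_S_mult cmp_eta_pow[OF w g]
        by (simp add: coeff_poly_cutoff coeff_pcompose_linear mult.commute)
      then have "\<sigma> i (etabar D g ^ n) = \<sigma> i (etabar D g powi w i)"
        using n by (simp add: sig_power sig_powi)
      then have "etabar D g ^ n = etabar D g powi w i" by (rule sig_inj)
      then show "etabar D g powi (int n - w i) = 1"
        using etabar_nonzero[OF g] by (simp add: power_int_diff)
    qed
    then show "[int n = w i] (mod int eKL)" by (simp add: cong_iff_dvd_diff)
  qed
next
  assume a: "periodic (\<lambda>i. cmp i x) \<and> (\<forall>i n. coeff (cmp i x) n \<noteq> 0 \<longrightarrow> [int n = w i] (mod int eKL))"
  show "weight w x" unfolding weight_def
  proof (intro ballI cmp_eqI)
    fix g i assume g: "g \<in> Gal D"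
    have "cmp (i - int (frobexp g)) x = cmp i x"
      using periodic_dvd[OF conjunct1[OF a] f'_dvd_frobexp[OF g]] .
    moreover have "\<sigma> i (etabar D g) ^ n * coeff (cmp i x) n = coeff (cmp i x) n * \<sigma> i (etabar D g) powi w i" for n
    proof (cases "coeff (cmp i x) n = 0")
      case False
      then have "etabar D g powi int n = etabar D g powi w i" using a etabar_powi_cong[OF g] by blast
      then have "\<sigma> i (etabar D g) powi int n = \<sigma> i (etabar D g) powi w i" by (metis sig_powi)
      then show ?thesis by (simp add: mult.commute)
    qed simp
    ultimately show "cmp i (gal_S D g x) = cmp i (x \<star> eta_pow D w g)"
      unfolding cmp_S_mult cmp_eta_pow[OF w g] cmp_gal[OF frobexp(2)[OF g]]
      by (intro poly_eqI) (simp add: coeff_poly_cutoff coeff_pcompose_linear mult.commute)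
  qed
qed

subsection \<open>Divisibility\<close>

lemma S_dvd_u_pow:
  assumes r: "periodic r" "\<And>i. r i \<le> e" and x: "x \<in> carrier S"
  shows "(\<exists>v\<in>carrier S. x = v \<star> u_pow D r) \<longleftrightarrow> (\<forall>i. \<forall>n<r i. coeff (cmp i x) n = 0)"
proof
  assume "\<exists>v\<in>carrier S. x = v \<star> u_pow D r"
  then obtain v where v: "x = v \<star> u_pow D r" by blast
  show "\<forall>i. \<forall>n<r i. coeff (cmp i x) n = 0"
    unfolding v cmp_S_mult cmp_u_pow[OF r(1)] mult.commute[of _ "monom _ _"]
    by (simp add: coeff_poly_cutoff coeff_monom_mult)
next
  assume a: "\<forall>i. \<forall>n<r i. coeff (cmp i x) n = 0"
  have xc: "ct (cmp i x) = cmp i x" for i using x by (simp add: S_carrier_cmp)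
  define v where "v = und_poly D (\<lambda>i. poly_shift (r i) (cmp i x))"
  have vc: "cmp i v = poly_shift (r i) (cmp i x)" for i
    unfolding v_def cmp_und_poly using cmp_cong[of "i mod int f" i] by (simp add: periodic_mod_f[OF r(1)])
  have "v \<in> carrier S" unfolding S_carrier_cmp vc
    by (intro allI poly_eqI) (simp add: coeff_poly_cutoff coeff_poly_shift S_coeff[OF x])
  moreover have "x = v \<star> u_pow D r"
  proof (rule cmp_eqI, rule poly_eqI)
    fix i n
    have "n \<ge> T \<Longrightarrow> coeff (cmp i x) n = 0" using xc[of i] by (metis coeff_poly_cutoff not_less)
    then show "coeff (cmp i x) n = coeff (cmp i (v \<star> u_pow D r)) n"
      unfolding cmp_S_mult cmp_u_pow[OF r(1)] mult.commute[of _ "monom _ _"] vc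
      using a by (auto simp: coeff_poly_cutoff coeff_monom_mult coeff_poly_shift)
  qed
  ultimately show "\<exists>v\<in>carrier S. x = v \<star> u_pow D r" by blast
qed

text \<open>u^r is a zero divisor: only the coefficients below T - r i survive the
  multiplication.\<close>

lemma mult_u_pow_cancel:
  assumes r: "periodic r" "\<And>i. r i \<le> e" and eq: "x \<star> u_pow D r = y \<star> u_pow D r"
  shows "n + r i < T \<Longrightarrow> coeff (cmp i x) n = coeff (cmp i y) n"
proof -
  assume n: "n + r i < T"
  have "coeff (cmp i (x \<star> u_pow D r)) (n + r i) = coeff (cmp i (y \<star> u_pow D r)) (n + r i)" using eq by simp
  then show ?thesis
    unfolding cmp_S_mult cmp_u_pow[OF r(1)] mult.commute[of _ "monom _ _"]
    using n by (simp add: coeff_poly_cutoff coeff_monom_mult)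
qed

text \<open>Modulo u ^ T the Frobenius image depends only on coefficients below e, and x u^r
  determines these because e + r i \<le> T. It is the reason why \<open>phi1\<close> is well defined
  on the filtration.\<close>

lemma frob_eq_if_mult_eq:
  assumes r: "periodic r" "\<And>i. r i \<le> e" and eq: "x \<star> u_pow D r = y \<star> u_pow D r"
  shows "frob D x = frob D y"
proof (rule cmp_eqI, rule poly_eqI)
  fix i n
  have "coeff (cmp (i - 1) x) (n div p) = coeff (cmp (i - 1) y) (n div p)" if "n < T" "p dvd n"
  proof (rule mult_u_pow_cancel[OF r eq])
    have "n div p < e" using that p_ge_3 by (simp add: T_eq div_less_iff_less_mult)
    then show "n div p + r (i - 1) < T" using r(2)[of "i - 1"] T_bounds by linarith
  qed
  then show "coeff (cmp i (frob D x)) n = coeff (cmp i (frob D y)) n"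
    using p_ge_3 unfolding cmp_frob by (auto simp: coeff_poly_cutoff coeff_pcompose_monom)
qed

lemma coeff_0_frob: "coeff (cmp (i + 1) (frob D x)) 0 = coeff (cmp i x) 0"
  using p_ge_3 by (simp add: cmp_frob coeff_poly_cutoff poly_0_coeff_0 del: coeff_cmp)

lemma coeff_0_S_mult: "coeff (cmp i (x \<star> y)) 0 = coeff (cmp i x) 0 * coeff (cmp i y) 0"
  unfolding cmp_S_mult using T_bounds by (simp add: coeff_poly_cutoff coeff_mult del: coeff_cmp)

text \<open>S is a product of f local rings, and a nonzero constant term at i means a unit in that
  factor. So the ideal contains each idempotent, and these add up to 1.\<close>

lemma one_in_ideal:
  assumes X: "X \<subseteq> carrier S" "\<And>x y. x \<in> X \<Longrightarrow> y \<in> X \<Longrightarrow> x + y \<in> X" "0 \<in> X"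
    "\<And>a x. a \<in> carrier S \<Longrightarrow> x \<in> X \<Longrightarrow> a \<star> x \<in> X"
    and unit: "\<And>i. \<exists>x\<in>X. coeff (cmp i x) 0 \<noteq> 0"
  shows "1 \<in> X"
proof -
  have "\<exists>z\<in>X. \<forall>j. cmp j z = (if j mod int f = i mod int f then 1 else 0)" for i
  proof -
    obtain x where x: "x \<in> X" "coeff (cmp i x) 0 \<noteq> 0" using unit by blast
    obtain y where y: "ct (cmp i x * y) = 1" using inverse_mod_monom[OF x(2), of T] by auto
    define a where "a = und_poly D (\<lambda>j. if j = i mod int f then ct y else 0)"
    have "a \<in> carrier S" unfolding a_def by (rule und_poly_S) auto
    moreover have "cmp j (a \<star> x) = (if j mod int f = i mod int f then 1 else 0)" for j
      unfolding cmp_S_mult a_def cmp_und_poly using y cmp_cong[of j i] by (auto simp: mult.commute)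
    ultimately show ?thesis using X(4) x(1) by blast
  qed
  then obtain z where z: "\<And>i. z i \<in> X" "\<And>i j. cmp j (z i) = (if j mod int f = i mod int f then 1 else 0)" by metis
  have "(\<Sum>i<n. z (int i)) \<in> X" for n by (induction n) (auto simp: X z)
  moreover have "(\<Sum>i<f. z (int i)) = 1"
  proof (rule cmp_eqI)
    fix j
    have "cmp j (\<Sum>i<f. z (int i)) = (\<Sum>i<f. if i = nat (j mod int f) then 1 else 0)"
      unfolding cmp_sum z
    proof (rule sum.cong[OF refl])
      fix i assume "i \<in> {..<f}"
      then have "int i mod int f = int i" by simp
      moreover have "j mod int f = int i \<longleftrightarrow> i = nat (j mod int f)" using int_mod_f[of j] by auto
      ultimately show "(if j mod int f = int i mod int f then 1 else 0) = (if i = nat (j mod int f) then 1 else (0::'e poly))" by simp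
    qed
    then show "cmp j (\<Sum>i<f. z (int i)) = cmp j 1" using int_mod_f[of j] by simp
  qed
  ultimately show ?thesis by metis
qed

text \<open>Serves to show that the filtration of an extension induces on the submodule nothing
  larger than its own filtration. If y had order j < s i at i, a multiplier w of order s i - j would
  turn it into u ^ s i, that is v u^s with v of constant term 1 at i, while w has constant term 0
  there. Frobenius carries these constant terms to index i + 1, where b is nonzero, and the two
  sides disagree.\<close>

lemma u_pow_dvd_if_frob_compatible:
  assumes s: "periodic s" "\<And>i. s i \<le> e" and b: "periodic b" "\<And>i. b i \<noteq> 0"
    and y: "y \<in> carrier S"
    and cmp: "\<And>w v. w \<in> carrier S \<Longrightarrow> v \<in> carrier S \<Longrightarrow> w \<star> y = v \<star> u_pow D s \<Longrightarrow>
      frob D w \<star> z = frob D v \<star> und_const D b"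
  shows "\<exists>v\<in>carrier S. y = v \<star> u_pow D s"
  unfolding S_dvd_u_pow[OF s y]
proof (rule ccontr)
  assume "\<not> (\<forall>i. \<forall>n<s i. coeff (cmp i y) n = 0)"
  then obtain i n where in0: "n < s i" "coeff (cmp i y) n \<noteq> 0" by blast
  define j where "j = (LEAST n. coeff (cmp i y) n \<noteq> 0)"
  have j: "coeff (cmp i y) j \<noteq> 0" unfolding j_def using in0(2) by (rule LeastI)
  have jn: "j \<le> n" unfolding j_def using in0(2) by (rule Least_le)
  have js: "j < s i" using jn in0 by simp
  have jl: "coeff (cmp i y) m = 0" if "m < j" for m using not_less_Least that unfolding j_def by blast
  define q where "q = poly_shift j (cmp i y)"
  have yq: "cmp i y = monom 1 j * q"
    by (rule poly_eqI) (simp add: q_def coeff_monom_mult coeff_poly_shift jl del: coeff_cmp)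
  have "coeff q 0 \<noteq> 0" using j by (simp add: q_def coeff_poly_shift del: coeff_cmp)
  then obtain q' where q': "ct (q * q') = 1" using inverse_mod_monom[of q T] by auto
  \<comment> \<open>\<open>q'\<close> inverts the unit part \<open>q\<close> of the component of y,
    so w y is u ^ s i at i and 0 at the other components.\<close>
  define w where "w = und_poly D (\<lambda>k. if k = i mod int f then ct (monom 1 (s i - j) * q') else 0)"
  define v where "v = und_poly D (\<lambda>k. if k = i mod int f then 1 else (0::'e poly))"
  have w: "w \<in> carrier S" "v \<in> carrier S" unfolding w_def v_def by (rule und_poly_S, simp)+
  have "w \<star> y = v \<star> u_pow D s"
  proof (rule cmp_eqI)
    fix k
    show "cmp k (w \<star> y) = cmp k (v \<star> u_pow D s)"
    proof (cases "k mod int f = i mod int f")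
      case True
      have "ct (monom 1 (s i - j) * q' * cmp i y) = ct (monom 1 (s i) * (q * q'))"
        unfolding yq using js by (simp add: mult_monom ac_simps)
      also have "\<dots> = ct (monom 1 (s i) * ct (q * q'))" by simp
      finally have "ct (monom 1 (s i - j) * q' * cmp i y) = ct (monom 1 (s i))" unfolding q' by simp
      moreover have "s k = s i" using True periodic_mod_f[OF s(1)] by metis
      ultimately show ?thesis using True cmp_cong[OF True]
        unfolding cmp_S_mult w_def v_def cmp_und_poly cmp_u_pow[OF s(1)] by simp
    qed (simp add: cmp_cut cmp_mult w_def v_def cmp_und_poly)
  qed
  from cmp[OF w this] have "coeff (cmp (i + 1) (frob D w \<star> z)) 0 = coeff (cmp (i + 1) (frob D v \<star> und_const D b)) 0" by simp
  moreover have "coeff (cmp i w) 0 = 0"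
    using js T_bounds unfolding w_def cmp_und_poly by (simp add: coeff_poly_cutoff coeff_mult)
  moreover have "coeff (cmp i v) 0 = 1" unfolding v_def cmp_und_poly by simp
  ultimately show False
    using b(2)[of "i + 1"] unfolding coeff_0_S_mult coeff_0_frob cmp_und_const[OF b(1)] by simp
qed

end

section \<open>Reduction of coefficients along orbits\<close>

text \<open>A coefficient in degree \<open>n \<ge> s i\<close> at index \<open>i\<close> is equivalent to a coefficient in degree
  \<open>r (i + 1) + p (n - s i)\<close> at index \<open>i + 1\<close>. The integer \<open>height i n\<close>, which is \<open>p ^ f - 1\<close> times the
  distance from \<open>n\<close> to \<open>r i + \<beta> i - \<alpha> i\<close>, is multiplied by \<open>p\<close> in each step.\<close>

locale orbit_data =
  fixes p f f' e T m :: nat and r s :: "int \<Rightarrow> nat" and w :: "int \<Rightarrow> int" and \<kappa> :: "int \<Rightarrow> 'e::field"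
  assumes p3: "p \<ge> 3" and f'_pos: "f' > 0" and f'_f: "f' dvd f" and f_pos: "f > 0" and T_def: "T = e * p"
    and r_per: "r (i + int f') = r i" and s_per: "s (i + int f') = s i"
    and w_per: "[w (i + int f') = w i] (mod int m)"
    and w_step: "[w (i + 1) = int (r (i + 1)) + int p * (w i - int (s i))] (mod int m)"
    and p_m: "coprime (int p) (int m)"
    and \<kappa>_per: "\<kappa> (i + int f') = \<kappa> i" and \<kappa>_nz: "\<kappa> i \<noteq> 0"
begin

section \<open>Heights and their expansion\<close>

definition "q1 = int p ^ f - 1"
text \<open>p times this sum is \<open>q1\<close> times the difference of the slopes of s and r at
  i; clearing the denominator keeps heights integral.\<close>

definition "acc i = (\<Sum>j<f. int p ^ (f - 1 - j) * (int (s (i + int j)) - int (r (i + int j))))"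
definition "height i n = q1 * (int n - int (r i)) - int p * acc i"

lemma per_mult: "(\<And>i. F (i + int f') = F i) \<Longrightarrow> F (i + int f' * int n) = F i"
proof (induction n)
  case (Suc n)
  have "i + int f' * int (Suc n) = (i + int f' * int n) + int f'" by (simp add: algebra_simps)
  then show ?case using Suc by metis
qed simp

lemma per_mod: "(\<And>i. F (i + int f') = F i) \<Longrightarrow> F (i mod int f') = F i"
proof -
  assume F: "\<And>i. F (i + int f') = F i"
  show ?thesis
  proof (cases "i div int f' \<ge> 0")
    case True
    then show ?thesis using per_mult[where F = F, OF F, of "i mod int f'" "nat (i div int f')"] by simp
  next
    case False
    then have "i mod int f' = i + int f' * int (nat (- (i div int f')))" by (simp add: minus_div_mult_eq_mod[symmetric] mult.commute)
    then show ?thesis using per_mult[where F = F, OF F, of i "nat (- (i div int f'))"] by metis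
  qed
qed

lemma per_f: "(\<And>i. F (i + int f') = F i) \<Longrightarrow> F (i + int f) = F i"
  using f'_f per_mult[of F i] by (metis dvd_def of_nat_mult)

lemma q1_pos: "q1 > 0"
  using p3 f_pos by (simp add: q1_def one_less_power)

lemma acc_per: "acc (i + int f') = acc i"
proof -
  have "int (s (i + int f' + int j)) - int (r (i + int f' + int j)) = int (s (i + int j)) - int (r (i + int j))" for j
    using s_per[of "i + int j"] r_per[of "i + int j"] by (simp add: algebra_simps)
  then show ?thesis by (simp add: acc_def)
qed

text \<open>Shifting the window of f digits by one multiplies the weighted sum by p and moves the
  leading digit to the end, where by periodicity it reappears unchanged.\<close>

lemma acc_step: "acc (i + 1) = int p * acc i + q1 * (int (r i) - int (s i))"
proof -
  define t where "t = (\<lambda>j. int (s (i + int j)) - int (r (i + int j)))"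
  have A: "(\<Sum>j<Suc f. int p ^ (f - j) * t j) = int p ^ f * t 0 + (\<Sum>j<f. int p ^ (f - Suc j) * t (Suc j))"
    by (subst sum.lessThan_Suc_shift) simp
  have B: "(\<Sum>j<Suc f. int p ^ (f - j) * t j) = int p * acc i + t f"
  proof -
    have "(\<Sum>j<f. int p ^ (f - j) * t j) = (\<Sum>j<f. int p * (int p ^ (f - 1 - j) * t j))"
    proof (rule sum.cong[OF refl])
      fix j assume "j \<in> {..<f}"
      then have "f - j = Suc (f - 1 - j)" by auto
      then show "int p ^ (f - j) * t j = int p * (int p ^ (f - 1 - j) * t j)" by simp
    qed
    also have "\<dots> = int p * acc i" by (simp add: acc_def t_def sum_distrib_left)
    finally show ?thesis by simp
  qed
  have C: "(\<Sum>j<f. int p ^ (f - Suc j) * t (Suc j)) = acc (i + 1)"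
    by (simp add: acc_def t_def algebra_simps)
  have "t f = t 0" unfolding t_def using per_f[where F = s, OF s_per, of i] per_f[where F = r, OF r_per, of i] by simp
  then show ?thesis using A B C by (simp add: t_def q1_def algebra_simps)
qed

lemma height_per: "height (i + int f') n = height i n"
  by (simp add: height_def acc_per r_per)

lemma height_step:
  assumes "r i \<le> n" "p dvd n - r i"
  shows "height i n = int p * height (i - 1) ((n - r i) div p + s (i - 1))"
proof -
  obtain k where k: "n - r i = p * k" using assms(2) by blast
  then have n: "int n = int (r i) + int p * int k" using assms(1) by (metis le_add_diff_inverse of_nat_add of_nat_mult)
  have kk: "(n - r i) div p = k" using k p3 by simp
  have acc: "acc i = int p * acc (i - 1) + q1 * (int (r (i - 1)) - int (s (i - 1)))"
    using acc_step[of "i - 1"] by simp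
  show ?thesis unfolding height_def kk acc n by (simp add: algebra_simps)
qed

lemma height_unique: "height i n = 0 \<Longrightarrow> height i n' = 0 \<Longrightarrow> n = n'"
proof -
  assume "height i n = 0" "height i n' = 0"
  then have "q1 * (int n - int (r i)) = q1 * (int n' - int (r i))" by (simp add: height_def)
  then show ?thesis using q1_pos by simp
qed

section \<open>The transition between neighbouring indices\<close>

definition "inU Y \<longleftrightarrow> (\<forall>i. Y (i + int f') = Y i) \<and>
  (\<forall>i n. Y i n \<noteq> (0::'e) \<longrightarrow> s i \<le> n \<and> n < T \<and> [int n = w i] (mod int m))"

text \<open>If Y is the coefficient family of y u^s, this is the family of (b/a) \<phi>(y) u^r, with
  \<kappa> = b/a. The variant \<open>Q'\<close> keeps only the degrees from s i on, which can be
  moved again.\<close>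

definition "Q Y i n = (if n < T \<and> r i \<le> n \<and> p dvd n - r i
  then \<kappa> i * Y (i - 1) ((n - r i) div p + s (i - 1)) else (0::'e))"

definition "Q' Y i n = (if s i \<le> n then Q Y i n else 0)"

text \<open>The degree of height zero, r i + \<beta> i - \<alpha> i, need not be an integer in the
  range of movable terms with the right congruence; \<open>valid\<close> records that it is.\<close>

definition "valid i \<longleftrightarrow> (\<exists>n. height i n = 0 \<and> s i \<le> n \<and> n < T \<and> [int n = w i] (mod int m))"

definition "cyc \<longleftrightarrow> (\<forall>i. valid i)"
definition "kprod = (\<Prod>i<f'. \<kappa> (int i))"
definition "hom_cond \<longleftrightarrow> cyc \<and> kprod = 1"
definition "special i n \<longleftrightarrow> hom_cond \<and> int f' dvd i \<and> height i n = 0"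

lemma inU_D: "inU Y \<Longrightarrow> Y (i + int f') = Y i"
  "inU Y \<Longrightarrow> Y i n \<noteq> 0 \<Longrightarrow> s i \<le> n" "inU Y \<Longrightarrow> Y i n \<noteq> 0 \<Longrightarrow> n < T"
  "inU Y \<Longrightarrow> Y i n \<noteq> 0 \<Longrightarrow> [int n = w i] (mod int m)"
  unfolding inU_def by blast+

lemma Q_nonzero:
  assumes "Q Y i n \<noteq> 0"
  shows "\<exists>k. Y (i - 1) k \<noteq> 0 \<and> height i n = int p * height (i - 1) k \<and> r i \<le> n \<and> n < T \<and>
    int n = int (r i) + int p * (int k - int (s (i - 1)))"
proof -
  have a: "n < T" "r i \<le> n" "p dvd n - r i" "Y (i - 1) ((n - r i) div p + s (i - 1)) \<noteq> 0"
    using assms by (auto simp: Q_def split: if_splits)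
  have "int p * int ((n - r i) div p) = int (n - r i)" using a(3) by (metis dvd_mult_div_cancel of_nat_mult)
  then have "int n = int (r i) + int p * (int ((n - r i) div p + s (i - 1)) - int (s (i - 1)))" using a(2) by simp
  then show ?thesis using a height_step[OF a(2,3)] by blast
qed

lemma Q_per: "(\<And>i. Y (i + int f') = Y i) \<Longrightarrow> Q Y (i + int f') = Q Y i"
proof
  fix n assume Y: "\<And>i. Y (i + int f') = Y i"
  have "i + int f' - 1 = (i - 1) + int f'" by simp
  then have "Y (i + int f' - 1) = Y (i - 1)" "s (i + int f' - 1) = s (i - 1)" using Y s_per by metis+
  then show "Q Y (i + int f') n = Q Y i n" by (simp add: Q_def r_per \<kappa>_per)
qed

lemma Q_cong_w:
  assumes Y: "inU Y" and "Q Y i n \<noteq> 0"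
  shows "[int n = w i] (mod int m)"
proof -
  obtain k where k: "Y (i - 1) k \<noteq> 0" "int n = int (r i) + int p * (int k - int (s (i - 1)))"
    using Q_nonzero[OF assms(2)] by blast
  have "[int k = w (i - 1)] (mod int m)" using inU_D(4)[OF Y k(1)] .
  then have "[int (r i) + int p * (int k - int (s (i - 1))) = int (r i) + int p * (w (i - 1) - int (s (i - 1)))] (mod int m)"
    by (intro cong_add cong_mult cong_diff cong_refl)
  also have "[int (r i) + int p * (w (i - 1) - int (s (i - 1))) = w i] (mod int m)"
    using cong_sym[OF w_step[of "i - 1"]] by simp
  finally show ?thesis using k(2) by simp
qed

lemma inU_Q': "inU Y \<Longrightarrow> inU (Q' Y)"
  unfolding inU_def
proof (intro conjI allI impI)
  assume "(\<forall>i. Y (i + int f') = Y i) \<and> (\<forall>i n. Y i n \<noteq> 0 \<longrightarrow> s i \<le> n \<and> n < T \<and> [int n = w i] (mod int m))"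
  then have Y: "inU Y" by (simp add: inU_def)
  show "Q' Y (i + int f') = Q' Y i" for i
    using Q_per[where Y = Y, OF inU_D(1)[OF Y], of i] by (auto simp: Q'_def s_per)
  fix i n assume a: "Q' Y i n \<noteq> 0"
  then have b: "s i \<le> n" "Q Y i n \<noteq> 0" by (auto simp: Q'_def split: if_splits)
  show "s i \<le> n" "n < T" using b by (auto simp: Q_def split: if_splits)
  show "[int n = w i] (mod int m)" by (rule Q_cong_w[OF Y b(2)])
qed

lemma inU_pow: "inU Y \<Longrightarrow> inU ((Q' ^^ k) Y)"
  by (induction k) (auto simp: inU_Q')

lemma inU_add: "inU Y \<Longrightarrow> inU Z \<Longrightarrow> inU (\<lambda>i n. Y i n + Z i n)"
  unfolding inU_def by (auto simp: fun_eq_iff) (metis add_0)+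

lemma inU_zero: "inU (\<lambda>i n. 0)"
  by (simp add: inU_def)

lemma inU_sum: "(\<And>k. k < N \<Longrightarrow> inU (F k)) \<Longrightarrow> inU (\<lambda>i n. \<Sum>k<(N::nat). F k i n)"
proof (induction N)
  case (Suc N)
  then show ?case using inU_add[of "\<lambda>i n. \<Sum>k<N. F k i n" "F N"] by simp
qed (simp add: inU_zero)

lemma Q_add: "Q (\<lambda>i n. Y i n + Z i n) i n = Q Y i n + Q Z i n"
  by (simp add: Q_def distrib_left)

lemma Q'_add: "Q' (\<lambda>i n. Y i n + Z i n) i n = Q' Y i n + Q' Z i n"
  by (simp add: Q'_def Q_add)

lemma Q'_sum: "Q' (\<lambda>i n. \<Sum>k<(N::nat). F k i n) i n = (\<Sum>k<N. Q' (F k) i n)"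
proof (induction N)
  case 0
  then show ?case by (simp add: Q'_def Q_def)
next
  case (Suc N)
  then show ?case using Q'_add[of "\<lambda>i n. \<Sum>k<N. F k i n" "F N" i n] by simp
qed

lemma Q'_pow_nonzero:
  "(Q' ^^ k) Y i n \<noteq> 0 \<Longrightarrow> \<exists>l. Y (i - int k) l \<noteq> 0 \<and> height i n = int p ^ k * height (i - int k) l"
proof (induction k arbitrary: i n)
  case (Suc k)
  then have "Q' ((Q' ^^ k) Y) i n \<noteq> 0" by simp
  then have "Q ((Q' ^^ k) Y) i n \<noteq> 0" unfolding Q'_def[of "(Q' ^^ k) Y"] by (auto split: if_splits)
  then obtain l where l: "(Q' ^^ k) Y (i - 1) l \<noteq> 0" "height i n = int p * height (i - 1) l" using Q_nonzero by blast
  obtain l' where "Y (i - 1 - int k) l' \<noteq> 0" "height (i - 1) l = int p ^ k * height (i - 1 - int k) l'"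
    using Suc.IH[OF l(1)] by blast
  then show ?case using l(2) by (intro exI[of _ l']) (simp add: algebra_simps)
qed auto

text \<open>A coefficient of height zero present after k steps has passed through degrees of height
  zero at each of the k preceding indices. For k \<ge> f' these meet every index class.\<close>

lemma Q'_pow_valid:
  "inU Y \<Longrightarrow> (Q' ^^ k) Y i n \<noteq> 0 \<Longrightarrow> height i n = 0 \<Longrightarrow> l \<le> k \<Longrightarrow> valid (i - int l)"
proof (induction k arbitrary: i n l)
  case 0
  then show ?case using inU_D(2-4)[OF 0(1)] unfolding valid_def by auto
next
  case (Suc k)
  show ?case
  proof (cases l)
    case 0
    have "inU ((Q' ^^ Suc k) Y)" by (rule inU_pow[OF Suc.prems(1)])
    then have "valid i" unfolding valid_def using inU_D(2-4)[OF \<open>inU ((Q' ^^ Suc k) Y)\<close> Suc.prems(2)] Suc.prems(3) by blast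
    then show ?thesis using 0 by simp
  next
    case (Suc l')
    have "Q' ((Q' ^^ k) Y) i n \<noteq> 0" using Suc.prems(2) by simp
    then have "Q ((Q' ^^ k) Y) i n \<noteq> 0" unfolding Q'_def[of "(Q' ^^ k) Y"] by (auto split: if_splits)
    then obtain j where j: "(Q' ^^ k) Y (i - 1) j \<noteq> 0" "height i n = int p * height (i - 1) j" using Q_nonzero by blast
    have "height (i - 1) j = 0" using j(2) Suc.prems(3) p3 by simp
    then have "valid (i - 1 - int l')" using Suc.IH[OF Suc.prems(1) j(1)] Suc.prems(4) Suc by simp
    then show ?thesis using Suc by (simp add: algebra_simps)
  qed
qed

lemma height_bound: "\<exists>B::nat. \<forall>i. \<forall>n<T. \<bar>height i n\<bar> \<le> int B"
proof -
  let ?B = "\<Sum>i<f'. \<Sum>n<T. nat \<bar>height (int i) n\<bar>"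
  have "\<bar>height i n\<bar> \<le> int ?B" if n: "n < T" for i n
  proof -
    define k where "k = nat (i mod int f')"
    have k: "k < f'" "int k = i mod int f'" using f'_pos by (auto simp: k_def nat_less_iff)
    have "height i n = height (int k) n" using per_mod[of "\<lambda>i. height i n", OF height_per] k(2) by metis
    moreover have "nat \<bar>height (int k) n\<bar> \<le> (\<Sum>n<T. nat \<bar>height (int k) n\<bar>)"
      using n by (intro member_le_sum[of n "{..<T}" "\<lambda>n. nat \<bar>height (int k) n\<bar>"]) auto
    moreover have "(\<Sum>n<T. nat \<bar>height (int k) n\<bar>) \<le> ?B"
      using k by (intro member_le_sum[of k "{..<f'}" "\<lambda>k. \<Sum>n<T. nat \<bar>height (int k) n\<bar>"]) auto
    ultimately show ?thesis by linarith
  qed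
  then show ?thesis by blast
qed

text \<open>After N steps a height is a multiple of p ^ N, whereas heights of degrees below T are
  bounded, so for large N only 0 remains. Since B < p ^ B, the bound itself serves as N.\<close>

lemma Q'_pow_height_0:
  "\<exists>N. \<forall>Y i n. (Q' ^^ N) Y i n \<noteq> 0 \<longrightarrow> n < T \<longrightarrow> height i n = 0"
proof -
  obtain B where B: "\<And>i n. n < T \<Longrightarrow> \<bar>height i n\<bar> \<le> int B" using height_bound by blast
  have "int B < int p ^ B"
  proof -
    have "B < 2 ^ B" by (rule less_exp)
    also have "(2::nat) ^ B \<le> p ^ B" using p3 by (intro power_mono) auto
    finally show ?thesis by (metis of_nat_less_iff of_nat_power)
  qed
  have "height i n = 0" if a: "(Q' ^^ B) Y i n \<noteq> 0" "n < T" for Y i n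
  proof (rule ccontr)
    assume nz: "height i n \<noteq> 0"
    obtain l where l: "height i n = int p ^ B * height (i - int B) l" using Q'_pow_nonzero[OF a(1)] by blast
    then have "height (i - int B) l \<noteq> 0" using nz by auto
    then have "1 \<le> \<bar>height (i - int B) l\<bar>" by simp
    then have "int p ^ B * 1 \<le> int p ^ B * \<bar>height (i - int B) l\<bar>" by (intro mult_left_mono) auto
    then have "int p ^ B \<le> \<bar>height i n\<bar>" using l by (simp add: abs_mult)
    then show False using B[OF a(2), of i] \<open>int B < int p ^ B\<close> by linarith
  qed
  then show ?thesis by blast
qed

text \<open>Uniqueness of the degree of height zero makes the chosen degrees periodic and shows that
  the transition carries each to the next. On them the transition becomes a scalar
  recursion.\<close>

lemma locus:
  assumes "cyc"
  obtains N where "\<And>i. height i (N i) = 0" "\<And>i. s i \<le> N i" "\<And>i. N i < T" "\<And>i. [int (N i) = w i] (mod int m)"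
    "\<And>i. N (i + int f') = N i" "\<And>Y i. Q Y i (N i) = \<kappa> i * Y (i - 1) (N (i - 1))"
proof -
  have "\<forall>i. \<exists>n. height i n = 0 \<and> s i \<le> n \<and> n < T \<and> [int n = w i] (mod int m)"
    using assms by (simp add: cyc_def valid_def)
  then obtain N where N: "\<And>i. height i (N i) = 0" "\<And>i. s i \<le> N i" "\<And>i. N i < T" "\<And>i. [int (N i) = w i] (mod int m)" by metis
  have per: "N (i + int f') = N i" for i
    using N(1)[of "i + int f'"] N(1)[of i] height_per height_unique by metis
  have step: "Q Y i (N i) = \<kappa> i * Y (i - 1) (N (i - 1))" for Y i
  proof -
    let ?k = "N (i - 1) - s (i - 1)"
    have "height i (r i + p * ?k) = int p * height (i - 1) (N (i - 1))"
      using height_step[of i "r i + p * ?k"] N(2)[of "i - 1"] p3 by simp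
    then have "N i = r i + p * ?k" using N(1) height_unique by (metis mult_zero_right)
    then show ?thesis using N(3)[of i] N(2)[of "i - 1"] p3 by (simp add: Q_def)
  qed
  show ?thesis by (rule that[OF N per step])
qed

section \<open>The scalar recursion around the cycle\<close>

lemma shift_forward:
  assumes per: "\<And>i. F (i + int f') = F i" and step: "\<And>i. F (i - 1) = (0::'e) \<Longrightarrow> F i = 0" and z: "F i0 = 0"
  shows "F i = 0"
proof -
  have fw: "F (i0 + int n) = 0" for n
  proof (induction n)
    case (Suc n)
    have "i0 + int (Suc n) - 1 = i0 + int n" by simp
    then show ?case using step[of "i0 + int (Suc n)"] Suc by metis
  qed (simp add: z)
  define n where "n = nat ((i - i0) mod int f')"
  have "int n = (i - i0) mod int f'" using f'_pos by (simp add: n_def)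
  then have "F ((i - i0) mod int f' + i0) = 0" using fw[of n] by (simp add: add.commute)
  moreover have "F (i - i0 + i0) = F ((i - i0) mod int f' + i0)"
    using per_mod[of "\<lambda>j. F (j + i0)" "i - i0"] per by (metis (no_types, lifting) add.commute add.left_commute)
  ultimately show ?thesis by simp
qed

definition "kpart n = (\<Prod>k<n. \<kappa> (int (Suc k)))"

lemma kprod_eq: "kprod = \<kappa> 0 * kpart (f' - 1)"
proof -
  have "kprod = (\<Prod>i<Suc (f' - 1). \<kappa> (int i))" using f'_pos by (simp add: kprod_def)
  also have "\<dots> = \<kappa> 0 * kpart (f' - 1)" by (subst prod.lessThan_Suc_shift) (simp add: kpart_def)
  finally show ?thesis .
qed

text \<open>The recursion y i = \<kappa> i y (i - 1) + R i is solved from index 0 upwards; closing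
  it after f' steps prescribes (1 - kprod) y 0. If kprod = 1, the closing equation at the multiples
  of f' is given up.\<close>

lemma cycle_solve:
  assumes R: "\<And>i. R (i + int f') = (R i :: 'e)"
  shows "\<exists>y. (\<forall>i. y (i + int f') = y i) \<and>
    (\<forall>i. \<not> (kprod = 1 \<and> int f' dvd i) \<longrightarrow> y i - \<kappa> i * y (i - 1) = R i)"
proof -
  define A where "A = rec_nat 0 (\<lambda>k a. R (int (Suc k)) + \<kappa> (int (Suc k)) * a)"
  have A0: "A 0 = 0" and AS: "A (Suc k) = R (int (Suc k)) + \<kappa> (int (Suc k)) * A k" for k by (auto simp: A_def)
  \<comment> \<open>The value at index 0 forced by the closing equation; any value would serve when
    that equation is dropped.\<close>
  define v where "v = (if kprod = 1 then 0 else (R 0 + \<kappa> 0 * A (f' - 1)) / (1 - kprod))"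
  define z where "z = (\<lambda>n. A n + kpart n * v)"
  have zS: "z (Suc n) = R (int (Suc n)) + \<kappa> (int (Suc n)) * z n" for n
    by (simp add: z_def AS kpart_def algebra_simps)
  have z0: "z 0 - \<kappa> 0 * z (f' - 1) = R 0" if "kprod \<noteq> 1"
  proof -
    have "z 0 - \<kappa> 0 * z (f' - 1) = v * (1 - kprod) - \<kappa> 0 * A (f' - 1)"
      unfolding kprod_eq by (simp add: z_def A0 kpart_def[of 0] algebra_simps)
    then show ?thesis using that by (simp add: v_def)
  qed
  define y where "y = (\<lambda>i. z (nat (i mod int f')))"
  have "y (i + int f') = y i" for i by (simp add: y_def)
  moreover have "y i - \<kappa> i * y (i - 1) = R i" if nsp: "\<not> (kprod = 1 \<and> int f' dvd i)" for i
  proof -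
    define k where "k = nat (i mod int f')"
    have k: "k < f'" "int k = i mod int f'" using f'_pos by (auto simp: k_def nat_less_iff)
    have Rk: "R i = R (int k)" and Kk: "\<kappa> i = \<kappa> (int k)" using per_mod[of R i] per_mod[of \<kappa> i] R \<kappa>_per k(2) by metis+
    show ?thesis
    proof (cases k)
      case 0
      then have d: "int f' dvd i" using k(2) by (simp add: dvd_eq_mod_eq_0)
      then obtain c where c: "i = int f' * c" by blast
      have "(i - 1) mod int f' = int f' - 1"
      proof -
        have "(i - 1) mod int f' = (int f' - 1) mod int f'" unfolding c
          by (metis (no_types) mod_diff_left_eq mod_mult_self1_is_0 mod_self mult.commute)
        then show ?thesis using f'_pos by (simp add: zmod_minus1)
      qed
      then have "y (i - 1) = z (f' - 1)" using f'_pos by (simp add: y_def nat_diff_distrib')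
      moreover have "y i = z 0" using 0 k(2) by (simp add: y_def)
      ultimately show ?thesis using z0 nsp d Rk Kk 0 by simp
    next
      case (Suc j)
      have "(i - 1) mod int f' = (int k - 1) mod int f'" using k(2) by (simp add: mod_diff_left_eq)
      also have "\<dots> = int j" using Suc k(1) by simp
      finally have "y (i - 1) = z j" by (simp add: y_def)
      moreover have "y i = z (Suc j)" using Suc by (simp add: y_def k_def)
      ultimately show ?thesis using zS[of j] Rk Kk Suc by simp
    qed
  qed
  ultimately show ?thesis by blast
qed

text \<open>The partial geometric series \<open>Y1\<close> inverts 1 - \<open>Q'\<close> up to the
  remainder \<open>R\<close>, which for large N lives at height zero. There the problem is the
  scalar recursion around the cycle, and \<open>Y2\<close> solves it.\<close>

theorem orbit_decomposition:
  assumes h_per: "\<And>i. h (i + int f') = h i"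
    and h_sup: "\<And>i n. h i n \<noteq> 0 \<Longrightarrow> n < T \<and> [int n = w i] (mod int m)"
  shows "\<exists>Y. inU Y \<and> (\<forall>i n. h i n - (Y i n - Q Y i n) \<noteq> 0 \<longrightarrow> n < s i \<or> special i n)"
proof -
  define hp where "hp = (\<lambda>i n. if s i \<le> n then h i n else 0)"
  have hp: "inU hp" unfolding inU_def hp_def using h_per h_sup s_per by (auto simp: fun_eq_iff split: if_splits)
  obtain N0 where N0: "\<And>Y i n. (Q' ^^ N0) Y i n \<noteq> 0 \<Longrightarrow> n < T \<Longrightarrow> height i n = 0" using Q'_pow_height_0 by blast
  \<comment> \<open>N0 steps bring the remainder to height zero, and f' steps make its history pass
    through every index class.\<close>
  define N where "N = f' + N0"
  define R where "R = (Q' ^^ N) hp"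
  have R: "inU R" unfolding R_def by (rule inU_pow[OF hp])
  have R0: "height i n = 0" if "R i n \<noteq> 0" for i n
  proof -
    have "R = (Q' ^^ N0) ((Q' ^^ f') hp)" by (simp add: R_def N_def add.commute[of f'] funpow_add)
    then show ?thesis using N0[of "(Q' ^^ f') hp" i n] that inU_D(3)[OF R that] by simp
  qed
  define Y1 where "Y1 = (\<lambda>i n. \<Sum>k<N. (Q' ^^ k) hp i n)"
  have Y1: "inU Y1" unfolding Y1_def by (rule inU_sum) (rule inU_pow[OF hp])
  have Y1_eq: "Y1 i n - Q' Y1 i n = hp i n - R i n" for i n
  proof -
    have "Q' Y1 i n = (\<Sum>k<N. (Q' ^^ Suc k) hp i n)" unfolding Y1_def by (simp add: Q'_sum)
    moreover have "(\<Sum>k<N. (Q' ^^ k) hp i n) - (\<Sum>k<N. (Q' ^^ Suc k) hp i n) = hp i n - (Q' ^^ N) hp i n"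
      unfolding sum_subtractf[symmetric] using sum_lessThan_telescope'[of "\<lambda>k. (Q' ^^ k) hp i n" N] by simp
    ultimately show ?thesis by (simp add: Y1_def R_def)
  qed
  have "\<exists>Y2. inU Y2 \<and> (\<forall>i n. \<not> special i n \<longrightarrow> Y2 i n - Q' Y2 i n = R i n)"
  proof (cases cyc)
    \<comment> \<open>A missing degree of height zero at one index interrupts every chain, so the
      remainder vanishes.\<close>
    case False
    then obtain i0 where i0: "\<not> valid i0" by (auto simp: cyc_def)
    have vper: "valid (i + int f') = valid i" for i
      unfolding valid_def height_per s_per using w_per[of i] by (meson cong_sym cong_trans)
    have "R i n = 0" for i n
    proof (rule ccontr)
      assume nz: "R i n \<noteq> 0"
      define l where "l = nat ((i - i0) mod int f')"
      have l: "int l = (i - i0) mod int f'" "l < f'" using f'_pos by (auto simp: l_def nat_less_iff)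
      have "valid (i - int l)"
        using Q'_pow_valid[OF hp, of N i n l] nz R0[OF nz] l(2) by (simp add: R_def N_def)
      moreover have "i - int l = i0 + int f' * ((i - i0) div int f')"
        unfolding l(1) by (simp add: minus_mod_eq_mult_div[symmetric] algebra_simps)
      then have "(i - int l) mod int f' = i0 mod int f'" by simp
      then have "valid (i - int l) = valid i0" using per_mod[of valid, OF vper] by metis
      ultimately show False using i0 by simp
    qed
    then show ?thesis using inU_zero by (intro exI[of _ "\<lambda>i n. 0"]) (simp add: Q'_def Q_def)
  next
    case True
    then obtain L where L: "\<And>i. height i (L i) = 0" "\<And>i. s i \<le> L i" "\<And>i. L i < T" "\<And>i. [int (L i) = w i] (mod int m)"
      "\<And>i. L (i + int f') = L i" "\<And>Y i. Q Y i (L i) = \<kappa> i * Y (i - 1) (L (i - 1))" using locus by metis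
    have Rper: "R (i + int f') (L (i + int f')) = R i (L i)" for i using inU_D(1)[OF R] L(5) by simp
    obtain y where y: "\<And>i. y (i + int f') = y i"
      "\<And>i. \<not> (kprod = 1 \<and> int f' dvd i) \<Longrightarrow> y i - \<kappa> i * y (i - 1) = R i (L i)"
      using cycle_solve[of "\<lambda>i. R i (L i)", OF Rper] by blast
    define Y2 where "Y2 = (\<lambda>i n. if n = L i then y i else 0)"
    have "inU Y2" unfolding inU_def Y2_def using L y(1) by (auto simp: fun_eq_iff split: if_splits)
    moreover have "Y2 i n - Q' Y2 i n = R i n" if ns: "\<not> special i n" for i n
    proof (cases "n = L i")
      case n: True
      have "\<not> (kprod = 1 \<and> int f' dvd i)" using ns True n L(1) by (auto simp: special_def hom_cond_def)
      then show ?thesis using y(2)[of i] L(2)[of i] L(6)[of Y2 i] n by (simp add: Y2_def Q'_def)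
    next
      case n: False
      have "R i n = 0" using R0 n L(1) height_unique by metis
      moreover have "Q' Y2 i n = 0"
      proof (rule ccontr)
        assume "Q' Y2 i n \<noteq> 0"
        then have "Q Y2 i n \<noteq> 0" by (auto simp: Q'_def split: if_splits)
        then obtain k where k: "Y2 (i - 1) k \<noteq> 0" "height i n = int p * height (i - 1) k" using Q_nonzero by blast
        then have "k = L (i - 1)" by (auto simp: Y2_def split: if_splits)
        then have "height i n = 0" using k(2) L(1) by simp
        then show False using n L(1) height_unique by metis
      qed
      ultimately show ?thesis using n by (simp add: Y2_def)
    qed
    ultimately show ?thesis by blast
  qed
  then obtain Y2 where Y2: "inU Y2" "\<And>i n. \<not> special i n \<Longrightarrow> Y2 i n - Q' Y2 i n = R i n" by blast
  define Y where "Y = (\<lambda>i n. Y1 i n + Y2 i n)"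
  have "inU Y" unfolding Y_def by (rule inU_add[OF Y1 Y2(1)])
  moreover have "n < s i \<or> special i n" if nz: "h i n - (Y i n - Q Y i n) \<noteq> 0" for i n
  proof (rule ccontr)
    assume a: "\<not> (n < s i \<or> special i n)"
    then have sn: "s i \<le> n" and ns: "\<not> special i n" by auto
    have "Y i n - Q Y i n = (Y1 i n - Q' Y1 i n) + (Y2 i n - Q' Y2 i n)"
      using sn by (simp add: Y_def Q_add Q'_def)
    also have "\<dots> = hp i n" using Y1_eq Y2(2)[OF ns] by simp
    also have "\<dots> = h i n" using sn by (simp add: hp_def)
    finally show False using nz by simp
  qed
  ultimately show ?thesis by blast
qed

text \<open>Descent: a nonzero value at height H comes from one at height H / p at the previous
  index, which is strictly smaller in size for H \<noteq> 0.\<close>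

lemma fixed_off_locus:
  assumes Y: "inU Y" and eq: "\<And>i n. height i n \<noteq> 0 \<Longrightarrow> s i \<le> n \<Longrightarrow> Y i n = Q Y i n"
  shows "height i n \<noteq> 0 \<Longrightarrow> Y i n = 0"
proof (induction "nat \<bar>height i n\<bar>" arbitrary: i n rule: less_induct)
  case less
  show ?case
  proof (rule ccontr)
    assume nz: "Y i n \<noteq> 0"
    then have "Q Y i n \<noteq> 0" using eq[OF less.prems] inU_D(2)[OF Y nz] by simp
    then obtain k where k: "Y (i - 1) k \<noteq> 0" "height i n = int p * height (i - 1) k" using Q_nonzero by blast
    have k0: "height (i - 1) k \<noteq> 0" using less.prems k(2) by auto
    have "\<bar>height i n\<bar> = int p * \<bar>height (i - 1) k\<bar>" unfolding k(2) by (simp add: abs_mult)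
    moreover have "1 * \<bar>height (i - 1) k\<bar> < int p * \<bar>height (i - 1) k\<bar>"
      using p3 k0 by (intro mult_strict_right_mono) auto
    ultimately have "nat \<bar>height (i - 1) k\<bar> < nat \<bar>height i n\<bar>" using k0 by simp
    then show False using less.hyps k(1) k0 by blast
  qed
qed

text \<open>Running from 0 to f' - 1 uses the recursion only at indices not divisible by f', so it
  determines the closing value without the equation at 0.\<close>

lemma cycle_kprod:
  assumes per: "\<And>i. y (i + int f') = (y i :: 'e)" and step: "\<And>i. \<not> int f' dvd i \<Longrightarrow> y i = \<kappa> i * y (i - 1)"
  shows "\<kappa> 0 * y (- 1) = kprod * y 0" and "kprod = 1 \<Longrightarrow> y 0 = \<kappa> 0 * y (- 1)" "y 0 = 0 \<Longrightarrow> y i = 0"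
proof -
  have part: "y (int n) = kpart n * y 0" if "n < f'" for n
    using that
  proof (induction n)
    case (Suc n)
    have "\<not> int f' dvd int (Suc n)" using Suc.prems by (metis int_dvd_int_iff nat_dvd_not_less zero_less_Suc)
    then have "y (int (Suc n)) = \<kappa> (int (Suc n)) * y (int n)" using step[of "int (Suc n)"] by simp
    then show ?case using Suc by (simp add: kpart_def ac_simps)
  qed (simp add: kpart_def)
  have "y (- 1) = y (int (f' - 1))" using per[of "- 1"] f'_pos by (simp add: of_nat_diff algebra_simps)
  then show 1: "\<kappa> 0 * y (- 1) = kprod * y 0" using part[of "f' - 1"] f'_pos by (simp add: kprod_eq)
  then show "kprod = 1 \<Longrightarrow> y 0 = \<kappa> 0 * y (- 1)" by simp
  assume z: "y 0 = 0"
  define n where "n = nat (i mod int f')"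
  have "int n = i mod int f'" "n < f'" using f'_pos by (auto simp: n_def nat_less_iff)
  then show "y i = 0" using part[of n] z per_mod[of y i] per by simp
qed

text \<open>The support lies at height zero. A nonzero value forces nonzero values at all preceding
  indices, so every index is valid, and one turn around the cycle multiplies the value by kprod,
  which must therefore be 1.\<close>

lemma fixed_family:
  assumes Y: "inU Y" and eq: "\<And>i n. s i \<le> n \<Longrightarrow> Y i n = Q Y i n" and nz: "Y i n \<noteq> 0"
  shows hom_cond
proof -
  have off: "height i n \<noteq> 0 \<Longrightarrow> Y i n = 0" for i n using fixed_off_locus[OF Y] eq by blast
  have v: "valid j" if "Y j k \<noteq> 0" for j k
    unfolding valid_def using inU_D(2-4)[OF Y that] off that by blast
  have fw: "\<exists>k. Y (j - 1) k \<noteq> 0" if "Y j l \<noteq> 0" for j l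
    using that eq[OF inU_D(2)[OF Y that]] Q_nonzero by metis
  have cyc unfolding cyc_def
  proof (rule ccontr)
    assume "\<not> (\<forall>i. valid i)"
    then obtain i0 where "\<not> valid i0" by blast
    then have "(if \<exists>k. Y i0 k \<noteq> 0 then 1 else 0) = (0::'e)" using v by auto
    moreover have "(if \<exists>k. Y (j + int f') k \<noteq> 0 then 1 else 0) = (if \<exists>k. Y j k \<noteq> 0 then 1 else (0::'e))" for j
      using inU_D(1)[OF Y] by simp
    moreover have "(if \<exists>k. Y (j - 1) k \<noteq> 0 then 1 else 0) = (0::'e) \<Longrightarrow> (if \<exists>k. Y j k \<noteq> 0 then 1 else 0) = (0::'e)" for j
      using fw by (auto split: if_splits)
    ultimately have "(if \<exists>k. Y i k \<noteq> 0 then 1 else 0) = (0::'e)"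
      using shift_forward[of "\<lambda>j. if \<exists>k. Y j k \<noteq> 0 then 1 else 0" i0 i] by blast
    then show False using nz by (auto split: if_splits)
  qed
  then obtain L where L: "\<And>i. height i (L i) = 0" "\<And>i. s i \<le> L i"
    "\<And>i. L (i + int f') = L i" "\<And>Y i. Q Y i (L i) = \<kappa> i * Y (i - 1) (L (i - 1))" using locus by metis
  have per: "Y (i + int f') (L (i + int f')) = Y i (L i)" for i using inU_D(1)[OF Y] L(3) by simp
  have st: "Y i (L i) = \<kappa> i * Y (i - 1) (L (i - 1))" for i by (rule trans[OF eq[OF L(2)] L(4)])
  note ck = cycle_kprod[of "\<lambda>i. Y i (L i)", OF per st]
  have "height i n = 0" using off nz by blast
  then have "n = L i" using L(1) height_unique by blast
  then have "Y 0 (L 0) \<noteq> 0" using ck(3)[of i] nz by blast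
  moreover have "Y 0 (L 0) = kprod * Y 0 (L 0)" using ck(1) st[of 0] by simp
  ultimately have "kprod = 1" by simp
  then show ?thesis using \<open>cyc\<close> by (simp add: hom_cond_def)
qed

text \<open>The partial products of \<kappa> along the cycle satisfy the recursion, and kprod = 1
  closes it.\<close>

lemma fixed_family_exists:
  assumes hom_cond
  shows "\<exists>Y. inU Y \<and> (\<forall>i n. Y i n = Q Y i n) \<and> (\<exists>i n. Y i n \<noteq> 0)"
proof -
  have c: cyc and k1: "kprod = 1" using assms by (auto simp: hom_cond_def)
  obtain L where L: "\<And>i. height i (L i) = 0" "\<And>i. s i \<le> L i" "\<And>i. L i < T" "\<And>i. [int (L i) = w i] (mod int m)"
    "\<And>i. L (i + int f') = L i" "\<And>Y i. Q Y i (L i) = \<kappa> i * Y (i - 1) (L (i - 1))" using locus[OF c] by metis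
  define y where "y = (\<lambda>i. kpart (nat (i mod int f')))"
  have yper: "y (i + int f') = y i" for i by (simp add: y_def)
  have st: "y i = \<kappa> i * y (i - 1)" if nd: "\<not> int f' dvd i" for i
  proof -
    define k where "k = nat (i mod int f')"
    have k: "k < f'" "int k = i mod int f'" using f'_pos by (auto simp: k_def nat_less_iff)
    have "k \<noteq> 0" using nd k(2) by (auto simp: dvd_eq_mod_eq_0)
    then obtain j where j: "k = Suc j" by (cases k) auto
    have "(i - 1) mod int f' = (int k - 1) mod int f'" using k(2) by (simp add: mod_diff_left_eq)
    also have "\<dots> = int j" using j k(1) by simp
    finally have "y (i - 1) = kpart j" by (simp add: y_def)
    moreover have "y i = kpart (Suc j)" using j by (simp add: y_def k_def)
    moreover have "\<kappa> i = \<kappa> (int (Suc j))" using per_mod[of \<kappa> i] \<kappa>_per k(2) j by metis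
    ultimately show ?thesis by (simp add: kpart_def mult.commute)
  qed
  have step: "y i = \<kappa> i * y (i - 1)" for i
  proof (cases "int f' dvd i")
    case True
    have "y 0 = \<kappa> 0 * y (- 1)" using cycle_kprod(2)[of y, OF yper st k1] .
    moreover obtain c where "i = int f' * c" using True by blast
    then have "i mod int f' = 0 mod int f'" "(i - 1) mod int f' = (- 1) mod int f'"
      by (auto simp: mod_eq_dvd_iff)
    then have "y i = y 0" "y (i - 1) = y (- 1)" "\<kappa> i = \<kappa> 0"
      using per_mod[of \<kappa> i] per_mod[of \<kappa> 0] \<kappa>_per by (auto simp: y_def)
    ultimately show ?thesis by simp
  qed (rule st)
  define Y where "Y = (\<lambda>i n. if n = L i then y i else 0)"
  have "inU Y" unfolding inU_def Y_def using L yper by (auto simp: fun_eq_iff split: if_splits)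
  moreover have "Y i n = Q Y i n" for i n
  proof (cases "n = L i")
    case True
    then show ?thesis using step[of i] L(6)[of Y i] by (simp add: Y_def)
  next
    case False
    have "Q Y i n = 0"
    proof (rule ccontr)
      assume "Q Y i n \<noteq> 0"
      then obtain k where k: "Y (i - 1) k \<noteq> 0" "height i n = int p * height (i - 1) k" using Q_nonzero by blast
      then have "k = L (i - 1)" by (auto simp: Y_def split: if_splits)
      then have "height i n = 0" using k(2) L(1) by simp
      then show False using False L(1) height_unique by metis
    qed
    then show ?thesis using False by (simp add: Y_def)
  qed
  moreover have "Y 0 (L 0) \<noteq> 0" by (simp add: Y_def y_def kpart_def)
  ultimately show ?thesis by blast
qed

text \<open>The hypothesis gives Y = \<open>Q\<close> Y from degree s i on, except perhaps at
  special terms. If these exist then kprod = 1, and the recursion at the other indices implies the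
  one at multiples of f'; so Y is fixed in all degrees from s i on.\<close>

theorem orbit_uniqueness:
  assumes Y: "inU Y" and adm: "\<And>i n. Y i n - Q Y i n \<noteq> 0 \<Longrightarrow> n < s i \<or> special i n"
  shows "Y i n - Q Y i n = 0"
proof -
  have eq: "Y i n = Q Y i n" if "s i \<le> n" "\<not> special i n" for i n using adm[of i n] that by auto
  have off: "height i n \<noteq> 0 \<Longrightarrow> Y i n = 0" for i n
    by (rule fixed_off_locus[OF Y]) (use eq in \<open>auto simp: special_def\<close>)
  have all: "Y i n = Q Y i n" if sn: "s i \<le> n" for i n
  proof (cases "special i n")
    case True
    then have hc: hom_cond and d: "int f' dvd i" and h0: "height i n = 0" by (auto simp: special_def)
    have c: cyc and k1: "kprod = 1" using hc by (auto simp: hom_cond_def)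
    obtain L where L: "\<And>i. height i (L i) = 0" "\<And>i. s i \<le> L i"
      "\<And>i. L (i + int f') = L i" "\<And>Y i. Q Y i (L i) = \<kappa> i * Y (i - 1) (L (i - 1))" using locus[OF c] by metis
    have per: "Y (i + int f') (L (i + int f')) = Y i (L i)" for i using inU_D(1)[OF Y] L(3) by simp
    have st: "Y i (L i) = \<kappa> i * Y (i - 1) (L (i - 1))" if "\<not> int f' dvd i" for i
      using eq[OF L(2)[of i]] L(4)[of Y i] that by (simp add: special_def)
    have "Y 0 (L 0) = \<kappa> 0 * Y (- 1) (L (- 1))" using cycle_kprod(2)[of "\<lambda>i. Y i (L i)", OF per st k1] .
    moreover have nL: "n = L i" using h0 L(1) height_unique by blast
    moreover obtain c where "i = int f' * c" using d by blast
    then have m: "i mod int f' = 0 mod int f'" "(i - 1) mod int f' = (- 1) mod int f'" by (auto simp: mod_eq_dvd_iff)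
    have "Y i (L i) = Y 0 (L 0)" "Y (i - 1) (L (i - 1)) = Y (- 1) (L (- 1))" "\<kappa> i = \<kappa> 0"
      using per_mod[of "\<lambda>i. Y i (L i)", OF per] per_mod[of \<kappa>, OF \<kappa>_per] m by metis+
    ultimately show ?thesis using L(4)[of Y i] by simp
  qed (rule eq[OF sn])
  show ?thesis
  proof (cases "s i \<le> n")
    case False
    then have Y0: "Y i n = 0" using inU_D(2)[OF Y] by blast
    \<comment> \<open>A nonzero value would have height zero, but \<open>hom_cond\<close> then
      places the degree of height zero at s i or above.\<close>
    have "Q Y i n = 0"
    proof (rule ccontr)
      assume "Q Y i n \<noteq> 0"
      then obtain k where k: "Y (i - 1) k \<noteq> 0" "height i n = int p * height (i - 1) k" using Q_nonzero by blast
      have "height (i - 1) k = 0" using off k(1) by blast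
      then have h0: "height i n = 0" using k(2) by simp
      have hom_cond using fixed_family[OF Y all k(1)] .
      then have "valid i" by (simp add: hom_cond_def cyc_def)
      then show False using h0 False height_unique unfolding valid_def by blast
    qed
    then show ?thesis using Y0 by simp
  qed (use all in simp)
qed

end

section \<open>Rank one modules and the normal form of extension parameters\<close>

context breuil_setting
begin

text \<open>From here on multiplication in S stays folded and is handled by ring laws; coefficients
  of components are expanded only on demand.\<close>

declare S_simps(1) [simp del] coeff_cmp [simp del]

lemma S_mult_def: "x \<star> y = ct (x * y)"
  by (simp add: S_simps(1))

lemma S_mult_S [simp, intro]: "x \<star> y \<in> carrier S"
  by (simp add: S_mult_def)

lemma S_assoc: "(x \<star> y) \<star> z = x \<star> (y \<star> z)"
  by (simp add: S_mult_def ac_simps)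

lemma S_comm: "x \<star> y = y \<star> x"
  by (simp add: S_mult_def ac_simps)

lemma S_lcomm: "x \<star> (y \<star> z) = y \<star> (x \<star> z)"
  by (metis S_assoc S_comm)

lemmas S_ac = S_assoc S_comm S_lcomm

lemma S_distrib: "(x + y) \<star> z = x \<star> z + y \<star> z" "z \<star> (x + y) = z \<star> x + z \<star> y"
  "(x - y) \<star> z = x \<star> z - y \<star> z" "z \<star> (x - y) = z \<star> x - z \<star> y"
  by (simp_all add: S_mult_def algebra_simps poly_cutoff_add poly_cutoff_diff)

lemma S_one_mult [simp]: "x \<in> carrier S \<Longrightarrow> 1 \<star> x = x" "x \<in> carrier S \<Longrightarrow> x \<star> 1 = x"
  "0 \<star> x = 0" "x \<star> 0 = 0"
  by (simp_all add: S_mult_def S_carrier)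

lemma frob_0 [simp]: "frob D 0 = 0"
  using frob_add[of 0 0] by (metis add_cancel_left_left add.right_neutral)

lemma gal_S_0: "g \<in> Gal D \<Longrightarrow> gal_S D g 0 = 0"
  using gal_S_add[of g 0 0] by (metis add_cancel_left_left add.right_neutral)

declare und_const_S [simp, intro] eta_pow_S [simp, intro]

lemma e_less_T: "n \<le> e \<Longrightarrow> n < T"
  using T_bounds ramK_pos by linarith

lemma rank1_dataD:
  assumes "rank1_data D r a c"
  shows "periodic r" "periodic a" "cong_periodic c" "r i \<le> e" "a i \<noteq> 0"
    "[c (i + 1) = int p * (c i + int (r i))] (mod int eKL)" "u_pow D r \<in> carrier S"
proof -
  show "periodic a" "cong_periodic c" "a i \<noteq> 0" "[c (i + 1) = int p * (c i + int (r i))] (mod int eKL)"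
    using assms by (auto simp: rank1_data_def periodic_def cong_periodic_def)
  have le: "r i \<le> e" for i using assms by (auto simp: rank1_data_def)
  show "r i \<le> e" by (rule le)
  show pr: "periodic r" using assms by (auto simp: rank1_data_def periodic_def)
  show "u_pow D r \<in> carrier S" by (rule u_pow_S[OF pr e_less_T[OF le]])
qed

lemma und_const_mult: "periodic a \<Longrightarrow> periodic b \<Longrightarrow> und_const D a \<star> und_const D b = und_const D (\<lambda>i. a i * b i)"
proof (rule cmp_eqI)
  fix i assume a: "periodic a" and b: "periodic b"
  have "periodic (\<lambda>i. a i * b i)" using a b by (simp add: periodic_def)
  then show "cmp i (und_const D a \<star> und_const D b) = cmp i (und_const D (\<lambda>i. a i * b i))"
    unfolding cmp_S_mult cmp_und_const[OF a] cmp_und_const[OF b] by (simp add: cmp_und_const ct_const)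
qed

lemma und_const_one: "und_const D (\<lambda>i. 1) = 1"
  by (rule cmp_eqI) (simp add: cmp_und_const periodic_def pCons_one)

lemma rank1_simps:
  "carrier (rank1 D r a c) = carrier S" "add (rank1 D r a c) = (+)" "zero (rank1 D r a c) = 0"
  "smult (rank1 D r a c) = mult S" "desc (rank1 D r a c) g x = gal_S D g x \<star> eta_pow D c g"
  "Fil (rank1 D r a c) = {x \<star> u_pow D r | x. x \<in> carrier S}"
  by (simp_all add: rank1_def)

text \<open>Frobenius does not see the ambiguity of x in x u^r, so the description has a unique
  solution.\<close>

lemma rank1_phi1:
  assumes "rank1_data D r a c" "x \<in> carrier S"
  shows "phi1 (rank1 D r a c) (x \<star> u_pow D r) = frob D x \<star> und_const D a"
proof -
  note rd = rank1_dataD[OF assms(1)]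
  have "(THE w. \<exists>x'\<in>carrier S. x \<star> u_pow D r = x' \<star> u_pow D r \<and> w = frob D x' \<star> und_const D a)
      = frob D x \<star> und_const D a"
  proof (rule the_equality)
    show "\<exists>x'\<in>carrier S. x \<star> u_pow D r = x' \<star> u_pow D r \<and> frob D x \<star> und_const D a = frob D x' \<star> und_const D a"
      using assms(2) by blast
    fix y assume "\<exists>x'\<in>carrier S. x \<star> u_pow D r = x' \<star> u_pow D r \<and> y = frob D x' \<star> und_const D a"
    then obtain x' where x': "x \<star> u_pow D r = x' \<star> u_pow D r" "y = frob D x' \<star> und_const D a" by blast
    show "y = frob D x \<star> und_const D a"
      unfolding x'(2) frob_eq_if_mult_eq[OF rd(1,4) x'(1)] ..
  qed
  then show ?thesis by (simp add: rank1_def)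
qed

end

locale breuil_pair = breuil_setting D
  for D :: "('a::{alg_closed_field,field_char_0}, 'k::field, 'e::field, 't::comm_ring_1) datum" +
  fixes r s :: "int \<Rightarrow> nat" and a b :: "int \<Rightarrow> 'e" and c d :: "int \<Rightarrow> int"
  assumes rM: "rank1_data D r a c" and rN: "rank1_data D s b d"
begin

abbreviation "M \<equiv> rank1 D r a c"
abbreviation "N \<equiv> rank1 D s b d"
abbreviation "ur \<equiv> u_pow D r"
abbreviation "us \<equiv> u_pow D s"
abbreviation "ua \<equiv> und_const D a"
abbreviation "ub \<equiv> und_const D b"
abbreviation "ua' \<equiv> und_const D (\<lambda>i. inverse (a i))"

text \<open>w is the weight of h and \<open>rc\<close> that of an equivariant lift of u^r m;
  \<kappa> is the scalar acquired by a coefficient moved to the next index.\<close>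

definition w :: "int \<Rightarrow> int" where "w i = int (r i) + c i - d i"
definition rc :: "int \<Rightarrow> int" where "rc i = int (r i) + c i"
definition \<kappa> :: "int \<Rightarrow> 'e" where "\<kappa> i = b i / a i"

lemmas rd = rank1_dataD[OF rM]
lemmas sd = rank1_dataD[OF rN]

declare rd(7) [simp, intro] sd(7) [simp, intro]

lemma per_a': "periodic (\<lambda>i. inverse (a i))"
  using rd(2) by (simp add: periodic_def)

lemma per_\<kappa>: "periodic \<kappa>"
  using rd(2) sd(2) by (simp add: periodic_def \<kappa>_def)

lemma ua'_ua: "ua' \<star> ua = 1"
  using und_const_mult[OF per_a' rd(2)] rd(5) by (simp add: und_const_one)

lemma ua'_ub: "ua' \<star> ub = und_const D \<kappa>"
  using und_const_mult[OF per_a' sd(2)] by (simp add: \<kappa>_def[abs_def] divide_inverse mult.commute)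

lemma per_rc: "cong_periodic rc"
  using rd(1,3) by (auto simp: cong_periodic_def periodic_def rc_def intro: cong_add)

lemma per_w: "cong_periodic w"
  using rd(1,3) sd(3) by (auto simp: cong_periodic_def periodic_def w_def intro!: cong_add cong_diff)

lemma frob_eta_rc: "g \<in> Gal D \<Longrightarrow> frob D (eta_pow D rc g) = eta_pow D c g"
  by (rule frob_eta_pow[OF per_rc rd(3)]) (use rd(6) in \<open>auto simp: rc_def add.commute\<close>)

lemma eta_rc: "g \<in> Gal D \<Longrightarrow> eta_pow D (\<lambda>i. int (r i)) g \<star> eta_pow D c g = eta_pow D rc g"
proof -
  assume g: "g \<in> Gal D"
  have "cong_periodic (\<lambda>i. int (r i))" using rd(1) by (simp add: cong_periodic_def periodic_def)
  then show ?thesis using eta_pow_mult[OF _ rd(3) g] by (simp add: rc_def[abs_def])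
qed

lemma eta_w: "g \<in> Gal D \<Longrightarrow> eta_pow D w g \<star> eta_pow D d g = eta_pow D rc g"
  using eta_pow_mult[OF per_w sd(3)] by (simp add: rc_def[abs_def] w_def)

lemma eta_inverse: "cong_periodic x \<Longrightarrow> g \<in> Gal D \<Longrightarrow> eta_pow D (\<lambda>i. - x i) g \<star> eta_pow D x g = 1"
proof -
  assume x: "cong_periodic x" and g: "g \<in> Gal D"
  have "cong_periodic (\<lambda>i. - x i)" using x by (simp add: cong_periodic_def cong_minus_minus_iff)
  then show ?thesis using eta_pow_mult[OF _ x g] eta_pow_0[OF g] by simp
qed

text \<open>In this form the condition arises when g is applied to u^r m + h n and the coefficients
  of n are compared.\<close>

lemma weight_w_iff:
  assumes x: "x \<in> carrier S"
  shows "weight w x \<longleftrightarrow> (\<forall>g\<in>Gal D. gal_S D g x \<star> eta_pow D d g = eta_pow D rc g \<star> x)"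
  unfolding weight_def
proof (intro ball_cong refl iffI)
  fix g assume g: "g \<in> Gal D"
  show "gal_S D g x \<star> eta_pow D d g = eta_pow D rc g \<star> x" if "gal_S D g x = x \<star> eta_pow D w g"
    unfolding that S_assoc eta_w[OF g] by (rule S_comm)
  assume a: "gal_S D g x \<star> eta_pow D d g = eta_pow D rc g \<star> x"
  have e: "eta_pow D d g \<star> eta_pow D (\<lambda>i. - d i) g = 1" using eta_inverse[OF sd(3) g] by (simp add: S_comm)
  have "gal_S D g x = (gal_S D g x \<star> eta_pow D d g) \<star> eta_pow D (\<lambda>i. - d i) g"
    using g by (simp add: S_assoc e)
  also have "\<dots> = ((eta_pow D w g \<star> eta_pow D d g) \<star> x) \<star> eta_pow D (\<lambda>i. - d i) g"
    unfolding a eta_w[OF g] ..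
  also have "\<dots> = (x \<star> eta_pow D w g) \<star> (eta_pow D d g \<star> eta_pow D (\<lambda>i. - d i) g)" by (simp add: S_ac)
  finally show "gal_S D g x = x \<star> eta_pow D w g" by (simp add: e)
qed

sublocale orb: orbit_data p f f' e T eKL r s w \<kappa>
proof
  show "p \<ge> 3" by (rule p_ge_3)
  show "f' > 0" by (rule resdegL_pos)
  show "f' dvd f" by (rule resdegL_dvd)
  show "f > 0" by (rule kf.f_pos)
  show "T = e * p" by (rule T_eq)
  show "r (i + int f') = r i" "s (i + int f') = s i" for i using rd(1) sd(1) by (auto simp: periodic_def)
  show "[w (i + int f') = w i] (mod int eKL)" for i using per_w by (simp add: cong_periodic_def)
  show "[w (i + 1) = int (r (i + 1)) + int p * (w i - int (s i))] (mod int eKL)" for i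
  proof -
    have "[int (r (i + 1)) + c (i + 1) - d (i + 1)
        = int (r (i + 1)) + int p * (c i + int (r i)) - int p * (d i + int (s i))] (mod int eKL)"
      by (intro cong_add cong_diff cong_refl rd(6) sd(6))
    moreover have "int (r (i + 1)) + int p * (c i + int (r i)) - int p * (d i + int (s i))
        = int (r (i + 1)) + int p * (w i - int (s i))" by (simp add: w_def algebra_simps)
    ultimately show ?thesis by (simp add: w_def)
  qed
  have "coprime p eKL" using prime_p tame by (simp add: prime_imp_coprime)
  then show "coprime (int p) (int eKL)" by simp
  show "\<kappa> (i + int f') = \<kappa> i" for i using per_\<kappa> by (simp add: periodic_def)
  show "\<kappa> i \<noteq> 0" for i using rd(5) sd(5) by (simp add: \<kappa>_def)
qed

section \<open>Coefficient families of parameter changes\<close>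

definition fam :: "'t poly \<Rightarrow> int \<Rightarrow> nat \<Rightarrow> 'e" where
  "fam y i n = coeff (cmp i (y \<star> us)) n"

definition Lmap :: "'t poly \<Rightarrow> 't poly" where
  "Lmap y = y \<star> us - (frob D y \<star> und_const D \<kappa>) \<star> ur"

lemma coeff_mult_u_pow:
  "periodic t \<Longrightarrow> coeff (cmp i (y \<star> u_pow D t)) n = (if n < T \<and> t i \<le> n then coeff (cmp i y) (n - t i) else 0)"
  unfolding cmp_S_mult by (simp add: cmp_u_pow mult.commute[of _ "monom _ _"] coeff_poly_cutoff coeff_monom_mult)

text \<open>Coefficients of y from degree T - s i on are lost, harmlessly: u^s annihilates them and
  Frobenius does not see them.\<close>

lemma fam_eq: "fam y i n = (if n < T \<and> s i \<le> n then coeff (cmp i y) (n - s i) else 0)"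
  unfolding fam_def by (rule coeff_mult_u_pow[OF sd(1)])

lemma Q_fam: "coeff (cmp i ((frob D y \<star> und_const D \<kappa>) \<star> ur)) n = orb.Q (fam y) i n"
proof (cases "n < T \<and> r i \<le> n")
  case True
  have "coeff (cmp i (frob D y \<star> und_const D \<kappa>)) (n - r i) = \<kappa> i * (if p dvd n - r i then coeff (cmp (i - 1) y) ((n - r i) div p) else 0)"
    using True p_ge_3 unfolding cmp_S_mult cmp_und_const[OF per_\<kappa>] cmp_frob
    by (simp add: coeff_poly_cutoff coeff_pcompose_monom mult.commute less_imp_diff_less)
  \<comment> \<open>The coefficient read by Frobenius has degree below e, so it stays within the
    range that the family records.\<close>
  moreover have "(n - r i) div p + s (i - 1) < T"
  proof -
    have "(n - r i) div p < e" using True p_ge_3 by (simp add: T_eq div_less_iff_less_mult less_imp_diff_less)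
    then show ?thesis using sd(4)[of "i - 1"] T_bounds by linarith
  qed
  ultimately show ?thesis unfolding coeff_mult_u_pow[OF rd(1)] orb.Q_def fam_eq using True by simp
qed (auto simp: coeff_mult_u_pow[OF rd(1)] orb.Q_def)

lemma coeff_Lmap: "coeff (cmp i (Lmap y)) n = fam y i n - orb.Q (fam y) i n"
  unfolding Lmap_def cmp_diff coeff_diff Q_fam by (simp only: fam_def)

lemma Lmap_S [simp, intro]: "Lmap y \<in> carrier S"
  unfolding Lmap_def by (intro S_diff S_mult_S)

lemma fam_inU: "weight w (y \<star> us) \<Longrightarrow> orb.inU (fam y)"
proof -
  assume wt: "weight w (y \<star> us)"
  then have "periodic (\<lambda>i. cmp i (y \<star> us))" "\<And>i n. fam y i n \<noteq> 0 \<Longrightarrow> [int n = w i] (mod int eKL)"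
    using weight_iff[OF per_w S_mult_S] unfolding fam_def by blast+
  moreover have "s i \<le> n \<and> n < T" if "fam y i n \<noteq> 0" for i n using that by (simp add: fam_eq split: if_splits)
  ultimately show ?thesis unfolding orb.inU_def by (auto simp: periodic_def fam_def[abs_def])
qed

lemma inU_fam:
  assumes Y: "orb.inU Y"
  shows "\<exists>y\<in>carrier S. weight w (y \<star> us) \<and> fam y = Y"
proof -
  define y where "y = und_poly D (\<lambda>i. \<Sum>n<T. monom (Y i (n + s i)) n)"
  have per: "periodic (\<lambda>i. \<Sum>n<T. monom (Y i (n + s i)) n)"
    using orb.inU_D(1)[OF Y] sd(1) by (simp add: periodic_def)
  have cy: "coeff (cmp i y) n = (if n < T then Y i (n + s i) else 0)" for i n
    unfolding y_def cmp_und_poly_periodic[OF per] by (simp add: coeff_sum)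
  have yS: "y \<in> carrier S" unfolding S_carrier_cmp by (intro allI poly_eqI) (simp add: coeff_poly_cutoff cy)
  have fy: "fam y = Y"
  proof (intro ext)
    fix i n
    show "fam y i n = Y i n" unfolding fam_eq cy using orb.inU_D(2,3)[OF Y, of i n] by auto
  qed
  have "weight w (y \<star> us)"
    unfolding weight_iff[OF per_w S_mult_S]
  proof (intro conjI allI impI)
    have "cmp (i + int f') (y \<star> us) = cmp i (y \<star> us)" for i
      by (rule poly_eqI) (use fy orb.inU_D(1)[OF Y, of i] in \<open>metis fam_def\<close>)
    then show "periodic (\<lambda>i. cmp i (y \<star> us))" by (simp add: periodic_def)
    show "[int n = w i] (mod int eKL)" if "coeff (cmp i (y \<star> us)) n \<noteq> 0" for i n
      using orb.inU_D(4)[OF Y, of i n] that fy unfolding fam_def by metis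
  qed
  then show ?thesis using yS fy by blast
qed

section \<open>Parameters, their changes and normal parameters\<close>

definition \<mu> :: "int \<Rightarrow> nat" where "\<mu> i = r i + s i - e"

text \<open>The parameters that occur: \<open>h_V\<close> shows that extensions lead into this
  space, and the models realise all of it. Truncated subtraction in \<mu> supplies the maximum with
  0.\<close>

definition V :: "'t poly set" where
  "V = {h \<in> carrier S. weight w h \<and> (\<forall>i. \<forall>n<\<mu> i. coeff (cmp i h) n = 0)}"

text \<open>\<open>W\<close> consists of the changes of the parameter \<open>h\<close> of an extension caused by replacing the
  equivariant lift \<open>z\<close> of \<open>u^r\<close> by \<open>z + y u^s n\<close>.\<close>

definition W :: "'t poly set" where
  "W = {Lmap y | y. y \<in> carrier S \<and> weight w (y \<star> us)}"

definition normal :: "'t poly \<Rightarrow> bool" where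
  "normal h \<longleftrightarrow> (\<forall>i n. coeff (cmp i h) n \<noteq> 0 \<longrightarrow> n < s i \<or> orb.special i n)"

lemma VD: "h \<in> V \<Longrightarrow> h \<in> carrier S" "h \<in> V \<Longrightarrow> weight w h" "h \<in> V \<Longrightarrow> n < \<mu> i \<Longrightarrow> coeff (cmp i h) n = 0"
  by (auto simp: V_def)

lemma weight_add: "weight w x \<Longrightarrow> weight w y \<Longrightarrow> weight w (x + y)"
  by (simp add: weight_def gal_S_add S_distrib)

lemma weight_diff: "weight w x \<Longrightarrow> weight w y \<Longrightarrow> weight w (x - y)"
proof -
  assume x: "weight w x" and y: "weight w y"
  have "gal_S D g (x - y) = gal_S D g x - gal_S D g y" if "g \<in> Gal D" for g
    using gal_S_add[OF that, of "x - y" y] by simp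
  then show ?thesis using x y by (simp add: weight_def S_distrib)
qed

lemma weight_const: "weight w x \<Longrightarrow> weight w ([:ir l:] \<star> x)"
  by (simp add: weight_def gal_S_mult gal_S_const S_assoc)

lemma V_closed: "x \<in> V \<Longrightarrow> y \<in> V \<Longrightarrow> x + y \<in> V" "x \<in> V \<Longrightarrow> y \<in> V \<Longrightarrow> x - y \<in> V"
  "x \<in> V \<Longrightarrow> [:ir l:] \<star> x \<in> V"
proof -
  show "x \<in> V \<Longrightarrow> y \<in> V \<Longrightarrow> x + y \<in> V" "x \<in> V \<Longrightarrow> y \<in> V \<Longrightarrow> x - y \<in> V"
    by (auto simp: V_def weight_add weight_diff cmp_add cmp_diff)
  have "cmp i ([:ir l:] \<star> x) = Polynomial.smult l (cmp i x)" if "x \<in> carrier S" for i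
    unfolding cmp_S_mult using that by (intro poly_eqI) (simp add: coeff_poly_cutoff coeff_cmp S_coeff)
  then show "x \<in> V \<Longrightarrow> [:ir l:] \<star> x \<in> V"
    by (simp add: V_def weight_const)
qed

lemma W_V: "x \<in> W \<Longrightarrow> x \<in> V"
proof -
  assume "x \<in> W"
  then obtain y where y: "x = Lmap y" "y \<in> carrier S" "weight w (y \<star> us)" by (auto simp: W_def)
  note U = fam_inU[OF y(3)]
  have wt: "weight w x"
    unfolding weight_iff[OF per_w Lmap_S[of y, folded y(1)]]
  proof (intro conjI allI impI)
    have "fam y (i + int f') = fam y i" "orb.Q (fam y) (i + int f') = orb.Q (fam y) i" for i
      using orb.inU_D(1)[OF U] orb.Q_per[where Y = "fam y", OF orb.inU_D(1)[OF U]] by auto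
    then have "cmp (i + int f') x = cmp i x" for i
      unfolding y(1) by (intro poly_eqI) (simp only: coeff_Lmap)
    then show "periodic (\<lambda>i. cmp i x)" by (simp add: periodic_def)
    fix i n assume "coeff (cmp i x) n \<noteq> 0"
    then have "fam y i n \<noteq> 0 \<or> orb.Q (fam y) i n \<noteq> 0" unfolding y(1) coeff_Lmap by auto
    then show "[int n = w i] (mod int eKL)" using orb.inU_D(4)[OF U] orb.Q_cong_w[OF U] by blast
  qed
  have "coeff (cmp i x) n = 0" if n: "n < \<mu> i" for i n
  proof -
    have "n < s i" "n < r i" using n rd(4)[of i] sd(4)[of i] by (auto simp: \<mu>_def)
    then show ?thesis unfolding y(1) coeff_Lmap by (simp add: fam_eq orb.Q_def)
  qed
  then show ?thesis using wt y(1) by (simp add: V_def)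
qed

text \<open>With \<open>W_normal\<close> this makes the normal parameters a complement of
  \<open>W\<close> in \<open>V\<close>; it is \<open>orbit_decomposition\<close> translated through
  \<open>fam\<close>.\<close>

lemma V_decomposition: "h \<in> V \<Longrightarrow> \<exists>x\<in>W. h - x \<in> V \<and> normal (h - x)"
proof -
  assume h: "h \<in> V"
  have iff: "periodic (\<lambda>i. cmp i h)" "\<And>i n. coeff (cmp i h) n \<noteq> 0 \<Longrightarrow> [int n = w i] (mod int eKL)"
    using VD(2)[OF h] unfolding weight_iff[OF per_w VD(1)[OF h]] by blast+
  have "coeff (cmp i h) n \<noteq> 0 \<Longrightarrow> n < T" for i n using S_coeff[OF VD(1)[OF h], of n] by (cases "n < T") (auto simp: coeff_cmp)
  then obtain Y where Y: "orb.inU Y" "\<And>i n. coeff (cmp i h) n - (Y i n - orb.Q Y i n) \<noteq> 0 \<Longrightarrow> n < s i \<or> orb.special i n"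
    using orb.orbit_decomposition[of "\<lambda>i n. coeff (cmp i h) n"] iff by (auto simp: periodic_def)
  obtain y where y: "y \<in> carrier S" "weight w (y \<star> us)" "fam y = Y" using inU_fam[OF Y(1)] by blast
  have xW: "Lmap y \<in> W" using y by (auto simp: W_def)
  moreover have "normal (h - Lmap y)"
    unfolding normal_def cmp_diff coeff_diff coeff_Lmap y(3) using Y(2) by blast
  ultimately show ?thesis using V_closed(2)[OF h W_V] by blast
qed

lemma W_normal: "x \<in> W \<Longrightarrow> normal x \<Longrightarrow> x = 0"
proof -
  assume "x \<in> W" and n: "normal x"
  then obtain y where y: "x = Lmap y" "weight w (y \<star> us)" by (auto simp: W_def)
  have "fam y i n - orb.Q (fam y) i n = 0" for i n
    by (rule orb.orbit_uniqueness[OF fam_inU[OF y(2)]]) (use n in \<open>simp add: normal_def y(1) coeff_Lmap\<close>)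
  then have "cmp i x = cmp i 0" for i unfolding y(1) by (intro poly_eqI) (simp add: coeff_Lmap)
  then show ?thesis by (rule cmp_eqI)
qed

lemma normal_diff: "normal x \<Longrightarrow> normal y \<Longrightarrow> normal (x - y)"
  unfolding normal_def cmp_diff coeff_diff by (metis diff_0_right)

subsection \<open>Morphisms between rank one modules\<close>

text \<open>A morphism is multiplication by t = \<theta> 1, and preserving the filtration means t
  u^r = y u^s for some y. Compatibility with \<open>phi1\<close> then gives t = (b/a) \<phi>(y), so
  y is in the kernel of \<open>Lmap\<close> and its family is fixed by the transition.\<close>

lemma hom_imp_hom_cond:
  assumes "has_nonzero_hom D M N"
  shows "orb.hom_cond"
proof -
  obtain \<theta> x where th: "\<theta> \<in> breuil_hom D M N" "x \<in> carrier M" "\<theta> x \<noteq> \<zero>\<^bsub>N\<^esub>"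
    using assms by (auto simp: has_nonzero_hom_def)
  have mh: "\<theta> \<in> module_hom S M N" and Fl: "\<theta> ` Fil M \<subseteq> Fil N"
    and ph: "\<And>x. x \<in> Fil M \<Longrightarrow> \<theta> (phi1 M x) = phi1 N (\<theta> x)"
    and ds: "\<And>g x. g \<in> Gal D \<Longrightarrow> x \<in> carrier M \<Longrightarrow> \<theta> (desc M g x) = desc N g (\<theta> x)"
    using th(1) by (auto simp: breuil_hom_def)
  have sm: "\<theta> (q \<star> z) = q \<star> \<theta> z" if "q \<in> carrier S" "z \<in> carrier S" for q z
    using mh that by (auto simp: LinearCombinations.module_hom_def rank1_simps)
  define t where "t = \<theta> 1"
  have tS: "t \<in> carrier S" using mh by (auto simp: LinearCombinations.module_hom_def rank1_simps t_def)
  have tx: "\<theta> z = z \<star> t" if "z \<in> carrier S" for z using sm[OF that S_one] that by (simp add: t_def)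
  have t0: "t \<noteq> 0" using th tx by (auto simp: rank1_simps)
  have "ur \<in> Fil M" by (auto simp: rank1_simps intro!: exI[of _ 1])
  then have "\<theta> ur \<in> Fil N" using Fl by blast
  then obtain y where y: "y \<in> carrier S" "ur \<star> t = y \<star> us" using tx[of ur] by (auto simp: rank1_simps)
  have "\<theta> (phi1 M ur) = phi1 N (\<theta> ur)" by (rule ph[OF \<open>ur \<in> Fil M\<close>])
  moreover have "phi1 M ur = ua" using rank1_phi1[OF rM S_one] by simp
  moreover have "phi1 N (\<theta> ur) = frob D y \<star> ub" using tx[of ur] y rank1_phi1[OF rN y(1)] by simp
  ultimately have at: "ua \<star> t = frob D y \<star> ub" using tx[of ua] by simp
  have "t = ua' \<star> (ua \<star> t)" using tS by (simp add: ua'_ua flip: S_assoc)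
  also have "\<dots> = frob D y \<star> und_const D \<kappa>" unfolding at ua'_ub[symmetric] by (rule S_lcomm)
  finally have tf: "t = frob D y \<star> und_const D \<kappa>" .
  have wt: "weight w (y \<star> us)"
    unfolding weight_w_iff[OF S_mult_S]
  proof
    fix g assume g: "g \<in> Gal D"
    have "\<theta> (eta_pow D c g) = gal_S D g t \<star> eta_pow D d g"
      using ds[OF g, of 1] gal_S_1[OF g] by (simp add: rank1_simps t_def)
    then have tg: "eta_pow D c g \<star> t = gal_S D g t \<star> eta_pow D d g" using tx[of "eta_pow D c g"] by simp
    have "gal_S D g (y \<star> us) \<star> eta_pow D d g = gal_S D g ur \<star> (gal_S D g t \<star> eta_pow D d g)"
      unfolding y(2)[symmetric] gal_S_mult[OF g] S_assoc ..
    also have "\<dots> = (eta_pow D (\<lambda>i. int (r i)) g \<star> eta_pow D c g) \<star> (ur \<star> t)"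
      unfolding tg[symmetric] gal_u_pow[OF rd(1) g] by (simp add: S_ac)
    finally show "gal_S D g (y \<star> us) \<star> eta_pow D d g = eta_pow D rc g \<star> (y \<star> us)"
      unfolding eta_rc[OF g] y(2) .
  qed
  have "Lmap y = 0" unfolding Lmap_def tf[symmetric] y(2)[symmetric] by (simp add: S_comm)
  then have eq: "fam y i n = orb.Q (fam y) i n" for i n using coeff_Lmap[of i y n] by simp
  \<comment> \<open>A vanishing family would give \<phi>(y) = 0 and hence t = 0.\<close>
  have "\<exists>i n. fam y i n \<noteq> 0"
  proof (rule ccontr)
    assume "\<not> ?thesis"
    then have "y \<star> us = 0 \<star> us" by (intro cmp_eqI poly_eqI) (simp add: fam_def[symmetric])
    then have "frob D y = frob D 0" by (rule frob_eq_if_mult_eq[OF sd(1,4)])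
    then show False using tf t0 by simp
  qed
  then show ?thesis using orb.fixed_family[OF fam_inU[OF wt] eq] by blast
qed

text \<open>A fixed family comes from some y with y u^s = t u^r for t = (b/a) \<phi>(y), and
  multiplication by this t is the morphism.\<close>

lemma hom_cond_imp_hom:
  assumes "orb.hom_cond"
  shows "has_nonzero_hom D M N"
proof -
  obtain Y i0 n0 where Y: "orb.inU Y" "\<And>i n. Y i n = orb.Q Y i n" "Y i0 n0 \<noteq> 0"
    using orb.fixed_family_exists[OF assms] by blast
  obtain y where y: "y \<in> carrier S" "weight w (y \<star> us)" "fam y = Y" using inU_fam[OF Y(1)] by blast
  define t where "t = frob D y \<star> und_const D \<kappa>"
  have "cmp i (Lmap y) = cmp i 0" for i using Y(2) by (intro poly_eqI) (simp add: coeff_Lmap y(3))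
  then have "Lmap y = 0" by (rule cmp_eqI)
  then have yt: "y \<star> us = t \<star> ur" by (simp add: Lmap_def t_def)
  have tS: "t \<in> carrier S" by (simp add: t_def)
  have t0: "t \<noteq> 0"
  proof
    assume "t = 0"
    then have "y \<star> us = 0" using yt by simp
    then have "fam y i0 n0 = 0" by (simp add: fam_def)
    then show False using Y(3) y(3) by simp
  qed
  have tg: "gal_S D g t \<star> eta_pow D d g = eta_pow D c g \<star> t" if g: "g \<in> Gal D" for g
  proof -
    define ws where "ws = (\<lambda>i. w i - int (s i))"
    have pws: "cong_periodic ws" using per_w sd(1) by (auto simp: ws_def cong_periodic_def periodic_def intro: cong_diff)
    have ps: "cong_periodic (\<lambda>i. int (s i))" using sd(1) by (simp add: cong_periodic_def periodic_def)
    \<comment> \<open>Equivariance of y is available only after multiplication by u^s. This is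
      enough, since t depends on \<phi>(y) alone.\<close>
    have "gal_S D g y \<star> us = (y \<star> eta_pow D ws g) \<star> us"
    proof -
      have e1: "eta_pow D ws g \<star> eta_pow D (\<lambda>i. int (s i)) g = eta_pow D w g"
        using eta_pow_mult[OF pws ps g] by (simp add: ws_def)
      have e2: "eta_pow D (\<lambda>i. int (s i)) g \<star> eta_pow D (\<lambda>i. - int (s i)) g = 1"
        using eta_inverse[OF ps g] by (simp add: S_comm)
      have "gal_S D g y \<star> (us \<star> eta_pow D (\<lambda>i. int (s i)) g) = (y \<star> us) \<star> eta_pow D w g"
        using y(2) g unfolding weight_def gal_u_pow[OF sd(1) g, symmetric] gal_S_mult[OF g, symmetric] by blast
      then have "(gal_S D g y \<star> us) \<star> (eta_pow D (\<lambda>i. int (s i)) g \<star> eta_pow D (\<lambda>i. - int (s i)) g)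
          = ((y \<star> eta_pow D ws g) \<star> us) \<star> (eta_pow D (\<lambda>i. int (s i)) g \<star> eta_pow D (\<lambda>i. - int (s i)) g)"
        unfolding e1[symmetric] by (metis S_assoc S_comm)
      then show ?thesis by (simp add: e2)
    qed
    then have fe: "frob D (gal_S D g y) = frob D (y \<star> eta_pow D ws g)" by (rule frob_eq_if_mult_eq[OF sd(1,4)])
    have pcd: "cong_periodic (\<lambda>i. c i - d i)" using rd(3) sd(3) by (auto simp: cong_periodic_def intro: cong_diff)
    have fw: "frob D (eta_pow D ws g) = eta_pow D (\<lambda>i. c i - d i) g"
    proof (rule frob_eta_pow[OF pws pcd g])
      fix i
      have "[c (i + 1) - d (i + 1) = int p * (c i + int (r i)) - int p * (d i + int (s i))] (mod int eKL)"
        by (intro cong_diff rd(6) sd(6))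
      moreover have "int p * (c i + int (r i)) - int p * (d i + int (s i)) = int p * ws i" by (simp add: ws_def w_def algebra_simps)
      ultimately show "[c (i + 1) - d (i + 1) = int p * ws i] (mod int eKL)" by simp
    qed
    have ed: "eta_pow D (\<lambda>i. c i - d i) g \<star> eta_pow D d g = eta_pow D c g" using eta_pow_mult[OF pcd sd(3) g] by simp
    have "gal_S D g t = frob D (gal_S D g y) \<star> und_const D \<kappa>"
      unfolding t_def gal_S_mult[OF g] gal_frob[OF g] gal_und_const[OF per_\<kappa> g] ..
    also have "\<dots> = t \<star> eta_pow D (\<lambda>i. c i - d i) g" unfolding fe frob_mult fw t_def by (simp add: S_ac)
    finally show ?thesis by (simp add: S_assoc ed) (rule S_comm)
  qed
  define \<theta> where "\<theta> = (\<lambda>x. x \<star> t)"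
  have "\<theta> \<in> breuil_hom D M N"
    unfolding breuil_hom_def
  proof (intro CollectI conjI ballI)
    show "\<theta> \<in> module_hom S M N" by (auto simp: LinearCombinations.module_hom_def rank1_simps \<theta>_def S_distrib S_assoc)
    have F: "\<theta> (x \<star> ur) = (x \<star> y) \<star> us" for x
      unfolding \<theta>_def S_assoc yt by (simp add: S_comm)
    then show "\<theta> ` Fil M \<subseteq> Fil N" by (auto simp: rank1_simps)
    fix x assume "x \<in> Fil M"
    then obtain x' where x': "x = x' \<star> ur" "x' \<in> carrier S" by (auto simp: rank1_simps)
    have "ua \<star> und_const D \<kappa> = (ua' \<star> ua) \<star> ub" unfolding ua'_ub[symmetric] by (simp add: S_ac)
    then have ab: "ua \<star> und_const D \<kappa> = ub" by (simp add: ua'_ua)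
    have "\<theta> (phi1 M x) = frob D x' \<star> (frob D y \<star> (ua \<star> und_const D \<kappa>))"
      unfolding x' rank1_phi1[OF rM x'(2)] \<theta>_def t_def by (simp add: S_ac)
    also have "\<dots> = phi1 N (\<theta> x)" unfolding x' F rank1_phi1[OF rN S_mult_S] ab frob_mult by (simp add: S_ac)
    finally show "\<theta> (phi1 M x) = phi1 N (\<theta> x)" .
  next
    fix g x assume g: "g \<in> Gal D"
    show "\<theta> (desc M g x) = desc N g (\<theta> x)"
      unfolding \<theta>_def rank1_simps gal_S_mult[OF g] S_assoc tg[OF g] ..
  qed
  moreover have "\<theta> 1 \<noteq> \<zero>\<^bsub>N\<^esub>" using t0 tS by (simp add: \<theta>_def rank1_simps)
  ultimately show ?thesis unfolding has_nonzero_hom_def by (intro bexI[of _ \<theta>] bexI[of _ 1]) (auto simp: rank1_simps)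
qed

lemma has_hom_iff: "has_nonzero_hom D M N \<longleftrightarrow> orb.hom_cond"
  using hom_imp_hom_cond hom_cond_imp_hom by blast

lemma slope_height: "(of_nat j :: rat) = of_nat (r 0) + slope D s 0 - slope D r 0 \<longleftrightarrow> orb.height 0 j = 0"
proof -
  have q1: "(of_nat p ^ f - 1 :: rat) = of_int orb.q1" by (simp add: orb.q1_def)
  have nz: "(of_int orb.q1 :: rat) \<noteq> 0" using orb.q1_pos by simp
  have "slope D s 0 - slope D r 0 = of_int (int p * orb.acc 0) / of_int orb.q1"
    unfolding slope_def q1 orb.acc_def
    by (simp add: diff_divide_distrib[symmetric] right_diff_distrib[symmetric] sum_subtractf[symmetric])
  then have "(of_nat j :: rat) = of_nat (r 0) + slope D s 0 - slope D r 0 \<longleftrightarrow>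
      of_nat j - of_nat (r 0) = (of_int (int p * orb.acc 0) :: rat) / of_int orb.q1"
    by (auto simp: algebra_simps)
  also have "\<dots> \<longleftrightarrow> (of_nat j - of_nat (r 0)) * of_int orb.q1 = (of_int (int p * orb.acc 0) :: rat)"
    by (rule nonzero_eq_divide_eq[OF nz])
  also have "\<dots> \<longleftrightarrow> (of_int (orb.height 0 j) :: rat) = 0" by (simp add: orb.height_def algebra_simps)
  finally show ?thesis by simp
qed

lemma special_iff: "orb.special i n \<longleftrightarrow> has_nonzero_hom D M N \<and> int f' dvd i \<and>
    (of_nat n :: rat) = of_nat (r 0) + slope D s 0 - slope D r 0"
proof -
  have "orb.height i n = orb.height 0 n" if "int f' dvd i"
    using orb.per_mod[of "\<lambda>i. orb.height i n" i] orb.height_per that by (simp add: dvd_eq_mod_eq_0)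
  then show ?thesis unfolding orb.special_def has_hom_iff slope_height by auto
qed

lemma range_cutoff: "(x :: 'e poly) \<in> range (poly_cutoff n) \<longleftrightarrow> poly_cutoff n x = x"
proof
  assume "x \<in> range (poly_cutoff n)"
  then obtain y where "x = poly_cutoff n y" by auto
  then show "poly_cutoff n x = x" by simp
next
  assume "poly_cutoff n x = x"
  then show "x \<in> range (poly_cutoff n)" by (rule range_eqI[OF sym])
qed

lemma monom_dvd_iff: "monom 1 n dvd (q :: 'e poly) \<longleftrightarrow> (\<forall>k<n. coeff q k = 0)"
proof
  assume "monom 1 n dvd q"
  then obtain q' where "q = monom 1 n * q'" by blast
  then show "\<forall>k<n. coeff q k = 0" by (simp add: coeff_monom_mult)
next
  assume "\<forall>k<n. coeff q k = 0"
  then have "q = monom 1 n * poly_shift n q" by (intro poly_eqI) (simp add: coeff_monom_mult coeff_poly_shift)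
  then show "monom 1 n dvd q" by (metis dvd_triv_left)
qed

lemma admissible_iff:
  "admissible D r a c s b d h \<longleftrightarrow> periodic h \<and> und_poly D h \<in> V \<and> normal (und_poly D h)"
proof -
  have mu: "nat (max 0 (int (r i) + int (s i) - int e)) = \<mu> i" for i by (simp add: \<mu>_def nat_diff_distrib' max_def) linarith
  show ?thesis
  proof (cases "periodic h")
    case True
    note ch = cmp_und_poly_periodic[OF True]
    have "admissible D r a c s b d h \<longleftrightarrow> (\<forall>i. ct (h i) = h i) \<and> (\<forall>i. \<forall>n<\<mu> i. coeff (h i) n = 0) \<and>
        (\<forall>i n. coeff (h i) n \<noteq> 0 \<longrightarrow> [int n = w i] (mod int eKL) \<and> (n < s i \<or> orb.special i n))"
      unfolding admissible_def mu range_cutoff monom_dvd_iff special_iff w_def using True by (auto simp: periodic_def)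
    moreover have "und_poly D h \<in> carrier S \<longleftrightarrow> (\<forall>i. ct (h i) = h i)" by (simp add: S_carrier_cmp ch)
    moreover have "weight w (und_poly D h) \<longleftrightarrow> (\<forall>i n. coeff (h i) n \<noteq> 0 \<longrightarrow> [int n = w i] (mod int eKL))"
      if "und_poly D h \<in> carrier S" unfolding weight_iff[OF per_w that] ch using True by simp
    ultimately show ?thesis using True unfolding V_def normal_def mem_Collect_eq ch by blast
  next
    case False
    then show ?thesis by (auto simp: admissible_def periodic_def)
  qed
qed

lemma und_poly_cmp: "und_poly D (\<lambda>i. cmp i x) = x"
proof (rule cmp_eqI)
  fix i
  show "cmp i (und_poly D (\<lambda>i. cmp i x)) = cmp i x"
    unfolding cmp_und_poly using cmp_cong[of "i mod int f" i] by simp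
qed

lemma admissible_cmp: "x \<in> V \<Longrightarrow> normal x \<Longrightarrow> admissible D r a c s b d (\<lambda>i. cmp i x)"
  unfolding admissible_iff und_poly_cmp using weight_iff[OF per_w VD(1)] VD(2) by blast

end

section \<open>Extensions of rank one modules\<close>

context breuil_setting
begin

lemma is_breuilD:
  assumes "is_breuil D P"
  shows "module S P" "submodule S (Fil P) P" "\<And>x. x \<in> carrier P \<Longrightarrow> monom 1 e \<odot>\<^bsub>P\<^esub> x \<in> Fil P"
    "\<And>x. x \<in> Fil P \<Longrightarrow> phi1 P x \<in> carrier P"
    "\<And>x y. x \<in> Fil P \<Longrightarrow> y \<in> Fil P \<Longrightarrow> phi1 P (x \<oplus>\<^bsub>P\<^esub> y) = phi1 P x \<oplus>\<^bsub>P\<^esub> phi1 P y"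
    "\<And>q x. q \<in> carrier S \<Longrightarrow> x \<in> Fil P \<Longrightarrow> phi1 P (q \<odot>\<^bsub>P\<^esub> x) = frob D q \<odot>\<^bsub>P\<^esub> phi1 P x"
    "module.gen_set S P (phi1 P ` Fil P)"
    "\<And>g x. g \<in> Gal D \<Longrightarrow> x \<in> carrier P \<Longrightarrow> desc P g x \<in> carrier P"
    "\<And>g x y. g \<in> Gal D \<Longrightarrow> x \<in> carrier P \<Longrightarrow> y \<in> carrier P \<Longrightarrow> desc P g (x \<oplus>\<^bsub>P\<^esub> y) = desc P g x \<oplus>\<^bsub>P\<^esub> desc P g y"
    "\<And>g x. g \<in> Gal D \<Longrightarrow> x \<in> Fil P \<Longrightarrow> desc P g x \<in> Fil P"
    "\<And>g x. g \<in> Gal D \<Longrightarrow> x \<in> Fil P \<Longrightarrow> desc P g (phi1 P x) = phi1 P (desc P g x)"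
    "\<And>g q x. g \<in> Gal D \<Longrightarrow> q \<in> carrier S \<Longrightarrow> x \<in> carrier P \<Longrightarrow> desc P g (q \<odot>\<^bsub>P\<^esub> x) = gal_S D g q \<odot>\<^bsub>P\<^esub> desc P g x"
    "\<And>g h x. g \<in> Gal D \<Longrightarrow> h \<in> Gal D \<Longrightarrow> x \<in> carrier P \<Longrightarrow> desc P g (desc P h x) = desc P (compose K g h) x"
proof -
  note A1 = assms[unfolded is_breuil_def]
  note A2 = A1[THEN conjunct2] note A3 = A2[THEN conjunct2] note A4 = A3[THEN conjunct2]
  note A5 = A4[THEN conjunct2] note A6 = A5[THEN conjunct2] note A7 = A6[THEN conjunct2]
  note A8 = A7[THEN conjunct2] note A9 = A8[THEN conjunct2] note A10 = A9[THEN conjunct2]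
  show "module S P" by (rule A1[THEN conjunct1])
  show "submodule S (Fil P) P" by (rule A3[THEN conjunct1])
  show "monom 1 e \<odot>\<^bsub>P\<^esub> x \<in> Fil P" if "x \<in> carrier P" for x by (rule bspec[OF A4[THEN conjunct1] that])
  show "phi1 P x \<in> carrier P" if "x \<in> Fil P" for x by (rule funcset_mem[OF A5[THEN conjunct1] that])
  show "phi1 P (x \<oplus>\<^bsub>P\<^esub> y) = phi1 P x \<oplus>\<^bsub>P\<^esub> phi1 P y" if "x \<in> Fil P" "y \<in> Fil P" for x y
    by (rule bspec[OF bspec[OF A6[THEN conjunct1] that(1)] that(2)])
  show "phi1 P (q \<odot>\<^bsub>P\<^esub> x) = frob D q \<odot>\<^bsub>P\<^esub> phi1 P x" if "q \<in> carrier S" "x \<in> Fil P" for q x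
    by (rule bspec[OF bspec[OF A7[THEN conjunct1] that(1)] that(2)])
  show "module.gen_set S P (phi1 P ` Fil P)" by (rule A8[THEN conjunct1])
  show "desc P g (desc P h x) = desc P (compose K g h) x" if "g \<in> Gal D" "h \<in> Gal D" "x \<in> carrier P" for g h x
    by (rule bspec[OF bspec[OF bspec[OF A10[THEN conjunct1] that(1)] that(2)] that(3)])
  fix g assume g: "g \<in> Gal D"
  note B1 = bspec[OF A9[THEN conjunct1] g]
  note B2 = B1[THEN conjunct2] note B3 = B2[THEN conjunct2] note B4 = B3[THEN conjunct2] note B5 = B4[THEN conjunct2]
  show "desc P g x \<in> carrier P" if "x \<in> carrier P" for x by (rule bij_betw_apply[OF B1[THEN conjunct1] that])
  show "desc P g (x \<oplus>\<^bsub>P\<^esub> y) = desc P g x \<oplus>\<^bsub>P\<^esub> desc P g y" if "x \<in> carrier P" "y \<in> carrier P" for x y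
    by (rule bspec[OF bspec[OF B2[THEN conjunct1] that(1)] that(2)])
  show "desc P g x \<in> Fil P" if "x \<in> Fil P" for x by (rule subsetD[OF B3[THEN conjunct1] imageI[OF that]])
  show "desc P g (phi1 P x) = phi1 P (desc P g x)" if "x \<in> Fil P" for x by (rule bspec[OF B4[THEN conjunct1] that])
  show "desc P g (q \<odot>\<^bsub>P\<^esub> x) = gal_S D g q \<odot>\<^bsub>P\<^esub> desc P g x" if "q \<in> carrier S" "x \<in> carrier P" for q x
    by (rule bspec[OF bspec[OF B5[THEN conjunct2] that(1)] that(2)])
qed

lemma breuil_homD:
  assumes "\<theta> \<in> breuil_hom D A B"
  shows "\<And>x. x \<in> carrier A \<Longrightarrow> \<theta> x \<in> carrier B"
    "\<And>x y. x \<in> carrier A \<Longrightarrow> y \<in> carrier A \<Longrightarrow> \<theta> (x \<oplus>\<^bsub>A\<^esub> y) = \<theta> x \<oplus>\<^bsub>B\<^esub> \<theta> y"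
    "\<And>q x. q \<in> carrier S \<Longrightarrow> x \<in> carrier A \<Longrightarrow> \<theta> (q \<odot>\<^bsub>A\<^esub> x) = q \<odot>\<^bsub>B\<^esub> \<theta> x"
    "\<And>x. x \<in> Fil A \<Longrightarrow> \<theta> x \<in> Fil B"
    "\<And>x. x \<in> Fil A \<Longrightarrow> \<theta> (phi1 A x) = phi1 B (\<theta> x)"
    "\<And>g x. g \<in> Gal D \<Longrightarrow> x \<in> carrier A \<Longrightarrow> \<theta> (desc A g x) = desc B g (\<theta> x)"
  using assms by (auto simp: breuil_hom_def LinearCombinations.module_hom_def)

lemma breuil_homI:
  assumes "\<And>x. x \<in> carrier A \<Longrightarrow> \<theta> x \<in> carrier B"
    "\<And>x y. x \<in> carrier A \<Longrightarrow> y \<in> carrier A \<Longrightarrow> \<theta> (x \<oplus>\<^bsub>A\<^esub> y) = \<theta> x \<oplus>\<^bsub>B\<^esub> \<theta> y"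
    "\<And>q x. q \<in> carrier S \<Longrightarrow> x \<in> carrier A \<Longrightarrow> \<theta> (q \<odot>\<^bsub>A\<^esub> x) = q \<odot>\<^bsub>B\<^esub> \<theta> x"
    "\<And>x. x \<in> Fil A \<Longrightarrow> \<theta> x \<in> Fil B"
    "\<And>x. x \<in> Fil A \<Longrightarrow> \<theta> (phi1 A x) = phi1 B (\<theta> x)"
    "\<And>g x. g \<in> Gal D \<Longrightarrow> x \<in> carrier A \<Longrightarrow> \<theta> (desc A g x) = desc B g (\<theta> x)"
  shows "\<theta> \<in> breuil_hom D A B"
  using assms by (auto simp: breuil_hom_def LinearCombinations.module_hom_def)

lemma submoduleD:
  assumes "submodule S F P"
  shows "F \<subseteq> carrier P" "\<And>x y. x \<in> F \<Longrightarrow> y \<in> F \<Longrightarrow> x \<oplus>\<^bsub>P\<^esub> y \<in> F" "\<zero>\<^bsub>P\<^esub> \<in> F"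
    "\<And>q x. q \<in> carrier S \<Longrightarrow> x \<in> F \<Longrightarrow> q \<odot>\<^bsub>P\<^esub> x \<in> F"
  using assms unfolding submodule_def by auto

text \<open>Needed for inverse maps: \<open>inv_into\<close> agrees with the inverse written in
  coordinates only on the carrier.\<close>

lemma breuil_hom_cong:
  assumes A: "is_breuil D A" and th: "\<theta> \<in> breuil_hom D A B" and eq: "\<And>x. x \<in> carrier A \<Longrightarrow> \<theta>' x = \<theta> x"
  shows "\<theta>' \<in> breuil_hom D A B"
proof -
  note a = is_breuilD[OF A] and t = breuil_homD[OF th] and f = submoduleD[OF is_breuilD(2)[OF A]]
  interpret A: Module.module S A by (rule a(1))
  have Fc: "x \<in> Fil A \<Longrightarrow> x \<in> carrier A" for x using f(1) by blast
  show ?thesis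
    by (rule breuil_homI) (simp_all add: eq Fc t a(4,8))
qed

end

locale breuil_ext = breuil_pair D r s a b c d
  for D :: "('a::{alg_closed_field,field_char_0}, 'k::field, 'e::field, 't::comm_ring_1) datum"
    and r s a b c d +
  fixes X :: "('a, 't, 't poly, 'p, 't poly) extension"
  assumes ext: "is_extension D M N X"
begin

abbreviation "P \<equiv> Mid X"
abbreviation pl (infixl "\<boxplus>" 65) where "x \<boxplus> y \<equiv> x \<oplus>\<^bsub>P\<^esub> y"
abbreviation sm (infixr "\<boxdot>" 75) where "q \<boxdot> y \<equiv> q \<odot>\<^bsub>P\<^esub> y"

lemma brP: "is_breuil D P" and inc: "Inc X \<in> breuil_hom D N P" and prj: "Proj X \<in> breuil_hom D P M"
  using ext by (auto simp: is_extension_def)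

lemmas bP = is_breuilD[OF brP]
lemmas fP = submoduleD[OF bP(2)]

sublocale P: Module.module S P by (rule bP(1))

lemma FilP: "x \<in> Fil P \<Longrightarrow> x \<in> carrier P"
  using fP(1) by blast

lemma sm_simps:
  "q \<in> carrier S \<Longrightarrow> q' \<in> carrier S \<Longrightarrow> x \<in> carrier P \<Longrightarrow> (q + q') \<boxdot> x = q \<boxdot> x \<boxplus> q' \<boxdot> x"
  "q \<in> carrier S \<Longrightarrow> x \<in> carrier P \<Longrightarrow> y \<in> carrier P \<Longrightarrow> q \<boxdot> (x \<boxplus> y) = q \<boxdot> x \<boxplus> q \<boxdot> y"
  "q \<in> carrier S \<Longrightarrow> q' \<in> carrier S \<Longrightarrow> x \<in> carrier P \<Longrightarrow> (q \<star> q') \<boxdot> x = q \<boxdot> q' \<boxdot> x"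
  "x \<in> carrier P \<Longrightarrow> 1 \<boxdot> x = x"
  "x \<in> carrier P \<Longrightarrow> 0 \<boxdot> x = \<zero>\<^bsub>P\<^esub>"
  using P.smult_l_distr[of q q' x] P.smult_r_distr[of q x y] P.smult_assoc1[of q q' x] P.smult_one[of x] P.smult_l_null[of x]
  by simp_all

lemma incD:
  "y \<in> carrier S \<Longrightarrow> Inc X y \<in> carrier P"
  "x \<in> carrier S \<Longrightarrow> y \<in> carrier S \<Longrightarrow> Inc X (x + y) = Inc X x \<boxplus> Inc X y"
  "q \<in> carrier S \<Longrightarrow> y \<in> carrier S \<Longrightarrow> Inc X (q \<star> y) = q \<boxdot> Inc X y"
  "y \<in> carrier S \<Longrightarrow> Inc X (y \<star> us) \<in> Fil P"
  "y \<in> carrier S \<Longrightarrow> phi1 P (Inc X (y \<star> us)) = Inc X (frob D y \<star> ub)"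
  "g \<in> Gal D \<Longrightarrow> y \<in> carrier S \<Longrightarrow> desc P g (Inc X y) = Inc X (gal_S D g y \<star> eta_pow D d g)"
proof -
  note i = breuil_homD[OF inc, unfolded rank1_simps]
  show "y \<in> carrier S \<Longrightarrow> Inc X y \<in> carrier P" by (rule i(1))
  show "x \<in> carrier S \<Longrightarrow> y \<in> carrier S \<Longrightarrow> Inc X (x + y) = Inc X x \<boxplus> Inc X y" by (rule i(2))
  show "q \<in> carrier S \<Longrightarrow> y \<in> carrier S \<Longrightarrow> Inc X (q \<star> y) = q \<boxdot> Inc X y" by (rule i(3))
  show "y \<in> carrier S \<Longrightarrow> Inc X (y \<star> us) \<in> Fil P" by (rule i(4)) auto
  show "phi1 P (Inc X (y \<star> us)) = Inc X (frob D y \<star> ub)" if y: "y \<in> carrier S"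
  proof -
    have "Inc X (phi1 N (y \<star> us)) = phi1 P (Inc X (y \<star> us))" by (rule i(5)) (use y in auto)
    then show ?thesis unfolding rank1_phi1[OF rN y] by (rule sym)
  qed
  show "g \<in> Gal D \<Longrightarrow> y \<in> carrier S \<Longrightarrow> desc P g (Inc X y) = Inc X (gal_S D g y \<star> eta_pow D d g)"
    by (rule i(6)[symmetric])
qed

lemma prjD:
  "x \<in> carrier P \<Longrightarrow> Proj X x \<in> carrier S"
  "x \<in> carrier P \<Longrightarrow> y \<in> carrier P \<Longrightarrow> Proj X (x \<boxplus> y) = Proj X x + Proj X y"
  "q \<in> carrier S \<Longrightarrow> x \<in> carrier P \<Longrightarrow> Proj X (q \<boxdot> x) = q \<star> Proj X x"
  "x \<in> Fil P \<Longrightarrow> \<exists>q\<in>carrier S. Proj X x = q \<star> ur"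
  "x \<in> Fil P \<Longrightarrow> q \<in> carrier S \<Longrightarrow> Proj X x = q \<star> ur \<Longrightarrow> Proj X (phi1 P x) = frob D q \<star> ua"
  "g \<in> Gal D \<Longrightarrow> x \<in> carrier P \<Longrightarrow> Proj X (desc P g x) = gal_S D g (Proj X x) \<star> eta_pow D c g"
proof -
  note i = breuil_homD[OF prj, unfolded rank1_simps]
  show "x \<in> carrier P \<Longrightarrow> Proj X x \<in> carrier S" by (rule i(1))
  show "x \<in> carrier P \<Longrightarrow> y \<in> carrier P \<Longrightarrow> Proj X (x \<boxplus> y) = Proj X x + Proj X y" by (rule i(2))
  show "q \<in> carrier S \<Longrightarrow> x \<in> carrier P \<Longrightarrow> Proj X (q \<boxdot> x) = q \<star> Proj X x" by (rule i(3))
  show "x \<in> Fil P \<Longrightarrow> \<exists>q\<in>carrier S. Proj X x = q \<star> ur" using i(4)[of x] by blast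
  show "x \<in> Fil P \<Longrightarrow> q \<in> carrier S \<Longrightarrow> Proj X x = q \<star> ur \<Longrightarrow> Proj X (phi1 P x) = frob D q \<star> ua"
    using i(5)[of x] rank1_phi1[OF rM, of q] by simp
  show "g \<in> Gal D \<Longrightarrow> x \<in> carrier P \<Longrightarrow> Proj X (desc P g x) = gal_S D g (Proj X x) \<star> eta_pow D c g"
    by (rule i(6))
qed

lemma Inc_inj: "x \<in> carrier S \<Longrightarrow> y \<in> carrier S \<Longrightarrow> Inc X x = Inc X y \<Longrightarrow> x = y"
  using ext inj_onD[of "Inc X" "carrier S" x y] by (simp add: is_extension_def rank1_simps)

lemma Proj_Inc: "y \<in> carrier S \<Longrightarrow> Proj X (Inc X y) = 0"
  using ext by (auto simp: is_extension_def rank1_simps)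

lemma Proj_0D: "x \<in> carrier P \<Longrightarrow> Proj X x = 0 \<Longrightarrow> \<exists>y\<in>carrier S. x = Inc X y"
  using ext by (auto simp: is_extension_def rank1_simps)

lemma Proj_surj: "q \<in> carrier S \<Longrightarrow> \<exists>x\<in>carrier P. Proj X x = q"
  proof -
  assume "q \<in> carrier S"
  then have "q \<in> Proj X ` carrier P" using ext by (simp add: is_extension_def rank1_simps)
  then show ?thesis by blast
qed

lemma Inc_0: "Inc X 0 = \<zero>\<^bsub>P\<^esub>"
  using incD(3)[of 0 0] sm_simps(5)[OF incD(1)[of 0]] by simp

lemma Proj_eqD:
  assumes x: "x \<in> carrier P" and y: "y \<in> carrier P" and eq: "Proj X x = Proj X y"
  shows "\<exists>v\<in>carrier S. x = y \<boxplus> Inc X v"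
proof -
  have m: "[:-1:] \<boxdot> y \<in> carrier P" using y by simp
  have "(- 1 :: 't poly) \<star> Proj X y = - Proj X y"
    using S_distrib(3)[of 0 1 "Proj X y"] prjD(1)[OF y] by simp
  moreover have "[:-1:] = (- 1 :: 't poly)" by (simp add: one_pCons)
  ultimately have "[:-1:] \<star> Proj X y = - Proj X y" by simp
  then have "Proj X (x \<boxplus> [:-1:] \<boxdot> y) = 0" using x y m eq by (simp add: prjD)
  then obtain v where v: "v \<in> carrier S" "x \<boxplus> [:-1:] \<boxdot> y = Inc X v" using Proj_0D[OF P.a_closed[OF x m]] by blast
  have z: "y \<boxplus> [:-1:] \<boxdot> y = \<zero>\<^bsub>P\<^esub>"
  proof -
    have "y \<boxplus> [:-1:] \<boxdot> y = (1 + [:-1:]) \<boxdot> y" using y by (simp only: sm_simps S_one S_const)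
    also have "1 + [:-1:] = (0 :: 't poly)" by (simp add: one_pCons)
    finally show ?thesis using sm_simps(5)[OF y] by simp
  qed
  have "y \<boxplus> Inc X v = x \<boxplus> (y \<boxplus> [:-1:] \<boxdot> y)"
    unfolding v(2)[symmetric] using x y m by (simp add: P.a_ac)
  then have "x = y \<boxplus> Inc X v" using x z by simp
  then show ?thesis using v(1) by blast
qed

lemma Inc_cancel:
  assumes x: "x \<in> carrier P" and y: "y \<in> carrier S" "y' \<in> carrier S" and eq: "x \<boxplus> Inc X y = x \<boxplus> Inc X y'"
  shows "y = y'"
  using P.M.add.right_cancel[of x "Inc X y" "Inc X y'"] P.M.a_comm[of x] x eq incD(1)[OF y(1)] incD(1)[OF y(2)] Inc_inj[OF y] by simp

text \<open>\<open>phi1\<close> of such an element projects to 0, so it is again an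
  \<open>Inc X z\<close>. Semilinearity relates z to the known \<open>phi1\<close> on u^s N for all
  multiples that fall there, which forces divisibility by u^s.\<close>

lemma Inc_Fil:
  assumes y: "y \<in> carrier S" and Fl: "Inc X y \<in> Fil P"
  shows "\<exists>v\<in>carrier S. y = v \<star> us"
proof -
  have "Proj X (phi1 P (Inc X y)) = frob D 0 \<star> ua"
    by (rule prjD(5)[OF Fl]) (use y in \<open>simp_all add: Proj_Inc\<close>)
  then obtain z where z: "z \<in> carrier S" "phi1 P (Inc X y) = Inc X z" using Proj_0D[OF bP(4)[OF Fl]] by auto
  show ?thesis
  proof (rule u_pow_dvd_if_frob_compatible[OF sd(1,4,2,5) y])
    fix w v assume w: "w \<in> carrier S" and v: "v \<in> carrier S" and eq: "w \<star> y = v \<star> us"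
    have "Inc X (frob D w \<star> z) = phi1 P (w \<boxdot> Inc X y)" using z Fl w by (simp add: incD bP(6))
    also have "w \<boxdot> Inc X y = Inc X (v \<star> us)" using incD(3)[OF w y] eq by simp
    also have "phi1 P \<dots> = Inc X (frob D v \<star> ub)" by (rule incD(5)[OF v])
    finally show "frob D w \<star> z = frob D v \<star> ub" by (rule Inc_inj[rotated 2]) auto
  qed
qed

text \<open>The q for which q u^r lifts to the filtration form an ideal. If all of them had zero
  constant term at i, then \<open>phi1\<close> would take values in the proper submodule of elements
  whose projection has zero constant term at i + 1, against generation.\<close>

lemma ur_lift: "\<exists>z\<in>Fil P. Proj X z = ur"
proof -
  define I where "I = {q \<in> carrier S. \<exists>z\<in>Fil P. Proj X z = q \<star> ur}"
  have "1 \<in> I"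
  proof (rule one_in_ideal)
    show "I \<subseteq> carrier S" by (auto simp: I_def)
    show "0 \<in> I" using fP(3) Inc_0 Proj_Inc[of 0] by (auto simp: I_def intro!: bexI[of _ "\<zero>\<^bsub>P\<^esub>"])
    show "q + q' \<in> I" if qI: "q \<in> I" "q' \<in> I" for q q'
    proof -
      obtain z z' where "z \<in> Fil P" "Proj X z = q \<star> ur" "z' \<in> Fil P" "Proj X z' = q' \<star> ur" "q \<in> carrier S" "q' \<in> carrier S"
        using qI unfolding I_def by blast
      then show ?thesis unfolding I_def
        by (intro CollectI conjI S_add bexI[of _ "z \<boxplus> z'"] fP(2)) (simp_all only: prjD FilP S_distrib)
    qed
    show "q' \<star> q \<in> I" if qI: "q' \<in> carrier S" "q \<in> I" for q' q
    proof -
      obtain z where "z \<in> Fil P" "Proj X z = q \<star> ur" "q \<in> carrier S"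
        using qI unfolding I_def by blast
      then show ?thesis unfolding I_def using qI(1)
        by (intro CollectI conjI S_mult_S bexI[of _ "q' \<boxdot> z"] fP(4)) (simp_all add: prjD FilP S_assoc)
    qed
    show "\<exists>q\<in>I. coeff (cmp i q) 0 \<noteq> 0" for i
    proof (rule ccontr)
      assume neg: "\<not> ?thesis"
      define Q where "Q = {x \<in> carrier P. coeff (cmp (i + 1) (Proj X x)) 0 = 0}"
      have "submodule S Q P"
        unfolding submodule_def
      proof (intro conjI P.module_axioms)
        show "Q \<subseteq> carrier P" by (auto simp: Q_def)
        show "\<forall>v w. v \<in> Q \<longrightarrow> w \<in> Q \<longrightarrow> v \<boxplus> w \<in> Q" by (simp add: Q_def prjD cmp_add)
        show "\<zero>\<^bsub>P\<^esub> \<in> Q" using Proj_Inc[of 0] Inc_0 by (simp add: Q_def)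
        show "\<forall>q v. q \<in> carrier S \<longrightarrow> v \<in> Q \<longrightarrow> q \<boxdot> v \<in> Q" by (simp add: Q_def prjD coeff_0_S_mult)
      qed
      moreover have "phi1 P ` Fil P \<subseteq> Q"
      proof
        fix y assume "y \<in> phi1 P ` Fil P"
        then obtain x where x: "x \<in> Fil P" "y = phi1 P x" by blast
        obtain q where q: "q \<in> carrier S" "Proj X x = q \<star> ur" using prjD(4)[OF x(1)] by blast
        then have "coeff (cmp i q) 0 = 0" using neg x(1) by (auto simp: I_def)
        then show "y \<in> Q" unfolding Q_def x(2) using bP(4)[OF x(1)] prjD(5)[OF x(1) q] by (simp add: coeff_0_S_mult coeff_0_frob)
      qed
      ultimately have "P.span (phi1 P ` Fil P) \<subseteq> Q" by (rule P.span_is_subset[rotated])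
      then have "carrier P \<subseteq> Q" using bP(7) by simp
      moreover obtain x where "x \<in> carrier P" "Proj X x = 1" using Proj_surj[OF S_one] by blast
      ultimately show False unfolding Q_def by auto
    qed
  qed
  then obtain z where "z \<in> Fil P" "Proj X z = 1 \<star> ur" unfolding I_def by blast
  then show ?thesis using S_one_mult(1)[OF rd(7)] by auto
qed

lemma desc_0: "g \<in> Gal D \<Longrightarrow> desc P g \<zero>\<^bsub>P\<^esub> = \<zero>\<^bsub>P\<^esub>"
  using bP(12)[of g 0 "\<zero>\<^bsub>P\<^esub>"] bP(8)[of g "\<zero>\<^bsub>P\<^esub>"] by (simp add: sm_simps gal_S_0)

lemma desc_finsum:
  assumes g: "g \<in> Gal D" and "finite A" and "F \<in> A \<rightarrow> carrier P"
  shows "desc P g (finsum P F A) = finsum P (\<lambda>i. desc P g (F i)) A"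
  using assms(2,3)
proof (induction A rule: finite_induct)
  case empty
  then show ?case by (simp add: desc_0[OF g])
next
  case (insert i A)
  have F: "F i \<in> carrier P" "F \<in> A \<rightarrow> carrier P" using insert.prems by auto
  have "(\<lambda>i. desc P g (F i)) \<in> A \<rightarrow> carrier P" "desc P g (F i) \<in> carrier P" using F bP(8)[OF g] by auto
  then show ?case using insert F by (simp add: bP(9)[OF g])
qed

lemma Proj_finsum:
  assumes "finite A" and "F \<in> A \<rightarrow> carrier P"
  shows "Proj X (finsum P F A) = (\<Sum>i\<in>A. Proj X (F i))"
  using assms
proof (induction A rule: finite_induct)
  case empty
  then show ?case using Proj_Inc[of 0] Inc_0 by simp
next
  case (insert i A)
  have F: "F i \<in> carrier P" "F \<in> A \<rightarrow> carrier P" using insert.prems by auto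
  then show ?case using insert by (simp add: prjD)
qed

lemma Fil_finsum:
  assumes "finite A" and "F \<in> A \<rightarrow> Fil P"
  shows "finsum P F A \<in> Fil P"
  using assms
proof (induction A rule: finite_induct)
  case empty
  then show ?case using fP(3) by simp
next
  case (insert i A)
  have F: "F i \<in> Fil P" "F \<in> A \<rightarrow> Fil P" using insert.prems by auto
  have "F \<in> A \<rightarrow> carrier P" using F(2) FilP by auto
  then show ?case using insert F by (simp add: FilP fP(2))
qed

text \<open>Averaging over the Galois group, weighted by an element of trace one of the residue field, makes
  the lift of \<open>u^r\<close> equivariant.\<close>

lemma equivariant_lift: "\<exists>z\<in>Fil P. Proj X z = ur \<and> (\<forall>g\<in>Gal D. desc P g z = eta_pow D rc g \<boxdot> z)"
proof -
  obtain z0 where z0: "z0 \<in> Fil P" "Proj X z0 = ur" using ur_lift by blast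
  obtain y where y: "(\<Sum>g\<in>Gal D. gal_res D g y) = 1" using trace_one by blast
  define nrc where "nrc = (\<lambda>i. - rc i)"
  have pn: "cong_periodic nrc" using per_rc by (simp add: nrc_def cong_periodic_def cong_minus_minus_iff)
  have inv: "eta_pow D nrc g \<star> eta_pow D rc g = 1" if "g \<in> Gal D" for g
    unfolding nrc_def by (rule eta_inverse[OF per_rc that])
  define z1 where "z1 = [:il y:] \<boxdot> z0"
  have z1: "z1 \<in> Fil P" unfolding z1_def using z0(1) by (intro fP(4)) simp_all
  note z1c = FilP[OF z1]
  \<comment> \<open>The inverse character cancels the expected eigenvalue, so summing over g
    projects to the eigenspace.\<close>
  define F where "F = (\<lambda>g. eta_pow D nrc g \<boxdot> desc P g z1)"
  have FF: "F g \<in> Fil P" if "g \<in> Gal D" for g unfolding F_def using that z1 by (intro fP(4) bP(10)) simp_all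
  have Fc: "F \<in> Gal D \<rightarrow> carrier P" using FF FilP by blast
  define z where "z = finsum P F (Gal D)"
  have "Proj X (F g) = [:il (gal_res D g y):] \<star> ur" if g: "g \<in> Gal D" for g
  proof -
    have "Proj X (F g) = eta_pow D nrc g \<star> (gal_S D g ([:il y:] \<star> ur) \<star> eta_pow D c g)"
      unfolding F_def using g z1c FilP[OF z0(1)] by (simp add: prjD bP(8) z1_def z0(2))
    also have "\<dots> = [:il (gal_res D g y):] \<star> (ur \<star> (eta_pow D nrc g \<star> (eta_pow D (\<lambda>i. int (r i)) g \<star> eta_pow D c g)))"
      unfolding gal_S_mult[OF g] gal_S_il[OF g] gal_u_pow[OF rd(1) g] by (simp add: S_ac)
    finally show ?thesis unfolding eta_rc[OF g] inv[OF g] by simp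
  qed
  then have "Proj X z = (\<Sum>g\<in>Gal D. [:il (gal_res D g y):] \<star> ur)"
    unfolding z_def Proj_finsum[OF finite_gal Fc] by simp
  also have "\<dots> = (\<Sum>g\<in>Gal D. [:il (gal_res D g y):]) \<star> ur"
    using finite_gal by (induction rule: finite_induct) (simp_all add: S_distrib)
  also have "(\<Sum>g\<in>Gal D. [:il (gal_res D g y):]) = [:il (\<Sum>g\<in>Gal D. gal_res D g y):]"
    using finite_gal by (induction rule: finite_induct) (simp_all add: il_add)
  also have "\<dots> = 1" by (simp add: y one_pCons)
  finally have Pz: "Proj X z = ur" by simp
  have "desc P h z = eta_pow D rc h \<boxdot> z" if h: "h \<in> Gal D" for h
  proof -
    have step: "desc P h (F g) = eta_pow D rc h \<boxdot> F (compose K h g)" if g: "g \<in> Gal D" for g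
    proof -
      have "gal_S D h (eta_pow D nrc g) = (gal_S D h (eta_pow D nrc g) \<star> eta_pow D nrc h) \<star> eta_pow D rc h"
        unfolding S_assoc inv[OF h] using h by simp
      also have "\<dots> = eta_pow D rc h \<star> eta_pow D nrc (compose K h g)"
        unfolding eta_pow_comp[OF pn h g] by (rule S_comm)
      finally have e: "gal_S D h (eta_pow D nrc g) = eta_pow D rc h \<star> eta_pow D nrc (compose K h g)" .
      have "desc P h (F g) = gal_S D h (eta_pow D nrc g) \<boxdot> desc P (compose K h g) z1"
        unfolding F_def using g h z1c by (simp add: bP(8,12,13))
      then show ?thesis unfolding e F_def using bP(8)[OF gal_comp[OF h g] z1c] by (simp add: sm_simps)
    qed
    have c1: "(\<lambda>g. F (compose K h g)) \<in> Gal D \<rightarrow> carrier P" using Fc gal_comp[OF h] by blast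
    have bij: "compose K h ` Gal D = Gal D" "inj_on (compose K h) (Gal D)" using gal_reindex[OF h] by (auto simp: bij_betw_def)
    have "desc P h z = finsum P (\<lambda>g. desc P h (F g)) (Gal D)" unfolding z_def by (rule desc_finsum[OF h finite_gal Fc])
    also have "\<dots> = finsum P (\<lambda>g. eta_pow D rc h \<boxdot> F (compose K h g)) (Gal D)"
      by (rule P.finsum_cong') (use step c1 in auto)
    also have "\<dots> = eta_pow D rc h \<boxdot> finsum P (\<lambda>g. F (compose K h g)) (Gal D)"
      by (rule P.finsum_smult_ldistr[symmetric, OF finite_gal eta_pow_S c1])
    also have "finsum P (\<lambda>g. F (compose K h g)) (Gal D) = z"
      using P.finsum_reindex[of F "compose K h" "Gal D"] Fc bij by (simp add: z_def)
    finally show ?thesis .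
  qed
  moreover have "z \<in> Fil P" unfolding z_def using FF by (intro Fil_finsum finite_gal) auto
  ultimately show ?thesis using Pz by blast
qed

end

subsection \<open>Frames\<close>

context breuil_pair
begin

text \<open>The product of \<open>ua'\<close> with \<open>phi1\<close> of z serves as m, so the last
  equation reads z = u^r m + h n, and z determines h.\<close>

definition frame :: "('a, 't, 't poly, 'p, 't poly) extension \<Rightarrow> 'p \<Rightarrow> 't poly \<Rightarrow> bool" where
  "frame X z h \<longleftrightarrow> h \<in> carrier S \<and> z \<in> Fil (Mid X) \<and> Proj X z = ur \<and>
     (\<forall>g\<in>Gal D. desc (Mid X) g z = eta_pow D rc g \<odot>\<^bsub>Mid X\<^esub> z) \<and>
     z = ur \<odot>\<^bsub>Mid X\<^esub> (ua' \<odot>\<^bsub>Mid X\<^esub> phi1 (Mid X) z) \<oplus>\<^bsub>Mid X\<^esub> Inc X h"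

text \<open>Turns out to be a coset of \<open>W\<close> in \<open>V\<close> and a complete invariant
  of the extension.\<close>

definition cls :: "('a, 't, 't poly, 'p, 't poly) extension \<Rightarrow> 't poly set" where
  "cls X = {h. \<exists>z. frame X z h}"

end

context breuil_ext
begin

lemma lift_frame:
  assumes z: "z \<in> Fil P" "Proj X z = ur" "\<And>g. g \<in> Gal D \<Longrightarrow> desc P g z = eta_pow D rc g \<boxdot> z"
  shows "\<exists>h. frame X z h"
proof -
  have m: "ua' \<boxdot> phi1 P z \<in> carrier P" using bP(4)[OF z(1)] by simp
  have "Proj X (phi1 P z) = frob D 1 \<star> ua" by (rule prjD(5)[OF z(1)]) (simp_all add: z(2))
  then have "Proj X (ua' \<boxdot> phi1 P z) = 1" using bP(4)[OF z(1)] by (simp add: prjD ua'_ua)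
  then have "Proj X z = Proj X (ur \<boxdot> ua' \<boxdot> phi1 P z)" using m by (simp add: prjD z(2))
  then obtain h where "h \<in> carrier S" "z = ur \<boxdot> ua' \<boxdot> phi1 P z \<boxplus> Inc X h"
    using Proj_eqD[OF FilP[OF z(1)], of "ur \<boxdot> ua' \<boxdot> phi1 P z"] m by auto
  then show ?thesis using z unfolding frame_def by blast
qed

lemma cls_nonempty: "\<exists>h. h \<in> cls X"
  using equivariant_lift lift_frame unfolding cls_def by blast

end

section \<open>Coordinates given by a frame\<close>

locale breuil_frame = breuil_ext D r s a b c d X
  for D :: "('a::{alg_closed_field,field_char_0}, 'k::field, 'e::field, 't::comm_ring_1) datum"
    and r s a b c d and X :: "('a, 't, 't poly, 'p, 't poly) extension" +
  fixes z :: 'p and h :: "'t poly"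
  assumes frame: "frame X z h"
begin

definition m :: 'p where "m = ua' \<boxdot> phi1 P z"

definition mk :: "'t poly \<Rightarrow> 't poly \<Rightarrow> 'p" where "mk x y = x \<boxdot> m \<boxplus> Inc X y"

lemma fr: "h \<in> carrier S" "z \<in> Fil P" "Proj X z = ur" "g \<in> Gal D \<Longrightarrow> desc P g z = eta_pow D rc g \<boxdot> z"
  "z = mk ur h"
  using frame by (auto simp: frame_def m_def mk_def)

lemmas zP = FilP[OF fr(2)]

lemma mP [simp]: "m \<in> carrier P"
  unfolding m_def using bP(4)[OF fr(2)] by simp

lemma ua_m: "ua \<boxdot> m = phi1 P z"
  unfolding m_def using bP(4)[OF fr(2)] ua'_ua by (simp add: sm_simps(4) S_comm[of ua] flip: sm_simps(3))

lemma Proj_m: "Proj X m = 1"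
proof -
  have "Proj X (phi1 P z) = frob D 1 \<star> ua" by (rule prjD(5)[OF fr(2)]) (simp_all add: fr(3))
  then show ?thesis using bP(4)[OF fr(2)] by (simp add: m_def prjD ua'_ua)
qed

lemma desc_m: "g \<in> Gal D \<Longrightarrow> desc P g m = eta_pow D c g \<boxdot> m"
proof -
  assume g: "g \<in> Gal D"
  note ph = bP(4)[OF fr(2)]
  have "desc P g m = ua' \<boxdot> phi1 P (desc P g z)"
    unfolding m_def using g ph by (simp add: bP(11,12) fr(2) gal_und_const[OF per_a'])
  also have "phi1 P (desc P g z) = eta_pow D c g \<boxdot> phi1 P z"
    unfolding fr(4)[OF g] using fr(2) by (simp add: bP(6) frob_eta_rc[OF g])
  finally show ?thesis unfolding m_def using ph by (simp add: S_comm flip: sm_simps(3))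
qed

lemma mk_P [simp]: "x \<in> carrier S \<Longrightarrow> y \<in> carrier S \<Longrightarrow> mk x y \<in> carrier P"
  by (simp add: mk_def incD(1))

lemma Proj_mk [simp]: "x \<in> carrier S \<Longrightarrow> y \<in> carrier S \<Longrightarrow> Proj X (mk x y) = x"
  by (simp add: mk_def prjD incD(1) Proj_m Proj_Inc)

lemma mk_inj: "x \<in> carrier S \<Longrightarrow> y \<in> carrier S \<Longrightarrow> x' \<in> carrier S \<Longrightarrow> y' \<in> carrier S \<Longrightarrow> mk x y = mk x' y' \<Longrightarrow> x = x' \<and> y = y'"
proof -
  assume A: "x \<in> carrier S" "y \<in> carrier S" "x' \<in> carrier S" "y' \<in> carrier S" "mk x y = mk x' y'"
  then have "x = x'" using Proj_mk[of x y] Proj_mk[of x' y'] by simp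
  then show ?thesis using Inc_cancel[OF _ A(2,4), of "x \<boxdot> m"] A by (simp add: mk_def)
qed

lemma mk_add: "x \<in> carrier S \<Longrightarrow> y \<in> carrier S \<Longrightarrow> x' \<in> carrier S \<Longrightarrow> y' \<in> carrier S \<Longrightarrow> mk (x + x') (y + y') = mk x y \<boxplus> mk x' y'"
  by (simp add: mk_def sm_simps incD P.a_ac)

lemma mk_smult: "q \<in> carrier S \<Longrightarrow> x \<in> carrier S \<Longrightarrow> y \<in> carrier S \<Longrightarrow> mk (q \<star> x) (q \<star> y) = q \<boxdot> mk x y"
  by (simp add: mk_def sm_simps incD)

lemma mk_0: "y \<in> carrier S \<Longrightarrow> mk 0 y = Inc X y"
  by (simp add: mk_def sm_simps incD)

lemma mk_desc: "g \<in> Gal D \<Longrightarrow> x \<in> carrier S \<Longrightarrow> y \<in> carrier S \<Longrightarrow>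
    desc P g (mk x y) = mk (gal_S D g x \<star> eta_pow D c g) (gal_S D g y \<star> eta_pow D d g)"
  by (simp add: mk_def bP(9,12) incD(1,6) desc_m sm_simps(3))

lemma mk_Fil_eq: "q \<in> carrier S \<Longrightarrow> y \<in> carrier S \<Longrightarrow> mk (q \<star> ur) (y \<star> us + q \<star> h) = q \<boxdot> z \<boxplus> Inc X (y \<star> us)"
proof -
  assume q: "q \<in> carrier S" and y: "y \<in> carrier S"
  have "mk (q \<star> ur) (y \<star> us + q \<star> h) = mk (q \<star> ur + 0) (q \<star> h + y \<star> us)" by (simp add: add.commute)
  also have "\<dots> = q \<boxdot> mk ur h \<boxplus> mk 0 (y \<star> us)" using q y fr(1) by (simp only: mk_add mk_smult S_mult_S S_zero rd(7))
  finally show ?thesis unfolding fr(5)[symmetric] mk_0[OF S_mult_S] .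
qed

lemma mk_Fil: "q \<in> carrier S \<Longrightarrow> y \<in> carrier S \<Longrightarrow> mk (q \<star> ur) (y \<star> us + q \<star> h) \<in> Fil P"
  unfolding mk_Fil_eq by (intro fP(2,4) incD(4) fr(2))

lemma mk_phi1: "q \<in> carrier S \<Longrightarrow> y \<in> carrier S \<Longrightarrow>
    phi1 P (mk (q \<star> ur) (y \<star> us + q \<star> h)) = mk (frob D q \<star> ua) (frob D y \<star> ub)"
  unfolding mk_Fil_eq by (simp add: bP(5,6) fP(4) incD(4,5) fr(2) mk_def sm_simps(3) ua_m)

text \<open>x and q z have the same projection, so they differ by an element of the filtration in
  the image of \<open>Inc\<close>, to which \<open>Inc_Fil\<close> applies.\<close>

lemma mk_FilD:
  assumes x: "x \<in> Fil P" and q: "q \<in> carrier S" and eq: "Proj X x = q \<star> ur"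
  shows "\<exists>y\<in>carrier S. x = mk (q \<star> ur) (y \<star> us + q \<star> h)"
proof -
  have qz: "q \<boxdot> z \<in> Fil P" using q by (intro fP(4) fr(2))
  have "Proj X x = Proj X (q \<boxdot> z)" using eq q zP by (simp add: prjD fr(3))
  then obtain v where v: "v \<in> carrier S" "x = q \<boxdot> z \<boxplus> Inc X v" using Proj_eqD[OF FilP[OF x] FilP[OF qz]] by blast
  have nq: "[:-1:] \<boxdot> q \<boxdot> z \<in> Fil P" by (rule fP(4)[OF S_const qz])
  have cz: "[:-1:] \<boxdot> q \<boxdot> z \<boxplus> q \<boxdot> z = \<zero>\<^bsub>P\<^esub>"
  proof -
    have "[:-1:] \<boxdot> q \<boxdot> z \<boxplus> q \<boxdot> z = ([:-1:] + 1) \<boxdot> q \<boxdot> z" using FilP[OF qz] by (simp only: sm_simps S_one S_const)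
    also have "[:-1:] + 1 = (0 :: 't poly)" by (simp add: one_pCons)
    finally show ?thesis using sm_simps(5)[OF FilP[OF qz]] by simp
  qed
  have "Inc X v = ([:-1:] \<boxdot> q \<boxdot> z \<boxplus> q \<boxdot> z) \<boxplus> Inc X v" unfolding cz using incD(1)[OF v(1)] by simp
  also have "\<dots> = [:-1:] \<boxdot> q \<boxdot> z \<boxplus> x" unfolding v(2) using FilP[OF nq] FilP[OF qz] incD(1)[OF v(1)] by (rule P.a_assoc)
  also have "\<dots> \<in> Fil P" by (intro fP(2) nq x)
  finally obtain y where "y \<in> carrier S" "v = y \<star> us" using Inc_Fil[OF v(1)] by blast
  then show ?thesis using v(2) mk_Fil_eq[OF q] by auto
qed

definition co :: "'p \<Rightarrow> 't poly" where "co x = (THE y. y \<in> carrier S \<and> x = mk (Proj X x) y)"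

lemma co_mk [simp]: "x \<in> carrier S \<Longrightarrow> y \<in> carrier S \<Longrightarrow> co (mk x y) = y"
  unfolding co_def by (rule the_equality) (auto dest: mk_inj)

lemma mk_surj: "x \<in> carrier P \<Longrightarrow> \<exists>u\<in>carrier S. \<exists>v\<in>carrier S. x = mk u v"
proof -
  assume x: "x \<in> carrier P"
  have "Proj X x = Proj X (Proj X x \<boxdot> m)" using x by (simp add: prjD Proj_m)
  then obtain v where "v \<in> carrier S" "x = Proj X x \<boxdot> m \<boxplus> Inc X v"
    using Proj_eqD[OF x, of "Proj X x \<boxdot> m"] x by (auto simp: prjD)
  then show ?thesis using prjD(1)[OF x] unfolding mk_def by blast
qed

lemma weight_h: "weight w h"
  unfolding weight_w_iff[OF fr(1)]
proof
  fix g assume g: "g \<in> Gal D"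
  have "mk (gal_S D g ur \<star> eta_pow D c g) (gal_S D g h \<star> eta_pow D d g) = desc P g (mk ur h)"
    by (rule mk_desc[OF g rd(7) fr(1), symmetric])
  also have "\<dots> = mk (eta_pow D rc g \<star> ur) (eta_pow D rc g \<star> h)"
    unfolding mk_smult[OF eta_pow_S rd(7) fr(1)] fr(5)[symmetric] by (rule fr(4)[OF g])
  finally show "gal_S D g h \<star> eta_pow D d g = eta_pow D rc g \<star> h"
    using mk_inj[OF S_mult_S S_mult_S S_mult_S S_mult_S] by blast
qed

text \<open>u^e m lies in the filtration, so u^e = q u^r and q h is a multiple of u^s for some q. In
  low degrees q is u^(e - r), hence h has order at least r + s - e.\<close>

lemma h_V: "h \<in> V"
proof -
  have "coeff (cmp i h) n = 0" if n: "n < \<mu> i" for i n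
  proof -
    have ue: "monom 1 e \<in> carrier S"
      unfolding S_carrier using e_less_T[of e] by (intro poly_eqI) (simp add: coeff_poly_cutoff coeff_monom)
    have "monom 1 e \<boxdot> mk 1 0 \<in> Fil P" by (intro bP(3) mk_P S_one S_zero)
    then have mF: "mk (monom 1 e) 0 \<in> Fil P" using mk_smult[OF ue S_one S_zero] ue by simp
    obtain q where q: "q \<in> carrier S" "monom 1 e = q \<star> ur" using prjD(4)[OF mF] ue by auto
    then obtain y where y: "y \<in> carrier S" "mk (monom 1 e) 0 = mk (q \<star> ur) (y \<star> us + q \<star> h)"
      using mk_FilD[OF mF q(1)] ue by auto
    have 0: "y \<star> us + q \<star> h = 0"
      using mk_inj[OF ue S_zero S_mult_S S_add[OF S_mult_S S_mult_S] y(2)] by simp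
    \<comment> \<open>The equation q u^r = u^e determines q only below T - r i, which covers the
      degrees used.\<close>
    have qc: "coeff (cmp i q) k = (if k = e - r i then 1 else 0)" if k: "k < T - r i" for k
    proof -
      have "coeff (cmp i (q \<star> ur)) (k + r i) = coeff (cmp i q) k"
        unfolding coeff_mult_u_pow[OF rd(1)] using k by auto
      moreover have "coeff (cmp i (monom 1 e)) (k + r i) = (if k = e - r i then 1 else 0)"
        using rd(4)[of i] by (auto simp: coeff_cmp coeff_monom)
      ultimately show ?thesis using q(2) by simp
    qed
    have n2: "n + (e - r i) < s i" using n rd(4)[of i] by (simp add: \<mu>_def)
    then have n3: "n + (e - r i) < T - r i" "n + (e - r i) < T" using sd(4)[of i] rd(4)[of i] T_bounds ramK_pos by linarith+
    have "coeff (cmp i (y \<star> us)) (n + (e - r i)) = 0" unfolding coeff_mult_u_pow[OF sd(1)] using n2 by simp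
    then have "0 = coeff (cmp i (q \<star> h)) (n + (e - r i))"
      using arg_cong[OF 0, of "\<lambda>x. coeff (cmp i x) (n + (e - r i))"] by (simp add: cmp_add)
    also have "\<dots> = (\<Sum>k\<le>n + (e - r i). coeff (cmp i q) k * coeff (cmp i h) (n + (e - r i) - k))"
      unfolding cmp_S_mult using n3(2) by (simp add: coeff_poly_cutoff coeff_mult)
    also have "\<dots> = (\<Sum>k\<le>n + (e - r i). if k = e - r i then coeff (cmp i h) n else 0)"
      by (rule sum.cong) (use n3 in \<open>auto simp: qc\<close>)
    finally show ?thesis by simp
  qed
  then show ?thesis using weight_h fr(1) by (simp add: V_def)
qed

text \<open>Moving z by y u^s n moves m by (b/a) \<phi>(y) n, hence u^r m by the term that
  \<open>Lmap y\<close> subtracts.\<close>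

lemma frame_shift:
  assumes y: "y \<in> carrier S" and wt: "weight w (y \<star> us)"
  shows "frame X (z \<boxplus> Inc X (y \<star> us)) (h + Lmap y)"
  unfolding frame_def
proof (intro conjI ballI)
  show "h + Lmap y \<in> carrier S" by (intro S_add fr(1) Lmap_S)
  show zF: "z \<boxplus> Inc X (y \<star> us) \<in> Fil P" by (intro fP(2) fr(2) incD(4) y)
  show "Proj X (z \<boxplus> Inc X (y \<star> us)) = ur" by (simp add: prjD zP incD(1) fr(3) Proj_Inc)
  have zeq: "z \<boxplus> Inc X (y \<star> us) = mk ur (h + y \<star> us)"
    using mk_Fil_eq[OF S_one y] fr(1) zP by (simp add: add.commute sm_simps)
  have ph: "phi1 P (mk ur (h + y \<star> us)) = mk ua (frob D y \<star> ub)"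
    using mk_phi1[OF S_one y] fr(1) by (simp add: add.commute)
  show "desc P g (z \<boxplus> Inc X (y \<star> us)) = eta_pow D rc g \<boxdot> (z \<boxplus> Inc X (y \<star> us))" if g: "g \<in> Gal D" for g
  proof -
    have "gal_S D g (y \<star> us) \<star> eta_pow D d g = eta_pow D rc g \<star> (y \<star> us)"
      using wt g unfolding weight_w_iff[OF S_mult_S] by blast
    then show ?thesis using g zP by (simp add: bP(9) incD(1,3,6) fr(4) sm_simps(2))
  qed
  have "ur \<boxdot> ua' \<boxdot> mk ua (frob D y \<star> ub) = mk ur ((frob D y \<star> und_const D \<kappa>) \<star> ur)"
  proof -
    have e: "ua' \<star> (frob D y \<star> ub) = frob D y \<star> und_const D \<kappa>"
      unfolding ua'_ub[symmetric] by (rule S_lcomm)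
    have "ur \<boxdot> ua' \<boxdot> mk ua (frob D y \<star> ub) = ur \<boxdot> mk 1 (frob D y \<star> und_const D \<kappa>)"
      using mk_smult[of ua' ua "frob D y \<star> ub"] by (simp add: e ua'_ua)
    also have "\<dots> = mk ur (ur \<star> (frob D y \<star> und_const D \<kappa>))"
      using mk_smult[OF rd(7) S_one, of "frob D y \<star> und_const D \<kappa>"] by simp
    finally show ?thesis by (simp add: S_comm)
  qed
  moreover have "mk ur x \<boxplus> Inc X x' = mk ur (x + x')" if "x \<in> carrier S" "x' \<in> carrier S" for x x'
    using mk_add[OF rd(7) that(1) S_zero that(2)] that by (simp add: mk_0)
  ultimately show "z \<boxplus> Inc X (y \<star> us) = ur \<boxdot> (ua' \<boxdot> phi1 P (z \<boxplus> Inc X (y \<star> us))) \<boxplus> Inc X (h + Lmap y)"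
    unfolding zeq ph by (simp add: fr(1) S_add Lmap_def S_diff algebra_simps)
qed

text \<open>Two equivariant lifts of u^r differ by an equivariant element y u^s n, so
  \<open>frame_shift\<close> computes the second parameter, and injectivity of \<open>Inc\<close>
  identifies it.\<close>

lemma frame_unique:
  assumes "frame X z' h'"
  shows "h' - h \<in> W"
proof -
  interpret F: breuil_frame D r s a b c d X z' h' by unfold_locales (rule assms)
  have "\<exists>y\<in>carrier S. z' = mk (1 \<star> ur) (y \<star> us + 1 \<star> h)"
    by (rule mk_FilD[OF F.fr(2) S_one]) (simp add: F.fr(3))
  then obtain y where y: "y \<in> carrier S" "z' = z \<boxplus> Inc X (y \<star> us)"
    using mk_Fil_eq[OF S_one] zP by (auto simp: sm_simps)
  have wt: "weight w (y \<star> us)"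
    unfolding weight_w_iff[OF S_mult_S]
  proof
    fix g assume g: "g \<in> Gal D"
    have "desc P g z \<boxplus> Inc X (gal_S D g (y \<star> us) \<star> eta_pow D d g) = desc P g z'"
      unfolding y(2) using g zP by (simp add: bP(9) incD(1,6))
    also have "\<dots> = desc P g z \<boxplus> Inc X (eta_pow D rc g \<star> (y \<star> us))"
      using F.fr(4)[OF g] fr(4)[OF g] zP unfolding y(2) by (simp add: sm_simps incD(1,3))
    finally show "gal_S D g (y \<star> us) \<star> eta_pow D d g = eta_pow D rc g \<star> (y \<star> us)"
      by (rule Inc_cancel[rotated 3]) (use g zP bP(8) in auto)
  qed
  have fs: "frame X z' (h + Lmap y)" unfolding y(2) by (rule frame_shift[OF y(1) wt])
  have "ur \<boxdot> (ua' \<boxdot> phi1 P z') \<boxplus> Inc X (h + Lmap y) = ur \<boxdot> (ua' \<boxdot> phi1 P z') \<boxplus> Inc X h'"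
    using fs assms unfolding frame_def by metis
  then have "h + Lmap y = h'"
    by (rule Inc_cancel[rotated 3]) (use bP(4)[OF F.fr(2)] fr(1) F.fr(1) in \<open>auto intro!: S_add\<close>)
  then have "h' - h = Lmap y" by auto
  then show ?thesis using y(1) wt by (auto simp: W_def)
qed

end

context breuil_ext
begin

lemma frame_locale: "frame X z h \<Longrightarrow> breuil_frame D r s a b c d X z h"
  by unfold_locales

lemma cls_V: "h \<in> cls X \<Longrightarrow> h \<in> V"
  unfolding cls_def using breuil_frame.h_V[OF frame_locale] by blast

lemma cls_diff: "h \<in> cls X \<Longrightarrow> h' \<in> cls X \<Longrightarrow> h' - h \<in> W"
  unfolding cls_def using breuil_frame.frame_unique[OF frame_locale] by blast

lemma cls_shift: "h \<in> cls X \<Longrightarrow> x \<in> W \<Longrightarrow> h + x \<in> cls X"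
  unfolding cls_def W_def using breuil_frame.frame_shift[OF frame_locale] by blast

end

subsection \<open>Morphisms of extensions in coordinates\<close>

context breuil_frame
begin

lemma mk_cases:
  assumes "x \<in> carrier P"
  obtains u v where "u \<in> carrier S" "v \<in> carrier S" "x = mk u v"
  using mk_surj[OF assms] by blast

lemma yh_S: "y \<star> us + q \<star> h \<in> carrier S"
  by (intro S_add S_mult_S)

lemma co_S: "x \<in> carrier P \<Longrightarrow> co x \<in> carrier S"
  by (erule mk_cases) simp

lemma co_simps:
  "x \<in> carrier P \<Longrightarrow> y \<in> carrier P \<Longrightarrow> co (x \<boxplus> y) = co x + co y"
  "q \<in> carrier S \<Longrightarrow> x \<in> carrier P \<Longrightarrow> co (q \<boxdot> x) = q \<star> co x"
  "g \<in> Gal D \<Longrightarrow> x \<in> carrier P \<Longrightarrow> co (desc P g x) = gal_S D g (co x) \<star> eta_pow D d g"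
  "n \<in> carrier S \<Longrightarrow> co (Inc X n) = n"
proof -
  show "co (x \<boxplus> y) = co x + co y" if "x \<in> carrier P" "y \<in> carrier P"
    by (rule mk_cases[OF that(1)], rule mk_cases[OF that(2)]) (simp add: S_add flip: mk_add)
  show "co (q \<boxdot> x) = q \<star> co x" if "q \<in> carrier S" "x \<in> carrier P"
    by (rule mk_cases[OF that(2)]) (simp add: that(1) flip: mk_smult)
  show "co (desc P g x) = gal_S D g (co x) \<star> eta_pow D d g" if "g \<in> Gal D" "x \<in> carrier P"
    by (rule mk_cases[OF that(2)]) (simp add: mk_desc[OF that(1)])
  show "n \<in> carrier S \<Longrightarrow> co (Inc X n) = n" by (simp flip: mk_0)
qed

lemma co_Fil:
  assumes x: "x \<in> Fil P" and q: "q \<in> carrier S" "Proj X x = q \<star> ur"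
  shows "\<exists>y\<in>carrier S. co x = y \<star> us + q \<star> h \<and> Proj X (phi1 P x) = frob D q \<star> ua \<and> co (phi1 P x) = frob D y \<star> ub"
proof -
  obtain y where y: "y \<in> carrier S" "x = mk (q \<star> ur) (y \<star> us + q \<star> h)" using mk_FilD[OF x q] by blast
  then show ?thesis by (intro bexI[of _ y]) (simp_all add: mk_phi1[OF q(1)] yh_S)
qed

lemma mk_co: "x \<in> carrier P \<Longrightarrow> mk (Proj X x) (co x) = x"
  by (erule mk_cases) simp

text \<open>In coordinates the pushforward along multiplication by l is (x, y) \<mapsto> (x, l y);
  it respects the filtrations because the parameters correspond. The case l = 1 supplies
  isomorphisms.\<close>

lemma scaled_hom:
  assumes Z: "is_extension D M N Z" "frame Z z' ([:ir l:] \<star> h)"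
  shows "(\<lambda>x. breuil_frame.mk D a Z z' (Proj X x) ([:ir l:] \<star> co x)) \<in> breuil_hom D P (Mid Z)"
proof -
  interpret Z: breuil_frame D r s a b c d Z z' "[:ir l:] \<star> h" using Z by unfold_locales
  let ?\<theta> = "\<lambda>x. Z.mk (Proj X x) ([:ir l:] \<star> co x)"
  have F: "?\<theta> x \<in> Fil (Mid Z) \<and> ?\<theta> (phi1 P x) = phi1 (Mid Z) (?\<theta> x)" if x: "x \<in> Fil P" for x
  proof -
    obtain q where q: "q \<in> carrier S" "Proj X x = q \<star> ur" using prjD(4)[OF x] by blast
    obtain y where y: "y \<in> carrier S" "co x = y \<star> us + q \<star> h" "Proj X (phi1 P x) = frob D q \<star> ua" "co (phi1 P x) = frob D y \<star> ub"
      using co_Fil[OF x q] by blast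
    have "[:ir l:] \<star> (y \<star> us + q \<star> h) = ([:ir l:] \<star> y) \<star> us + q \<star> ([:ir l:] \<star> h)"
      by (simp add: S_distrib S_ac)
    then have t: "?\<theta> x = Z.mk (q \<star> ur) (([:ir l:] \<star> y) \<star> us + q \<star> ([:ir l:] \<star> h))"
      unfolding q(2) y(2) by simp
    show ?thesis unfolding t y(3,4) Z.mk_phi1[OF q(1) S_mult_S] frob_mult frob_const
      using Z.mk_Fil[OF q(1) S_mult_S] by (simp add: S_assoc)
  qed
  show ?thesis
  proof (rule breuil_homI)
    show "?\<theta> x \<in> carrier (Mid Z)" if "x \<in> carrier P" for x using that by (simp add: prjD)
    show "?\<theta> (x \<boxplus> y) = ?\<theta> x \<oplus>\<^bsub>Mid Z\<^esub> ?\<theta> y" if "x \<in> carrier P" "y \<in> carrier P" for x y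
      using that by (simp add: prjD co_simps S_distrib flip: Z.mk_add)
    show "?\<theta> (q \<boxdot> x) = q \<odot>\<^bsub>Mid Z\<^esub> ?\<theta> x" if "q \<in> carrier S" "x \<in> carrier P" for q x
      using that by (simp add: prjD co_simps S_lcomm[of q] flip: Z.mk_smult)
    show "?\<theta> (desc P g x) = desc (Mid Z) g (?\<theta> x)" if g: "g \<in> Gal D" and x: "x \<in> carrier P" for g x
      unfolding Z.mk_desc[OF g prjD(1)[OF x] S_mult_S] prjD(6)[OF g x] co_simps(3)[OF g x] gal_S_mult[OF g, of "[:ir l:]"]
        gal_S_const[OF g] S_assoc ..
  qed (use F in blast)+
qed

text \<open>The converse: a morphism over multiplication by l carries a frame to a frame, since
  frames are expressed through structure that morphisms preserve.\<close>

lemma hom_frame: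
  assumes th: "\<theta> \<in> breuil_hom D P (Mid Z)" "\<And>y. y \<in> carrier S \<Longrightarrow> \<theta> (Inc X y) = Inc Z ([:ir l:] \<star> y)"
    "\<And>x. x \<in> carrier P \<Longrightarrow> Proj Z (\<theta> x) = Proj X x"
  shows "frame Z (\<theta> z) ([:ir l:] \<star> h)"
  unfolding frame_def
proof (intro conjI ballI S_mult_S)
  note t = breuil_homD[OF th(1)]
  show "\<theta> z \<in> Fil (Mid Z)" by (rule t(4)[OF fr(2)])
  show "Proj Z (\<theta> z) = ur" using th(3)[OF zP] fr(3) by simp
  show "desc (Mid Z) g (\<theta> z) = eta_pow D rc g \<odot>\<^bsub>Mid Z\<^esub> \<theta> z" if g: "g \<in> Gal D" for g
    using t(6)[OF g zP] t(3)[OF eta_pow_S zP] fr(4)[OF g] by simp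
  have ph: "phi1 P z \<in> carrier P" by (rule bP(4)[OF fr(2)])
  have "\<theta> z = \<theta> (ur \<boxdot> (ua' \<boxdot> phi1 P z) \<boxplus> Inc X h)" using fr(5) unfolding mk_def m_def by simp
  also have "\<dots> = ur \<odot>\<^bsub>Mid Z\<^esub> (ua' \<odot>\<^bsub>Mid Z\<^esub> phi1 (Mid Z) (\<theta> z)) \<oplus>\<^bsub>Mid Z\<^esub> Inc Z ([:ir l:] \<star> h)"
    using ph incD(1)[OF fr(1)] by (simp add: t(2,3,5) fr(2) th(2)[OF fr(1)])
  finally show "\<theta> z = ur \<odot>\<^bsub>Mid Z\<^esub> (ua' \<odot>\<^bsub>Mid Z\<^esub> phi1 (Mid Z) (\<theta> z)) \<oplus>\<^bsub>Mid Z\<^esub> Inc Z ([:ir l:] \<star> h)" .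
qed

end

context breuil_pair
begin

lemma extI: "is_extension D M N X \<Longrightarrow> breuil_ext D r s a b c d X"
  by unfold_locales

lemma frameI: "is_extension D M N X \<Longrightarrow> frame X z h \<Longrightarrow> breuil_frame D r s a b c d X z h"
  by unfold_locales

lemma one_const: "[:ir 1:] = (1 :: 't poly)"
  by (simp add: one_pCons)

lemma scaling_iff:
  assumes X: "is_extension D M N X" and Z: "is_extension D M N Z" and h: "h \<in> cls X"
  shows "is_scaling D N l X Z \<longleftrightarrow> [:ir l:] \<star> h \<in> cls Z"
proof -
  obtain z where z: "frame X z h" using h by (auto simp: cls_def)
  interpret X: breuil_frame D r s a b c d X z h by (rule frameI[OF X z])
  show ?thesis
  proof
    assume "is_scaling D N l X Z"
    then obtain \<theta> where "\<theta> \<in> breuil_hom D (Mid X) (Mid Z)" "\<And>y. y \<in> carrier S \<Longrightarrow> \<theta> (Inc X y) = Inc Z ([:ir l:] \<star> y)"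
      "\<And>x. x \<in> carrier (Mid X) \<Longrightarrow> Proj Z (\<theta> x) = Proj X x"
      unfolding is_scaling_def rank1_simps by blast
    then have "frame Z (\<theta> z) ([:ir l:] \<star> h)" by (rule X.hom_frame)
    then show "[:ir l:] \<star> h \<in> cls Z" by (auto simp: cls_def)
  next
    assume "[:ir l:] \<star> h \<in> cls Z"
    then obtain z' where z': "frame Z z' ([:ir l:] \<star> h)" by (auto simp: cls_def)
    interpret Z: breuil_frame D r s a b c d Z z' "[:ir l:] \<star> h" by (rule frameI[OF Z z'])
    have "(\<lambda>x. Z.mk (Proj X x) ([:ir l:] \<star> X.co x)) \<in> breuil_hom D (Mid X) (Mid Z)" by (rule X.scaled_hom[OF Z z'])
    then show "is_scaling D N l X Z" unfolding is_scaling_def rank1_simps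
      by (rule bexI[rotated]) (simp add: X.prjD X.Proj_Inc X.co_simps Z.mk_0)
  qed
qed

text \<open>An isomorphism is in particular a scaling by 1. Conversely one common parameter gives
  such scalings in both directions, and in coordinates they are mutually inverse.\<close>

lemma ext_iso_iff:
  assumes X: "is_extension D M N X" and Y: "is_extension D M N Y"
  shows "ext_iso D N X Y \<longleftrightarrow> cls X \<inter> cls Y \<noteq> {}"
proof
  assume "ext_iso D N X Y"
  then obtain \<theta> where "\<theta> \<in> breuil_hom D (Mid X) (Mid Y)" "\<forall>y\<in>carrier N. \<theta> (Inc X y) = Inc Y y"
    "\<forall>x\<in>carrier (Mid X). Proj Y (\<theta> x) = Proj X x"
    unfolding ext_iso_def by blast
  then have "is_scaling D N 1 X Y"
    unfolding is_scaling_def rank1_simps one_const by (intro bexI[of _ \<theta>]) simp_all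
  moreover obtain h where h: "h \<in> cls X" using breuil_ext.cls_nonempty[OF extI[OF X]] by blast
  ultimately have "1 \<star> h \<in> cls Y" unfolding scaling_iff[OF X Y h] one_const by simp
  moreover have "h \<in> carrier S" using h by (auto simp: cls_def frame_def)
  ultimately show "cls X \<inter> cls Y \<noteq> {}" using h by auto
next
  assume "cls X \<inter> cls Y \<noteq> {}"
  then obtain h z z' where f: "frame X z h" "frame Y z' h" by (auto simp: cls_def)
  have hS: "h \<in> carrier S" using f by (simp add: frame_def)
  interpret X: breuil_frame D r s a b c d X z h by (rule frameI[OF X f(1)])
  interpret Y: breuil_frame D r s a b c d Y z' h by (rule frameI[OF Y f(2)])
  define \<theta> where "\<theta> = (\<lambda>x. Y.mk (Proj X x) ([:ir 1:] \<star> X.co x))"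
  define \<theta>' where "\<theta>' = (\<lambda>x. X.mk (Proj Y x) ([:ir 1:] \<star> Y.co x))"
  have f': "frame X z ([:ir 1:] \<star> h)" "frame Y z' ([:ir 1:] \<star> h)" using f S_one_mult(1)[OF hS] by (simp_all only: one_const)
  have h1: "\<theta> \<in> breuil_hom D (Mid X) (Mid Y)" unfolding \<theta>_def by (rule X.scaled_hom[OF Y f'(2)])
  have h2: "\<theta>' \<in> breuil_hom D (Mid Y) (Mid X)" unfolding \<theta>'_def by (rule Y.scaled_hom[OF X f'(1)])
  have e1: "\<theta> x = Y.mk (Proj X x) (X.co x)" if "x \<in> carrier (Mid X)" for x
    unfolding \<theta>_def one_const using X.co_S[OF that] by simp
  have e2: "\<theta>' x = X.mk (Proj Y x) (Y.co x)" if "x \<in> carrier (Mid Y)" for x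
    unfolding \<theta>'_def one_const using Y.co_S[OF that] by simp
  note c = breuil_homD(1)[OF h1] breuil_homD(1)[OF h2]
  have i1: "\<theta>' (\<theta> x) = x" if x: "x \<in> carrier (Mid X)" for x
    unfolding e2[OF c(1)[OF x]] unfolding e1[OF x] using X.mk_co[OF x] X.prjD(1)[OF x] X.co_S[OF x] by simp
  have i2: "\<theta> (\<theta>' x) = x" if x: "x \<in> carrier (Mid Y)" for x
    unfolding e1[OF c(2)[OF x]] unfolding e2[OF x] using Y.mk_co[OF x] Y.prjD(1)[OF x] Y.co_S[OF x] by simp
  have bij: "bij_betw \<theta> (carrier (Mid X)) (carrier (Mid Y))"
    by (rule bij_betw_byWitness[of _ \<theta>']) (use i1 i2 c in auto)
  have inv: "inv_into (carrier (Mid X)) \<theta> x = \<theta>' x" if x: "x \<in> carrier (Mid Y)" for x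
    by (rule inv_into_f_eq[OF bij_betw_imp_inj_on[OF bij] c(2)[OF x] i2[OF x]])
  show "ext_iso D N X Y"
    unfolding ext_iso_def
  proof (intro bexI[OF _ h1] conjI ballI)
    show "bij_betw \<theta> (carrier (Mid X)) (carrier (Mid Y))" by (rule bij)
    show "inv_into (carrier (Mid X)) \<theta> \<in> breuil_hom D (Mid Y) (Mid X)" by (rule breuil_hom_cong[OF Y.brP h2 inv])
    show "\<theta> (Inc X n) = Inc Y n" if "n \<in> carrier N" for n
      using that by (simp add: e1 rank1_simps X.incD(1) X.Proj_Inc X.co_simps Y.mk_0)
    show "Proj Y (\<theta> x) = Proj X x" if "x \<in> carrier (Mid X)" for x
      using that by (simp add: e1 X.prjD(1) X.co_S)
  qed
qed

text \<open>The pair of lifts (z, z') lies in the fibre product, and its image in the Baer sum is a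
  frame with parameter h + h'. In the other direction the map adds the second coordinates.\<close>

lemma baer_iff:
  assumes X: "is_extension D M N X" and Y: "is_extension D M N Y" and Z: "is_extension D M N Z"
    and h: "h \<in> cls X" and h': "h' \<in> cls Y"
  shows "is_baer_sum D N X Y Z \<longleftrightarrow> h + h' \<in> cls Z"
proof -
  obtain z z' where f: "frame X z h" "frame Y z' h'" using h h' by (auto simp: cls_def)
  interpret X: breuil_frame D r s a b c d X z h by (rule frameI[OF X f(1)])
  interpret Y: breuil_frame D r s a b c d Y z' h' by (rule frameI[OF Y f(2)])
  let ?F = "fibre_product X Y"
  have fp: "carrier ?F = {(x, y). x \<in> carrier (Mid X) \<and> y \<in> carrier (Mid Y) \<and> Proj X x = Proj Y y}"
    "(x, y) \<oplus>\<^bsub>?F\<^esub> (x', y') = (x \<oplus>\<^bsub>Mid X\<^esub> x', y \<oplus>\<^bsub>Mid Y\<^esub> y')"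
    "q \<odot>\<^bsub>?F\<^esub> (x, y) = (q \<odot>\<^bsub>Mid X\<^esub> x, q \<odot>\<^bsub>Mid Y\<^esub> y)"
    "Fil ?F = {(x, y). x \<in> Fil (Mid X) \<and> y \<in> Fil (Mid Y) \<and> Proj X x = Proj Y y}"
    "phi1 ?F (x, y) = (phi1 (Mid X) x, phi1 (Mid Y) y)"
    "desc ?F g (x, y) = (desc (Mid X) g x, desc (Mid Y) g y)" for x y x' y' q g
    by (simp_all add: fibre_product_def)
  show ?thesis
  proof
    assume "is_baer_sum D N X Y Z"
    then obtain \<theta> where th: "\<theta> \<in> breuil_hom D ?F (Mid Z)" "\<And>y y'. y \<in> carrier S \<Longrightarrow> y' \<in> carrier S \<Longrightarrow> \<theta> (Inc X y, Inc Y y') = Inc Z (y + y')"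
      "\<And>x y. (x, y) \<in> carrier ?F \<Longrightarrow> Proj Z (\<theta> (x, y)) = Proj X x"
      unfolding is_baer_sum_def rank1_simps by blast
    note t = breuil_homD[OF th(1)]
    have zz: "(z, z') \<in> Fil ?F" "(z, z') \<in> carrier ?F"
      by (simp_all add: fp X.fr(2,3) Y.fr(2,3) X.zP Y.zP)
    have ph: "phi1 (Mid X) z \<in> carrier (Mid X)" "phi1 (Mid Y) z' \<in> carrier (Mid Y)" using X.bP(4)[OF X.fr(2)] Y.bP(4)[OF Y.fr(2)] .
    have "Proj X (phi1 (Mid X) z) = frob D 1 \<star> ua" "Proj Y (phi1 (Mid Y) z') = frob D 1 \<star> ua"
      by (intro X.prjD(5) Y.prjD(5) X.fr(2) Y.fr(2) S_one, simp add: X.fr(3) Y.fr(3))+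
    then have phF: "phi1 ?F (z, z') \<in> carrier ?F" using ph by (simp add: fp)
    have sF: "q \<odot>\<^bsub>?F\<^esub> x \<in> carrier ?F" if "q \<in> carrier S" "x \<in> carrier ?F" for q x
      using that by (cases x) (simp add: fp X.prjD Y.prjD)
    have iF: "(Inc X h, Inc Y h') \<in> carrier ?F"
      by (simp add: fp X.incD(1)[OF X.fr(1)] Y.incD(1)[OF Y.fr(1)] X.Proj_Inc[OF X.fr(1)] Y.Proj_Inc[OF Y.fr(1)])
    have "frame Z (\<theta> (z, z')) (h + h')"
      unfolding frame_def
    proof (intro conjI ballI S_add X.fr(1) Y.fr(1))
      show "\<theta> (z, z') \<in> Fil (Mid Z)" by (rule t(4)[OF zz(1)])
      show "Proj Z (\<theta> (z, z')) = ur" using th(3)[OF zz(2)] X.fr(3) by simp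
      show "desc (Mid Z) g (\<theta> (z, z')) = eta_pow D rc g \<odot>\<^bsub>Mid Z\<^esub> \<theta> (z, z')" if g: "g \<in> Gal D" for g
        using t(6)[OF g zz(2)] t(3)[OF eta_pow_S zz(2)] X.fr(4)[OF g] Y.fr(4)[OF g] by (simp add: fp)
      have "(z, z') = ur \<odot>\<^bsub>?F\<^esub> (ua' \<odot>\<^bsub>?F\<^esub> phi1 ?F (z, z')) \<oplus>\<^bsub>?F\<^esub> (Inc X h, Inc Y h')"
        using X.fr(5) Y.fr(5) unfolding X.mk_def X.m_def Y.mk_def Y.m_def by (simp add: fp)
      then have "\<theta> (z, z') = \<theta> (ur \<odot>\<^bsub>?F\<^esub> (ua' \<odot>\<^bsub>?F\<^esub> phi1 ?F (z, z')) \<oplus>\<^bsub>?F\<^esub> (Inc X h, Inc Y h'))" by (rule arg_cong)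
      also have "\<dots> = ur \<odot>\<^bsub>Mid Z\<^esub> (ua' \<odot>\<^bsub>Mid Z\<^esub> phi1 (Mid Z) (\<theta> (z, z'))) \<oplus>\<^bsub>Mid Z\<^esub> Inc Z (h + h')"
        using phF sF[OF und_const_S phF] iF
        by (simp only: t(2,3) t(5)[OF zz(1)] th(2)[OF X.fr(1) Y.fr(1)] sF rd(7) und_const_S)
      finally show "\<theta> (z, z') = ur \<odot>\<^bsub>Mid Z\<^esub> (ua' \<odot>\<^bsub>Mid Z\<^esub> phi1 (Mid Z) (\<theta> (z, z'))) \<oplus>\<^bsub>Mid Z\<^esub> Inc Z (h + h')" .
    qed
    then show "h + h' \<in> cls Z" by (auto simp: cls_def)
  next
    assume "h + h' \<in> cls Z"
    then obtain z'' where z'': "frame Z z'' (h + h')" by (auto simp: cls_def)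
    interpret Z: breuil_frame D r s a b c d Z z'' "h + h'" by (rule frameI[OF Z z''])
    let ?\<theta> = "\<lambda>(x, y). Z.mk (Proj X x) (X.co x + Y.co y)"
    have sumS: "X.co x + Y.co y \<in> carrier S" if "x \<in> carrier (Mid X)" "y \<in> carrier (Mid Y)" for x y
      using that by (intro S_add X.co_S Y.co_S)
    have F: "?\<theta> (x, y) \<in> Fil (Mid Z) \<and> ?\<theta> (phi1 ?F (x, y)) = phi1 (Mid Z) (?\<theta> (x, y))" if xy: "(x, y) \<in> Fil ?F" for x y
    proof -
      have x: "x \<in> Fil (Mid X)" and y: "y \<in> Fil (Mid Y)" and e: "Proj X x = Proj Y y" using xy by (simp_all add: fp)
      obtain q where q: "q \<in> carrier S" "Proj X x = q \<star> ur" using X.prjD(4)[OF x] by blast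
      have q': "Proj Y y = q \<star> ur" using q e by simp
      obtain v where v: "v \<in> carrier S" "X.co x = v \<star> us + q \<star> h" "Proj X (phi1 (Mid X) x) = frob D q \<star> ua" "X.co (phi1 (Mid X) x) = frob D v \<star> ub"
        using X.co_Fil[OF x q] by blast
      obtain v' where v': "v' \<in> carrier S" "Y.co y = v' \<star> us + q \<star> h'" "Y.co (phi1 (Mid Y) y) = frob D v' \<star> ub"
        using Y.co_Fil[OF y q(1) q'] by blast
      have vS: "v + v' \<in> carrier S" using v(1) v'(1) by (rule S_add)
      have "X.co x + Y.co y = (v + v') \<star> us + q \<star> (h + h')"
        unfolding v(2) v'(2) by (simp add: S_distrib)
      then have t: "?\<theta> (x, y) = Z.mk (q \<star> ur) ((v + v') \<star> us + q \<star> (h + h'))"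
        using q(2) by simp
      have "?\<theta> (phi1 ?F (x, y)) = Z.mk (frob D q \<star> ua) (frob D (v + v') \<star> ub)"
        by (simp add: fp v(3,4) v'(3) frob_add S_distrib)
      then show ?thesis unfolding t Z.mk_phi1[OF q(1) vS] using Z.mk_Fil[OF q(1) vS] by blast
    qed
    have "?\<theta> \<in> breuil_hom D ?F (Mid Z)"
    proof (rule breuil_homI)
      show "?\<theta> x \<in> carrier (Mid Z)" if "x \<in> carrier ?F" for x using that by (auto simp: fp X.prjD Y.prjD sumS)
      show "?\<theta> (x \<oplus>\<^bsub>?F\<^esub> y) = ?\<theta> x \<oplus>\<^bsub>Mid Z\<^esub> ?\<theta> y" if xy: "x \<in> carrier ?F" "y \<in> carrier ?F" for x y
      proof -
        obtain x1 x2 y1 y2 where d: "x = (x1, x2)" "y = (y1, y2)" by (cases x, cases y)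
        have c: "x1 \<in> carrier (Mid X)" "x2 \<in> carrier (Mid Y)" "y1 \<in> carrier (Mid X)" "y2 \<in> carrier (Mid Y)" using xy by (simp_all add: fp d)
        have "?\<theta> (x \<oplus>\<^bsub>?F\<^esub> y) = Z.mk (Proj X x1 + Proj X y1) ((X.co x1 + Y.co x2) + (X.co y1 + Y.co y2))"
          using c by (simp add: d fp X.prjD X.co_simps Y.co_simps ac_simps)
        then show ?thesis using c by (simp add: d Z.mk_add sumS X.prjD)
      qed
      show "?\<theta> (q \<odot>\<^bsub>?F\<^esub> x) = q \<odot>\<^bsub>Mid Z\<^esub> ?\<theta> x" if q: "q \<in> carrier S" and x: "x \<in> carrier ?F" for q x
      proof -
        obtain x1 x2 where d: "x = (x1, x2)" by (cases x)
        have c: "x1 \<in> carrier (Mid X)" "x2 \<in> carrier (Mid Y)" using x by (simp_all add: fp d)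
        have "?\<theta> (q \<odot>\<^bsub>?F\<^esub> x) = Z.mk (q \<star> Proj X x1) (q \<star> (X.co x1 + Y.co x2))"
          using c q by (simp add: d fp X.prjD X.co_simps Y.co_simps S_distrib)
        then show ?thesis using c q by (simp add: d Z.mk_smult sumS X.prjD)
      qed
      show "?\<theta> x \<in> Fil (Mid Z)" "?\<theta> (phi1 ?F x) = phi1 (Mid Z) (?\<theta> x)" if "x \<in> Fil ?F" for x
        using F[of "fst x" "snd x"] that by simp_all
      show "?\<theta> (desc ?F g x) = desc (Mid Z) g (?\<theta> x)" if g: "g \<in> Gal D" and x: "x \<in> carrier ?F" for g x
      proof -
        obtain x1 x2 where d: "x = (x1, x2)" by (cases x)
        have c: "x1 \<in> carrier (Mid X)" "x2 \<in> carrier (Mid Y)" using x by (simp_all add: fp d)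
        have "desc (Mid Z) g (?\<theta> x) = Z.mk (gal_S D g (Proj X x1) \<star> eta_pow D c g) (gal_S D g (X.co x1 + Y.co x2) \<star> eta_pow D d g)"
          using Z.mk_desc[OF g X.prjD(1)[OF c(1)] sumS[OF c]] by (simp add: d)
        then show ?thesis using c g by (simp add: d fp X.prjD X.co_simps Y.co_simps gal_S_add[OF g] S_distrib)
      qed
    qed
    then show "is_baer_sum D N X Y Z"
      unfolding is_baer_sum_def rank1_simps
    proof (rule bexI[rotated], intro conjI ballI)
      show "?\<theta> (Inc X n, Inc Y n') = Inc Z (n + n')" if "n \<in> carrier S" "n' \<in> carrier S" for n n'
        using that by (simp add: X.Proj_Inc X.co_simps Y.co_simps Z.mk_0 S_add)
      show "case x of (x, y) \<Rightarrow> Proj Z (?\<theta> (x, y)) = Proj X x" if "x \<in> carrier ?F" for x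
        using that by (auto simp: fp X.prjD Y.prjD sumS)
    qed
  qed
qed

end

subsection \<open>Model extensions\<close>

context breuil_setting
begin

lemma frob_cong:
  assumes "\<And>i n. n < e \<Longrightarrow> coeff (cmp i x) n = coeff (cmp i y) n"
  shows "frob D x = frob D y"
proof (rule cmp_eqI, rule poly_eqI)
  fix i n
  have "coeff (cmp (i - 1) x) (n div p) = coeff (cmp (i - 1) y) (n div p)" if "n < T" "p dvd n"
    by (rule assms) (use that p_ge_3 in \<open>simp add: T_eq div_less_iff_less_mult\<close>)
  then show "coeff (cmp i (frob D x)) n = coeff (cmp i (frob D y)) n"
    using p_ge_3 unfolding cmp_frob by (auto simp: coeff_poly_cutoff coeff_pcompose_monom)
qed

end

context breuil_pair
begin

text \<open>This covers both the model extensions and the split extension, whose maps \<open>phi1\<close> have different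
  junk values outside the filtration.\<close>

definition coordinatised :: "'t poly \<Rightarrow> ('a, 't, 't poly, 't poly \<times> 't poly, 't poly) extension \<Rightarrow> bool" where
  "coordinatised h X \<longleftrightarrow>
     carrier (Mid X) = carrier S \<times> carrier S \<and> \<zero>\<^bsub>Mid X\<^esub> = (0, 0) \<and>
     (\<forall>x y x' y'. (x, y) \<oplus>\<^bsub>Mid X\<^esub> (x', y') = (x + x', y + y')) \<and>
     (\<forall>q x y. q \<odot>\<^bsub>Mid X\<^esub> (x, y) = (q \<star> x, q \<star> y)) \<and>
     Fil (Mid X) = {(q \<star> ur, y \<star> us + q \<star> h) | q y. q \<in> carrier S \<and> y \<in> carrier S} \<and>
     (\<forall>q\<in>carrier S. \<forall>y\<in>carrier S.
        phi1 (Mid X) (q \<star> ur, y \<star> us + q \<star> h) = (frob D q \<star> ua, frob D y \<star> ub)) \<and>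
     (\<forall>g x y. desc (Mid X) g (x, y) = (gal_S D g x \<star> eta_pow D c g, gal_S D g y \<star> eta_pow D d g)) \<and>
     Inc X = (\<lambda>y. (0, y)) \<and> Proj X = fst"

text \<open>Well-definedness of \<open>phi1\<close> on a model. Coefficients of y below e appear in
  y u^s below 2 e, and there q h depends only on coefficients of q that q u^r determines, because 2
  e + r i \<le> T.\<close>

lemma frob_unique:
  assumes q: "q \<star> ur = q' \<star> ur" and eq: "y \<star> us + q \<star> h = y' \<star> us + q' \<star> h"
  shows "frob D q = frob D q'" "frob D y = frob D y'"
proof -
  show "frob D q = frob D q'" by (rule frob_eq_if_mult_eq[OF rd(1,4) q])
  show "frob D y = frob D y'"
  proof (rule frob_cong)
    fix i n assume n: "n < e"
    define k where "k = n + s i"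
    have k: "k < T - r i" "k < T" "s i \<le> k" using n rd(4)[of i] sd(4)[of i] T_bounds unfolding k_def by linarith+
    have "coeff (cmp i q) j = coeff (cmp i q') j" if "j \<le> k" for j
      by (rule mult_u_pow_cancel[OF rd(1,4) q]) (use that k in linarith)
    then have "coeff (cmp i (q \<star> h)) k = coeff (cmp i (q' \<star> h)) k"
      unfolding cmp_S_mult using k by (simp add: coeff_poly_cutoff coeff_mult)
    moreover have "coeff (cmp i (y \<star> us)) k + coeff (cmp i (q \<star> h)) k = coeff (cmp i (y' \<star> us)) k + coeff (cmp i (q' \<star> h)) k"
      using arg_cong[OF eq, of "\<lambda>x. coeff (cmp i x) k"] by (simp add: cmp_add)
    ultimately have "coeff (cmp i (y \<star> us)) k = coeff (cmp i (y' \<star> us)) k" by simp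
    then show "coeff (cmp i y) n = coeff (cmp i y') n"
      unfolding coeff_mult_u_pow[OF sd(1)] using k by (simp add: k_def)
  qed
qed

lemma coordinatised_model: "coordinatised (und_poly D h) (model_extension D r a c s b d h)"
  unfolding coordinatised_def
proof (intro conjI ballI)
  let ?h = "und_poly D h"
  fix q y assume qy: "q \<in> carrier S" "y \<in> carrier S"
  have "(THE w. \<exists>x'\<in>carrier S. \<exists>y'\<in>carrier S.
      (q \<star> ur, y \<star> us + q \<star> ?h) = (x' \<star> ur, y' \<star> us + x' \<star> ?h) \<and>
      w = (frob D x' \<star> ua, frob D y' \<star> ub)) = (frob D q \<star> ua, frob D y \<star> ub)" (is "(THE w. ?Q w) = ?w")
  proof (rule the_equality)
    show "?Q ?w" using qy by blast
    fix w assume "?Q w"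
    then obtain x' y' where e: "q \<star> ur = x' \<star> ur" "y \<star> us + q \<star> ?h = y' \<star> us + x' \<star> ?h"
      "w = (frob D x' \<star> ua, frob D y' \<star> ub)" by blast
    show "w = ?w" unfolding e(3) frob_unique[OF e(1,2)] ..
  qed
  then show "phi1 (Mid (model_extension D r a c s b d h)) (q \<star> ur, y \<star> us + q \<star> ?h) = ?w"
    by (simp add: model_extension_def)
qed (simp_all add: model_extension_def)

lemma coordinatised_split: "coordinatised 0 (split_extension M N)"
  unfolding coordinatised_def
  by (auto simp: split_extension_def rank1_simps rank1_phi1[OF rM] rank1_phi1[OF rN])

end

locale breuil_model = breuil_pair D r s a b c d
  for D :: "('a::{alg_closed_field,field_char_0}, 'k::field, 'e::field, 't::comm_ring_1) datum"
    and r s a b c d +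
  fixes X :: "('a, 't, 't poly, 't poly \<times> 't poly, 't poly) extension" and h :: "'t poly"
  assumes coo: "coordinatised h X" and hV: "h \<in> V"
begin

abbreviation "P \<equiv> Mid X"

lemma cP: "carrier P = carrier S \<times> carrier S" "\<zero>\<^bsub>P\<^esub> = (0, 0)" "(x, y) \<oplus>\<^bsub>P\<^esub> (x', y') = (x + x', y + y')"
    "q \<odot>\<^bsub>P\<^esub> (x, y) = (q \<star> x, q \<star> y)"
    "Fil P = {(q \<star> ur, y \<star> us + q \<star> h) | q y. q \<in> carrier S \<and> y \<in> carrier S}"
    "q \<in> carrier S \<Longrightarrow> y \<in> carrier S \<Longrightarrow>
        phi1 P (q \<star> ur, y \<star> us + q \<star> h) = (frob D q \<star> ua, frob D y \<star> ub)"
    "desc P g (x, y) = (gal_S D g x \<star> eta_pow D c g, gal_S D g y \<star> eta_pow D d g)"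
    "Inc X = (\<lambda>y. (0, y))" "Proj X = fst"
  using coo unfolding coordinatised_def by blast+

lemmas hS = VD(1)[OF hV]

lemma Fil_I: "q \<in> carrier S \<Longrightarrow> y \<in> carrier S \<Longrightarrow> x = q \<star> ur \<Longrightarrow> x' = y \<star> us + q \<star> h \<Longrightarrow> (x, x') \<in> Fil P"
  unfolding cP(5) by blast

lemma Fil_E:
  assumes "x \<in> Fil P"
  obtains q y where "q \<in> carrier S" "y \<in> carrier S" "x = (q \<star> ur, y \<star> us + q \<star> h)"
  using assms unfolding cP(5) by blast

sublocale P: Module.module S P
proof (rule module_criteria[OF S_cring])
  show "\<forall>v\<in>carrier P. \<exists>n\<in>carrier P. v \<oplus>\<^bsub>P\<^esub> n = \<zero>\<^bsub>P\<^esub>"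
  proof
    fix v assume "v \<in> carrier P"
    then obtain x y where "v = (x, y)" "x \<in> carrier S" "y \<in> carrier S" by (auto simp: cP)
    then show "\<exists>n\<in>carrier P. v \<oplus>\<^bsub>P\<^esub> n = \<zero>\<^bsub>P\<^esub>"
      by (intro bexI[of _ "(- x, - y)"]) (auto simp: cP S_minus)
  qed
qed (auto simp: cP S_distrib S_assoc S_add ac_simps)

definition B :: "('t poly \<times> 't poly) set" where "B = {(1, 0), (0, 1)}"

lemma lincomb_B: "\<alpha> \<in> B \<rightarrow> carrier S \<Longrightarrow> P.lincomb \<alpha> B = (\<alpha> (1, 0), \<alpha> (0, 1))"
proof -
  assume \<alpha>: "\<alpha> \<in> B \<rightarrow> carrier S"
  then have a: "\<alpha> (1, 0) \<in> carrier S" "\<alpha> (0, 1) \<in> carrier S" by (auto simp: B_def)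
  have c: "\<alpha> (1, 0) \<odot>\<^bsub>P\<^esub> (1, 0) = (\<alpha> (1, 0), 0)" "\<alpha> (0, 1) \<odot>\<^bsub>P\<^esub> (0, 1) = (0, \<alpha> (0, 1))" using a by (simp_all add: cP)
  have "P.lincomb \<alpha> B = \<alpha> (1, 0) \<odot>\<^bsub>P\<^esub> (1, 0) \<oplus>\<^bsub>P\<^esub> \<alpha> (0, 1) \<odot>\<^bsub>P\<^esub> (0, 1)"
    unfolding P.lincomb_def B_def using a c by (simp add: cP(1,2) P.finsum_insert) (simp add: cP)
  then show ?thesis unfolding c by (simp add: cP)
qed

lemma free: "finite B" "B \<subseteq> carrier P" "P.gen_set B" "P.lin_indpt B"
proof -
  show fin: "finite B" and sub: "B \<subseteq> carrier P" by (auto simp: B_def cP)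
  show "P.gen_set B"
  proof
    show "P.span B \<subseteq> carrier P" by (rule P.span_is_subset2[OF sub])
    show "carrier P \<subseteq> P.span B"
    proof
      fix v assume "v \<in> carrier P"
      then obtain x y where v: "v = (x, y)" "x \<in> carrier S" "y \<in> carrier S" by (auto simp: cP)
      define \<alpha> where "\<alpha> = (\<lambda>w :: 't poly \<times> 't poly. if w = (1, 0) then x else y)"
      have "\<alpha> \<in> B \<rightarrow> carrier S" using v by (simp add: \<alpha>_def)
      moreover have "P.lincomb \<alpha> B = v" unfolding lincomb_B[OF \<open>\<alpha> \<in> B \<rightarrow> carrier S\<close>] v by (simp add: \<alpha>_def)
      ultimately show "v \<in> P.span B" unfolding P.finite_span[OF fin sub] by blast
    qed
  qed
  show "P.lin_indpt B"
  proof (rule P.finite_lin_indpt2[OF fin sub])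
    fix \<alpha> assume \<alpha>: "\<alpha> \<in> B \<rightarrow> carrier S" "P.lincomb \<alpha> B = \<zero>\<^bsub>P\<^esub>"
    have "(\<alpha> (1, 0), \<alpha> (0, 1)) = (0, 0)" using \<alpha>(2) unfolding lincomb_B[OF \<alpha>(1)] cP(2) .
    then show "\<forall>v\<in>B. \<alpha> v = \<zero>\<^bsub>S\<^esub>" by (simp add: B_def)
  qed
qed

lemma Fil_submodule: "submodule S (Fil P) P"
  unfolding submodule_def
proof (intro conjI allI impI P.module_axioms)
  show "Fil P \<subseteq> carrier P" by (auto elim!: Fil_E simp: cP(1) S_add)
  show "\<zero>\<^bsub>P\<^esub> \<in> Fil P" unfolding cP(2) by (rule Fil_I[of 0 0]) auto
  show "x \<oplus>\<^bsub>P\<^esub> y \<in> Fil P" if "x \<in> Fil P" "y \<in> Fil P" for x y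
  proof -
    obtain q v where x: "q \<in> carrier S" "v \<in> carrier S" "x = (q \<star> ur, v \<star> us + q \<star> h)" by (rule Fil_E[OF \<open>x \<in> Fil P\<close>])
    obtain q' v' where y: "q' \<in> carrier S" "v' \<in> carrier S" "y = (q' \<star> ur, v' \<star> us + q' \<star> h)" by (rule Fil_E[OF \<open>y \<in> Fil P\<close>])
    show ?thesis unfolding x(3) y(3) cP(3)
      by (rule Fil_I[OF S_add[OF x(1) y(1)] S_add[OF x(2) y(2)]]) (simp_all add: S_distrib ac_simps)
  qed
  show "k \<odot>\<^bsub>P\<^esub> x \<in> Fil P" if k: "k \<in> carrier S" and xF: "x \<in> Fil P" for k x
  proof -
    obtain q v where x: "q \<in> carrier S" "v \<in> carrier S" "x = (q \<star> ur, v \<star> us + q \<star> h)" by (rule Fil_E[OF xF])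
    show ?thesis unfolding x(3) cP(4)
      by (rule Fil_I[of "k \<star> q" "k \<star> v"]) (simp_all add: S_distrib S_assoc)
  qed
qed

text \<open>The converse of \<open>h_V\<close>: the bound \<mu> makes u^(e - r) h divisible by u^s,
  so u^e m is corrected by a multiple of u^s n.\<close>

lemma ue_Fil: "x \<in> carrier P \<Longrightarrow> monom 1 e \<odot>\<^bsub>P\<^esub> x \<in> Fil P"
proof -
  assume "x \<in> carrier P"
  then obtain x1 x2 where x: "x = (x1, x2)" "x1 \<in> carrier S" "x2 \<in> carrier S" by (auto simp: cP)
  have co: "u_pow D (\<lambda>i. e - t i) \<star> u_pow D t = monom 1 e" "u_pow D (\<lambda>i. e - t i) \<in> carrier S"
    if t: "periodic t" "\<And>i. t i \<le> e" for t
  proof -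
    have p: "periodic (\<lambda>i. e - t i)" using t(1) by (simp add: periodic_def)
    show "u_pow D (\<lambda>i. e - t i) \<in> carrier S" by (rule u_pow_S[OF p]) (rule e_less_T, simp)
    show "u_pow D (\<lambda>i. e - t i) \<star> u_pow D t = monom 1 e"
    proof (rule cmp_eqI)
      fix i
      have "ct (monom 1 e) = (monom 1 e :: 'e poly)"
        using e_less_T[of e] by (intro poly_eqI) (simp add: coeff_poly_cutoff coeff_monom)
      moreover have "cmp i (monom 1 e) = monom 1 e" by (intro poly_eqI) (simp add: coeff_cmp coeff_monom)
      ultimately show "cmp i (u_pow D (\<lambda>i. e - t i) \<star> u_pow D t) = cmp i (monom 1 e)"
        unfolding cmp_S_mult cmp_u_pow[OF p] cmp_u_pow[OF t(1)] using t(2)[of i] by (simp add: mult_monom)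
    qed
  qed
  note cr = co[OF rd(1,4)] and cs = co[OF sd(1,4)]
  let ?r = "u_pow D (\<lambda>i. e - r i)" and ?s = "u_pow D (\<lambda>i. e - s i)"
  have pr: "periodic (\<lambda>i. e - r i)" using rd(1) by (simp add: periodic_def)
  have "\<exists>v\<in>carrier S. ?r \<star> h = v \<star> us"
    unfolding S_dvd_u_pow[OF sd(1,4) S_mult_S]
  proof (intro allI impI)
    fix i n assume n: "n < s i"
    have "coeff (cmp i (h \<star> ?r)) n = 0"
      unfolding coeff_mult_u_pow[OF pr] using VD(3)[OF hV, of "n - (e - r i)" i] n rd(4)[of i] by (auto simp: \<mu>_def)
    then show "coeff (cmp i (?r \<star> h)) n = 0" by (simp add: S_comm)
  qed
  then obtain v where v: "v \<in> carrier S" "?r \<star> h = v \<star> us" by blast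
  show ?thesis unfolding x(1) cP(4)
  \<comment> \<open>Multiplying u^r m + h n by x1 u^(e - r) also produces x1 v u^s n, which the
    second witness removes.\<close>
  proof (rule Fil_I[of "x1 \<star> ?r" "x2 \<star> ?s - x1 \<star> v"])
    show "monom 1 e \<star> x1 = (x1 \<star> ?r) \<star> ur" unfolding cr(1)[symmetric] by (simp add: S_ac)
    have "(x2 \<star> ?s - x1 \<star> v) \<star> us + (x1 \<star> ?r) \<star> h
        = x2 \<star> (?s \<star> us) - x1 \<star> (v \<star> us) + x1 \<star> (?r \<star> h)"
      by (simp add: S_distrib S_assoc)
    then show "monom 1 e \<star> x2 = (x2 \<star> ?s - x1 \<star> v) \<star> us + (x1 \<star> ?r) \<star> h"
      unfolding v(2) cs(1) by (simp add: S_comm)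
  qed (auto intro!: S_diff)
qed

lemma phi1_add: "x \<in> Fil P \<Longrightarrow> y \<in> Fil P \<Longrightarrow> phi1 P (x \<oplus>\<^bsub>P\<^esub> y) = phi1 P x \<oplus>\<^bsub>P\<^esub> phi1 P y"
proof -
  assume xF: "x \<in> Fil P" and yF: "y \<in> Fil P"
  obtain q v where x: "q \<in> carrier S" "v \<in> carrier S" "x = (q \<star> ur, v \<star> us + q \<star> h)" by (rule Fil_E[OF xF])
  obtain q' v' where y: "q' \<in> carrier S" "v' \<in> carrier S" "y = (q' \<star> ur, v' \<star> us + q' \<star> h)" by (rule Fil_E[OF yF])
  have "x \<oplus>\<^bsub>P\<^esub> y = ((q + q') \<star> ur, (v + v') \<star> us + (q + q') \<star> h)"
    unfolding x(3) y(3) cP(3) by (simp add: S_distrib ac_simps)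
  then have "phi1 P (x \<oplus>\<^bsub>P\<^esub> y) = (frob D (q + q') \<star> ua, frob D (v + v') \<star> ub)"
    using cP(6)[OF S_add[OF x(1) y(1)] S_add[OF x(2) y(2)]] by simp
  then show ?thesis unfolding x(3) y(3) cP(6)[OF x(1,2)] cP(6)[OF y(1,2)] frob_add S_distrib unfolding cP(3) .
qed

lemma phi1_smult: "k \<in> carrier S \<Longrightarrow> x \<in> Fil P \<Longrightarrow> phi1 P (k \<odot>\<^bsub>P\<^esub> x) = frob D k \<odot>\<^bsub>P\<^esub> phi1 P x"
proof -
  assume k: "k \<in> carrier S" and xF: "x \<in> Fil P"
  obtain q v where x: "q \<in> carrier S" "v \<in> carrier S" "x = (q \<star> ur, v \<star> us + q \<star> h)" by (rule Fil_E[OF xF])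
  have "k \<odot>\<^bsub>P\<^esub> x = ((k \<star> q) \<star> ur, (k \<star> v) \<star> us + (k \<star> q) \<star> h)"
    unfolding x(3) cP(4) by (simp add: S_distrib S_assoc)
  then have "phi1 P (k \<odot>\<^bsub>P\<^esub> x) = (frob D (k \<star> q) \<star> ua, frob D (k \<star> v) \<star> ub)"
    using cP(6)[OF S_mult_S S_mult_S, of k q k v] by simp
  then show ?thesis unfolding x(3) cP(6)[OF x(1,2)] frob_mult S_assoc unfolding cP(4) .
qed

lemma phi1_P: "x \<in> Fil P \<Longrightarrow> phi1 P x \<in> carrier P"
  by (erule Fil_E) (simp add: cP(1,6))

text \<open>The two generators of the filtration are sent to b n and a m, and the constants a, b are
  invertible.\<close>

lemma phi1_gen: "P.gen_set (phi1 P ` Fil P)"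
proof
  have sub: "phi1 P ` Fil P \<subseteq> carrier P" using phi1_P by blast
  show "P.span (phi1 P ` Fil P) \<subseteq> carrier P" by (rule P.span_is_subset2[OF sub])
  note G = submoduleD[OF P.span_is_submodule[OF sub]]
  have "(0 \<star> ur, 1 \<star> us + 0 \<star> h) \<in> Fil P" "(1 \<star> ur, 0 \<star> us + 1 \<star> h) \<in> Fil P"
    by (rule Fil_I[OF _ _ refl refl]; simp)+
  then have "phi1 P (0 \<star> ur, 1 \<star> us + 0 \<star> h) \<in> P.span (phi1 P ` Fil P)"
    "phi1 P (1 \<star> ur, 0 \<star> us + 1 \<star> h) \<in> P.span (phi1 P ` Fil P)"
    using P.in_own_span[OF sub] by blast+
  then have g: "(0, ub) \<in> P.span (phi1 P ` Fil P)" "(ua, 0) \<in> P.span (phi1 P ` Fil P)"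
    unfolding cP(6)[OF S_zero S_one] cP(6)[OF S_one S_zero] by simp_all
  have pb: "periodic (\<lambda>i. inverse (b i))" using sd(2) by (simp add: periodic_def)
  let ?b = "und_const D (\<lambda>i. inverse (b i))"
  have bb: "?b \<star> ub = 1" using und_const_mult[OF pb sd(2)] sd(5) by (simp add: und_const_one)
  show "carrier P \<subseteq> P.span (phi1 P ` Fil P)"
  proof
    fix w assume "w \<in> carrier P"
    then obtain x y where w: "w = (x, y)" "x \<in> carrier S" "y \<in> carrier S" by (auto simp: cP)
    have "(x \<star> ua') \<odot>\<^bsub>P\<^esub> (ua, 0) \<oplus>\<^bsub>P\<^esub> (y \<star> ?b) \<odot>\<^bsub>P\<^esub> (0, ub) = w"
      unfolding w cP(3,4) S_assoc ua'_ua bb using w by simp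
    moreover have "(x \<star> ua') \<odot>\<^bsub>P\<^esub> (ua, 0) \<oplus>\<^bsub>P\<^esub> (y \<star> ?b) \<odot>\<^bsub>P\<^esub> (0, ub) \<in> P.span (phi1 P ` Fil P)"
      by (intro G(2,4) g S_mult_S)
    ultimately show "w \<in> P.span (phi1 P ` Fil P)" by simp
  qed
qed

section \<open>Descent data on the model\<close>

lemma desc_P: "g \<in> Gal D \<Longrightarrow> x \<in> carrier P \<Longrightarrow> desc P g x \<in> carrier P"
  by (auto simp: cP)

lemma desc_comp: "g \<in> Gal D \<Longrightarrow> g' \<in> Gal D \<Longrightarrow> desc P g (desc P g' x) = desc P (compose K g g') x"
proof -
  assume g: "g \<in> Gal D" and g': "g' \<in> Gal D"
  have "gal_S D g (gal_S D g' y \<star> eta_pow D t g') \<star> eta_pow D t g = gal_S D (compose K g g') y \<star> eta_pow D t (compose K g g')"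
    if "cong_periodic t" for y t
    unfolding gal_S_mult[OF g] gal_gal[OF g g'] S_assoc eta_pow_comp[OF that g g'] ..
  then show ?thesis using rd(3) sd(3) by (cases x) (simp add: cP)
qed

lemma desc_id: "x \<in> carrier P \<Longrightarrow> desc P (\<lambda>y\<in>K. y) x = x"
  by (cases x) (simp add: cP gal_S_id eta_pow_id[OF rd(3)] eta_pow_id[OF sd(3)])

lemma desc_bij: "g \<in> Gal D \<Longrightarrow> bij_betw (desc P g) (carrier P) (carrier P)"
proof -
  assume g: "g \<in> Gal D"
  obtain g' where g': "g' \<in> Gal D" "compose K g g' = (\<lambda>y\<in>K. y)" "compose K g' g = (\<lambda>y\<in>K. y)" by (rule gal_inv[OF g])
  show ?thesis
    by (rule bij_betw_byWitness[of _ "desc P g'"]) (use g g' in \<open>auto simp: desc_comp desc_id intro: desc_P\<close>)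
qed

lemma h_weight: "g \<in> Gal D \<Longrightarrow> gal_S D g h \<star> eta_pow D d g = eta_pow D rc g \<star> h"
  using VD(2)[OF hV] unfolding weight_w_iff[OF hS] by blast

lemma frob_eta_s: "g \<in> Gal D \<Longrightarrow> frob D (eta_pow D (\<lambda>i. int (s i) + d i) g) = eta_pow D d g"
proof -
  have "cong_periodic (\<lambda>i. int (s i) + d i)"
    using sd(1,3) by (auto simp: cong_periodic_def periodic_def intro: cong_add)
  then show "g \<in> Gal D \<Longrightarrow> frob D (eta_pow D (\<lambda>i. int (s i) + d i) g) = eta_pow D d g"
    by (rule frob_eta_pow[OF _ sd(3)]) (use sd(6) in \<open>auto simp: add.commute\<close>)
qed

text \<open>The weight of h lets g multiply u^r m + h n as a whole by a single character, so the
  filtration is preserved.\<close>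

lemma desc_Fil:
  assumes g: "g \<in> Gal D" and q: "q \<in> carrier S" and y: "y \<in> carrier S"
  shows "desc P g (q \<star> ur, y \<star> us + q \<star> h) =
    ((gal_S D g q \<star> eta_pow D rc g) \<star> ur,
     (gal_S D g y \<star> eta_pow D (\<lambda>i. int (s i) + d i) g) \<star> us + (gal_S D g q \<star> eta_pow D rc g) \<star> h)"
proof -
  have ps: "cong_periodic (\<lambda>i. int (s i))" using sd(1) by (simp add: cong_periodic_def periodic_def)
  have es: "eta_pow D (\<lambda>i. int (s i)) g \<star> eta_pow D d g = eta_pow D (\<lambda>i. int (s i) + d i) g"
    by (rule eta_pow_mult[OF ps sd(3) g])
  have 1: "gal_S D g (q \<star> ur) \<star> eta_pow D c g = (gal_S D g q \<star> eta_pow D rc g) \<star> ur"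
    unfolding gal_S_mult[OF g] gal_u_pow[OF rd(1) g] eta_rc[OF g, symmetric] by (simp add: S_ac)
  have 2: "gal_S D g (y \<star> us) \<star> eta_pow D d g = (gal_S D g y \<star> eta_pow D (\<lambda>i. int (s i) + d i) g) \<star> us"
    unfolding gal_S_mult[OF g] gal_u_pow[OF sd(1) g] es[symmetric] by (simp add: S_ac)
  have 3: "gal_S D g (q \<star> h) \<star> eta_pow D d g = (gal_S D g q \<star> eta_pow D rc g) \<star> h"
    unfolding gal_S_mult[OF g] S_assoc h_weight[OF g] ..
  show ?thesis unfolding cP(7) 1 gal_S_add[OF g] S_distrib 2 3 ..
qed

lemma desc_phi1:
  assumes g: "g \<in> Gal D" and xF: "x \<in> Fil P"
  shows "desc P g x \<in> Fil P" "desc P g (phi1 P x) = phi1 P (desc P g x)"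
proof -
  obtain q y where x: "q \<in> carrier S" "y \<in> carrier S" "x = (q \<star> ur, y \<star> us + q \<star> h)" by (rule Fil_E[OF xF])
  show "desc P g x \<in> Fil P" unfolding x(3) desc_Fil[OF g x(1,2)] by (rule Fil_I[OF S_mult_S S_mult_S refl refl])
  have "phi1 P (desc P g x) = (frob D (gal_S D g q \<star> eta_pow D rc g) \<star> ua,
      frob D (gal_S D g y \<star> eta_pow D (\<lambda>i. int (s i) + d i) g) \<star> ub)"
    unfolding x(3) desc_Fil[OF g x(1,2)] by (rule cP(6)[OF S_mult_S S_mult_S])
  also have "\<dots> = desc P g (frob D q \<star> ua, frob D y \<star> ub)"
    unfolding cP(7) gal_S_mult[OF g] gal_frob[OF g] frob_mult frob_eta_rc[OF g] frob_eta_s[OF g]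
      gal_und_const[OF rd(2) g] gal_und_const[OF sd(2) g] by (simp add: S_ac)
  finally show "desc P g (phi1 P x) = phi1 P (desc P g x)" unfolding x(3) cP(6)[OF x(1,2)] by (rule sym)
qed

lemma model_is_breuil: "is_breuil D P"
  unfolding is_breuil_def
proof (intro conjI ballI allI)
  show "module S P" by (rule P.module_axioms)
  show "\<exists>B. finite B \<and> B \<subseteq> carrier P \<and> P.gen_set B \<and> P.lin_indpt B" using free by blast
  show "submodule S (Fil P) P" by (rule Fil_submodule)
  show "phi1 P \<in> Fil P \<rightarrow> carrier P" using phi1_P by blast
  show "monom 1 e \<odot>\<^bsub>P\<^esub> x \<in> Fil P" if "x \<in> carrier P" for x by (rule ue_Fil[OF that])
  show "phi1 P (x \<oplus>\<^bsub>P\<^esub> y) = phi1 P x \<oplus>\<^bsub>P\<^esub> phi1 P y" if "x \<in> Fil P" "y \<in> Fil P" for x y by (rule phi1_add[OF that])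
  show "phi1 P (q \<odot>\<^bsub>P\<^esub> x) = frob D q \<odot>\<^bsub>P\<^esub> phi1 P x" if "q \<in> carrier S" "x \<in> Fil P" for q x by (rule phi1_smult[OF that])
  show "desc P (\<lambda>y\<in>K. y) x = x" if "x \<in> carrier P" for x by (rule desc_id[OF that])
  show "P.gen_set (phi1 P ` Fil P)" by (rule phi1_gen)
  fix g assume g: "g \<in> Gal D"
  show "bij_betw (desc P g) (carrier P) (carrier P)" by (rule desc_bij[OF g])
  show "desc P g (x \<oplus>\<^bsub>P\<^esub> y) = desc P g x \<oplus>\<^bsub>P\<^esub> desc P g y" for x y
    by (cases x, cases y) (simp add: cP gal_S_add[OF g] S_distrib)
  show "desc P g ` Fil P \<subseteq> Fil P" by (rule image_subsetI[OF desc_phi1(1)[OF g]])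
  show sl: "desc P g (q \<odot>\<^bsub>P\<^esub> x) = gal_S D g q \<odot>\<^bsub>P\<^esub> desc P g x" for q x
    by (cases x) (simp add: cP gal_S_mult[OF g] S_assoc)
  show "desc P g ([:inr D l:] \<odot>\<^bsub>P\<^esub> x) = [:inr D l:] \<odot>\<^bsub>P\<^esub> desc P g x" for l x
    unfolding sl gal_S_const[OF g] ..
  show "desc P g (phi1 P x) = phi1 P (desc P g x)" if "x \<in> Fil P" for x by (rule desc_phi1(2)[OF g that])
  show "desc P g (desc P g' x) = desc P (compose K g g') x" if "g' \<in> Gal D" for g' x by (rule desc_comp[OF g that])
qed

lemma model_is_extension: "is_extension D M N X"
  unfolding is_extension_def
proof (intro conjI model_is_breuil)
  show "Inc X \<in> breuil_hom D N P"
  proof (rule breuil_homI)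
    fix x assume "x \<in> Fil N"
    then obtain y where y: "y \<in> carrier S" "x = y \<star> us" by (auto simp: rank1_simps)
    have e: "Inc X x = (0 \<star> ur, y \<star> us + 0 \<star> h)" by (simp add: cP(8) y(2))
    show "Inc X x \<in> Fil P" unfolding e by (rule Fil_I[OF S_zero y(1) refl refl])
    show "Inc X (phi1 N x) = phi1 P (Inc X x)" unfolding e cP(6)[OF S_zero y(1)] unfolding y(2) rank1_phi1[OF rN y(1)] by (simp add: cP(8))
  qed (simp_all add: cP rank1_simps gal_S_0)
  show "Proj X \<in> breuil_hom D P M"
  proof (rule breuil_homI)
    fix x assume xF: "x \<in> Fil P"
    obtain q y where x: "q \<in> carrier S" "y \<in> carrier S" "x = (q \<star> ur, y \<star> us + q \<star> h)" by (rule Fil_E[OF xF])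
    show "Proj X x \<in> Fil M" using x by (auto simp: cP(9) rank1_simps)
    show "Proj X (phi1 P x) = phi1 M (Proj X x)" unfolding x(3) cP(6)[OF x(1,2)] by (simp add: cP(9) rank1_phi1[OF rM x(1)])
  qed (auto simp: cP rank1_simps)
  show "inj_on (Inc X) (carrier N)" by (auto simp: cP inj_on_def)
  show "Inc X ` carrier N = {x \<in> carrier P. Proj X x = \<zero>\<^bsub>M\<^esub>}" by (auto simp: cP rank1_simps)
  show "Proj X ` carrier P = carrier M" by (auto simp: cP rank1_simps image_iff)
qed

lemma model_frame: "frame X (ur, h) h"
  unfolding frame_def
proof (intro conjI ballI)
  have e: "(ur, h) = (1 \<star> ur, 0 \<star> us + 1 \<star> h)" using hS by simp
  show "h \<in> carrier S" by (rule hS)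
  show "(ur, h) \<in> Fil P" unfolding e by (rule Fil_I[OF S_one S_zero refl refl])
  show "Proj X (ur, h) = ur" by (simp add: cP)
  show "desc P g (ur, h) = eta_pow D rc g \<odot>\<^bsub>P\<^esub> (ur, h)" if g: "g \<in> Gal D" for g
    unfolding cP(4,7) h_weight[OF g] gal_u_pow[OF rd(1) g] eta_rc[OF g, symmetric] by (simp add: S_ac)
  have ph: "phi1 P (ur, h) = (ua, 0)" unfolding e cP(6)[OF S_one S_zero] by simp
  show "(ur, h) = ur \<odot>\<^bsub>P\<^esub> (ua' \<odot>\<^bsub>P\<^esub> phi1 P (ur, h)) \<oplus>\<^bsub>P\<^esub> Inc X h"
    unfolding ph by (simp add: cP ua'_ua)
qed

end

context breuil_pair
begin

lemma model_extension:
  assumes "und_poly D h \<in> V"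
  shows "is_extension D M N (model_extension D r a c s b d h)" "und_poly D h \<in> cls (model_extension D r a c s b d h)"
proof -
  interpret breuil_model D r s a b c d "model_extension D r a c s b d h" "und_poly D h"
    by unfold_locales (use coordinatised_model assms in auto)
  show "is_extension D M N (model_extension D r a c s b d h)" by (rule model_is_extension)
  show "und_poly D h \<in> cls (model_extension D r a c s b d h)" using model_frame by (auto simp: cls_def)
qed

lemma zero_V: "0 \<in> V"
  by (simp add: V_def weight_def gal_S_0)

lemma split_extension:
  shows "is_extension D M N (split_extension M N)" "0 \<in> cls (split_extension M N)"
proof -
  interpret breuil_model D r s a b c d "split_extension M N" 0
    by unfold_locales (use coordinatised_split zero_V in auto)
  show "is_extension D M N (split_extension M N)" by (rule model_is_extension)
  show "0 \<in> cls (split_extension M N)" using model_frame by (auto simp: cls_def)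
qed

end

section \<open>The space of extension classes\<close>

context breuil_pair
begin

abbreviation "Ext \<equiv> Ext1 D M N"

definition mdl where "mdl h = model_extension D r a c s b d (\<lambda>i. cmp i h)"

text \<open>The extension class with parameter h. It depends on h only modulo \<open>W\<close>, so
  \<open>Kl\<close> identifies V / W with the extension classes.\<close>

definition Kl :: "'t poly \<Rightarrow> ('a, 't, 't poly, 't poly \<times> 't poly, 't poly) extension set" where
  "Kl h = {Z \<in> extensions D M N. h \<in> cls Z}"

lemma mdl: "h \<in> V \<Longrightarrow> mdl h \<in> extensions D M N" "h \<in> V \<Longrightarrow> h \<in> cls (mdl h)"
  using model_extension[of "\<lambda>i. cmp i h"] unfolding und_poly_cmp by (simp_all add: mdl_def extensions_def)

lemma extD: "X \<in> extensions D M N \<Longrightarrow> is_extension D M N X"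
  by (simp add: extensions_def)

lemmas cls_ext = breuil_ext.cls_nonempty[OF extI[OF extD]] breuil_ext.cls_V[OF extI[OF extD]]
  breuil_ext.cls_diff[OF extI[OF extD]] breuil_ext.cls_shift[OF extI[OF extD]]

text \<open>Two frames of one extension have symmetric roles, so the difference of their parameters
  and its negative both lie in \<open>W\<close>.\<close>

lemma W_uminus: "h \<in> V \<Longrightarrow> x \<in> W \<Longrightarrow> - x \<in> W"
  using cls_ext(3)[OF mdl(1) cls_ext(4)[OF mdl(1) mdl(2)] mdl(2), of h x] by simp

lemma cls_iff: "X \<in> extensions D M N \<Longrightarrow> h \<in> cls X \<Longrightarrow> h' \<in> cls X \<longleftrightarrow> h' - h \<in> W"
  using cls_ext(3)[of X h h'] cls_ext(4)[of X h "h' - h"] by auto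

lemma Kl_eqI: "h \<in> V \<Longrightarrow> h' - h \<in> W \<Longrightarrow> Kl h = Kl h'"
proof -
  assume h: "h \<in> V" and d: "h' - h \<in> W"
  have d': "h - h' \<in> W" using W_uminus[OF h d] by simp
  show ?thesis unfolding Kl_def using cls_iff[of _ h h'] cls_iff[of _ h' h] d d' by blast
qed

lemma Kl_eqD: "h \<in> V \<Longrightarrow> Kl h = Kl h' \<Longrightarrow> h' - h \<in> W"
proof -
  assume h: "h \<in> V" and eq: "Kl h = Kl h'"
  have "mdl h \<in> Kl h" using mdl[OF h] by (simp add: Kl_def)
  then have "h' \<in> cls (mdl h)" unfolding eq by (simp add: Kl_def)
  then show ?thesis using cls_ext(3)[OF mdl(1)[OF h] mdl(2)[OF h]] by blast
qed

lemma iso_class: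
  assumes X: "X \<in> extensions D M N" and h: "h \<in> cls X"
  shows "{(X, Y). X \<in> extensions D M N \<and> Y \<in> extensions D M N \<and> ext_iso D N X Y} `` {X} = Kl h"
proof -
  have "ext_iso D N X Y \<longleftrightarrow> h \<in> cls Y" if Y: "Y \<in> extensions D M N" for Y
  proof -
    have "ext_iso D N X Y \<longleftrightarrow> cls X \<inter> cls Y \<noteq> {}" by (rule ext_iso_iff[OF extD[OF X] extD[OF Y]])
    also have "\<dots> \<longleftrightarrow> h \<in> cls Y"
    proof
      assume "cls X \<inter> cls Y \<noteq> {}"
      then obtain k where k: "k \<in> cls X" "k \<in> cls Y" by blast
      have "h - k \<in> W" by (rule cls_ext(3)[OF X k(1) h])
      then show "h \<in> cls Y" using cls_iff[OF Y k(2)] by blast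
    qed (use h in blast)
    finally show ?thesis .
  qed
  then show ?thesis using X by (auto simp: Kl_def)
qed

lemma Ex_carrier: "carrier Ext = Kl ` V"
proof -
  have "carrier Ext = (\<Union>X\<in>extensions D M N. {{(X, Y). X \<in> extensions D M N \<and> Y \<in> extensions D M N \<and> ext_iso D N X Y} `` {X}})"
    unfolding Ext1_def quotient_def by simp
  also have "\<dots> = Kl ` V"
  proof (intro equalityI subsetI)
    fix A assume "A \<in> (\<Union>X\<in>extensions D M N. {{(X, Y). X \<in> extensions D M N \<and> Y \<in> extensions D M N \<and> ext_iso D N X Y} `` {X}})"
    then obtain X where X: "X \<in> extensions D M N" "A = {(X, Y). X \<in> extensions D M N \<and> Y \<in> extensions D M N \<and> ext_iso D N X Y} `` {X}" by blast
    obtain h where h: "h \<in> cls X" using cls_ext(1)[OF X(1)] by blast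
    show "A \<in> Kl ` V" unfolding X(2) iso_class[OF X(1) h] using cls_ext(2)[OF X(1) h] by blast
  next
    fix A assume "A \<in> Kl ` V"
    then obtain h where h: "h \<in> V" "A = Kl h" by blast
    show "A \<in> (\<Union>X\<in>extensions D M N. {{(X, Y). X \<in> extensions D M N \<and> Y \<in> extensions D M N \<and> ext_iso D N X Y} `` {X}})"
      using iso_class[OF mdl(1)[OF h(1)] mdl(2)[OF h(1)]] mdl(1)[OF h(1)] h(2) by blast
  qed
  finally show ?thesis .
qed

lemma Ex_zero: "\<zero>\<^bsub>Ext\<^esub> = Kl 0"
proof -
  have s: "split_extension M N \<in> extensions D M N" using split_extension(1) by (simp add: extensions_def)
  have "ext_iso D N Z (split_extension M N) \<longleftrightarrow> 0 \<in> cls Z" if Z: "Z \<in> extensions D M N" for Z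
  proof
    assume "ext_iso D N Z (split_extension M N)"
    then obtain k where k: "k \<in> cls Z" "k \<in> cls (split_extension M N)"
      unfolding ext_iso_iff[OF extD[OF Z] split_extension(1)] by blast
    have "0 - k \<in> W" by (rule cls_ext(3)[OF s k(2) split_extension(2)])
    then show "0 \<in> cls Z" using cls_iff[OF Z k(1)] by blast
  next
    assume "0 \<in> cls Z"
    then show "ext_iso D N Z (split_extension M N)"
      unfolding ext_iso_iff[OF extD[OF Z] split_extension(1)] using split_extension(2) by blast
  qed
  then show ?thesis unfolding Ext1_def Kl_def by auto
qed

lemma Ex_add: "h \<in> V \<Longrightarrow> h' \<in> V \<Longrightarrow> Kl h \<oplus>\<^bsub>Ext\<^esub> Kl h' = Kl (h + h')"
proof -
  assume h: "h \<in> V" and h': "h' \<in> V"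
  have "(\<exists>X\<in>Kl h. \<exists>Y\<in>Kl h'. is_baer_sum D N X Y Z) \<longleftrightarrow> h + h' \<in> cls Z" if Z: "Z \<in> extensions D M N" for Z
  proof
    assume "\<exists>X\<in>Kl h. \<exists>Y\<in>Kl h'. is_baer_sum D N X Y Z"
    then obtain X Y where XY: "X \<in> Kl h" "Y \<in> Kl h'" "is_baer_sum D N X Y Z" by blast
    then show "h + h' \<in> cls Z" using baer_iff[OF extD extD extD[OF Z], of X Y h h'] by (simp add: Kl_def)
  next
    assume "h + h' \<in> cls Z"
    then have "is_baer_sum D N (mdl h) (mdl h') Z"
      using baer_iff[OF extD[OF mdl(1)[OF h]] extD[OF mdl(1)[OF h']] extD[OF Z] mdl(2)[OF h] mdl(2)[OF h']] by blast
    moreover have "mdl h \<in> Kl h" "mdl h' \<in> Kl h'" using mdl h h' by (simp_all add: Kl_def)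
    ultimately show "\<exists>X\<in>Kl h. \<exists>Y\<in>Kl h'. is_baer_sum D N X Y Z" by blast
  qed
  then have "{Z \<in> extensions D M N. \<exists>X\<in>Kl h. \<exists>Y\<in>Kl h'. is_baer_sum D N X Y Z} = Kl (h + h')" unfolding Kl_def[of "h + h'"] by blast
  then show ?thesis unfolding Ext1_def by simp
qed

lemma Ex_smult: "h \<in> V \<Longrightarrow> l \<odot>\<^bsub>Ext\<^esub> Kl h = Kl ([:ir l:] \<star> h)"
proof -
  assume h: "h \<in> V"
  have "(\<exists>X\<in>Kl h. is_scaling D N l X Z) \<longleftrightarrow> [:ir l:] \<star> h \<in> cls Z" if Z: "Z \<in> extensions D M N" for Z
  proof
    assume "\<exists>X\<in>Kl h. is_scaling D N l X Z"
    then obtain X where X: "X \<in> Kl h" "is_scaling D N l X Z" by blast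
    then show "[:ir l:] \<star> h \<in> cls Z" using scaling_iff[OF extD extD[OF Z], of X h l] by (simp add: Kl_def)
  next
    assume "[:ir l:] \<star> h \<in> cls Z"
    then have "is_scaling D N l (mdl h) Z"
      using scaling_iff[OF extD[OF mdl(1)[OF h]] extD[OF Z] mdl(2)[OF h]] by blast
    moreover have "mdl h \<in> Kl h" using mdl h by (simp add: Kl_def)
    ultimately show "\<exists>X\<in>Kl h. is_scaling D N l X Z" by blast
  qed
  then have "{Z \<in> extensions D M N. \<exists>X\<in>Kl h. is_scaling D N l X Z} = Kl ([:ir l:] \<star> h)"
    unfolding Kl_def[of "[:ir l:] \<star> h"] by blast
  then show ?thesis unfolding Ext1_def by simp
qed

lemma V_uminus: "x \<in> V \<Longrightarrow> - x \<in> V"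
  using V_closed(2)[OF zero_V, of x] by simp

lemma Ex_E:
  assumes "A \<in> carrier Ext"
  obtains h where "h \<in> V" "A = Kl h"
  using assms unfolding Ex_carrier by blast

lemma Kl_Ex: "h \<in> V \<Longrightarrow> Kl h \<in> carrier Ext"
  unfolding Ex_carrier by blast

lemma ir_const: "[:ir (x + y):] = [:ir x:] + [:ir y:]" "[:ir (x * y):] = [:ir x:] \<star> [:ir y:]"
proof -
  show "[:ir (x + y):] = [:ir x:] + [:ir y:]" by (simp add: ir_add)
  have "ct ([:ir x:] * [:ir y:]) = [:ir x:] * [:ir y:]" using S_const[of "ir x * ir y"] unfolding S_carrier by (simp add: mult.commute)
  then show "[:ir (x * y):] = [:ir x:] \<star> [:ir y:]" unfolding S_mult_def by (simp add: ir_mult mult.commute)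
qed

lemma Ex_module: "module class_ring Ext"
proof (rule module_criteria)
  show "cring (class_ring :: 'e ring)" by (rule class_cring.cring_axioms)
  show "\<zero>\<^bsub>Ext\<^esub> \<in> carrier Ext" unfolding Ex_zero by (rule Kl_Ex[OF zero_V])
  show "\<forall>v w. v \<in> carrier Ext \<and> w \<in> carrier Ext \<longrightarrow> v \<oplus>\<^bsub>Ext\<^esub> w \<in> carrier Ext"
    by (auto elim!: Ex_E simp: Ex_add intro!: Kl_Ex V_closed)
  show "\<forall>v\<in>carrier Ext. \<exists>n\<in>carrier Ext. v \<oplus>\<^bsub>Ext\<^esub> n = \<zero>\<^bsub>Ext\<^esub>"
  proof
    fix v assume "v \<in> carrier Ext"
    then obtain h where h: "h \<in> V" "v = Kl h" by (rule Ex_E)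
    show "\<exists>n\<in>carrier Ext. v \<oplus>\<^bsub>Ext\<^esub> n = \<zero>\<^bsub>Ext\<^esub>"
      by (intro bexI[of _ "Kl (- h)"] Kl_Ex V_uminus h(1)) (simp add: h Ex_add V_uminus Ex_zero)
  qed
  show "\<forall>l v. l \<in> carrier class_ring \<and> v \<in> carrier Ext \<longrightarrow> l \<odot>\<^bsub>Ext\<^esub> v \<in> carrier Ext"
    by (auto elim!: Ex_E simp: Ex_smult intro!: Kl_Ex V_closed)
  show "\<forall>v w. v \<in> carrier Ext \<and> w \<in> carrier Ext \<longrightarrow> v \<oplus>\<^bsub>Ext\<^esub> w = w \<oplus>\<^bsub>Ext\<^esub> v"
    by (auto elim!: Ex_E simp: Ex_add add.commute)
  show "\<forall>v w x. v \<in> carrier Ext \<and> w \<in> carrier Ext \<and> x \<in> carrier Ext \<longrightarrow> v \<oplus>\<^bsub>Ext\<^esub> w \<oplus>\<^bsub>Ext\<^esub> x = v \<oplus>\<^bsub>Ext\<^esub> (w \<oplus>\<^bsub>Ext\<^esub> x)"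
    by (auto elim!: Ex_E simp: Ex_add V_closed add.assoc)
  show "\<forall>v\<in>carrier Ext. v \<oplus>\<^bsub>Ext\<^esub> \<zero>\<^bsub>Ext\<^esub> = v" by (auto elim!: Ex_E simp: Ex_add Ex_zero zero_V)
  show "\<forall>x y v. x \<in> carrier class_ring \<and> y \<in> carrier class_ring \<and> v \<in> carrier Ext \<longrightarrow>
      (x \<otimes>\<^bsub>class_ring\<^esub> y) \<odot>\<^bsub>Ext\<^esub> v = x \<odot>\<^bsub>Ext\<^esub> (y \<odot>\<^bsub>Ext\<^esub> v)"
    by (auto elim!: Ex_E simp: Ex_smult V_closed ir_const S_assoc)
  show "\<forall>v\<in>carrier Ext. \<one>\<^bsub>class_ring\<^esub> \<odot>\<^bsub>Ext\<^esub> v = v"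
  proof
    fix v assume "v \<in> carrier Ext"
    then obtain h where h: "h \<in> V" "v = Kl h" by (rule Ex_E)
    then show "\<one>\<^bsub>class_ring\<^esub> \<odot>\<^bsub>Ext\<^esub> v = v"
      using Ex_smult[OF h(1), of 1] S_one_mult(1)[OF VD(1)[OF h(1)]] unfolding one_const by simp
  qed
  show "\<forall>x y v. x \<in> carrier class_ring \<and> y \<in> carrier class_ring \<and> v \<in> carrier Ext \<longrightarrow>
      (x \<oplus>\<^bsub>class_ring\<^esub> y) \<odot>\<^bsub>Ext\<^esub> v = x \<odot>\<^bsub>Ext\<^esub> v \<oplus>\<^bsub>Ext\<^esub> y \<odot>\<^bsub>Ext\<^esub> v"
    by (auto elim!: Ex_E simp: Ex_smult Ex_add V_closed ir_const(1) S_distrib simp del: add_pCons)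
  show "\<forall>l v w. l \<in> carrier class_ring \<and> v \<in> carrier Ext \<and> w \<in> carrier Ext \<longrightarrow>
      l \<odot>\<^bsub>Ext\<^esub> (v \<oplus>\<^bsub>Ext\<^esub> w) = l \<odot>\<^bsub>Ext\<^esub> v \<oplus>\<^bsub>Ext\<^esub> l \<odot>\<^bsub>Ext\<^esub> w"
    by (auto elim!: Ex_E simp: Ex_smult Ex_add V_closed S_distrib)
qed

lemma Ex_vectorspace: "vectorspace class_ring Ext"
  unfolding vectorspace_def using Ex_module class_field.field_axioms by blast

subsection \<open>A basis\<close>

text \<open>One index for each free coefficient of a normal parameter; by periodicity i < f'
  suffices.\<close>

definition J :: "(nat \<times> nat) set" where
  "J = {(i, j). i < f' \<and> \<mu> (int i) \<le> j \<and> j < T \<and> [int j = w (int i)] (mod int eKL) \<and> (j < s (int i) \<or> orb.special (int i) j)}"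

definition \<epsilon> :: "nat \<times> nat \<Rightarrow> 't poly" where
  "\<epsilon> x = und_poly D (\<lambda>k. if k mod int f' = int (fst x) then monom 1 (snd x) else 0)"

lemma coeff_\<epsilon>: "coeff (cmp k (\<epsilon> x)) n = (if k mod int f' = int (fst x) \<and> n = snd x then 1 else 0)"
proof -
  have "periodic (\<lambda>k. if k mod int f' = int (fst x) then monom (1 :: 'e) (snd x) else 0)" by (simp add: periodic_def)
  from cmp_und_poly_periodic[OF this] show ?thesis unfolding \<epsilon>_def by simp
qed

lemma mod_f': "int f' dvd k - k mod int f'"
  by (simp add: minus_mod_eq_mult_div)

lemma per_\<mu>: "periodic \<mu>"
  using rd(1) sd(1) by (simp add: periodic_def \<mu>_def)

lemma special_mod: "orb.special k n \<longleftrightarrow> orb.special (k mod int f') n"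
  unfolding special_iff by (simp add: dvd_eq_mod_eq_0)

lemma J_mod: "(nat (k mod int f'), n) \<in> J \<longleftrightarrow>
   \<mu> k \<le> n \<and> n < T \<and> [int n = w k] (mod int eKL) \<and> (n < s k \<or> orb.special k n)"
proof -
  have pos: "0 \<le> k mod int f'" "k mod int f' < int f'" using resdegL_pos by simp_all
  have e: "\<mu> k = \<mu> (k mod int f')" "s k = s (k mod int f')"
    using periodic_dvd[OF per_\<mu> mod_f'[of k]] periodic_dvd[OF sd(1) mod_f'[of k]] by simp_all
  have "[w k = w (k mod int f')] (mod int eKL)" by (rule cong_periodic_dvd[OF per_w mod_f'])
  then have "[int n = w k] (mod int eKL) \<longleftrightarrow> [int n = w (k mod int f')] (mod int eKL)"
    by (simp add: cong_def)
  then show ?thesis unfolding J_def using pos e special_mod[of k n] by auto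
qed

lemma \<epsilon>_V: "x \<in> J \<Longrightarrow> \<epsilon> x \<in> V" and \<epsilon>_normal: "x \<in> J \<Longrightarrow> normal (\<epsilon> x)"
proof -
  assume x: "x \<in> J"
  have *: "(nat (k mod int f'), n) \<in> J" if "coeff (cmp k (\<epsilon> x)) n \<noteq> 0" for k n
  proof -
    have "k mod int f' = int (fst x)" "n = snd x" using that by (auto simp: coeff_\<epsilon> split: if_splits)
    then have "(nat (k mod int f'), n) = x" by (cases x) simp
    then show ?thesis using x by simp
  qed
  show "normal (\<epsilon> x)" unfolding normal_def using * J_mod by blast
  have S: "\<epsilon> x \<in> carrier S" unfolding S_carrier_cmp
  proof (intro allI poly_eqI)
    fix k n show "coeff (ct (cmp k (\<epsilon> x))) n = coeff (cmp k (\<epsilon> x)) n"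
      using *[of k n] J_mod[of k n] by (cases "coeff (cmp k (\<epsilon> x)) n = 0") (simp_all add: coeff_poly_cutoff)
  qed
  have "cmp (k + int f') (\<epsilon> x) = cmp k (\<epsilon> x)" for k by (rule poly_eqI) (simp add: coeff_\<epsilon>)
  then have "weight w (\<epsilon> x)" unfolding weight_iff[OF per_w S] using * J_mod by (auto simp: periodic_def)
  moreover have "coeff (cmp k (\<epsilon> x)) n = 0" if "n < \<mu> k" for k n using *[of k n] J_mod[of k n] that by auto
  ultimately show "\<epsilon> x \<in> V" using S by (simp add: V_def)
qed

lemma finite_J: "finite J"
  by (rule finite_subset[of _ "{..<f'} \<times> {..<T}"]) (auto simp: J_def)

definition comb :: "(nat \<times> nat \<Rightarrow> 'e) \<Rightarrow> (nat \<times> nat) set \<Rightarrow> 't poly" where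
  "comb \<beta> A = (\<Sum>x\<in>A. [:ir (\<beta> x):] \<star> \<epsilon> x)"

lemma coeff_const_mult: "x \<in> carrier S \<Longrightarrow> coeff (cmp i ([:ir l:] \<star> x)) n = l * coeff (cmp i x) n"
  unfolding cmp_S_mult by (simp add: coeff_poly_cutoff coeff_cmp S_coeff)

lemma comb_V: "finite A \<Longrightarrow> A \<subseteq> J \<Longrightarrow> comb \<beta> A \<in> V"
  unfolding comb_def by (induction A rule: finite_induct) (auto intro!: V_closed zero_V \<epsilon>_V)

lemma coeff_comb: "finite A \<Longrightarrow> A \<subseteq> J \<Longrightarrow> coeff (cmp k (comb \<beta> A)) n = (if (nat (k mod int f'), n) \<in> A then \<beta> (nat (k mod int f'), n) else 0)"
proof (induction A rule: finite_induct)
  case empty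
  then show ?case by (simp add: comb_def)
next
  case (insert x A)
  have pos: "0 \<le> k mod int f'" using resdegL_pos by simp
  have "coeff (cmp k (comb \<beta> (insert x A))) n = \<beta> x * coeff (cmp k (\<epsilon> x)) n + coeff (cmp k (comb \<beta> A)) n"
    using insert by (simp add: comb_def cmp_add coeff_const_mult VD(1) \<epsilon>_V)
  moreover have "k mod int f' = int (fst x) \<and> n = snd x \<longleftrightarrow> (nat (k mod int f'), n) = x" using pos by (cases x) auto
  ultimately show ?case using insert by (auto simp: coeff_\<epsilon>)
qed

lemma comb_normal: "normal (comb \<beta> J)"
  unfolding normal_def using coeff_comb[OF finite_J subset_refl] J_mod by metis

lemma normal_comb:
  assumes h: "h \<in> V" "normal h"
  shows "h = comb (\<lambda>(i, n). coeff (cmp (int i) h) n) J"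
proof (intro cmp_eqI poly_eqI)
  fix k n
  have it: "periodic (\<lambda>i. cmp i h)" "\<And>i n. coeff (cmp i h) n \<noteq> 0 \<Longrightarrow> [int n = w i] (mod int eKL)"
    using VD(2)[OF h(1)] unfolding weight_iff[OF per_w VD(1)[OF h(1)]] by blast+
  have e: "cmp k h = cmp (int (nat (k mod int f'))) h"
    using periodic_dvd[OF it(1) mod_f'[of k]] resdegL_pos by simp
  have "(nat (k mod int f'), n) \<in> J" if nz: "coeff (cmp k h) n \<noteq> 0"
  proof -
    have "n < T" using nz S_coeff[OF VD(1)[OF h(1)], of n] by (cases "n < T") (auto simp: coeff_cmp)
    moreover have "\<mu> k \<le> n" using VD(3)[OF h(1), of n k] nz by (meson not_le)
    ultimately show ?thesis unfolding J_mod using it(2)[OF nz] h(2) nz unfolding normal_def by blast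
  qed
  then show "coeff (cmp k h) n = coeff (cmp k (comb (\<lambda>(i, n). coeff (cmp (int i) h) n) J)) n"
    unfolding coeff_comb[OF finite_J subset_refl] prod.case e[symmetric] by (simp split: if_splits) blast
qed

interpretation E: vectorspace class_ring Ext
  by (rule Ex_vectorspace)

definition Bs where "Bs = (\<lambda>x. Kl (\<epsilon> x)) ` J"

lemma finsum_comb: "finite A \<Longrightarrow> A \<subseteq> J \<Longrightarrow> finsum Ext (\<lambda>x. \<beta> x \<odot>\<^bsub>Ext\<^esub> Kl (\<epsilon> x)) A = Kl (comb \<beta> A)"
proof (induction A rule: finite_induct)
  case empty
  then show ?case by (simp add: comb_def Ex_zero)
next
  case (insert x A)
  have c: "\<beta> y \<odot>\<^bsub>Ext\<^esub> Kl (\<epsilon> y) \<in> carrier Ext" if "y \<in> J" for y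
    unfolding Ex_smult[OF \<epsilon>_V[OF that]] by (intro Kl_Ex V_closed \<epsilon>_V that)
  have "finsum Ext (\<lambda>x. \<beta> x \<odot>\<^bsub>Ext\<^esub> Kl (\<epsilon> x)) (insert x A) = \<beta> x \<odot>\<^bsub>Ext\<^esub> Kl (\<epsilon> x) \<oplus>\<^bsub>Ext\<^esub> finsum Ext (\<lambda>x. \<beta> x \<odot>\<^bsub>Ext\<^esub> Kl (\<epsilon> x)) A"
    by (rule E.M.finsum_insert) (use insert c in auto)
  also have "\<dots> = Kl ([:ir (\<beta> x):] \<star> \<epsilon> x) \<oplus>\<^bsub>Ext\<^esub> Kl (comb \<beta> A)" using insert by (simp add: Ex_smult \<epsilon>_V)
  also have "\<dots> = Kl ([:ir (\<beta> x):] \<star> \<epsilon> x + comb \<beta> A)" using insert by (intro Ex_add V_closed \<epsilon>_V comb_V) auto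
  finally show ?case using insert by (simp add: comb_def)
qed

text \<open>Equal classes have parameters differing by an element of \<open>W\<close>. The
  difference is also normal, hence 0, and the coefficients can be read off.\<close>

lemma comb_inj: "Kl (comb \<beta> J) = Kl (comb \<gamma> J) \<Longrightarrow> x \<in> J \<Longrightarrow> \<beta> x = \<gamma> x"
proof -
  assume eq: "Kl (comb \<beta> J) = Kl (comb \<gamma> J)" and x: "x \<in> J"
  have "comb \<gamma> J - comb \<beta> J \<in> W" by (rule Kl_eqD[OF comb_V[OF finite_J subset_refl] eq])
  moreover have "normal (comb \<gamma> J - comb \<beta> J)" by (intro normal_diff comb_normal)
  ultimately have "comb \<gamma> J - comb \<beta> J = 0" by (rule W_normal)
  then have e: "comb \<gamma> J = comb \<beta> J" by simp
  have "fst x < f'" using x by (auto simp: J_def)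
  then have m: "nat (int (fst x) mod int f') = fst x" by simp
  show ?thesis
    using coeff_comb[OF finite_J subset_refl, of "int (fst x)" \<beta> "snd x"] coeff_comb[OF finite_J subset_refl, of "int (fst x)" \<gamma> "snd x"] x e
    by (simp add: m)
qed

lemma \<epsilon>_comb: "x \<in> J \<Longrightarrow> comb (\<lambda>y. if y = x then 1 else 0) J = \<epsilon> x"
proof (intro cmp_eqI poly_eqI)
  fix k n assume x: "x \<in> J"
  have pos: "0 \<le> k mod int f'" using resdegL_pos by simp
  have "k mod int f' = int (fst x) \<and> n = snd x \<longleftrightarrow> (nat (k mod int f'), n) = x" using pos by (cases x) auto
  then show "coeff (cmp k (comb (\<lambda>y. if y = x then 1 else 0) J)) n = coeff (cmp k (\<epsilon> x)) n"
    unfolding coeff_comb[OF finite_J subset_refl] coeff_\<epsilon> using x by auto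
qed

lemma Kl_\<epsilon>_inj: "inj_on (\<lambda>x. Kl (\<epsilon> x)) J"
proof (rule inj_onI)
  fix x y assume x: "x \<in> J" and y: "y \<in> J" and eq: "Kl (\<epsilon> x) = Kl (\<epsilon> y)"
  have "(if x = x then 1 else 0) = (if x = y then 1 else (0 :: 'e))"
    by (rule comb_inj[OF _ x]) (simp only: \<epsilon>_comb[OF x] \<epsilon>_comb[OF y] eq)
  then show "x = y" by (auto split: if_splits)
qed

lemma lincomb_Bs: "E.lincomb \<beta> Bs = Kl (comb (\<lambda>x. \<beta> (Kl (\<epsilon> x))) J)"
proof -
  have c: "(\<lambda>v. \<beta> v \<odot>\<^bsub>Ext\<^esub> v) \<in> Bs \<rightarrow> carrier Ext"
    unfolding Bs_def by (auto simp: Ex_smult \<epsilon>_V intro!: Kl_Ex V_closed)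
  have "E.lincomb \<beta> Bs = finsum Ext (\<lambda>v. \<beta> v \<odot>\<^bsub>Ext\<^esub> v) ((\<lambda>x. Kl (\<epsilon> x)) ` J)"
    unfolding E.lincomb_def Bs_def ..
  also have "\<dots> = finsum Ext (\<lambda>x. \<beta> (Kl (\<epsilon> x)) \<odot>\<^bsub>Ext\<^esub> Kl (\<epsilon> x)) J"
    by (rule E.M.finsum_reindex) (use c Kl_\<epsilon>_inj in \<open>auto simp: Bs_def\<close>)
  also have "\<dots> = Kl (comb (\<lambda>x. \<beta> (Kl (\<epsilon> x))) J)" by (rule finsum_comb[OF finite_J subset_refl])
  finally show ?thesis .
qed

lemma Bs_basis: "E.basis Bs" "finite Bs" "card Bs = card J"
proof -
  show fin: "finite Bs" unfolding Bs_def by (rule finite_imageI[OF finite_J])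
  show "card Bs = card J" unfolding Bs_def by (rule card_image[OF Kl_\<epsilon>_inj])
  have sub: "Bs \<subseteq> carrier Ext" unfolding Bs_def by (auto intro!: Kl_Ex \<epsilon>_V)
  have "E.lin_indpt Bs"
  proof (rule E.finite_lin_indpt2[OF fin sub])
    fix \<alpha> :: "_ \<Rightarrow> 'e" assume "E.lincomb \<alpha> Bs = \<zero>\<^bsub>Ext\<^esub>"
    then have "Kl (comb (\<lambda>x. \<alpha> (Kl (\<epsilon> x))) J) = Kl 0" unfolding lincomb_Bs Ex_zero .
    also have "0 = comb (\<lambda>x. 0) J" by (simp add: comb_def)
    finally have "\<alpha> (Kl (\<epsilon> x)) = 0" if "x \<in> J" for x using comb_inj[OF _ that] by blast
    then show "\<forall>v\<in>Bs. \<alpha> v = \<zero>\<^bsub>class_ring\<^esub>" by (simp add: Bs_def)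
  qed
  moreover have "E.gen_set Bs"
  proof
    show "E.span Bs \<subseteq> carrier Ext" by (rule E.span_is_subset2[OF sub])
    show "carrier Ext \<subseteq> E.span Bs"
    proof
      fix A assume "A \<in> carrier Ext"
      then obtain h where h: "h \<in> V" "A = Kl h" by (rule Ex_E)
      obtain x where x: "x \<in> W" "h - x \<in> V" "normal (h - x)" using V_decomposition[OF h(1)] by blast
      define \<beta> where "\<beta> = (\<lambda>(i, n). coeff (cmp (int i) (h - x)) n)"
      have "Kl (h - x) = Kl h" by (rule Kl_eqI[OF x(2)]) (simp add: x(1))
      then have A: "A = Kl (comb \<beta> J)" using normal_comb[OF x(2,3)] h(2) by (simp add: \<beta>_def)
      define \<alpha> where "\<alpha> = (\<lambda>v. \<beta> (the_inv_into J (\<lambda>x. Kl (\<epsilon> x)) v))"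
      have "comb (\<lambda>x. \<alpha> (Kl (\<epsilon> x))) J = comb \<beta> J"
        unfolding comb_def by (rule sum.cong) (simp_all add: \<alpha>_def the_inv_into_f_f[OF Kl_\<epsilon>_inj])
      then have "A = E.lincomb \<alpha> Bs" unfolding A lincomb_Bs by simp
      then show "A \<in> E.span Bs" unfolding E.finite_span[OF fin sub] by auto
    qed
  qed
  ultimately show "E.basis Bs" using sub by (simp add: E.basis_def)
qed

lemma Ex_fin_dim: "vectorspace.fin_dim class_ring Ext"
  using Bs_basis unfolding E.fin_dim_def E.basis_def by blast

lemma Ex_dim: "vectorspace.dim class_ring Ext = card J"
  using E.dim_basis[OF Bs_basis(2,1)] Bs_basis(3) by simp

text \<open>Degrees below s i account for the sum. The others are special: their index is a multiple
  of f' below f', hence 0, and the degree of height zero is unique, so at most one element is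
  added.\<close>

lemma card_J: "card J = (if has_nonzero_hom D M N then 1 else 0)
    + (\<Sum>i<f'. card {j::int. max 0 (int (r (int i)) + int (s (int i)) - int e) \<le> j \<and> j < int (s (int i)) \<and>
             [j = int (r (int i)) + c (int i) - d (int i)] (mod int eKL)})"
proof -
  define J0 where "J0 = (SIGMA i:{..<f'}. {j. \<mu> (int i) \<le> j \<and> j < s (int i) \<and> [int j = w (int i)] (mod int eKL)})"
  define J1 where "J1 = {x \<in> J. s (int (fst x)) \<le> snd x}"
  have sT: "s i < T" for i using e_less_T[OF sd(4)] .
  have J: "J = J0 \<union> J1" unfolding J_def J0_def J1_def using sT by (auto intro: less_trans)
  have dis: "J0 \<inter> J1 = {}" by (auto simp: J0_def J1_def)
  have fin: "finite J0" "finite J1" using finite_J J by auto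
  have "card {j. \<mu> (int i) \<le> j \<and> j < s (int i) \<and> [int j = w (int i)] (mod int eKL)}
      = card {j::int. max 0 (int (r (int i)) + int (s (int i)) - int e) \<le> j \<and> j < int (s (int i)) \<and>
             [j = int (r (int i)) + c (int i) - d (int i)] (mod int eKL)}" (is "card ?A = card ?B") for i
  proof -
    have "?B = int ` ?A"
    proof (intro equalityI subsetI)
      fix j assume j: "j \<in> ?B"
      then have "j = int (nat j)" by auto
      moreover have "nat j \<in> ?A" using j by (auto simp: \<mu>_def w_def)
      ultimately show "j \<in> int ` ?A" by blast
    qed (auto simp: \<mu>_def w_def)
    then show ?thesis by (simp add: card_image)
  qed
  then have c0: "card J0 = (\<Sum>i<f'. card {j::int. max 0 (int (r (int i)) + int (s (int i)) - int e) \<le> j \<and> j < int (s (int i)) \<and>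
             [j = int (r (int i)) + c (int i) - d (int i)] (mod int eKL)})"
    unfolding J0_def by (subst card_SigmaI) auto
  have c1: "card J1 = (if has_nonzero_hom D M N then 1 else 0)"
  proof (cases "has_nonzero_hom D M N")
    case True
    then have hc: "orb.hom_cond" by (simp add: has_hom_iff)
    then obtain n where n: "orb.height 0 n = 0" "s 0 \<le> n" "n < T" "[int n = w 0] (mod int eKL)"
      unfolding orb.hom_cond_def orb.cyc_def orb.valid_def by blast
    have uniq: "n' = n" if "orb.height 0 n' = 0" for n'
    proof -
      have "orb.q1 * (int n' - int (r 0)) = orb.q1 * (int n - int (r 0))" using that n(1) by (simp add: orb.height_def)
      then show ?thesis using orb.q1_pos by simp
    qed
    \<comment> \<open>As r 0 \<le> e, the lower bound is at most s 0, which n already exceeds or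
      equals.\<close>
    have "\<mu> 0 \<le> n" using n(2) rd(4)[of 0] by (simp add: \<mu>_def)
    then have "(0, n) \<in> J1" using n hc resdegL_pos by (auto simp: J1_def J_def orb.special_def)
    moreover have "x = (0, n)" if "x \<in> J1" for x
    proof -
      have sp: "orb.special (int (fst x)) (snd x)" "fst x < f'" using that by (auto simp: J1_def J_def)
      then have "int f' dvd int (fst x)" by (simp add: orb.special_def)
      then have "fst x = 0" using sp(2) by (meson int_dvd_int_iff dvd_imp_le not_less not_gr_zero)
      then show ?thesis using sp(1) uniq[of "snd x"] by (cases x) (simp add: orb.special_def)
    qed
    ultimately have "J1 = {(0, n)}" by blast
    then show ?thesis using True by simp
  next
    case False
    then have "J1 = {}" unfolding J1_def J_def by (auto simp: orb.special_def has_hom_iff)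
    then show ?thesis using False by simp
  qed
  show ?thesis unfolding J card_Un_disjoint[OF fin dis] c0 c1 by simp
qed

text \<open>The parameters of X form a coset of \<open>W\<close>, which meets the normal parameters
  in exactly one point; the components of this point are the admissible family. The underlying type
  of X is arbitrary here.\<close>

lemma normal_form:
  assumes X: "is_extension D M N X"
  shows "\<exists>!h. admissible D r a c s b d h \<and> ext_iso D N X (model_extension D r a c s b d h)"
proof -
  interpret X: breuil_ext D r s a b c d X by (rule extI[OF X])
  have iff: "ext_iso D N X (model_extension D r a c s b d h) \<longleftrightarrow> und_poly D h \<in> cls X" if ad: "admissible D r a c s b d h" for h
  proof -
    have hV: "und_poly D h \<in> V" using ad unfolding admissible_iff by blast
    let ?Y = "model_extension D r a c s b d h"
    interpret Y: breuil_ext D r s a b c d ?Y by (rule extI[OF model_extension(1)[OF hV]])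
    show ?thesis unfolding ext_iso_iff[OF X model_extension(1)[OF hV]]
    proof
      assume "cls X \<inter> cls ?Y \<noteq> {}"
      then obtain k where k: "k \<in> cls X" "k \<in> cls ?Y" by blast
      have "und_poly D h - k \<in> W" by (rule Y.cls_diff[OF k(2) model_extension(2)[OF hV]])
      then show "und_poly D h \<in> cls X" using X.cls_shift[OF k(1), of "und_poly D h - k"] by simp
    qed (use model_extension(2)[OF hV] in blast)
  qed
  obtain h0 where h0: "h0 \<in> cls X" using X.cls_nonempty by blast
  obtain x where x: "x \<in> W" "h0 - x \<in> V" "normal (h0 - x)" using V_decomposition[OF X.cls_V[OF h0]] by blast
  define h where "h = (\<lambda>i. cmp i (h0 - x))"
  have ad: "admissible D r a c s b d h" unfolding h_def by (rule admissible_cmp[OF x(2,3)])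
  have "- x \<in> W" by (rule W_uminus[OF X.cls_V[OF h0] x(1)])
  then have "und_poly D h \<in> cls X" using X.cls_shift[OF h0, of "- x"] unfolding h_def und_poly_cmp by simp
  show ?thesis
  proof (rule ex1I[of _ h])
    show "admissible D r a c s b d h \<and> ext_iso D N X (model_extension D r a c s b d h)"
      using ad iff[OF ad] \<open>und_poly D h \<in> cls X\<close> by blast
    fix h' assume h': "admissible D r a c s b d h' \<and> ext_iso D N X (model_extension D r a c s b d h')"
    then have "und_poly D h' \<in> cls X" using iff by blast
    then have "und_poly D h' - und_poly D h \<in> W" by (rule X.cls_diff[OF \<open>und_poly D h \<in> cls X\<close>])
    moreover have "normal (und_poly D h' - und_poly D h)"
      using h' ad unfolding admissible_iff by (intro normal_diff) blast+
    ultimately have "und_poly D h' - und_poly D h = 0" by (rule W_normal)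
    then have eq: "und_poly D h' = und_poly D h" by simp
    have "periodic h'" "periodic h" using h' ad unfolding admissible_iff by blast+
    then show "h' = h" using eq cmp_und_poly_periodic[of h'] cmp_und_poly_periodic[of h] by (intro ext) metis
  qed
qed

end

theorem theorem1p11:
  fixes D :: "('a::{alg_closed_field,field_char_0}, 'k::field, 'e::field, 't::comm_ring_1) datum"
    and r s :: "int \<Rightarrow> nat" and a b :: "int \<Rightarrow> 'e" and c d :: "int \<Rightarrow> int"
    and M N :: "('a, 't, 't poly) breuil"
  assumes "setting D"
    and "rank1_data D r a c" and "M = rank1 D r a c"
    and "rank1_data D s b d" and "N = rank1 D s b d"
  shows "(\<forall>h. admissible D r a c s b d h \<longrightarrow>
            is_extension D M N (model_extension D r a c s b d h))
    \<and> (\<forall>X :: ('a, 't, 't poly, 'p, 't poly) extension. is_extension D M N X \<longrightarrow>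
            (\<exists>!h. admissible D r a c s b d h \<and> ext_iso D N X (model_extension D r a c s b d h)))
    \<and> vectorspace class_ring (Ext1 D M N)
    \<and> vectorspace.fin_dim class_ring (Ext1 D M N)
    \<and> vectorspace.dim class_ring (Ext1 D M N) =
        (if has_nonzero_hom D M N then 1 else 0)
        + (\<Sum>i<resdegL D. card {j::int.
             max 0 (int (r (int i)) + int (s (int i)) - int (ramK D)) \<le> j \<and> j < int (s (int i)) \<and>
             [j = int (r (int i)) + c (int i) - d (int i)] (mod int (ram_KL D))})"
proof -
  interpret B: breuil_pair D r s a b c d by unfold_locales (use assms in simp_all)
  show ?thesis
    unfolding assms(3,5)
  proof (intro conjI allI impI)
    show "is_extension D B.M B.N (model_extension D r a c s b d h)" if "admissible D r a c s b d h" for h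
      using that B.model_extension(1)[of h] unfolding B.admissible_iff by blast
    show "\<exists>!h. admissible D r a c s b d h \<and> ext_iso D B.N X (model_extension D r a c s b d h)"
      if "is_extension D B.M B.N X" for X :: "('a, 't, 't poly, 'p, 't poly) extension"
      by (rule B.normal_form[OF that])
    show "vectorspace class_ring (Ext1 D B.M B.N)" by (rule B.Ex_vectorspace)
    show "vectorspace.fin_dim class_ring (Ext1 D B.M B.N)" by (rule B.Ex_fin_dim)
    show "vectorspace.dim class_ring (Ext1 D B.M B.N) =
        (if has_nonzero_hom D B.M B.N then 1 else 0)
        + (\<Sum>i<resdegL D. card {j::int.
             max 0 (int (r (int i)) + int (s (int i)) - int (ramK D)) \<le> j \<and> j < int (s (int i)) \<and>
             [j = int (r (int i)) + c (int i) - d (int i)] (mod int (ram_KL D))})"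
      unfolding B.Ex_dim by (rule B.card_J)
  qed
qed

end
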